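(* For every integer $m\ge1$, the vertex operator algebra $\mathcal W(p)^{A_m}$ is strongly generated by $E^{(m)}$, $F^{(m)}$, $H$ and $\omega$; that is, $\mathcal W(p)^{A_m}$ is spanned by $\mathbf 1$ and the monomials $a^1_{-n_1-1}\cdots a^k_{-n_k-1}\mathbf 1$ with $k\ge1$, $n_i\ge0$ and $a^i\in\{E^{(m)},F^{(m)},H,\omega\}$.
   Context: Fix an integer $p\ge 2$. Let $L=\mathbb Z\alpha$ with $\langle\alpha,\alpha\rangle=2p$, $M(1)$ the Heisenberg vertex algebra, $V_L=M(1)\otimes\mathbb C[L]$ the lattice vertex algebra with conformal vector $\omega=\frac{1}{4p}\alpha(-1)^2\mathbf 1+\frac{p-1}{2p}\alpha(-2)\mathbf 1$ (central charge $c_{p,1}=1-6(p-1)^2/p$), $Y(a,z)=\sum_n a_nz^{-n-1}$, and $Q=e^{\alpha}_0$ the screening operator. The triplet vertex algebra $\mathcal W(p)$ is the Virasoro submodule of $V_L$ generated by the singular vectors $Q^ie^{-n\alpha}$ ($n\ge0$, $0\le i\le2n$); it is a vertex subalgebra. For $m\ge1$ let $\sigma=\exp(\pi i\,\alpha(0)/(pm))$, which acts on $M(1)\otimes e^{n\alpha}$ as $e^{2\pi in/m}$, and set $\mathcal W(p)^{A_m}=\mathcal W(p)\cap V_L^{\sigma}=\mathcal W(p)\cap\bigoplus_{n\in\mathbb Z}M(1)\otimes e^{nm\alpha}$. Put $F^{(m)}=e^{-m\alpha}$, $E^{(m)}=Q^{2m}e^{-m\alpha}$, $H=Qe^{-\alpha}$.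 *)

theory Defs
  imports Complex_Main "HOL-Library.Multiset" "HOL-Analysis.Infinite_Sum"
begin

text \<open>Concrete model of the lattice vertex algebra V_L, L = Z alpha, (alpha,alpha) = 2p.
  A basis vector of V_L = M(1) (x) C[L] is indexed by a pair (c, h): the multiset c of
  naturals encodes the Heisenberg monomial prod_{j in c} alpha(-j-1), and h encodes e^{h alpha}.
  Vectors are finitely supported coefficient functions on this basis.\<close>

type_synonym idx = "nat multiset \<times> int"
type_synonym vec = "idx \<Rightarrow> complex"

definition bv :: "idx \<Rightarrow> vec" where
  "bv b = (\<lambda>b'. if b' = b then 1 else 0)"

definition lin :: "(idx \<Rightarrow> vec) \<Rightarrow> vec \<Rightarrow> vec" where
  "lin f v = (\<lambda>b'. \<Sum>b\<in>{b. v b \<noteq> 0}. v b * f b b')"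

text \<open>Heisenberg operators alpha(r); [alpha(k), alpha(l)] = 2p k delta_{k+l,0}.\<close>
definition alpha_b :: "nat \<Rightarrow> int \<Rightarrow> idx \<Rightarrow> vec" where
  "alpha_b p r b = (case b of (c, h) \<Rightarrow>
     if r < 0 then bv (add_mset (nat (- r - 1)) c, h)
     else if r = 0 then (\<lambda>b'. of_int (2 * int p * h) * bv (c, h) b')
     else (\<lambda>b'. of_int (2 * int p * r) * of_nat (count c (nat r - 1))
                  * bv (c - {# nat r - 1 #}, h) b'))"

definition alpha :: "nat \<Rightarrow> int \<Rightarrow> vec \<Rightarrow> vec" where
  "alpha p r = lin (alpha_b p r)"

text \<open>Weight of a partition encoded as multiset (element k = part k+1), and z_mu.\<close>
definition pwt :: "nat multiset \<Rightarrow> nat" where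
  "pwt \<mu> = sum_mset (image_mset Suc \<mu>)"

definition zee :: "nat multiset \<Rightarrow> complex" where
  "zee \<mu> = of_nat (prod_mset (image_mset Suc \<mu>) * (\<Prod>k\<in>set_mset \<mu>. fact (count \<mu> k)))"

text \<open>Modes of Y(e^{g alpha}, z) = E^-(-g alpha,z) E^+(-g alpha,z) e_{g alpha} z^{g alpha(0)}
  (trivial cocycle, admissible since L is even of rank one), on basis vectors.
  Creation part: coefficient of z^i in exp(sum_k g alpha(-k) z^k / k);
  annihilation part: coefficient of z^{-j} in exp(- sum_k g alpha(k) z^{-k}/k).\<close>
definition latt :: "nat \<Rightarrow> int \<Rightarrow> int \<Rightarrow> idx \<Rightarrow> vec" where
  "latt p g n b = (case b of (c, h) \<Rightarrow> (\<lambda>(c', h').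
     if h' \<noteq> g + h then 0 else
     (\<Sum>\<nu>\<in>{\<nu>. \<nu> \<subseteq># c}.
       \<Sum>\<mu>\<in>{\<mu>. int (pwt \<mu>) = - n - 1 - 2 * int p * g * h + int (pwt \<nu>)}.
         (if c' = c - \<nu> + \<mu> then
            (of_int g ^ size \<mu> / zee \<mu>)
            * (of_int (- 2 * int p * g) ^ size \<nu>
               * (\<Prod>k\<in>set_mset \<nu>. of_nat (count c k choose count \<nu> k)))
          else 0))))"

text \<open>Modes of Y(alpha(-j_1-1)...alpha(-j_k-1) e^{g alpha}, z), via the iterate formula
  Y(alpha(-j-1) b, z) = : (d^j/dz^j alpha(z) / j!) Y(b,z) :.\<close>
primrec hm :: "nat \<Rightarrow> nat list \<Rightarrow> int \<Rightarrow> int \<Rightarrow> vec \<Rightarrow> vec" where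
  "hm p [] g n v = lin (latt p g n) v"
| "hm p (j # js) g n v = (\<lambda>b'.
      (\<Sum>\<^sub>\<infinity>r\<in>{r::int. r < 0}. (of_int (- r - 1) gchoose j)
            * alpha p r (hm p js g (n - r - int j - 1) v) b')
    + (\<Sum>\<^sub>\<infinity>r\<in>{r::int. 0 \<le> r}. (of_int (- r - 1) gchoose j)
            * hm p js g (n - r - int j - 1) (alpha p r v) b'))"

text \<open>vmode p a n v = a_n v, where Y(a,z) = sum_n a_n z^{-n-1}.\<close>
definition vmode :: "nat \<Rightarrow> vec \<Rightarrow> int \<Rightarrow> vec \<Rightarrow> vec" where
  "vmode p a n v = (\<lambda>b'. \<Sum>b\<in>{b. a b \<noteq> 0}.
      a b * hm p (sorted_list_of_multiset (fst b)) (snd b) n v b')"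

definition vac :: vec where "vac = bv ({#}, 0)"

definition eL :: "int \<Rightarrow> vec" where "eL n = bv ({#}, n)"

definition omega :: "nat \<Rightarrow> vec" where
  "omega p = (\<lambda>b. of_real (1 / (4 * real p)) * bv ({#0, 0#}, 0) b
               + of_real ((real p - 1) / (2 * real p)) * bv ({#1#}, 0) b)"

definition Vir :: "nat \<Rightarrow> int \<Rightarrow> vec \<Rightarrow> vec" where
  "Vir p n = vmode p (omega p) (n + 1)"

definition Qs :: "nat \<Rightarrow> vec \<Rightarrow> vec" where
  "Qs p = vmode p (eL 1) 0"

definition Fm :: "nat \<Rightarrow> vec" where "Fm m = eL (- int m)"
definition Em :: "nat \<Rightarrow> nat \<Rightarrow> vec" where "Em p m = (Qs p ^^ (2 * m)) (eL (- int m))"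
definition Hv :: "nat \<Rightarrow> vec" where "Hv p = Qs p (eL (-1))"

inductive_set Wtrip :: "nat \<Rightarrow> vec set" for p where
  gen: "i \<le> 2 * n \<Longrightarrow> (Qs p ^^ i) (eL (- int n)) \<in> Wtrip p"
| zero: "(\<lambda>_. 0) \<in> Wtrip p"
| add: "u \<in> Wtrip p \<Longrightarrow> v \<in> Wtrip p \<Longrightarrow> (\<lambda>b. u b + v b) \<in> Wtrip p"
| smult: "u \<in> Wtrip p \<Longrightarrow> (\<lambda>b. a * u b) \<in> Wtrip p"
| vir: "u \<in> Wtrip p \<Longrightarrow> Vir p n u \<in> Wtrip p"

text \<open>W(p)^{A_m} = W(p) intersected with the sum of M(1) (x) e^{n m alpha}.\<close>
definition WA :: "nat \<Rightarrow> nat \<Rightarrow> vec set" where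
  "WA p m = {v \<in> Wtrip p. \<forall>b. v b \<noteq> 0 \<longrightarrow> int m dvd snd b}"

inductive_set Mon :: "nat \<Rightarrow> nat \<Rightarrow> vec set" for p m where
  vac: "vac \<in> Mon p m"
| step: "w \<in> Mon p m \<Longrightarrow> a \<in> {Em p m, Fm m, Hv p, omega p}
          \<Longrightarrow> vmode p a (- int n - 1) w \<in> Mon p m"

definition cspan :: "vec set \<Rightarrow> vec set" where
  "cspan S = {v. \<exists>F c. finite F \<and> F \<subseteq> S \<and> v = (\<lambda>b. \<Sum>w\<in>F. c w * w b)}"

end

theory Submission imports Defs "HOL-Library.Poly_Mapping" "HOL-Library.Multiset_Order"
begin

text \<open>
  The argument runs in the doublet setting, where half-integral multiples of \<open>\<alpha>\<close> are allowed and
  the generators are \<open>Q\<^sup>i e\<^sup>-\<^sup>n\<^sup>\<alpha>\<^sup>/\<^sup>2\<close> with \<open>0 \<le> i \<le> n\<close>. The vertex operator of \<open>e\<^sup>-\<^sup>\<alpha>\<^sup>/\<^sup>2\<close> satisfies a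
  second order null vector equation. On a singular vector this equation is a recursion that expresses the
  modes through Virasoro descendants of lower ones, except at one resonant mode; there the difference
  with a known singular vector lies in the kernel of a power of \<open>Q\<close>, and in the relevant degrees that
  kernel consists of Virasoro descendants of the highest weight vector. The latter is a dimension
  count: the top symbols of Virasoro monomials give enough independent vectors in the kernel, and a
  diagonally dominant matrix shows that the power of \<open>Q\<close> is onto. Hence the Virasoro module generated
  by the singular vectors is closed under \<open>e\<^sup>-\<^sup>\<alpha>\<^sup>/\<^sup>2\<close>, and, since \<open>Q\<close> acts by derivations, under all
  generators of the orbifold.

  Conversely, the span of the monomials is stable under the negative Virasoro modes, so that it
  suffices to reach the singular vectors of charge divisible by \<open>m\<close>. The extremal ones come from
  \<open>F\<^sup>(\<^sup>m\<^sup>)\<close> and, by the Leibniz rule for \<open>Q\<close>, from \<open>E\<^sup>(\<^sup>m\<^sup>)\<close>; the others follow because a suitable mode of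
  \<open>H\<close> maps \<open>Q\<^sup>i e\<^sup>-\<^sup>n\<^sup>\<alpha>\<close> to a nonzero multiple of \<open>Q\<^sup>i\<^sup>+\<^sup>1 e\<^sup>-\<^sup>(\<^sup>n\<^sup>+\<^sup>1\<^sup>)\<^sup>\<alpha>\<close> modulo lower singular vectors.
\<close>

section \<open>The Fock space\<close>

text \<open>\<open>Wtrip\<close> is only given as a Virasoro submodule, so its stability under the
  modes of its own elements has to be earned. The field of e^{-alpha/2} is chosen because its null
  vector sits at level 2: on \<open>Qp n i\<close> the resulting polynomial in the mode index has
  just two roots, which belong to the singular vectors with n + 1 and n - 1. The price is a larger
  module and the signs \<open>par\<close> of half-integral charges.

  The kernel is found without character formulas. At level r, for k + 1 applications of the
  screening operator, the partitions with at most k parts 1 index Virasoro vectors in the kernel,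
  and the other partitions, stripped of k + 1 parts 1, index a basis of the target level.
  Independence of the first and surjectivity onto the second leave no room for further kernel
  vectors.

  Operators are stored without their charge shift, as endomorphisms of one polynomial ring;
  identities between fields are reduced to the vacuum by commuting with Heisenberg modes.\<close>

text \<open>The variable \<open>var j\<close> stands for the creation operator \<open>\<alpha>(-j-1)\<close>.\<close>

type_synonym fock = "nat multiset \<Rightarrow>\<^sub>0 complex"

abbreviation lookup :: "fock \<Rightarrow> nat multiset \<Rightarrow> complex" where "lookup \<equiv> Poly_Mapping.lookup"
abbreviation keys :: "fock \<Rightarrow> nat multiset set" where "keys \<equiv> Poly_Mapping.keys"

definition cst :: "complex \<Rightarrow> fock" where "cst z = Poly_Mapping.single {#} z"
definition mon :: "nat multiset \<Rightarrow> fock" where "mon c = Poly_Mapping.single c 1"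
definition var :: "nat \<Rightarrow> fock" where "var j = mon {#j#}"

lemma cst_0 [simp]: "cst 0 = 0" by (simp add: cst_def)
lemma cst_1 [simp]: "cst 1 = 1"
  unfolding cst_def using single_one by (metis zero_multiset_def)
lemma cst_add: "cst (a + b) = cst a + cst b" by (simp add: cst_def single_add)
lemma cst_minus: "cst (- a) = - cst a" by (simp add: cst_def single_uminus)
lemma cst_diff: "cst (a - b) = cst a - cst b" by (simp add: cst_def single_diff)
lemma cst_mult: "cst (a * b) = cst a * cst b"
  by (simp add: cst_def mult_single)
lemma cst_sum: "cst (sum f A) = (\<Sum>x\<in>A. cst (f x))"
  by (induction A rule: infinite_finite_induct) (auto simp: cst_add)
lemma mon_empty [simp]: "mon {#} = 1"
  by (metis cst_1 cst_def mon_def)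
lemma mon_plus: "mon (c + d) = mon c * mon d" by (simp add: mon_def mult_single)
lemma mon_add: "mon (add_mset j c) = var j * mon c"
  by (simp add: mon_def var_def mult_single)
lemma lookup_cst_mult [simp]: "lookup (cst z * f) c = z * lookup f c"
proof -
  have "lookup (cst z * f) c = (\<Sum>l. (z when {#} = l) * (\<Sum>q. lookup f q when c = l + q))"
    by (simp add: lookup_mult cst_def lookup_single when_mult)
  also have "\<dots> = (\<Sum>l. (z * (\<Sum>q. lookup f q when c = l + q)) when {#} = l)"
    by (simp add: when_mult)
  also have "\<dots> = z * lookup f c" by simp
  finally show ?thesis .
qed
lemma lookup_mon: "lookup (mon c) d = (if c = d then 1 else 0)"
  by (simp add: mon_def lookup_single when_def)
lemma lookup_cst: "lookup (cst z) d = (if d = {#} then z else 0)"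
  by (simp add: cst_def lookup_single when_def)
lemma lookup_1: "lookup 1 d = (if d = {#} then 1 else 0)"
  by (metis cst_1 lookup_cst)
lemma keys_mon [simp]: "keys (mon c) = {c}" by (simp add: mon_def)
lemma cst_eq_0_iff [simp]: "cst z = 0 \<longleftrightarrow> z = 0"
  by (metis cst_0 lookup_cst lookup_zero)
lemma cst_inverse_mult: "z \<noteq> 0 \<Longrightarrow> cst z * (cst (1 / z) * f) = f"
  by (simp flip: cst_mult mult.assoc)
lemma fock_eqI: "(\<And>c. lookup f c = lookup g c) \<Longrightarrow> f = g"
  by (rule poly_mapping_eqI)

lemma fock_expand: assumes "finite A" "keys f \<subseteq> A"
  shows "f = (\<Sum>c\<in>A. cst (lookup f c) * mon c)"
proof (rule fock_eqI)
  fix d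
  have "lookup (\<Sum>c\<in>A. cst (lookup f c) * mon c) d = (\<Sum>c\<in>A. if c = d then lookup f c else 0)"
    by (simp add: lookup_sum lookup_mon if_distrib cong: if_cong)
  also have "\<dots> = lookup f d"
    using assms by (auto simp: sum.delta in_keys_iff)
  finally show "lookup f d = lookup (\<Sum>c\<in>A. cst (lookup f c) * mon c) d" by simp
qed

lemma fock_induct_mon [case_names mon add scale]:
  assumes "\<And>c. P (mon c)" "\<And>f g. P f \<Longrightarrow> P g \<Longrightarrow> P (f + g)" "\<And>z f. P f \<Longrightarrow> P (cst z * f)"
  shows "P f"
proof -
  have P0: "P 0" using assms(3)[of "mon {#}" 0] assms(1)[of "{#}"] by simp
  have "P (\<Sum>c\<in>A. cst (lookup f c) * mon c)" if "finite A" for A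
    using that by (induction A) (auto simp: P0 assms)
  then show ?thesis by (subst fock_expand[OF finite_keys order_refl, of f]) simp
qed

lemma fock_induct [case_names one var add scale]:
  assumes "P 1" "\<And>j f. P f \<Longrightarrow> P (var j * f)"
    "\<And>f g. P f \<Longrightarrow> P g \<Longrightarrow> P (f + g)" "\<And>z f. P f \<Longrightarrow> P (cst z * f)"
  shows "P f"
proof (induction f rule: fock_induct_mon)
  case (mon c)
  show ?case by (induction c) (auto simp: mon_add assms)
qed (use assms in auto)

section \<open>Linear operators, levels and partial derivatives\<close>

definition clin :: "(fock \<Rightarrow> fock) \<Rightarrow> bool" where
  "clin T \<longleftrightarrow> (\<forall>f g. T (f + g) = T f + T g) \<and> (\<forall>z f. T (cst z * f) = cst z * T f)"

lemma clinI: "(\<And>f g. T (f + g) = T f + T g) \<Longrightarrow> (\<And>z f. T (cst z * f) = cst z * T f) \<Longrightarrow> clin T"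
  by (auto simp: clin_def)
lemma clin_add: "clin T \<Longrightarrow> T (f + g) = T f + T g" by (auto simp: clin_def)
lemma clin_scale: "clin T \<Longrightarrow> T (cst z * f) = cst z * T f" by (auto simp: clin_def)
lemma clin_0: "clin T \<Longrightarrow> T 0 = 0" using clin_scale[of T 0 0] by simp
lemma clin_minus: "clin T \<Longrightarrow> T (- f) = - T f"
  using clin_scale[of T "-1" f] by (simp add: cst_minus)
lemma clin_diff: "clin T \<Longrightarrow> T (f - g) = T f - T g"
  using clin_add[of T f "- g"] by (simp add: clin_minus)
lemma clin_sum: "clin T \<Longrightarrow> T (sum g A) = (\<Sum>x\<in>A. T (g x))"
  by (induction A rule: infinite_finite_induct) (auto simp: clin_0 clin_add)
lemmas clin_simps = clin_add clin_scale clin_0 clin_minus clin_diff clin_sum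

lemma clin_id: "clin (\<lambda>f. f)" by (auto simp: clin_def)
lemma clin_mult: "clin (\<lambda>f. g * f)" by (auto simp: clin_def algebra_simps)
lemma clin_comp: "clin S \<Longrightarrow> clin T \<Longrightarrow> clin (\<lambda>f. S (T f))" by (auto simp: clin_def)
lemma clin_plus: "clin S \<Longrightarrow> clin T \<Longrightarrow> clin (\<lambda>f. S f + T f)" by (auto simp: clin_def algebra_simps)
lemma clin_sub: "clin S \<Longrightarrow> clin T \<Longrightarrow> clin (\<lambda>f. S f - T f)" by (auto simp: clin_def algebra_simps)
lemma clin_mul: "clin T \<Longrightarrow> clin (\<lambda>f. g * T f)" by (auto simp: clin_def algebra_simps)
lemma clin_zero: "clin (\<lambda>f. 0)" by (auto simp: clin_def)
lemma clin_if: "(b \<Longrightarrow> clin S) \<Longrightarrow> (\<not> b \<Longrightarrow> clin T) \<Longrightarrow> clin (\<lambda>f. if b then S f else T f)" by (auto simp: clin_def)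

lemma clin_eq_mon: assumes "clin S" "clin T" "\<And>c. S (mon c) = T (mon c)" shows "S f = T f"
  by (induction f rule: fock_induct_mon) (auto simp: assms clin_simps)

lemma clin_eqI: assumes "clin S" "clin T" "S 1 = T 1" "\<And>j f. S f = T f \<Longrightarrow> S (var j * f) = T (var j * f)"
  shows "S f = T f"
  by (induction f rule: fock_induct) (auto simp: assms clin_simps)

definition lext :: "(nat multiset \<Rightarrow> fock) \<Rightarrow> fock \<Rightarrow> fock" where
  "lext \<phi> f = (\<Sum>c\<in>keys f. cst (lookup f c) * \<phi> c)"

lemma lext_superset: assumes "finite A" "keys f \<subseteq> A"
  shows "lext \<phi> f = (\<Sum>c\<in>A. cst (lookup f c) * \<phi> c)"
  unfolding lext_def by (rule sum.mono_neutral_left) (use assms in \<open>auto simp: in_keys_iff\<close>)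

lemma clin_lext: "clin (lext \<phi>)"
proof (rule clinI)
  fix f g
  let ?A = "keys f \<union> keys g"
  have "keys (f + g) \<subseteq> ?A" by (rule keys_add)
  then show "lext \<phi> (f + g) = lext \<phi> f + lext \<phi> g"
    by (simp add: lext_superset[of ?A] lookup_add cst_add algebra_simps sum.distrib)
next
  fix z f
  have "keys (cst z * f) \<subseteq> keys f" by (auto simp: in_keys_iff)
  then show "lext \<phi> (cst z * f) = cst z * lext \<phi> f"
    by (simp add: lext_superset[of "keys f"] cst_mult sum_distrib_left mult.assoc)
qed

lemma lext_mon [simp]: "lext \<phi> (mon c) = \<phi> c"
  by (simp add: lext_def lookup_mon)

text \<open>An integer level, although weights are natural numbers: operators may lower it below 0,
  and \<open>lev_neg\<close> then yields vanishing. The zero vector has every level.\<close>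

definition lev :: "int \<Rightarrow> fock \<Rightarrow> bool" where "lev n f \<longleftrightarrow> (\<forall>c\<in>keys f. int (pwt c) = n)"

lemma pwt_add [simp]: "pwt (add_mset j c) = j + 1 + pwt c" by (simp add: pwt_def)
lemma pwt_empty [simp]: "pwt {#} = 0" by (simp add: pwt_def)
lemma pwt_plus: "pwt (c + d) = pwt c + pwt d" by (simp add: pwt_def)
lemma pwt_eq_0 [simp]: "pwt c = 0 \<longleftrightarrow> c = {#}" by (cases c) auto
lemma size_le_pwt: "size c \<le> pwt c" by (induction c) auto
lemma mem_pwt: "j \<in># c \<Longrightarrow> j < pwt c"
  by (drule insert_DiffM, drule arg_cong[where f = pwt]) simp

lemma finite_pwt_le: "finite {c. pwt c \<le> n}"
proof -
  have "{c. pwt c \<le> n} \<subseteq> mset ` {xs. set xs \<subseteq> {..<n} \<and> length xs \<le> n}"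
  proof
    fix c assume c: "c \<in> {c. pwt c \<le> n}"
    obtain xs where xs: "c = mset xs" using ex_mset by metis
    have "set xs \<subseteq> {..<n}" using c xs mem_pwt[of _ c] by fastforce
    moreover have "length xs \<le> n" using c xs size_le_pwt[of c] by simp
    ultimately show "c \<in> mset ` {xs. set xs \<subseteq> {..<n} \<and> length xs \<le> n}" using xs by auto
  qed
  moreover have "finite {xs. set xs \<subseteq> {..<n} \<and> length xs \<le> n}" by (rule finite_lists_length_le) simp
  ultimately show ?thesis using finite_surj by blast
qed

lemma finite_pwt_eq: "finite {c. pwt c = n}" by (rule finite_subset[OF _ finite_pwt_le[of n]]) auto
lemma finite_pwt_int: "finite {c. int (pwt c) = m}"
  by (rule finite_subset[OF _ finite_pwt_le[of "nat m"]]) auto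

lemma lev_0 [simp]: "lev n 0" by (simp add: lev_def)
lemma lev_add: "lev n f \<Longrightarrow> lev n g \<Longrightarrow> lev n (f + g)"
  using keys_add[of f g] by (auto simp: lev_def)
lemma lev_scale: "lev n f \<Longrightarrow> lev n (cst z * f)" by (auto simp: lev_def in_keys_iff)
lemma lev_diff: "lev n f \<Longrightarrow> lev n g \<Longrightarrow> lev n (f - g)"
  using lev_add[OF _ lev_scale[of n g "-1"]] by (simp add: cst_minus)
lemma lev_sum: "(\<And>x. x \<in> A \<Longrightarrow> lev n (g x)) \<Longrightarrow> lev n (sum g A)"
  by (induction A rule: infinite_finite_induct) (auto simp: lev_add)
lemma lev_mon: "lev (int (pwt c)) (mon c)" by (simp add: lev_def)
lemma lev_1 [simp]: "lev 0 1" using lev_mon[of "{#}"] by simp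
lemma lev_mult: assumes "lev m f" "lev n g" shows "lev (m + n) (f * g)"
  using assms keys_mult[of f g] unfolding lev_def by (force simp: pwt_plus)
lemma lev_var: "lev n f \<Longrightarrow> lev (n + int j + 1) (var j * f)"
  using lev_mult[OF lev_mon[of "{#j#}"], of n f] by (simp add: var_def algebra_simps)
lemma lev_neg: "lev n f \<Longrightarrow> n < 0 \<Longrightarrow> f = 0"
  using keys_eq_empty[of f] by (fastforce simp: lev_def)
lemma lev_zero_cst: "lev 0 f \<Longrightarrow> f = cst (lookup f {#})"
  by (rule fock_eqI) (auto simp: lookup_cst lev_def in_keys_iff)
lemma lev_lookup: "lev n f \<Longrightarrow> int (pwt c) \<noteq> n \<Longrightarrow> lookup f c = 0"
  by (auto simp: lev_def in_keys_iff)

lemma keys_bound: "\<exists>N. \<forall>c\<in>keys f. pwt c \<le> N"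
  by (meson finite_imageI finite_keys finite_nat_set_iff_bounded_le imageI)

definition der :: "nat \<Rightarrow> fock \<Rightarrow> fock" where
  "der j = lext (\<lambda>c. cst (of_nat (count c j)) * mon (c - {#j#}))"

lemma clin_der: "clin (der j)" by (simp add: der_def clin_lext)

lemma der_var: "der j (var k * f) = (if j = k then f else 0) + var k * der j f"
proof (rule clin_eq_mon[of "\<lambda>f. der j (var k * f)" "\<lambda>f. (if j = k then f else 0) + var k * der j f"])
  show "clin (\<lambda>f. der j (var k * f))" by (rule clin_comp[OF clin_der clin_mult])
  show "clin (\<lambda>f. (if j = k then f else 0) + var k * der j f)"
    by (intro clin_plus clin_if clin_id clin_zero clin_mul clin_der)
  fix c
  show "der j (var k * mon c) = (if j = k then mon c else 0) + var k * der j (mon c)"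
  proof (cases "j = k")
    case True
    show ?thesis
    proof (cases "j \<in># c")
      case True
      then have "var j * mon (c - {#j#}) = mon c" by (metis insert_DiffM mon_add)
      then show ?thesis using \<open>j = k\<close> by (simp add: der_def flip: mon_add) (simp add: mon_add cst_add algebra_simps)
    next
      case False
      then have "count c j = 0" by (simp add: not_in_iff)
      then show ?thesis using \<open>j = k\<close> by (simp add: der_def flip: mon_add)
    qed
  next
    case False
    then have "cst (of_nat (count c j)) * mon (add_mset k c - {#j#}) = cst (of_nat (count c j)) * (var k * mon (c - {#j#}))"
      by (cases "j \<in># c") (auto simp: mon_add[symmetric] add_mset_diff_bothsides not_in_iff diff_add_mset_swap)
    then show ?thesis using False by (simp add: der_def flip: mon_add)
  qed
qed

lemma der_1 [simp]: "der j 1 = 0" by (simp add: der_def flip: mon_empty)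

lemma der_mon: "der j (mon c) = cst (of_nat (count c j)) * mon (c - {#j#})" by (simp add: der_def)

lemma lookup_der: "lookup (der j f) c = of_nat (count c j + 1) * lookup f (add_mset j c)"
proof (induction f rule: fock_induct_mon)
  case (mon d)
  show ?case
  proof (cases "j \<in># d")
    case True
    then have "d - {#j#} = c \<longleftrightarrow> d = add_mset j c" by (metis add_mset_remove_trivial insert_DiffM)
    then show ?thesis by (auto simp: der_mon lookup_mon)
  next
    case False
    then show ?thesis by (auto simp: der_mon lookup_mon not_in_iff)
  qed
next
  case (add f g) then show ?case by (simp add: clin_add[OF clin_der] lookup_add distrib_left)
next
  case (scale z f) then show ?case unfolding clin_scale[OF clin_der] lookup_cst_mult by (simp add: mult_ac)
qed

text \<open>This is how scalars are recognised below: a vector killed by all positive Heisenberg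
  modes is a multiple of the vacuum, since multiplicities are invertible over the complex
  numbers.\<close>

lemma der_all_0: assumes "\<And>j. der j f = 0" shows "f = cst (lookup f {#})"
proof (rule fock_eqI)
  fix c
  show "lookup f c = lookup (cst (lookup f {#})) c"
  proof (cases c)
    case empty then show ?thesis by (simp add: lookup_cst)
  next
    case (add j d)
    have "of_nat (count d j + 1) * lookup f (add_mset j d) = 0"
      using lookup_der[of j f d] assms by simp
    then have "lookup f c = 0" using add by (metis Suc_eq_plus1 Zero_neq_Suc mult_eq_0_iff of_nat_eq_0_iff)
    then show ?thesis using add by (simp add: lookup_cst)
  qed
qed

lemma lev_der: "lev n f \<Longrightarrow> lev (n - int j - 1) (der j f)"
  by (force simp: lev_def in_keys_iff lookup_der)

lemma der_large: "\<forall>c\<in>keys f. pwt c \<le> N \<Longrightarrow> N \<le> j \<Longrightarrow> der j f = 0"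
  by (rule fock_eqI) (force simp: lookup_der in_keys_iff)

lemma der_comm: "der j (der k f) = der k (der j f)"
  by (rule fock_eqI) (auto simp: lookup_der add_mset_commute)

text \<open>The coefficient of \<open>z\<^sup>m\<close> in \<open>exp (\<kappa> \<Sum>\<^sub>k \<alpha>(-k) z\<^sup>k / k)\<close>.\<close>

definition SS :: "complex \<Rightarrow> int \<Rightarrow> fock" where
  "SS \<kappa> m = (\<Sum>\<mu>\<in>{\<mu>. int (pwt \<mu>) = m}. cst (\<kappa> ^ size \<mu> / zee \<mu>) * mon \<mu>)"

lemma lookup_SS: "lookup (SS \<kappa> m) \<mu> = (if int (pwt \<mu>) = m then \<kappa> ^ size \<mu> / zee \<mu> else 0)"
proof -
  have "lookup (SS \<kappa> m) \<mu> = (\<Sum>\<nu>\<in>{\<nu>. int (pwt \<nu>) = m}. if \<nu> = \<mu> then \<kappa> ^ size \<nu> / zee \<nu> else 0)"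
    unfolding SS_def by (simp add: lookup_sum lookup_mon if_distrib cong: if_cong)
  also have "\<dots> = (if int (pwt \<mu>) = m then \<kappa> ^ size \<mu> / zee \<mu> else 0)"
    by (simp add: sum.delta' finite_pwt_int)
  finally show ?thesis .
qed

lemma zee_nonzero [simp]: "zee \<mu> \<noteq> 0"
proof -
  have "(\<Prod>x\<in>#\<mu>. Suc x) \<noteq> 0" by (induction \<mu>) auto
  then show ?thesis unfolding zee_def of_nat_eq_0_iff by auto
qed

lemma zee_add: "zee (add_mset j \<mu>) = of_nat (j + 1) * of_nat (count \<mu> j + 1) * zee \<mu>"
proof -
  let ?K = "insert j (set_mset \<mu>)"
  have f: "(\<Prod>k\<in>set_mset \<mu>. fact (count \<mu> k)::nat) = (\<Prod>k\<in>?K. fact (count \<mu> k))"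
    by (rule prod.mono_neutral_left) (auto simp: not_in_iff)
  have "(\<Prod>k\<in>?K. fact (count (add_mset j \<mu>) k)::nat) = fact (count \<mu> j + 1) * (\<Prod>k\<in>?K-{j}. fact (count \<mu> k))"
    by (subst prod.remove[of _ j]) auto
  also have "\<dots> = (count \<mu> j + 1) * (fact (count \<mu> j) * (\<Prod>k\<in>?K-{j}. fact (count \<mu> k)))"
    by (simp add: algebra_simps)
  also have "(fact (count \<mu> j) * (\<Prod>k\<in>?K-{j}. fact (count \<mu> k))) = (\<Prod>k\<in>?K. fact (count \<mu> k)::nat)"
    by (subst (2) prod.remove[of _ j]) auto
  finally have g: "(\<Prod>k\<in>?K. fact (count (add_mset j \<mu>) k)::nat) = (count \<mu> j + 1) * (\<Prod>k\<in>set_mset \<mu>. fact (count \<mu> k))"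
    by (simp add: f)
  then show ?thesis unfolding zee_def set_mset_add_mset_insert g
    by (simp add: algebra_simps)
qed

lemma zee_empty [simp]: "zee {#} = 1" by (simp add: zee_def)

lemma SS_neg [simp]: "m < 0 \<Longrightarrow> SS \<kappa> m = 0" by (auto simp: SS_def)
lemma SS_0 [simp]: "SS \<kappa> 0 = 1"
  by (rule fock_eqI) (auto simp: lookup_SS lookup_1)
lemma lev_SS: "lev m (SS \<kappa> m)" by (auto simp: lev_def in_keys_iff lookup_SS split: if_splits)

text \<open>The generating series is the exponential of a form linear in the variables, so a
  derivative only multiplies it by kappa z^(j+1) / (j+1).\<close>

lemma der_SS: "der j (SS \<kappa> m) = cst (\<kappa> / of_nat (j + 1)) * SS \<kappa> (m - int j - 1)"
proof (rule fock_eqI)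
  fix c
  have nz: "(of_nat (j + 1) :: complex) \<noteq> 0" "(of_nat (count c j + 1) :: complex) \<noteq> 0"
    using of_nat_neq_0 by (metis Suc_eq_plus1)+
  have e: "int (pwt (add_mset j c)) = m \<longleftrightarrow> int (pwt c) = m - int j - 1" by auto
  show "lookup (der j (SS \<kappa> m)) c = lookup (cst (\<kappa> / of_nat (j + 1)) * SS \<kappa> (m - int j - 1)) c"
    unfolding lookup_der lookup_SS lookup_cst_mult e using nz
    by (simp add: zee_add field_simps del: of_nat_Suc of_nat_add)
qed

section \<open>Finitely supported sums over mode indices\<close>

abbreviation fs :: "('i \<Rightarrow> fock) \<Rightarrow> bool" where "fs g \<equiv> finite {r. g r \<noteq> 0}"

lemma fs_add: "fs g \<Longrightarrow> fs h \<Longrightarrow> fs (\<lambda>r. g r + h r)"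
  by (rule finite_subset[of _ "{r. g r \<noteq> 0} \<union> {r. h r \<noteq> 0}"]) auto
lemma fs_lin: "clin T \<Longrightarrow> fs g \<Longrightarrow> fs (\<lambda>r. T (g r))"
  by (erule finite_subset[rotated]) (auto simp: clin_0)
lemma fs_mult: "fs g \<Longrightarrow> fs (\<lambda>r. h r * g r)"
  by (erule finite_subset[rotated]) auto
lemma fs_sub: "fs g \<Longrightarrow> (\<And>r. g r = 0 \<Longrightarrow> h r = 0) \<Longrightarrow> fs h"
  by (erule finite_subset[rotated]) auto
lemma fs_delta [simp]: "fs (\<lambda>r. if r = a then g r else 0)"
  by (rule finite_subset[of _ "{a}"]) auto
lemma fs_int: "(\<And>r. r < a \<Longrightarrow> g r = 0) \<Longrightarrow> (\<And>r. r > b \<Longrightarrow> g r = 0) \<Longrightarrow> fs (g :: int \<Rightarrow> fock)"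
  by (rule finite_subset[of _ "{a..b}"]) (force intro: leI, simp)
text \<open>\<open>Sum_any\<close> is 0 as soon as the support is infinite, so every rearrangement
  of a sum of modes carries a proof that the support is finite.\<close>

lemma SA_add: "fs g \<Longrightarrow> fs h \<Longrightarrow> Sum_any (\<lambda>r. g r + h r) = Sum_any g + Sum_any h"
  by (rule Sum_any.distrib)
lemma SA_lin: "clin T \<Longrightarrow> fs g \<Longrightarrow> T (Sum_any g) = Sum_any (\<lambda>r. T (g r))"
  by (subst (2) Sum_any.expand_superset[of "{r. g r \<noteq> 0}"])
     (auto simp: Sum_any.expand_set clin_sum clin_0)
lemma SA_mult: "fs g \<Longrightarrow> h * Sum_any g = Sum_any (\<lambda>r. h * g r)"
  by (rule SA_lin[OF clin_mult])
lemma SA_diff: "fs g \<Longrightarrow> fs h \<Longrightarrow> Sum_any (\<lambda>r. g r - h r) = Sum_any g - Sum_any h"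
  using SA_add[of g "\<lambda>r. - h r"] SA_lin[of "\<lambda>f. - f" h] by (simp add: clin_def)
lemma SA_shift: "Sum_any (\<lambda>r::int. g (r + k)) = Sum_any g"
  by (rule Sum_any.reindex_cong[of "\<lambda>r. r - k"])
     (auto intro!: bijI' exI[of _ "_ + k"])
lemma SA_reflect: "Sum_any (\<lambda>r::int. g (k - r)) = Sum_any g"
  by (rule Sum_any.reindex_cong[of "\<lambda>r. k - r"])
     (auto intro!: bijI' exI[of _ "k - _"])
lemma fs_shift: "fs g \<Longrightarrow> fs (\<lambda>r::int. g (r + k))"
  by (rule finite_subset[of _ "(\<lambda>r. r - k) ` {r. g r \<noteq> 0}"]) (auto intro: rev_image_eqI)
lemma fs_reflect: "fs g \<Longrightarrow> fs (\<lambda>r::int. g (k - r))"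
  by (rule finite_subset[of _ "(\<lambda>r. k - r) ` {r. g r \<noteq> 0}"]) (auto intro: rev_image_eqI)
lemma clin_SA: "(\<And>r. clin (T r)) \<Longrightarrow> (\<And>f. fs (\<lambda>r. T r f)) \<Longrightarrow> clin (\<lambda>f. Sum_any (\<lambda>r. T r f))"
  by (intro clinI) (simp_all add: clin_add clin_scale SA_add SA_mult)
lemma lev_SA: "(\<And>r. lev n (g r)) \<Longrightarrow> lev n (Sum_any g)"
  by (simp add: Sum_any.expand_set lev_sum)
text \<open>Moving the cut of a normal ordering from 0 to k exchanges |k| modes, each at the cost of
  the same vector K, with the sign of k.\<close>

lemma SA_interval: "Sum_any (\<lambda>s::int. if 0 \<le> s \<and> s < k then K else if k \<le> s \<and> s < 0 then - K else 0) = cst (of_int k) * (K :: fock)"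
proof -
  have "Sum_any (\<lambda>s::int. if 0 \<le> s \<and> s < k then K else if k \<le> s \<and> s < 0 then - K else 0)
     = (\<Sum>s\<in>{min 0 k..<max 0 k}. if 0 \<le> s \<and> s < k then K else if k \<le> s \<and> s < 0 then - K else 0)"
    by (rule Sum_any.expand_superset) auto
  also have "\<dots> = cst (of_int k) * K"
  proof (cases "0 \<le> k")
    case True
    then have "(\<Sum>s\<in>{min 0 k..<max 0 k}. if 0 \<le> s \<and> s < k then K else if k \<le> s \<and> s < 0 then - K else 0) = (\<Sum>s\<in>{0..<k}. K)"
      by (intro sum.cong) auto
    also have "\<dots> = cst (of_int k) * K" using True
    proof -
      have "of_nat n * K = cst (of_nat n) * K" for n
        by (induction n) (auto simp: cst_add algebra_simps)
      from this[of "nat k"] show ?thesis using True by simp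
    qed
    finally show ?thesis .
  next
    case False
    then have "(\<Sum>s\<in>{min 0 k..<max 0 k}. if 0 \<le> s \<and> s < k then K else if k \<le> s \<and> s < 0 then - K else 0) = (\<Sum>s\<in>{k..<0}. - K)"
      by (intro sum.cong) auto
    also have "\<dots> = cst (of_int k) * K" using False
    proof -
      have "of_nat n * K = cst (of_nat n) * K" for n
        by (induction n) (auto simp: cst_add algebra_simps)
      from this[of "nat (-k)"] show ?thesis using False by (simp add: cst_minus)
    qed
    finally show ?thesis .
  qed
  finally show ?thesis .
qed
lemma fs_interval: "fs (\<lambda>s::int. if 0 \<le> s \<and> s < k then K else if k \<le> s \<and> s < 0 then - K else (0::fock))"
  by (rule finite_subset[of _ "{min 0 k..<max 0 k}"]) auto

lemma clin_cst: "clin T \<Longrightarrow> T (cst z) = cst z * T 1" using clin_scale[of T z 1] by simp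

lemma cst_dist2: "cst a * (X + (cst b * K + cst c * K)) = cst a * X + cst (a * (b + c)) * K"
  by (simp add: cst_add cst_mult algebra_simps)
lemma cst_dist1: "cst a * (cst b * K + cst c * K) = cst (a * (b + c)) * K"
  by (simp add: cst_add cst_mult algebra_simps)
lemma cst_comb: "cst a * cst b - cst c * cst d = cst (a * b - c * d)"
  by (simp add: cst_diff cst_mult)

section \<open>Heisenberg, lattice and Virasoro operators\<close>

text \<open>All charges are doubled: the index \<open>\<chi>\<close> refers to the summand \<open>M(1) \<otimes> exp (\<chi> \<alpha> / 2)\<close>, so that half-integral
  multiples of \<open>\<alpha>\<close> are covered as well.\<close>

locale trip = fixes p :: nat assumes p2: "2 \<le> p"
begin

abbreviation "pc \<equiv> (of_nat p :: complex)"

lemma pc_nz [simp]: "pc \<noteq> 0" using p2 by auto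
lemma p_nz [simp]: "p \<noteq> 0" using p2 by auto

text \<open>The zero mode is the pairing of alpha with chi alpha / 2, that is p chi; the factor 2 p
  r of the positive modes is the Heisenberg commutator.\<close>

definition al :: "int \<Rightarrow> int \<Rightarrow> fock \<Rightarrow> fock" where
  "al \<chi> r f = (if r < 0 then var (nat (- r - 1)) * f
     else if r = 0 then cst (pc * of_int \<chi>) * f
     else cst (2 * pc * of_int r) * der (nat (r - 1)) f)"

lemma clin_al: "clin (al \<chi> r)"
  unfolding al_def by (cases "r < 0"; cases "r = 0") (auto simp: clin_mult clin_mul clin_der)

lemma al_neg: "al \<chi> (- int j - 1) f = var j * f" by (simp add: al_def)
lemma al_0: "al \<chi> 0 f = cst (pc * of_int \<chi>) * f" by (simp add: al_def)
lemma al_pos: "al \<chi> (int j + 1) f = cst (2 * pc * of_nat (j + 1)) * der j f" by (simp add: al_def algebra_simps)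
lemma al_chi: "r \<noteq> 0 \<Longrightarrow> al \<chi> r f = al \<chi>' r f" by (simp add: al_def)

lemma int_cases3: obtains "r = 0" | j where "r = int j + 1" | j where "r = - int j - 1"
proof -
  consider "r = 0" | "r > 0" | "r < 0" by linarith
  then show ?thesis
  proof cases
    case 2 then show ?thesis using that(2)[of "nat (r - 1)"] by simp
  next
    case 3 then show ?thesis using that(3)[of "nat (- r - 1)"] by simp
  qed (use that in auto)
qed

lemma al_comm: "al \<chi> r (al \<chi> s f) = al \<chi> s (al \<chi> r f) + cst (if r + s = 0 then 2 * pc * of_int r else 0) * f"
  apply (cases r rule: int_cases3; cases s rule: int_cases3)
          apply (simp_all only: al_neg al_0 al_pos clin_scale[OF clin_der] der_var der_comm[of _ _ f])
          apply (auto simp: algebra_simps cst_minus cst_add cst_mult cst_diff)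
  done

lemma al_1: "r > 0 \<Longrightarrow> al \<chi> r 1 = 0" by (simp add: al_def)

lemma lev_al: "lev n f \<Longrightarrow> lev (n - r) (al \<chi> r f)"
proof (cases r rule: int_cases3)
  case 1 then show "lev n f \<Longrightarrow> lev (n - r) (al \<chi> r f)" by (simp add: al_0 lev_scale)
next
  case (2 j) then show "lev n f \<Longrightarrow> lev (n - r) (al \<chi> r f)"
    using lev_scale[OF lev_der[of n f j]] unfolding 2 al_pos by (simp add: diff_diff_eq)
next
  case (3 j) then show "lev n f \<Longrightarrow> lev (n - r) (al \<chi> r f)"
    using lev_var[of n f j] unfolding 3 al_neg by (simp add: algebra_simps)
qed

lemma al_high: "\<exists>N. \<forall>r>N. al \<chi> r f = 0"
proof -
  obtain N where N: "\<forall>c\<in>keys f. pwt c \<le> N" using keys_bound by blast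
  have "al \<chi> r f = 0" if "r > int N" for r
    using that der_large[OF N, of "nat (r - 1)"] by (auto simp: al_def)
  then show ?thesis by blast
qed

text \<open>A family with the commutation relations of a vertex operator is determined by the constant
  terms of its values at the vacuum.\<close>

lemma fam_zero:
  assumes lin: "\<And>m. clin (X m)"
    and comm: "\<And>m r f. r \<noteq> 0 \<Longrightarrow> al \<chi> r (X m f) = X m (al \<chi> r f) + cst k * X (m - r) f"
    and c0: "\<And>m. lookup (X m 1) {#} = 0" and neg: "\<And>m. m < 0 \<Longrightarrow> X m 1 = 0"
  shows "X (m::int) f = 0"
proof -
  have one: "X (int m) 1 = 0" for m :: nat
  proof (induction m rule: less_induct)
    case (less m)
    have "der j (X (int m) 1) = 0" for j
    proof -
      have z: "X (int m - (int j + 1)) 1 = 0"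
      proof (cases "int m - (int j + 1) < 0")
        case False
        then have e: "int m - (int j + 1) = int (m - (j + 1))" by simp
        show ?thesis unfolding e using False by (intro less) simp
      qed (rule neg)
      have "al \<chi> (int j + 1) (X (int m) 1) = 0"
        using comm[of "int j + 1" "int m" 1] z by (simp add: al_1 clin_0[OF lin])
      then show ?thesis using of_nat_neq_0[of j, where 'a=complex] by (simp add: al_pos)
    qed
    then have "X (int m) 1 = cst (lookup (X (int m) 1) {#})" by (rule der_all_0)
    then show ?case using c0 by simp
  qed
  have one': "X m 1 = 0" for m using one[of "nat m"] neg[of m] by (cases "m < 0") auto
  have "\<forall>m. X m f = 0"
  proof (induction f rule: fock_induct)
    case (var j f)
    then show ?case using comm[of "- int j - 1" _ f] by (simp add: al_neg)
  qed (auto simp: one' clin_add[OF lin] clin_scale[OF lin])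
  then show ?thesis by simp
qed

section \<open>Vertex operators on the Fock space\<close>

definition Bin :: "nat multiset \<Rightarrow> nat multiset \<Rightarrow> complex" where
  "Bin c \<nu> = (\<Prod>k\<in>set_mset \<nu>. of_nat (count c k choose count \<nu> k))"

lemma Bin_superset: "finite K \<Longrightarrow> set_mset \<nu> \<subseteq> K \<Longrightarrow> Bin c \<nu> = (\<Prod>k\<in>K. of_nat (count c k choose count \<nu> k))"
  unfolding Bin_def by (rule prod.mono_neutral_left) (auto simp: not_in_iff)

lemma Bin_not_sub: "\<not> \<nu> \<subseteq># c \<Longrightarrow> Bin c \<nu> = 0"
proof -
  assume "\<not> \<nu> \<subseteq># c"
  then obtain k where k: "count c k < count \<nu> k" by (meson not_le subseteq_mset_def)
  then have "k \<in># \<nu>" using count_inI by force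
  then show ?thesis using k unfolding Bin_def by (intro prod_zero) (auto intro!: bexI[of _ k] simp: binomial_eq_0)
qed

text \<open>Pascal's rule. \<open>Bin\<close> counts the ways in which the annihilation half of a
  vertex operator removes a submultiset from a monomial, and a new factor is either kept or
  removed.\<close>

lemma Bin_add: "Bin (add_mset j c) \<nu> = Bin c \<nu> + (if j \<in># \<nu> then Bin c (\<nu> - {#j#}) else 0)"
proof (cases "j \<in># \<nu>")
  case False
  then have "Bin (add_mset j c) \<nu> = Bin c \<nu>"
    unfolding Bin_def by (intro prod.cong) auto
  then show ?thesis using False by simp
next
  case True
  let ?K = "set_mset \<nu>"
  have s: "set_mset (\<nu> - {#j#}) \<subseteq> ?K" by (auto dest: in_diffD)
  obtain a where a: "count \<nu> j = Suc a" using True by (metis count_eq_zero_iff not0_implies_Suc)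
  let ?R = "\<Prod>k\<in>?K - {j}. of_nat (count c k choose count \<nu> k) :: complex"
  have 1: "Bin (add_mset j c) \<nu> = of_nat (Suc (count c j) choose Suc a) * ?R"
    unfolding Bin_def by (subst prod.remove[of _ j]) (use True a in auto)
  have 2: "Bin c \<nu> = of_nat (count c j choose Suc a) * ?R"
    unfolding Bin_def by (subst prod.remove[of _ j]) (use True a in auto)
  have 3: "Bin c (\<nu> - {#j#}) = of_nat (count c j choose a) * ?R"
    unfolding Bin_superset[OF finite_set_mset s] by (subst prod.remove[of _ j]) (use True a in auto)
  show ?thesis using True unfolding 1 2 3 by (simp add: algebra_simps)
qed

text \<open>The coefficient of \<open>z\<^sup>m\<close> in the vertex operator of \<open>exp (\<gamma> \<alpha> / 2)\<close>, stripped of its charge shift and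
  of the factor \<open>z\<close> to the power \<open>\<gamma> \<alpha>(0) / 2\<close>; it is therefore independent of the charge it acts on.\<close>

definition V :: "int \<Rightarrow> int \<Rightarrow> fock \<Rightarrow> fock" where
  "V \<gamma> m = lext (\<lambda>c. \<Sum>\<nu>\<in>{\<nu>. \<nu> \<subseteq># c}. cst ((- pc * of_int \<gamma>) ^ size \<nu> * Bin c \<nu>) * SS (of_int \<gamma> / 2) (m + int (pwt \<nu>)) * mon (c - \<nu>))"

lemma clin_V: "clin (V \<gamma> m)" unfolding V_def by (rule clin_lext)

lemma finite_sub_mset [simp]: "finite {\<nu>. \<nu> \<subseteq># (c :: nat multiset)}"
proof (rule finite_subset[OF _ finite_pwt_le[of "pwt c"]])
  show "{\<nu>. \<nu> \<subseteq># c} \<subseteq> {ca. pwt ca \<le> pwt c}"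
    by (metis (mono_tags, lifting) Collect_mono le_add1 pwt_plus subset_mset.le_iff_add)
qed

lemma V_1: "V \<gamma> m 1 = SS (of_int \<gamma> / 2) m"
proof -
  have "V \<gamma> m (mon {#}) = SS (of_int \<gamma> / 2) m"
    unfolding V_def lext_mon by (simp add: Bin_def)
  then show ?thesis by simp
qed

text \<open>The creation operator commutes with the creation half and has a scalar commutator with
  the exponent of the annihilation half; the scalar carries z^(-j-1), hence the shift of m.\<close>

lemma V_var: "V \<gamma> m (var j * f) = var j * V \<gamma> m f - cst (pc * of_int \<gamma>) * V \<gamma> (m + int j + 1) f"
proof (rule clin_eq_mon[of "\<lambda>f. V \<gamma> m (var j * f)" "\<lambda>f. var j * V \<gamma> m f - cst (pc * of_int \<gamma>) * V \<gamma> (m + int j + 1) f"])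
  show "clin (\<lambda>f. V \<gamma> m (var j * f))" by (rule clin_comp[OF clin_V clin_mult])
  show "clin (\<lambda>f. var j * V \<gamma> m f - cst (pc * of_int \<gamma>) * V \<gamma> (m + int j + 1) f)"
    by (intro clin_sub clin_mul clin_V)
  fix c
  let ?t = "- pc * of_int \<gamma>"
  let ?S = "SS (of_int \<gamma> / 2)"
  define G where "G \<nu> = cst (?t ^ size \<nu>) * ?S (m + int (pwt \<nu>)) * mon (add_mset j c - \<nu>)" for \<nu>
  let ?D = "{\<nu>. \<nu> \<subseteq># add_mset j c}"
  have "V \<gamma> m (var j * mon c) = (\<Sum>\<nu>\<in>?D. cst (Bin (add_mset j c) \<nu>) * G \<nu>)"
    unfolding mon_add[symmetric] V_def lext_mon G_def by (simp add: cst_mult mult_ac)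
  also have "\<dots> = (\<Sum>\<nu>\<in>?D. cst (Bin c \<nu>) * G \<nu>) + (\<Sum>\<nu>\<in>?D. if j \<in># \<nu> then cst (Bin c (\<nu> - {#j#})) * G \<nu> else 0)"
    unfolding Bin_add sum.distrib[symmetric] by (intro sum.cong) (auto simp: cst_add algebra_simps)
  also have "(\<Sum>\<nu>\<in>?D. cst (Bin c \<nu>) * G \<nu>) = (\<Sum>\<nu>\<in>{\<nu>. \<nu> \<subseteq># c}. cst (Bin c \<nu>) * G \<nu>)"
    by (rule sum.mono_neutral_right) (auto simp: Bin_not_sub intro: subset_mset.order_trans)
  also have "\<dots> = var j * V \<gamma> m (mon c)"
    unfolding V_def lext_mon sum_distrib_left
  proof (intro sum.cong refl)
    fix \<nu> assume "\<nu> \<in> {\<nu>. \<nu> \<subseteq># c}"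
    then have "mon (add_mset j c - \<nu>) = var j * mon (c - \<nu>)"
      using multiset_diff_union_assoc[of \<nu> c "{#j#}"] by (simp add: mon_add[symmetric])
    then show "cst (Bin c \<nu>) * G \<nu> = var j * (cst (?t ^ size \<nu> * Bin c \<nu>) * ?S (m + int (pwt \<nu>)) * mon (c - \<nu>))"
      unfolding G_def by (simp add: cst_mult mult_ac)
  qed
  also have "(\<Sum>\<nu>\<in>?D. if j \<in># \<nu> then cst (Bin c (\<nu> - {#j#})) * G \<nu> else 0)
      = (\<Sum>\<nu>\<in>{\<nu>\<in>?D. j \<in># \<nu>}. cst (Bin c (\<nu> - {#j#})) * G \<nu>)"
    by (rule sum.inter_filter[symmetric]) simp
  also have "\<dots> = (\<Sum>\<nu>\<in>{\<nu>. \<nu> \<subseteq># c}. cst (Bin c \<nu>) * G (add_mset j \<nu>))"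
    by (rule sum.reindex_bij_witness[of _ "add_mset j" "\<lambda>\<nu>. \<nu> - {#j#}"])
       (auto simp: subset_eq_diff_conv)
  also have "\<dots> = - cst (pc * of_int \<gamma>) * V \<gamma> (m + int j + 1) (mon c)"
    unfolding V_def lext_mon sum_distrib_left
    by (intro sum.cong refl) (simp add: G_def cst_mult cst_minus algebra_simps)
  finally show "V \<gamma> m (var j * mon c) = var j * V \<gamma> m (mon c) - cst (pc * of_int \<gamma>) * V \<gamma> (m + int j + 1) (mon c)"
    by simp
qed

lemma der_V: "der j (V \<gamma> m f) = V \<gamma> m (der j f) + cst (of_int \<gamma> / (2 * of_nat (j + 1))) * V \<gamma> (m - int j - 1) f"
proof -
  have "\<forall>m. der j (V \<gamma> m f) = V \<gamma> m (der j f) + cst (of_int \<gamma> / (2 * of_nat (j + 1))) * V \<gamma> (m - int j - 1) f"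
  proof (induction f rule: fock_induct)
    case one
    then show ?case by (simp add: V_1 der_SS clin_0[OF clin_V] del: of_nat_Suc of_nat_add)
  next
    case (var k f)
    show ?case
    proof
      fix m
      show "der j (V \<gamma> m (var k * f)) = V \<gamma> m (der j (var k * f)) + cst (of_int \<gamma> / (2 * of_nat (j + 1))) * V \<gamma> (m - int j - 1) (var k * f)"
        unfolding V_var clin_diff[OF clin_der] clin_scale[OF clin_der] der_var clin_add[OF clin_V]
        using var by (auto simp: algebra_simps clin_0[OF clin_V])
    qed
  next
    case (add f g) then show ?case by (simp add: clin_add[OF clin_V] clin_add[OF clin_der] algebra_simps)
  next
    case (scale z f) then show ?case
      unfolding clin_scale[OF clin_V] clin_scale[OF clin_der] by (simp add: algebra_simps)
  qed
  then show ?thesis by simp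
qed

text \<open>The relation [alpha(r), Y(z)] = p gamma z^r Y(z) for every r; for r = 0 it is the jump
  of the charge from chi to chi + gamma.\<close>

lemma al_V: "al (\<chi> + \<gamma>) r (V \<gamma> m f) = V \<gamma> m (al \<chi> r f) + cst (pc * of_int \<gamma>) * V \<gamma> (m - r) f"
proof (cases r rule: int_cases3)
  case 1 then show ?thesis unfolding 1 al_0 clin_scale[OF clin_V] by (simp add: cst_add cst_mult algebra_simps)
next
  case (2 j)
  have nz: "(of_nat (j + 1) :: complex) \<noteq> 0" using of_nat_neq_0 by (metis Suc_eq_plus1)
  have "al (\<chi> + \<gamma>) r (V \<gamma> m f) = V \<gamma> m (al \<chi> r f) + cst (2 * pc * of_nat (j + 1)) * (cst (of_int \<gamma> / (2 * of_nat (j + 1))) * V \<gamma> (m - int j - 1) f)"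
    unfolding 2 al_pos der_V distrib_left clin_scale[OF clin_V] ..
  also have "cst (2 * pc * of_nat (j + 1)) * (cst (of_int \<gamma> / (2 * of_nat (j + 1))) * V \<gamma> (m - int j - 1) f) = cst (pc * of_int \<gamma>) * V \<gamma> (m - int j - 1) f"
    unfolding mult.assoc[symmetric] cst_mult[symmetric] using nz by (simp del: of_nat_Suc of_nat_add)
  finally show ?thesis by (simp add: 2 algebra_simps)
next
  case (3 j) then show ?thesis unfolding 3 al_neg V_var by (simp add: algebra_simps)
qed

lemma al_V': "al \<chi> r (V \<gamma> m f) = V \<gamma> m (al (\<chi> - \<gamma>) r f) + cst (pc * of_int \<gamma>) * V \<gamma> (m - r) f"
  using al_V[of "\<chi> - \<gamma>" \<gamma>] by simp

lemma lev_V: "lev n f \<Longrightarrow> lev (n + m) (V \<gamma> m f)"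
proof -
  assume f: "lev n f"
  have m: "lev (int (pwt c) + m) (V \<gamma> m (mon c))" for c
    unfolding V_def lext_mon
  proof (intro lev_sum)
    fix \<nu> assume "\<nu> \<in> {\<nu>. \<nu> \<subseteq># c}"
    then have e: "pwt c = pwt (c - \<nu>) + pwt \<nu>" using pwt_plus[of "c - \<nu>" \<nu>] by simp
    show "lev (int (pwt c) + m) (cst ((- pc * of_int \<gamma>) ^ size \<nu> * Bin c \<nu>) * SS (of_int \<gamma> / 2) (m + int (pwt \<nu>)) * mon (c - \<nu>))"
      using lev_scale[OF lev_mult[OF lev_SS[of "m + int (pwt \<nu>)" "of_int \<gamma> / 2"] lev_mon[of "c - \<nu>"]], of "(- pc * of_int \<gamma>) ^ size \<nu> * Bin c \<nu>"] e
      by (simp add: mult.assoc add_ac)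
  qed
  have "V \<gamma> m f = (\<Sum>c\<in>keys f. cst (lookup f c) * V \<gamma> m (mon c))"
    by (subst fock_expand[OF finite_keys order_refl, of f]) (simp add: clin_sum[OF clin_V] clin_scale[OF clin_V])
  moreover have "lev (n + m) (\<Sum>c\<in>keys f. cst (lookup f c) * V \<gamma> m (mon c))"
    using f m by (intro lev_sum lev_scale) (auto simp: lev_def)
  ultimately show ?thesis by simp
qed

lemma V_low: "\<exists>N. \<forall>m<N. V \<gamma> m f = 0"
proof (induction f rule: fock_induct_mon)
  case (mon c)
  have "V \<gamma> m (mon c) = 0" if "m < - int (pwt c)" for m
    by (rule lev_neg[OF lev_V[OF lev_mon]]) (use that in auto)
  then show ?case by blast
next
  case (add f g)
  then obtain N1 N2 where "\<forall>m<N1. V \<gamma> m f = 0" "\<forall>m<N2. V \<gamma> m g = 0" by auto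
  then show ?case by (intro exI[of _ "min N1 N2"]) (simp add: clin_add[OF clin_V])
next
  case (scale z f)
  then show ?case by (auto simp: clin_scale[OF clin_V])
qed

lemma fs_NV: "fs (\<lambda>r. if r < (b::int) then al \<chi> r (V \<gamma> (m + r) f) else V \<gamma> (m + r) (al \<chi>' r f))"
proof -
  obtain N1 where 1: "\<forall>m<N1. V \<gamma> m f = 0" using V_low by blast
  obtain N2 where 2: "\<forall>r>N2. al \<chi>' r f = 0" using al_high by blast
  show ?thesis
    by (rule fs_int[where a = "min b (N1 - m)" and b = "max b N2"])
       (use 1 2 in \<open>auto simp: clin_0[OF clin_al] clin_0[OF clin_V]\<close>)
qed

lemma NV_comm_aux:
  assumes s: "s \<noteq> 0"
  shows "al \<chi>' s (if r < 0 then al \<chi>' r (V \<gamma> (m + r) f) else V \<gamma> (m + r) (al \<chi> r f)) =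
      (if r < 0 then al \<chi>' r (V \<gamma> (m + r) (al \<chi> s f)) else V \<gamma> (m + r) (al \<chi> r (al \<chi> s f)))
    + cst (pc * of_int \<gamma>) * (if r < 0 then al \<chi>' r (V \<gamma> (m - s + r) f) else V \<gamma> (m - s + r) (al \<chi> r f))
    + (if r = - s then cst (2 * pc * of_int s) * V \<gamma> (m - s) f else 0)"
proof (cases "r < 0")
  case True
  have "al \<chi>' s (al \<chi>' r (V \<gamma> (m + r) f)) = al \<chi>' r (al \<chi>' s (V \<gamma> (m + r) f)) + cst (if s + r = 0 then 2 * pc * of_int s else 0) * V \<gamma> (m + r) f"
    by (rule al_comm)
  also have "al \<chi>' s (V \<gamma> (m + r) f) = V \<gamma> (m + r) (al \<chi> s f) + cst (pc * of_int \<gamma>) * V \<gamma> (m + r - s) f"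
    using al_V'[of \<chi>' s \<gamma> "m + r" f] al_chi[OF s, of "\<chi>' - \<gamma>" f \<chi>] by simp
  finally show ?thesis using True
    by (auto simp: clin_add[OF clin_al] clin_scale[OF clin_al] algebra_simps)
next
  case False
  have "al \<chi>' s (V \<gamma> (m + r) (al \<chi> r f)) = V \<gamma> (m + r) (al \<chi> s (al \<chi> r f)) + cst (pc * of_int \<gamma>) * V \<gamma> (m + r - s) (al \<chi> r f)"
    using al_V'[of \<chi>' s \<gamma> "m + r" "al \<chi> r f"] al_chi[OF s, of "\<chi>' - \<gamma>" _ \<chi>] by simp
  also have "al \<chi> s (al \<chi> r f) = al \<chi> r (al \<chi> s f) + cst (if s + r = 0 then 2 * pc * of_int s else 0) * f"
    by (rule al_comm)
  finally show ?thesis using False unfolding clin_add[OF clin_V] clin_scale[OF clin_V]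
    by (auto simp: algebra_simps)
qed

text \<open>The normally ordered product of alpha(z) with the vertex operator;
  \<open>V_deriv\<close> identifies gamma / 2 times it with the Euler derivative.\<close>

definition NV :: "int \<Rightarrow> int \<Rightarrow> int \<Rightarrow> fock \<Rightarrow> fock" where
  "NV \<chi> \<gamma> m f = Sum_any (\<lambda>r. if r < 0 then al (\<chi> + \<gamma>) r (V \<gamma> (m + r) f) else V \<gamma> (m + r) (al \<chi> r f))"

lemma clin_NV: "clin (NV \<chi> \<gamma> m)"
  unfolding NV_def by (rule clin_SA) (intro clin_if clin_comp[OF clin_al clin_V] clin_comp[OF clin_V clin_al], rule fs_NV)

lemma NV_comm: assumes s: "s \<noteq> 0"
  shows "al \<chi>'' s (NV \<chi> \<gamma> m f) = NV \<chi> \<gamma> m (al \<chi>'' s f) + cst (pc * of_int \<gamma>) * NV \<chi> \<gamma> (m - s) f + cst (2 * pc * of_int s) * V \<gamma> (m - s) f"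
proof -
  have e: "al \<chi>'' s g = al (\<chi> + \<gamma>) s g" "al \<chi>'' s g = al \<chi> s g" for g using al_chi[OF s] by auto
  have "al \<chi>'' s (NV \<chi> \<gamma> m f) = Sum_any (\<lambda>r. al (\<chi> + \<gamma>) s (if r < 0 then al (\<chi> + \<gamma>) r (V \<gamma> (m + r) f) else V \<gamma> (m + r) (al \<chi> r f)))"
    unfolding NV_def e(1) by (rule SA_lin[OF clin_al fs_NV])
  also have "\<dots> = Sum_any (\<lambda>r. (if r < 0 then al (\<chi> + \<gamma>) r (V \<gamma> (m + r) (al \<chi> s f)) else V \<gamma> (m + r) (al \<chi> r (al \<chi> s f)))
    + cst (pc * of_int \<gamma>) * (if r < 0 then al (\<chi> + \<gamma>) r (V \<gamma> (m - s + r) f) else V \<gamma> (m - s + r) (al \<chi> r f))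
    + (if r = - s then cst (2 * pc * of_int s) * V \<gamma> (m - s) f else 0))"
    by (simp only: NV_comm_aux[OF s, of "\<chi> + \<gamma>" _ \<gamma> m f \<chi>])
  also have "\<dots> = NV \<chi> \<gamma> m (al \<chi> s f) + cst (pc * of_int \<gamma>) * NV \<chi> \<gamma> (m - s) f + cst (2 * pc * of_int s) * V \<gamma> (m - s) f"
    by (subst SA_add, intro fs_add fs_mult fs_NV, rule fs_delta, subst SA_add, rule fs_NV, intro fs_mult fs_NV)
       (simp add: NV_def SA_mult[OF fs_NV] del: Sum_any.cong cong: Sum_any.cong)
  finally show ?thesis by (simp only: e(2))
qed

lemma NV_1: "lookup (NV \<chi> \<gamma> m 1) {#} = (if m = 0 then pc * of_int \<chi> else 0)"
proof -
  have "NV \<chi> \<gamma> m 1 = Sum_any (\<lambda>r. (if r < 0 then al (\<chi> + \<gamma>) r (V \<gamma> (m + r) 1) else 0) + (if r = 0 then cst (pc * of_int \<chi>) * V \<gamma> m 1 else 0))"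
    unfolding NV_def by (rule Sum_any.cong) (auto simp: al_1 clin_0[OF clin_V] al_0 clin_cst[OF clin_V])
  also have "\<dots> = Sum_any (\<lambda>r. (if r < 0 then al (\<chi> + \<gamma>) r (V \<gamma> (m + r) 1) else 0)) + cst (pc * of_int \<chi>) * V \<gamma> m 1"
    by (subst SA_add) (rule fs_sub[OF fs_NV[of 0 "\<chi> + \<gamma>" \<gamma> m 1 \<chi>]], simp split: if_splits, rule fs_delta, simp)
  finally have e: "NV \<chi> \<gamma> m 1 = Sum_any (\<lambda>r. (if r < 0 then al (\<chi> + \<gamma>) r (V \<gamma> (m + r) 1) else 0)) + cst (pc * of_int \<chi>) * V \<gamma> m 1" .
  have v: "lookup (var j * g) {#} = 0" for j g
  proof (rule ccontr)
    assume "\<not> ?thesis"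
    then have "{#} \<in> keys (var j * g)" by (simp add: in_keys_iff)
    then have "{#} \<in> {a + b |a b. a \<in> keys (var j) \<and> b \<in> keys g}" using keys_mult by blast
    then show False by (auto simp: var_def)
  qed
  have "lookup (Sum_any (\<lambda>r. (if r < 0 then al (\<chi> + \<gamma>) r (V \<gamma> (m + r) 1) else 0))) {#} = 0"
    unfolding Sum_any.expand_set lookup_sum by (rule sum.neutral) (auto simp: al_def v)
  then show ?thesis unfolding e by (simp add: lookup_add V_1 lookup_SS)
qed

lemma NV_neg_one: "m < 0 \<Longrightarrow> NV \<chi> \<gamma> m 1 = 0"
proof -
  assume m: "m < 0"
  have "V \<gamma> (m + r) (al \<chi> r 1) = 0" if "\<not> r < 0" for r
    using that m by (cases "r = 0") (auto simp: al_0 al_1 clin_0[OF clin_V] clin_cst[OF clin_V] V_1)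
  then show ?thesis using m
    unfolding NV_def by (intro trans[OF Sum_any.cong Sum_any.neutral]) (auto simp: V_1 clin_0[OF clin_al])
qed

text \<open>On charge chi the true exponent of z is m + p gamma chi / 2, so the left side is z d/dz
  of the vertex operator. Both sides have the same Heisenberg commutators, since the extra term of
  \<open>NV_comm\<close> matches the change of the exponent from m - r to m.\<close>

lemma V_deriv: "cst (of_int m + pc * of_int \<gamma> * of_int \<chi> / 2) * V \<gamma> m f = cst (of_int \<gamma> / 2) * NV \<chi> \<gamma> m f"
proof -
  define X where "X m f = cst (of_int m + pc * of_int \<gamma> * of_int \<chi> / 2) * V \<gamma> m f - cst (of_int \<gamma> / 2) * NV \<chi> \<gamma> m f" for m f
  have "X m f = 0"
  proof (rule fam_zero[where X = X and k = "pc * of_int \<gamma>" and \<chi> = 0])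
    show "clin (X m)" for m unfolding X_def by (intro clin_sub clin_mul clin_V clin_NV)
    show "lookup (X m 1) {#} = 0" for m
      by (simp add: X_def lookup_minus V_1 lookup_SS NV_1)
    show "X m 1 = 0" if "m < 0" for m using that by (simp add: X_def V_1 NV_neg_one)
    fix m r :: int and f assume r: "r \<noteq> 0"
    have v: "al 0 r (V \<gamma> m f) = V \<gamma> m (al 0 r f) + cst (pc * of_int \<gamma>) * V \<gamma> (m - r) f"
      using al_V'[of 0 r \<gamma> m f] al_chi[OF r, of "0 - \<gamma>" f 0] by simp
    show "al 0 r (X m f) = X m (al 0 r f) + cst (pc * of_int \<gamma>) * X (m - r) f"
      unfolding X_def clin_diff[OF clin_al] clin_scale[OF clin_al] v NV_comm[OF r]
      by (simp add: cst_add cst_mult cst_diff cst_inverse_mult algebra_simps)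
         (simp flip: cst_mult mult.assoc add: mult_ac)
  qed
  then show ?thesis by (simp add: X_def)
qed

section \<open>Virasoro operators\<close>

definition Lt :: "int \<Rightarrow> int \<Rightarrow> fock \<Rightarrow> int \<Rightarrow> fock" where
  "Lt \<chi> n f r = (if r < 0 then al \<chi> r (al \<chi> (n - r) f) else al \<chi> (n - r) (al \<chi> r f))"

text \<open>The modes of \<open>omega\<close>. The field of alpha(-2) applied to the vacuum is the
  derivative of alpha(z), whence the factor n + 1 and its sign.\<close>

definition L :: "int \<Rightarrow> int \<Rightarrow> fock \<Rightarrow> fock" where
  "L \<chi> n f = cst (1 / (4 * pc)) * Sum_any (Lt \<chi> n f) - cst ((pc - 1) / (2 * pc) * (of_int n + 1)) * al \<chi> n f"

text \<open>The conformal weight of exp(chi alpha / 2), see \<open>L_0_1\<close>.\<close>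

definition hw :: "int \<Rightarrow> complex" where
  "hw \<chi> = pc * of_int \<chi> ^ 2 / 4 - (pc - 1) * of_int \<chi> / 2"

lemma fs_Lt: "fs (Lt \<chi> n f)"
proof -
  obtain N where N: "\<forall>r>N. al \<chi> r f = 0" using al_high by blast
  show ?thesis unfolding Lt_def
    by (rule fs_int[where a = "min 0 (n - N)" and b = "max 0 N"])
       (use N in \<open>auto simp: clin_0[OF clin_al]\<close>)
qed

lemma clin_Lt: "clin (\<lambda>f. Lt \<chi> n f r)"
  unfolding Lt_def by (intro clin_if clin_comp[OF clin_al clin_al])

lemma clin_L: "clin (L \<chi> n)"
  unfolding L_def by (intro clin_sub clin_mul clin_al clin_SA clin_Lt fs_Lt)

lemma lev_L: "lev k f \<Longrightarrow> lev (k - n) (L \<chi> n f)"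
proof -
  assume f: "lev k f"
  have "lev (k - n) (Lt \<chi> n f r)" for r
    unfolding Lt_def using lev_al[OF lev_al[OF f, of "n - r" \<chi>], of r \<chi>] lev_al[OF lev_al[OF f, of r \<chi>], of "n - r" \<chi>]
    by (simp add: algebra_simps)
  then show ?thesis unfolding L_def by (intro lev_diff lev_scale lev_SA lev_al f)
qed

lemma Lt_al: "Lt \<chi> n (al \<chi> s f) r = al \<chi> s (Lt \<chi> n f r)
   + ((if r = - s then cst (- 2 * pc * of_int s) * al \<chi> (n + s) f else 0)
    + (if r = n + s then cst (- 2 * pc * of_int s) * al \<chi> (n + s) f else 0))"
proof -
  have 1: "al \<chi> r (al \<chi> s g) = al \<chi> s (al \<chi> r g) + (if r = - s then cst (- 2 * pc * of_int s) * g else 0)" for g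
    using al_comm[of \<chi> r s g] by (auto simp: add_eq_0_iff2)
  have 2: "al \<chi> (n - r) (al \<chi> s g) = al \<chi> s (al \<chi> (n - r) g) + (if r = n + s then cst (- 2 * pc * of_int s) * g else 0)" for g
    using al_comm[of \<chi> "n - r" s g] by (auto simp: algebra_simps)
  show ?thesis
    unfolding Lt_def 1 2 clin_add[OF clin_al] if_distrib[of "al _ _"] clin_scale[OF clin_al] clin_0[OF clin_al]
    by (auto simp: 1 2)
qed

text \<open>For the quadratic part alone alpha(z) is primary of weight 1. The last term is the
  anomaly caused by the linear summand of the conformal vector.\<close>

lemma L_al: "L \<chi> n (al \<chi> s f) = al \<chi> s (L \<chi> n f) - cst (of_int s) * al \<chi> (n + s) f
    - cst (if n + s = 0 then (pc - 1) * of_int n * (of_int n + 1) else 0) * f"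
proof -
  have "Sum_any (Lt \<chi> n (al \<chi> s f)) = Sum_any (\<lambda>r. al \<chi> s (Lt \<chi> n f r)
   + ((if r = - s then cst (- 2 * pc * of_int s) * al \<chi> (n + s) f else 0)
    + (if r = n + s then cst (- 2 * pc * of_int s) * al \<chi> (n + s) f else 0)))"
    by (rule Sum_any.cong) (rule Lt_al)
  also have "\<dots> = Sum_any (\<lambda>r. al \<chi> s (Lt \<chi> n f r)) + (cst (- 2 * pc * of_int s) * al \<chi> (n + s) f + cst (- 2 * pc * of_int s) * al \<chi> (n + s) f)"
    by (subst SA_add, rule fs_lin[OF clin_al fs_Lt], intro fs_add fs_delta, subst SA_add, rule fs_delta, rule fs_delta) simp
  also have "Sum_any (\<lambda>r. al \<chi> s (Lt \<chi> n f r)) = al \<chi> s (Sum_any (Lt \<chi> n f))"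
    by (rule SA_lin[OF clin_al fs_Lt, symmetric])
  finally have 1: "cst (1 / (4 * pc)) * Sum_any (Lt \<chi> n (al \<chi> s f)) = cst (1 / (4 * pc)) * al \<chi> s (Sum_any (Lt \<chi> n f)) - cst (of_int s) * al \<chi> (n + s) f"
  proof -
    assume "Sum_any (Lt \<chi> n (al \<chi> s f)) = al \<chi> s (Sum_any (Lt \<chi> n f)) + (cst (- 2 * pc * of_int s) * al \<chi> (n + s) f + cst (- 2 * pc * of_int s) * al \<chi> (n + s) f)"
    then have "cst (1 / (4 * pc)) * Sum_any (Lt \<chi> n (al \<chi> s f)) = cst (1 / (4 * pc)) * al \<chi> s (Sum_any (Lt \<chi> n f)) + cst (1 / (4 * pc) * (- 2 * pc * of_int s + - 2 * pc * of_int s)) * al \<chi> (n + s) f"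
      by (simp only: cst_dist2)
    moreover have "1 / (4 * pc) * (- 2 * pc * of_int s + - 2 * pc * of_int s) = - of_int s" by (simp add: field_simps)
    ultimately show ?thesis by (simp add: cst_minus)
  qed
  have 2: "cst ((pc - 1) / (2 * pc) * (of_int n + 1)) * al \<chi> n (al \<chi> s f) = cst ((pc - 1) / (2 * pc) * (of_int n + 1)) * al \<chi> s (al \<chi> n f)
     + cst (if n + s = 0 then (pc - 1) * of_int n * (of_int n + 1) else 0) * f"
  proof -
    have "(pc - 1) / (2 * pc) * (of_int n + 1) * (if n + s = 0 then 2 * pc * of_int n else 0) = (if n + s = 0 then (pc - 1) * of_int n * (of_int n + 1) else 0)"
      by (simp add: field_simps)
    then show ?thesis unfolding al_comm[of \<chi> n s f] distrib_left mult.assoc[symmetric] cst_mult[symmetric] by simp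
  qed
  show ?thesis unfolding L_def clin_diff[OF clin_al] clin_scale[OF clin_al] 1 2 by simp
qed

lemma L_pos_1: "n > 0 \<Longrightarrow> L \<chi> n 1 = 0"
proof -
  assume n: "n > 0"
  have "Lt \<chi> n 1 r = 0" for r
    using n by (cases "r = 0") (auto simp: Lt_def al_1 clin_0[OF clin_al] al_0 clin_cst[OF clin_al])
  then show ?thesis using n by (simp add: L_def al_1)
qed

lemma L_0_1: "L \<chi> 0 1 = cst (hw \<chi>)"
proof -
  have e: "Lt \<chi> 0 1 r = (if r = 0 then cst (pc * of_int \<chi> * (pc * of_int \<chi>)) else 0)" for r
    by (cases "r = 0") (auto simp: Lt_def al_1 clin_0[OF clin_al] al_0 cst_mult)
  have e': "Lt \<chi> 0 1 = (\<lambda>r. if r = 0 then cst (pc * of_int \<chi> * (pc * of_int \<chi>)) else 0)" by (rule ext) (rule e)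
  have "L \<chi> 0 1 = cst (1 / (4 * pc) * (pc * of_int \<chi> * (pc * of_int \<chi>)) - (pc - 1) / (2 * pc) * (of_int 0 + 1) * (pc * of_int \<chi>))"
    by (simp only: L_def e' Sum_any.delta al_0 mult_1_right cst_comb)
  also have "1 / (4 * pc) * (pc * of_int \<chi> * (pc * of_int \<chi>)) - (pc - 1) / (2 * pc) * (of_int 0 + 1) * (pc * of_int \<chi>) = hw \<chi>"
    by (simp add: hw_def field_simps power2_eq_square)
  finally show ?thesis .
qed

lemma L_m1_1: "L \<chi> (-1) 1 = cst (of_int \<chi> / 2) * var 0"
proof -
  have e: "Lt \<chi> (-1) 1 r = (if r = 0 then cst (pc * of_int \<chi>) * var 0 else 0) + (if r = -1 then cst (pc * of_int \<chi>) * var 0 else 0)" for r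
  proof (cases "r = 0 \<or> r = -1")
    case True then show ?thesis by (auto simp: Lt_def al_0 al_def clin_cst[OF clin_al] mult.commute)
  next
    case False
    then have "(r > 0 \<and> al \<chi> r 1 = 0) \<or> (r < 0 \<and> al \<chi> (- 1 - r) 1 = 0)" by (cases "r > 0") (auto simp: al_1)
    then show ?thesis using False by (auto simp: Lt_def clin_0[OF clin_al])
  qed
  have "Sum_any (Lt \<chi> (-1) 1) = cst (pc * of_int \<chi>) * var 0 + cst (pc * of_int \<chi>) * var 0"
    by (subst Sum_any.cong[OF e], subst SA_add) (rule fs_delta, rule fs_delta, simp)
  note SA = this
  have "L \<chi> (-1) 1 = cst (1 / (4 * pc) * (pc * of_int \<chi> + pc * of_int \<chi>)) * var 0"
    unfolding L_def SA cst_dist1 by simp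
  also have "1 / (4 * pc) * (pc * of_int \<chi> + pc * of_int \<chi>) = of_int \<chi> / 2" by (simp add: field_simps)
  finally show ?thesis .
qed

text \<open>The commutator of two modes minus the expected Virasoro mode commutes with the whole
  Heisenberg algebra, hence is a scalar, which vanishes for degree reasons when \<open>m + n \<noteq> 0\<close>.\<close>

lemma Virasoro: "\<exists>z. \<forall>f. L \<chi> m (L \<chi> n f) - L \<chi> n (L \<chi> m f) = cst (of_int (m - n)) * L \<chi> (m + n) f + (if m + n = 0 then cst z * f else 0)"
proof -
  define X where "X f = L \<chi> m (L \<chi> n f) - L \<chi> n (L \<chi> m f) - cst (of_int (m - n)) * L \<chi> (m + n) f" for f
  have linX: "clin X" unfolding X_def by (intro clin_sub clin_mul clin_L clin_comp[OF clin_L clin_L])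
  define A where "A n = (pc - 1) * of_int n * (of_int n + 1)" for n :: int
  have com: "X (al \<chi> r f) = al \<chi> r (X f)" for r f
  proof -
    have nest: "L \<chi> m (L \<chi> n (al \<chi> r f)) = al \<chi> r (L \<chi> m (L \<chi> n f)) - cst (of_int r) * al \<chi> (m + r) (L \<chi> n f) - cst (if m + r = 0 then A m else 0) * L \<chi> n f
       - cst (of_int r) * (al \<chi> (n + r) (L \<chi> m f) - cst (of_int (n + r)) * al \<chi> (m + n + r) f - cst (if m + n + r = 0 then A m else 0) * f)
       - cst (if n + r = 0 then A n else 0) * L \<chi> m f" for m n
      unfolding L_al[of \<chi> n r f] clin_diff[OF clin_L] clin_scale[OF clin_L] L_al A_def by (simp add: add_ac)
    have k: "- cst (of_int r) * (cst (if m + n + r = 0 then A m else 0) * f) + cst (of_int r) * (cst (if m + n + r = 0 then A n else 0) * f)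
        = cst (of_int (m - n)) * (cst (if m + n + r = 0 then A (m + n) else 0) * f)"
    proof (cases "m + n + r = 0")
      case True
      then have r: "r = - (m + n)" by simp
      have "- of_int r * A m + of_int r * A n = of_int (m - n) * A (m + n)"
        unfolding r A_def by (simp add: algebra_simps)
      then have "cst (- of_int r * A m + of_int r * A n) * f = cst (of_int (m - n) * A (m + n)) * f" by simp
      then show ?thesis unfolding cst_add cst_mult cst_minus distrib_right mult.assoc using True by simp
    qed simp
    show ?thesis
      unfolding X_def nest[of m n] nest[of n m] clin_diff[OF clin_al] clin_scale[OF clin_al] L_al[of \<chi> "m + n"]
      using k unfolding A_def
      by (simp add: algebra_simps cst_add cst_diff add.commute[of n m])
  qed
  have "der j (X 1) = 0" for j
    using com[of "int j + 1" 1] of_nat_neq_0[of j, where 'a=complex]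
    by (simp add: al_1 clin_0[OF linX]) (simp add: al_pos)
  then have c: "X 1 = cst (lookup (X 1) {#})" by (rule der_all_0)
  have X: "X f = cst (lookup (X 1) {#}) * f" for f
  proof (rule clin_eqI[OF linX clin_mult])
    show "X 1 = cst (lookup (X 1) {#}) * 1" using c by simp
    fix j f assume "X f = cst (lookup (X 1) {#}) * f"
    then show "X (var j * f) = cst (lookup (X 1) {#}) * (var j * f)"
      using com[of "- int j - 1" f] by (simp add: al_neg mult_ac)
  qed
  have z: "lookup (X 1) {#} = 0" if "m + n \<noteq> 0"
  proof -
    have "lev (- m - n) (X 1)" unfolding X_def
      using lev_L[OF lev_L[OF lev_1, of n \<chi>], of m \<chi>] lev_L[OF lev_L[OF lev_1, of m \<chi>], of n \<chi>] lev_L[OF lev_1, of "m + n" \<chi>]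
      by (intro lev_diff lev_scale) (simp_all add: minus_diff_commute[of n m])
    then show ?thesis using that by (intro lev_lookup[of "- m - n"]) auto
  qed
  show ?thesis
  proof (intro exI[of _ "lookup (X 1) {#}"] allI)
    fix f
    have "L \<chi> m (L \<chi> n f) - L \<chi> n (L \<chi> m f) = cst (of_int (m - n)) * L \<chi> (m + n) f + X f" by (simp add: X_def)
    then show "L \<chi> m (L \<chi> n f) - L \<chi> n (L \<chi> m f) = cst (of_int (m - n)) * L \<chi> (m + n) f + (if m + n = 0 then cst (lookup (X 1) {#}) * f else 0)"
      unfolding X[of f] using z by auto
  qed
qed

text \<open>Every mode between the two cuts has the same commutator p gamma V_m with the vertex
  operator, whatever its index.\<close>

lemma NV_split: "Sum_any (\<lambda>s. if s < b then al (\<chi> + \<gamma>) s (V \<gamma> (m + s) f) else V \<gamma> (m + s) (al \<chi> s f))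
   = NV \<chi> \<gamma> m f + cst (of_int b) * (cst (pc * of_int \<gamma>) * V \<gamma> m f)"
proof -
  let ?K = "cst (pc * of_int \<gamma>) * V \<gamma> m f"
  let ?N = "\<lambda>s. if s < 0 then al (\<chi> + \<gamma>) s (V \<gamma> (m + s) f) else V \<gamma> (m + s) (al \<chi> s f)"
  have K: "al (\<chi> + \<gamma>) s (V \<gamma> (m + s) f) = V \<gamma> (m + s) (al \<chi> s f) + ?K" for s
    using al_V[of \<chi> \<gamma> s "m + s" f] by simp
  have "Sum_any (\<lambda>s. if s < b then al (\<chi> + \<gamma>) s (V \<gamma> (m + s) f) else V \<gamma> (m + s) (al \<chi> s f))
    = Sum_any (\<lambda>s. ?N s + (if 0 \<le> s \<and> s < b then ?K else if b \<le> s \<and> s < 0 then - ?K else 0))"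
    by (rule Sum_any.cong) (auto simp: K)
  also have "\<dots> = Sum_any ?N + cst (of_int b) * ?K"
    by (subst SA_add, rule fs_NV, rule fs_interval) (simp only: SA_interval)
  finally show ?thesis by (simp add: NV_def)
qed

text \<open>The vertex operator is primary of weight \<open>hw gamma\<close>: the commutator with
  L_n applies z^(n+1) d/dz + (n+1) z^n \<open>hw gamma\<close>, and the derivative is evaluated by
  \<open>V_deriv\<close>.\<close>

lemma L_V: "L (\<chi> + \<gamma>) n (V \<gamma> m f) = V \<gamma> m (L \<chi> n f)
   + cst (of_int (m - n) + pc * of_int \<gamma> * of_int \<chi> / 2 + (of_int n + 1) * hw \<gamma>) * V \<gamma> (m - n) f"
proof -
  let ?k = "cst (pc * of_int \<gamma>)"
  define A where "A r = (if r < 0 then al (\<chi> + \<gamma>) r (V \<gamma> (m - n + r) f) else V \<gamma> (m - n + r) (al \<chi> r f))" for r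
  \<comment> \<open>\<open>A r\<close> comes from the commutator with alpha(n-r), \<open>B r\<close>
    from the one with alpha(r). Under r to n - r the second becomes a normal ordering with cut n + 1
    instead of 0, and \<open>NV_split\<close> supplies the difference.\<close>
  define B where "B r = (if r < 0 then V \<gamma> (m - r) (al \<chi> (n - r) f) else al (\<chi> + \<gamma>) (n - r) (V \<gamma> (m - r) f))" for r
  have fsA: "fs A" unfolding A_def by (rule fs_NV)
  have BB: "B (n - s) = (if s < n + 1 then al (\<chi> + \<gamma>) s (V \<gamma> (m - n + s) f) else V \<gamma> (m - n + s) (al \<chi> s f))" for s
    unfolding B_def by (simp add: algebra_simps)
  have fsB: "fs B"
  proof -
    have "fs (\<lambda>s. B (n - s))" unfolding BB by (rule fs_NV)
    from fs_reflect[OF this, of n] show ?thesis by simp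
  qed
  have SB: "Sum_any B = NV \<chi> \<gamma> (m - n) f + cst (of_int (n + 1)) * (?k * V \<gamma> (m - n) f)"
    unfolding SA_reflect[of B n, symmetric] BB by (rule NV_split)
  have SA: "Sum_any A = NV \<chi> \<gamma> (m - n) f" unfolding A_def NV_def ..
  have t: "Lt (\<chi> + \<gamma>) n (V \<gamma> m f) r = V \<gamma> m (Lt \<chi> n f r) + ?k * (A r + B r)" for r
    by (cases "r < 0")
       (auto simp: Lt_def A_def B_def al_V clin_add[OF clin_al] clin_scale[OF clin_al] distrib_left diff_diff_eq2 add_diff_eq diff_add_eq)
  have "Sum_any (Lt (\<chi> + \<gamma>) n (V \<gamma> m f)) = Sum_any (\<lambda>r. V \<gamma> m (Lt \<chi> n f r) + ?k * (A r + B r))"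
    by (rule Sum_any.cong) (rule t)
  also have "\<dots> = V \<gamma> m (Sum_any (Lt \<chi> n f)) + ?k * (Sum_any A + Sum_any B)"
    by (subst SA_add, rule fs_lin[OF clin_V fs_Lt], intro fs_mult fs_add fsA fsB)
       (simp add: SA_lin[OF clin_V fs_Lt] SA_mult[OF fs_add[OF fsA fsB], symmetric] SA_add[OF fsA fsB])
  finally have S: "Sum_any (Lt (\<chi> + \<gamma>) n (V \<gamma> m f)) = V \<gamma> m (Sum_any (Lt \<chi> n f)) + ?k * (Sum_any A + Sum_any B)" .
  define W where "W = V \<gamma> (m - n) f"
  define N where "N = NV \<chi> \<gamma> (m - n) f"
  have D: "cst (of_int (m - n) + pc * of_int \<gamma> * of_int \<chi> / 2) * W = cst (of_int \<gamma> / 2) * N"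
    unfolding W_def N_def by (rule V_deriv)
  have gen: "cst a * (Y + cst k * (N + (N + cst l * (cst k * W)))) = cst a * Y + (cst (2 * a * k) * N + cst (a * k * l * k) * W)" for a k l Y
    by (simp add: cst_add cst_mult algebra_simps) (metis cst_1 cst_add mult_2_right one_add_one)
  have e1: "2 * (1 / (4 * pc)) * (pc * of_int \<gamma>) = of_int \<gamma> / 2" by (simp add: field_simps)
  have "cst (1 / (4 * pc)) * Sum_any (Lt (\<chi> + \<gamma>) n (V \<gamma> m f)) = cst (1 / (4 * pc)) * V \<gamma> m (Sum_any (Lt \<chi> n f))
     + (cst (of_int (m - n) + pc * of_int \<gamma> * of_int \<chi> / 2) * W + cst (1 / (4 * pc) * (pc * of_int \<gamma>) * of_int (n + 1) * (pc * of_int \<gamma>)) * W)"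
    unfolding S SA SB W_def[symmetric] N_def[symmetric] gen e1 D ..
  then have "L (\<chi> + \<gamma>) n (V \<gamma> m f) = V \<gamma> m (L \<chi> n f) +
      ((cst (of_int (m - n) + pc * of_int \<gamma> * of_int \<chi> / 2) * W + cst (1 / (4 * pc) * (pc * of_int \<gamma>) * of_int (n + 1) * (pc * of_int \<gamma>)) * W)
       - cst ((pc - 1) / (2 * pc) * (of_int n + 1)) * (?k * W))"
    unfolding L_def clin_diff[OF clin_V] clin_scale[OF clin_V] al_V W_def by (simp only: distrib_left algebra_simps)
  also have "((cst (of_int (m - n) + pc * of_int \<gamma> * of_int \<chi> / 2) * W + cst (1 / (4 * pc) * (pc * of_int \<gamma>) * of_int (n + 1) * (pc * of_int \<gamma>)) * W)
       - cst ((pc - 1) / (2 * pc) * (of_int n + 1)) * (?k * W))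
    = cst ((of_int (m - n) + pc * of_int \<gamma> * of_int \<chi> / 2) + 1 / (4 * pc) * (pc * of_int \<gamma>) * of_int (n + 1) * (pc * of_int \<gamma>) - (pc - 1) / (2 * pc) * (of_int n + 1) * (pc * of_int \<gamma>)) * W"
    by (simp only: cst_add cst_diff cst_mult distrib_right left_diff_distrib mult.assoc)
  also have "(of_int (m - n) + pc * of_int \<gamma> * of_int \<chi> / 2) + 1 / (4 * pc) * (pc * of_int \<gamma>) * of_int (n + 1) * (pc * of_int \<gamma>) - (pc - 1) / (2 * pc) * (of_int n + 1) * (pc * of_int \<gamma>)
    = of_int (m - n) + pc * of_int \<gamma> * of_int \<chi> / 2 + (of_int n + 1) * hw \<gamma>"
    by (simp add: hw_def field_simps power2_eq_square)
  finally show ?thesis by (simp add: W_def)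
qed

section \<open>The second order null vector equation\<close>

lemma L_high: "\<exists>N. \<forall>n>N. L \<chi> n f = 0"
proof (induction f rule: fock_induct_mon)
  case (mon c)
  have "L \<chi> n (mon c) = 0" if "n > int (pwt c)" for n
    by (rule lev_neg[OF lev_L[OF lev_mon]]) (use that in auto)
  then show ?case by blast
next
  case (add f g)
  then obtain N1 N2 where "\<forall>m>N1. L \<chi> m f = 0" "\<forall>m>N2. L \<chi> m g = 0" by auto
  then show ?case by (intro exI[of _ "max N1 N2"]) (simp add: clin_add[OF clin_L])
next
  case (scale z f)
  then show ?case by (auto simp: clin_scale[OF clin_L])
qed

text \<open>The halves of a normally ordered product of the stress tensor with the field of
  e^{-alpha/2}. Here L_{-1} stands on the left, while in the field of L_{-2} e it stands on the
  right; with s the exponent of z, this turns the factor s (s - 1) of the second derivative into s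
  (s + p - 1).\<close>

definition bz1 :: "int \<Rightarrow> int \<Rightarrow> fock \<Rightarrow> int \<Rightarrow> fock" where
  "bz1 \<chi> m f n = (if n > 0 then L (\<chi> - 1) (- n) (V (-1) (m - n) f) else 0)"
definition bz2 :: "int \<Rightarrow> int \<Rightarrow> fock \<Rightarrow> int \<Rightarrow> fock" where
  "bz2 \<chi> m f n = (if n \<ge> 0 then V (-1) (m + n) (L \<chi> n f) else 0)"

lemma fs_bz1: "fs (bz1 \<chi> m f)"
proof -
  obtain N where N: "\<forall>m<N. V (-1) m f = 0" using V_low by blast
  show ?thesis unfolding bz1_def
    by (rule fs_int[where a = 0 and b = "max 0 (m - N)"]) (use N in \<open>auto simp: clin_0[OF clin_L]\<close>)
qed
lemma fs_bz2: "fs (bz2 \<chi> m f)"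
proof -
  obtain N where N: "\<forall>n>N. L \<chi> n f = 0" using L_high by blast
  show ?thesis unfolding bz2_def
    by (rule fs_int[where a = 0 and b = "max 0 N"]) (use N in \<open>auto simp: clin_0[OF clin_V]\<close>)
qed
lemma clin_bz1: "clin (\<lambda>f. bz1 \<chi> m f n)" unfolding bz1_def by (intro clin_if clin_zero clin_comp[OF clin_L clin_V])
lemma clin_bz2: "clin (\<lambda>f. bz2 \<chi> m f n)" unfolding bz2_def by (intro clin_if clin_zero clin_comp[OF clin_V clin_L])

lemma al_L: "al \<chi> s (L \<chi> n f) = L \<chi> n (al \<chi> s f) + cst (of_int s) * al \<chi> (n + s) f
    + cst (if n + s = 0 then (pc - 1) * of_int n * (of_int n + 1) else 0) * f"
  by (simp add: L_al)

text \<open>Belavin--Polyakov--Zamolodchikov: the equation of modes that expresses \<open>L\<^sub>-\<^sub>1 (L\<^sub>-\<^sub>1 e) = p L\<^sub>-\<^sub>2 e\<close> for \<open>e = exp (- \<alpha> / 2)\<close>.\<close>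

lemma null_vector_equation: "cst pc * (Sum_any (bz1 \<chi> m f) + Sum_any (bz2 \<chi> m f))
   = cst ((of_int m - pc * of_int \<chi> / 2) * (of_int m - pc * of_int \<chi> / 2 + pc - 1)) * V (-1) m f"
proof -
  define \<sigma> where "\<sigma> m = of_int m - pc * of_int \<chi> / 2" for m
  define X where "X m f = cst pc * (Sum_any (bz1 \<chi> m f) + Sum_any (bz2 \<chi> m f)) - cst (\<sigma> m * (\<sigma> m + pc - 1)) * V (-1) m f" for m f
  have linX: "clin (X m)" for m unfolding X_def
    by (intro clin_sub clin_mul clin_plus clin_SA clin_bz1 clin_bz2 fs_bz1 fs_bz2 clin_V)
  have levX: "lev m (X m 1)" for m
  proof -
    have "lev m (bz1 \<chi> m 1 n)" for n
      using lev_L[OF lev_V[OF lev_1, of "m - n" "-1"], of "- n" "\<chi> - 1"] by (simp add: bz1_def)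
    moreover have "lev m (bz2 \<chi> m 1 n)" for n
      using lev_V[OF lev_L[OF lev_1, of n \<chi>], of "m + n" "-1"] by (simp add: bz2_def)
    moreover have "lev m (V (-1) m 1)" using lev_V[OF lev_1, of m "-1"] by simp
    ultimately show ?thesis unfolding X_def by (intro lev_diff lev_scale lev_add lev_SA)
  qed
  have "X m f = 0"
  proof (rule fam_zero[where X = X and k = "- pc" and \<chi> = 0])
    show "X m 1 = 0" if "m < 0" for m using lev_neg[OF levX that] .
    show "lookup (X m 1) {#} = 0" for m
    proof (cases "m = 0")
      case True
      have "bz1 \<chi> 0 1 n = 0" for n by (simp add: bz1_def V_1 clin_0[OF clin_L])
      moreover have "bz2 \<chi> 0 1 n = (if n = 0 then cst (hw \<chi>) else 0)" for n
        by (auto simp: bz2_def L_pos_1 L_0_1 clin_cst[OF clin_V] V_1 clin_0[OF clin_V])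
      ultimately have "X 0 1 = cst pc * cst (hw \<chi>) - cst (\<sigma> 0 * (\<sigma> 0 + pc - 1))"
        by (simp add: X_def V_1)
      also have "\<dots> = cst (pc * hw \<chi> - \<sigma> 0 * (\<sigma> 0 + pc - 1))" by (simp only: cst_diff cst_mult)
      also have "pc * hw \<chi> - \<sigma> 0 * (\<sigma> 0 + pc - 1) = 0" by (simp add: hw_def \<sigma>_def field_simps power2_eq_square)
      finally show ?thesis using True by simp
    next
      case False then show ?thesis using lev_lookup[OF levX] by simp
    qed
    fix m r :: int and f assume r: "r \<noteq> 0"
    have e: "al 0 r g = al (\<chi> - 1) r g" "al 0 r g = al \<chi> r g" for g using al_chi[OF r] by auto
    have v: "al (\<chi> - 1) r (V (-1) m g) = V (-1) m (al \<chi> r g) + cst (- pc) * V (-1) (m - r) g" for m g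
      using al_V[of \<chi> "-1" r m g] by simp
    \<comment> \<open>The anomaly in \<open>al_L\<close> occurs only when the mode indices cancel.
      This happens for one n, which lies in the range of \<open>bz1\<close> if r > 0 and of
      \<open>bz2\<close> if r < 0.\<close>
    let ?D = "cst ((pc - 1) * of_int r * (of_int r - 1)) * V (-1) (m - r) f"
    have 1: "al 0 r (bz1 \<chi> m f n) = bz1 \<chi> m (al \<chi> r f) n + cst (- pc) * bz1 \<chi> (m - r) f n
       + (cst (of_int r) * (if n > 0 then al (\<chi> - 1) (r - n) (V (-1) (m - n) f) else 0) + (if n = r then (if r > 0 then ?D else 0) else 0))" for n
    proof (cases "n > 0")
      case True
      have c: "cst (if - n + r = 0 then (pc - 1) * of_int (- n) * (of_int (- n) + 1) else 0) * V (-1) (m - n) f = (if n = r then (if r > 0 then ?D else 0) else 0)"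
        using True by (auto simp: algebra_simps)
      show ?thesis using True unfolding bz1_def e(1)
        by (simp only: if_True al_L v clin_add[OF clin_L] clin_scale[OF clin_L] c[symmetric])
           (simp add: algebra_simps)
    next
      case False then show ?thesis by (auto simp: bz1_def clin_0[OF clin_al])
    qed
    have 2: "al 0 r (bz2 \<chi> m f n) = bz2 \<chi> m (al \<chi> r f) n + cst (- pc) * bz2 \<chi> (m - r) f n
       + (cst (of_int r) * (if n \<ge> 0 then V (-1) (m + n) (al \<chi> (n + r) f) else 0) + (if n = - r then (if r > 0 then 0 else ?D) else 0))" for n
    proof (cases "n \<ge> 0")
      case True
      have c: "cst (if n + r = 0 then (pc - 1) * of_int n * (of_int n + 1) else 0) * V (-1) (m + n) f = (if n = - r then (if r > 0 then 0 else ?D) else 0)"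
        using True r by (auto simp: algebra_simps add_eq_0_iff2)
      show ?thesis using True unfolding bz2_def e(1)
        by (simp only: if_True al_L v clin_add[OF clin_V] clin_scale[OF clin_V] c[symmetric])
           (simp add: algebra_simps)
    next
      case False then show ?thesis using r by (auto simp: bz2_def clin_0[OF clin_al])
    qed
    \<comment> \<open>After a reflection of one and a shift of the other, the two commutator sums
      are the halves of one normally ordered product with cut r, to which \<open>NV_split\<close>
      and \<open>V_deriv\<close> apply.\<close>
    define E1 where "E1 n = (if n > 0 then al (\<chi> - 1) (r - n) (V (-1) (m - n) f) else 0)" for n
    define E2 where "E2 n = (if n \<ge> 0 then V (-1) (m + n) (al \<chi> (n + r) f) else 0)" for n
    have E1r: "E1 (r - j) = (if j < r then al (\<chi> - 1) j (V (-1) (m - r + j) f) else 0)" for j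
      by (simp add: E1_def algebra_simps)
    have E2r: "E2 (j + - r) = (if j < r then 0 else V (-1) (m - r + j) (al \<chi> j f))" for j
      by (simp add: E2_def algebra_simps)
    note fsN = fs_NV[of r "\<chi> - 1" "-1" "m - r" f \<chi>]
    have fE1r: "fs (\<lambda>j. E1 (r - j))" unfolding E1r by (rule fs_sub[OF fsN]) (simp split: if_splits)
    have fE2r: "fs (\<lambda>j. E2 (j + - r))" unfolding E2r by (rule fs_sub[OF fsN]) (simp split: if_splits)
    have fE1: "fs E1" using fs_reflect[OF fE1r, of r] by simp
    have fE2: "fs E2" using fs_shift[OF fE2r, of r] by simp
    have "Sum_any E1 + Sum_any E2 = Sum_any (\<lambda>j. E1 (r - j) + E2 (j + - r))"
      unfolding SA_add[OF fE1r fE2r] SA_reflect SA_shift ..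
    also have "\<dots> = Sum_any (\<lambda>j. if j < r then al (\<chi> + - 1) j (V (-1) (m - r + j) f) else V (-1) (m - r + j) (al \<chi> j f))"
      by (rule Sum_any.cong) (simp only: E1r E2r, simp)
    also have "\<dots> = NV \<chi> (-1) (m - r) f + cst (of_int r) * (cst (pc * of_int (-1)) * V (-1) (m - r) f)"
      by (rule NV_split)
    also have "NV \<chi> (-1) (m - r) f = cst (- 2 * \<sigma> (m - r)) * V (-1) (m - r) f"
    proof -
      have "cst (of_int (m - r) + pc * of_int (-1) * of_int \<chi> / 2) * V (-1) (m - r) f = cst (of_int (-1) / 2) * NV \<chi> (-1) (m - r) f"
        by (rule V_deriv)
      then have "cst (-2) * (cst (\<sigma> (m - r)) * V (-1) (m - r) f) = cst (-2) * (cst (- 1 / 2) * NV \<chi> (-1) (m - r) f)"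
        by (simp add: \<sigma>_def)
      then show ?thesis by (simp flip: mult.assoc cst_mult)
    qed
    also have "cst (- 2 * \<sigma> (m - r)) * V (-1) (m - r) f + cst (of_int r) * (cst (pc * of_int (-1)) * V (-1) (m - r) f)
      = cst (- 2 * \<sigma> (m - r) + of_int r * (pc * of_int (-1))) * V (-1) (m - r) f"
      by (simp only: cst_add cst_mult distrib_right mult.assoc)
    finally have E: "Sum_any E1 + Sum_any E2 = cst (- 2 * \<sigma> (m - r) - of_int r * pc) * V (-1) (m - r) f"
      by simp
    have S1: "al 0 r (Sum_any (bz1 \<chi> m f)) = Sum_any (bz1 \<chi> m (al \<chi> r f)) + cst (- pc) * Sum_any (bz1 \<chi> (m - r) f) + (cst (of_int r) * Sum_any E1 + (if r > 0 then ?D else 0))"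
      unfolding SA_lin[OF clin_al fs_bz1] 1 E1_def[symmetric]
      by (subst SA_add, intro fs_add fs_mult fs_bz1, intro fs_add fs_mult fE1 fs_delta, subst SA_add, rule fs_bz1, intro fs_mult fs_bz1,
          subst SA_add, intro fs_mult fE1, rule fs_delta) (simp add: SA_mult[OF fs_bz1] SA_mult[OF fE1])
    have S2: "al 0 r (Sum_any (bz2 \<chi> m f)) = Sum_any (bz2 \<chi> m (al \<chi> r f)) + cst (- pc) * Sum_any (bz2 \<chi> (m - r) f) + (cst (of_int r) * Sum_any E2 + (if r > 0 then 0 else ?D))"
      unfolding SA_lin[OF clin_al fs_bz2] 2 E2_def[symmetric]
      by (subst SA_add, intro fs_add fs_mult fs_bz2, intro fs_add fs_mult fE2 fs_delta, subst SA_add, rule fs_bz2, intro fs_mult fs_bz2,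
          subst SA_add, intro fs_mult fE2, rule fs_delta) (simp add: SA_mult[OF fs_bz2] SA_mult[OF fE2])
    define W where "W = V (-1) (m - r) f"
    have "al 0 r (X m f) = cst pc * (al 0 r (Sum_any (bz1 \<chi> m f)) + al 0 r (Sum_any (bz2 \<chi> m f))) - cst (\<sigma> m * (\<sigma> m + pc - 1)) * al 0 r (V (-1) m f)"
      unfolding X_def clin_diff[OF clin_al] clin_scale[OF clin_al] clin_add[OF clin_al] ..
    also have "al 0 r (Sum_any (bz1 \<chi> m f)) + al 0 r (Sum_any (bz2 \<chi> m f)) = (Sum_any (bz1 \<chi> m (al \<chi> r f)) + Sum_any (bz2 \<chi> m (al \<chi> r f)))
       + cst (- pc) * (Sum_any (bz1 \<chi> (m - r) f) + Sum_any (bz2 \<chi> (m - r) f)) + (cst (of_int r) * (Sum_any E1 + Sum_any E2) + ?D)"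
      unfolding S1 S2 by (simp add: distrib_left)
    also have "cst (of_int r) * (Sum_any E1 + Sum_any E2) + ?D = cst (of_int r * (- 2 * \<sigma> (m - r) - of_int r * pc) + (pc - 1) * of_int r * (of_int r - 1)) * W"
      unfolding E W_def by (simp only: cst_add cst_mult distrib_right mult.assoc)
    \<comment> \<open>The collected commutator terms are the change of the quadratic polynomial
      under m to m - r, which closes the family for \<open>fam_zero\<close>.\<close>
    also have "of_int r * (- 2 * \<sigma> (m - r) - of_int r * pc) + (pc - 1) * of_int r * (of_int r - 1) = \<sigma> (m - r) * (\<sigma> (m - r) + pc - 1) - \<sigma> m * (\<sigma> m + pc - 1)"
      by (simp add: \<sigma>_def algebra_simps)
    also have "al 0 r (V (-1) m f) = V (-1) m (al \<chi> r f) + cst (- pc) * W" unfolding e(1) v W_def ..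
    finally have fin: "al 0 r (X m f) = cst pc * (Sum_any (bz1 \<chi> m (al \<chi> r f)) + Sum_any (bz2 \<chi> m (al \<chi> r f))
       + cst (- pc) * (Sum_any (bz1 \<chi> (m - r) f) + Sum_any (bz2 \<chi> (m - r) f))
       + cst (\<sigma> (m - r) * (\<sigma> (m - r) + pc - 1) - \<sigma> m * (\<sigma> m + pc - 1)) * W)
      - cst (\<sigma> m * (\<sigma> m + pc - 1)) * (V (-1) m (al \<chi> r f) + cst (- pc) * W)" .
    have gen: "cst pc * (A + cst (- pc) * B + cst (q' - q) * W) - cst q * (Y + cst (- pc) * W) = (cst pc * A - cst q * Y) + cst (- pc) * (cst pc * B - cst q' * W)" for A B Y q q'
      by (simp add: cst_minus cst_diff algebra_simps)
    show "al 0 r (X m f) = X m (al 0 r f) + cst (- pc) * X (m - r) f"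
      unfolding fin gen unfolding X_def e(2) W_def ..
  qed (rule linX)
  then show ?thesis by (simp add: X_def \<sigma>_def)
qed

section \<open>Products of vertex operators\<close>

lemma SS_rec: assumes "m \<le> int N"
  shows "cst (of_int m) * SS \<kappa> m = cst \<kappa> * (\<Sum>k<N. var k * SS \<kappa> (m - int k - 1))"
proof -
  \<comment> \<open>The recursion is z d/dz of the exponential series. The cut-off N only has to be
    at least m, because terms of negative index vanish; \<open>V_SS\<close> uses one cut-off for
    several m.\<close>
  define X where "X m = cst (of_int m) * SS \<kappa> m - cst \<kappa> * (\<Sum>k<N. var k * SS \<kappa> (m - int k - 1))" for m
  have lk: "lev m (var k * SS \<kappa> (m - int k - 1))" for m k using lev_var[OF lev_SS[of "m - int k - 1" \<kappa>], of k] by simp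
  have lv: "lev m (X m)" for m unfolding X_def
    by (intro lev_diff lev_scale lev_sum lev_SS lk)
  have z: "X (int m) = 0" if "m \<le> N" for m using that
  proof (induction m rule: less_induct)
    case (less m)
    have "der j (X (int m)) = 0" for j
    proof (cases "j < m")
      case True
      have nz: "(of_nat (j + 1) :: complex) \<noteq> 0" using of_nat_neq_0 by (metis Suc_eq_plus1)
      define c where "c = \<kappa> / of_nat (j + 1)"
      have ce: "\<kappa> = c * of_nat (j + 1)" unfolding c_def using nz by simp
      have ih: "X (int m - int j - 1) = 0"
      proof -
        have e: "int m - int j - 1 = int (m - (j + 1))" using True by simp
        show ?thesis unfolding e using less(2) True by (intro less(1)) auto
      qed
      have "(\<Sum>k<N. der j (var k * SS \<kappa> (int m - int k - 1))) = SS \<kappa> (int m - int j - 1) + cst c * (\<Sum>k<N. var k * SS \<kappa> (int m - int j - 1 - int k - 1))"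
      proof -
        have "(\<Sum>k<N. der j (var k * SS \<kappa> (int m - int k - 1))) = (\<Sum>k<N. (if j = k then SS \<kappa> (int m - int k - 1) else 0) + cst c * (var k * SS \<kappa> (int m - int j - 1 - int k - 1)))"
          by (intro sum.cong refl) (simp add: der_var der_SS c_def algebra_simps)
        also have "\<dots> = SS \<kappa> (int m - int j - 1) + cst c * (\<Sum>k<N. var k * SS \<kappa> (int m - int j - 1 - int k - 1))"
          using True less(2) by (simp add: sum.distrib sum_distrib_left)
        finally show ?thesis .
      qed
      then have "der j (X (int m)) = cst (of_int (int m)) * (cst c * SS \<kappa> (int m - int j - 1)) - cst \<kappa> * (SS \<kappa> (int m - int j - 1) + cst c * (\<Sum>k<N. var k * SS \<kappa> (int m - int j - 1 - int k - 1)))"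
        unfolding X_def clin_diff[OF clin_der] clin_scale[OF clin_der] clin_sum[OF clin_der] der_SS c_def by simp
      also have "\<dots> = cst c * X (int m - int j - 1) + (cst (of_int (int m) * c) - cst (of_int (int m - int j - 1) * c) - cst \<kappa>) * SS \<kappa> (int m - int j - 1)"
        unfolding X_def by (simp only: cst_mult algebra_simps)
      also have "cst (of_int (int m) * c) - cst (of_int (int m - int j - 1) * c) - cst \<kappa> = 0"
        unfolding cst_diff[symmetric] cst_eq_0_iff unfolding ce by (simp add: algebra_simps)
      finally show ?thesis by (simp add: ih)
    next
      case False
      then show ?thesis using lev_neg[OF lev_der[OF lv[of "int m"], of j]] by simp
    qed
    then have "X (int m) = cst (lookup (X (int m)) {#})" by (rule der_all_0)
    moreover have "lookup (X (int m)) {#} = 0"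
    proof (cases "m = 0")
      case False then show ?thesis using lev_lookup[OF lv[of "int m"], of "{#}"] by simp
    next
      case True then show ?thesis unfolding X_def by simp
    qed
    ultimately show ?case by simp
  qed
  have "X m = 0" using assms lev_neg[OF lv, of m] z[of "nat m"] by (cases "m < 0") auto
  then show ?thesis by (simp add: X_def)
qed

text \<open>The recursion obeyed by the coefficients of (1 - x)^q, in the form in which it arises
  from \<open>SS_rec\<close>.\<close>

lemma gbin_rec: "of_nat l * ((- 1) ^ l * (q gchoose l)) = - q * (\<Sum>i<l. (- 1) ^ i * (q gchoose i :: complex))"
proof (cases l)
  case (Suc k)
  have "(\<Sum>i\<le>k. (q gchoose i) * (- 1) ^ i) = (- 1) ^ k * (q - 1 gchoose k)"
    by (rule gbinomial_sum_lower_neg)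
  moreover have "of_nat (Suc k) * (q gchoose Suc k) = q * (q - 1 gchoose k)" 
    by (metis gbinomial_absorption)
  ultimately show ?thesis unfolding Suc lessThan_Suc_atMost
    by (simp add: mult_ac) 
qed simp

text \<open>Moving the annihilation half past a creation exponential in w produces the factor (1 -
  w/z)^(p gamma kappa), here expanded. Both sides are compared through the recursions
  \<open>SS_rec\<close> and \<open>gbin_rec\<close>, without formal exponentials.\<close>

lemma V_SS: "V \<gamma> a (SS \<kappa> (int b) * f) = (\<Sum>i\<le>b. cst ((- 1) ^ i * (pc * of_int \<gamma> * \<kappa> gchoose i)) * (SS \<kappa> (int b - int i) * V \<gamma> (a + int i) f))"
proof (induction b arbitrary: a rule: less_induct)
  case (less b)
  define q where "q = pc * of_int \<gamma> * \<kappa>"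
  define \<beta> where "\<beta> i = (- 1) ^ i * (q gchoose i)" for i
  show ?case
  proof (cases "b = 0")
    case True then show ?thesis by simp
  next
    case False
    define R where "R i = SS \<kappa> (int b - int i) * V \<gamma> (a + int i) f" for i :: nat
    have ih: "V \<gamma> a (SS \<kappa> (int b - int k - 1) * f) = (\<Sum>i<b - k. cst (\<beta> i) * (SS \<kappa> (int b - int k - 1 - int i) * V \<gamma> (a + int i) f))" if "k < b" for k a
    proof -
      have e: "int b - int k - 1 = int (b - k - 1)" using that by simp
      have e2: "{..<b - k} = {..b - k - 1}" using that by auto
      show ?thesis unfolding e e2 \<beta>_def q_def using that by (intro less) simp
    qed
    have "cst (of_nat b) * V \<gamma> a (SS \<kappa> (int b) * f) = V \<gamma> a ((cst (of_int (int b)) * SS \<kappa> (int b)) * f)"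
      by (simp add: mult.assoc clin_scale[OF clin_V])
    also have "\<dots> = V \<gamma> a (\<Sum>k<b. cst \<kappa> * (var k * (SS \<kappa> (int b - int k - 1) * f)))"
      unfolding SS_rec[OF order_refl] by (simp add: sum_distrib_left sum_distrib_right mult.assoc)
    also have "\<dots> = (\<Sum>k<b. cst \<kappa> * (var k * V \<gamma> a (SS \<kappa> (int b - int k - 1) * f) - cst (pc * of_int \<gamma>) * V \<gamma> (a + int k + 1) (SS \<kappa> (int b - int k - 1) * f)))"
      by (simp add: clin_sum[OF clin_V] clin_scale[OF clin_V] V_var)
    also have "\<dots> = cst \<kappa> * (\<Sum>k<b. var k * V \<gamma> a (SS \<kappa> (int b - int k - 1) * f)) - cst q * (\<Sum>k<b. V \<gamma> (a + int k + 1) (SS \<kappa> (int b - int k - 1) * f))"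
      unfolding q_def by (simp add: sum_subtractf sum_distrib_left right_diff_distrib cst_mult mult_ac)
    also have "(\<Sum>k<b. var k * V \<gamma> a (SS \<kappa> (int b - int k - 1) * f)) = (\<Sum>k<b. \<Sum>i<b. cst (\<beta> i) * ((var k * SS \<kappa> (int b - int i - int k - 1)) * V \<gamma> (a + int i) f))"
    proof (rule sum.cong[OF refl])
      fix k assume "k \<in> {..<b}"
      then have kb: "k < b" by simp
      have "var k * V \<gamma> a (SS \<kappa> (int b - int k - 1) * f) = (\<Sum>i<b - k. cst (\<beta> i) * ((var k * SS \<kappa> (int b - int i - int k - 1)) * V \<gamma> (a + int i) f))"
        unfolding ih[OF kb] sum_distrib_left by (intro sum.cong refl) (simp add: algebra_simps)
      also have "\<dots> = (\<Sum>i<b. cst (\<beta> i) * ((var k * SS \<kappa> (int b - int i - int k - 1)) * V \<gamma> (a + int i) f))"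
        by (rule sum.mono_neutral_left) auto
      finally show "var k * V \<gamma> a (SS \<kappa> (int b - int k - 1) * f) = (\<Sum>i<b. cst (\<beta> i) * ((var k * SS \<kappa> (int b - int i - int k - 1)) * V \<gamma> (a + int i) f))" .
    qed
    also have "\<dots> = (\<Sum>i<b. cst (\<beta> i) * ((\<Sum>k<b. var k * SS \<kappa> (int b - int i - int k - 1)) * V \<gamma> (a + int i) f))"
      by (subst sum.swap) (simp add: sum_distrib_left sum_distrib_right)
    also have "cst \<kappa> * \<dots> = (\<Sum>i<b. cst (\<beta> i) * ((cst \<kappa> * (\<Sum>k<b. var k * SS \<kappa> (int b - int i - int k - 1))) * V \<gamma> (a + int i) f))"
      by (simp add: sum_distrib_left mult_ac)
    also have "\<dots> = (\<Sum>i<b. cst (\<beta> i * of_int (int b - int i)) * R i)"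
      by (intro sum.cong refl) (simp add: SS_rec[of "int b - int _" b \<kappa>, symmetric] R_def cst_mult mult_ac)
    also have "(\<Sum>k<b. V \<gamma> (a + int k + 1) (SS \<kappa> (int b - int k - 1) * f)) = (\<Sum>k<b. \<Sum>i<b - k. cst (\<beta> i) * R (k + i + 1))"
    proof (rule sum.cong[OF refl])
      fix k assume "k \<in> {..<b}"
      then have kb: "k < b" by simp
      show "V \<gamma> (a + int k + 1) (SS \<kappa> (int b - int k - 1) * f) = (\<Sum>i<b - k. cst (\<beta> i) * R (k + i + 1))"
        unfolding ih[OF kb] R_def by (intro sum.cong refl) (simp add: algebra_simps)
    qed
    also have "\<dots> = (\<Sum>l\<le>b. cst (\<Sum>i<l. \<beta> i) * R l)"
    proof -
      have "(\<Sum>k<b. \<Sum>i<b - k. cst (\<beta> i) * R (k + i + 1)) = (\<Sum>(k,i)\<in>Sigma {..<b} (\<lambda>k. {..<b - k}). cst (\<beta> i) * R (k + i + 1))"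
        by (simp add: sum.Sigma)
      also have "\<dots> = (\<Sum>(l,i)\<in>Sigma {..b} (\<lambda>l. {..<l}). cst (\<beta> i) * R l)"
        by (rule sum.reindex_bij_witness[of _ "\<lambda>(l,i). (l - i - 1, i)" "\<lambda>(k,i). (k + i + 1, i)"]) auto
      also have "\<dots> = (\<Sum>l\<le>b. cst (\<Sum>i<l. \<beta> i) * R l)"
        by (simp add: sum.Sigma[symmetric] cst_sum sum_distrib_right)
      finally show ?thesis .
    qed
    finally have "cst (of_nat b) * V \<gamma> a (SS \<kappa> (int b) * f) = (\<Sum>i<b. cst (\<beta> i * of_int (int b - int i)) * R i) - cst q * (\<Sum>l\<le>b. cst (\<Sum>i<l. \<beta> i) * R l)" .
    also have "(\<Sum>i<b. cst (\<beta> i * of_int (int b - int i)) * R i) = (\<Sum>i\<le>b. cst (\<beta> i * of_int (int b - int i)) * R i)"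
      by (rule sum.mono_neutral_left) auto
    also have "\<dots> - cst q * (\<Sum>l\<le>b. cst (\<Sum>i<l. \<beta> i) * R l) = (\<Sum>l\<le>b. cst (\<beta> l * of_int (int b - int l) - q * (\<Sum>i<l. \<beta> i)) * R l)"
      unfolding sum_distrib_left[of "cst q"] sum_subtractf[symmetric] by (simp only: cst_diff cst_mult left_diff_distrib mult.assoc)
    also have "\<dots> = (\<Sum>l\<le>b. cst (of_nat b * \<beta> l) * R l)"
    proof (intro sum.cong refl arg_cong[of _ _ "\<lambda>z. cst z * _"])
      fix l
      have "of_nat l * \<beta> l = - q * (\<Sum>i<l. \<beta> i)" unfolding \<beta>_def by (rule gbin_rec)
      then show "\<beta> l * of_int (int b - int l) - q * (\<Sum>i<l. \<beta> i) = of_nat b * \<beta> l"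
        by (simp add: algebra_simps)
    qed
    finally have "cst (of_nat b) * (V \<gamma> a (SS \<kappa> (int b) * f) - (\<Sum>l\<le>b. cst (\<beta> l) * R l)) = 0"
      by (simp add: right_diff_distrib sum_distrib_left cst_mult mult_ac)
    then show ?thesis using False unfolding \<beta>_def R_def q_def by simp
  qed
qed

lemma SS_add: "SS (\<kappa> + \<kappa>') m = Sum_any (\<lambda>a. SS \<kappa> a * SS \<kappa>' (m - a))"
proof -
  define X where "X m = SS (\<kappa> + \<kappa>') m - Sum_any (\<lambda>a. SS \<kappa> a * SS \<kappa>' (m - a))" for m
  have fs1: "fs (\<lambda>a. SS \<kappa> a * SS \<kappa>' (m - a))" for m
    by (rule fs_int[where a = 0 and b = m]) auto
  have lk: "lev m (SS \<kappa> a * SS \<kappa>' (m - a))" for m a using lev_mult[OF lev_SS[of a] lev_SS[of "m - a"]] by simp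
  have lv: "lev m (X m)" for m unfolding X_def by (intro lev_diff lev_SS lev_SA lk)
  have dm: "der j (f * g) = der j f * g + f * der j g" for j f g
  proof (induction f rule: fock_induct)
    case (var k f) show ?case unfolding mult.assoc der_var var by (simp add: algebra_simps)
  next
    case (scale z f) show ?case unfolding mult.assoc clin_scale[OF clin_der] scale by (simp add: algebra_simps)
  qed (simp_all add: distrib_right clin_add[OF clin_der])
  have z: "X (int m) = 0" for m
  proof (induction m rule: less_induct)
    case (less m)
    have "der j (X (int m)) = 0" for j
    proof (cases "j < m")
      case True
      let ?m = "int m - int j - 1"
      have ih: "X ?m = 0"
      proof -
        have e: "int m - int j - 1 = int (m - (j + 1))" using True by simp
        show ?thesis unfolding e using True by (intro less) auto
      qed
      let ?c = "\<lambda>\<kappa>. cst (\<kappa> / of_nat (j + 1))"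
      define G where "G a = SS \<kappa> a * SS \<kappa>' (?m - a)" for a
      have fsG: "fs G" unfolding G_def by (rule fs1)
      have d: "der j (SS \<kappa> a * SS \<kappa>' (int m - a)) = ?c \<kappa> * G (a + (- int j - 1)) + ?c \<kappa>' * G a" for a
      proof -
        have e1: "?m - (a + (- int j - 1)) = int m - a" "a - int j - 1 = a + (- int j - 1)" "int m - a - int j - 1 = ?m - a" by auto
        have a1: "der j (SS \<kappa>' (int m - a)) = ?c \<kappa>' * SS \<kappa>' (?m - a)" using der_SS[of j \<kappa>' "int m - a"] unfolding e1(3) .
        have a2: "der j (SS \<kappa> a) = ?c \<kappa> * SS \<kappa> (a + (- int j - 1))" using der_SS[of j \<kappa> a] unfolding e1(2) .
        show ?thesis unfolding dm a1 a2 G_def e1(1) by (simp only: mult_ac)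
      qed
      have "der j (Sum_any (\<lambda>a. SS \<kappa> a * SS \<kappa>' (int m - a))) = Sum_any (\<lambda>a. ?c \<kappa> * G (a + (- int j - 1)) + ?c \<kappa>' * G a)"
        unfolding SA_lin[OF clin_der fs1] d ..
      also have "\<dots> = ?c \<kappa> * Sum_any (\<lambda>a. G (a + (- int j - 1))) + ?c \<kappa>' * Sum_any G"
        unfolding SA_add[OF fs_mult[OF fs_shift[OF fsG]] fs_mult[OF fsG]] SA_mult[OF fsG] SA_mult[OF fs_shift[OF fsG]] ..
      also have "\<dots> = ?c (\<kappa> + \<kappa>') * Sum_any (\<lambda>a. SS \<kappa> a * SS \<kappa>' (?m - a))"
        unfolding SA_shift unfolding G_def by (simp only: cst_add add_divide_distrib distrib_right)
      finally have "der j (X (int m)) = ?c (\<kappa> + \<kappa>') * X ?m"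
        unfolding X_def clin_diff[OF clin_der] der_SS by (simp add: right_diff_distrib)
      then show ?thesis by (simp add: ih)
    next
      case False
      then show ?thesis using lev_neg[OF lev_der[OF lv[of "int m"], of j]] by simp
    qed
    then have "X (int m) = cst (lookup (X (int m)) {#})" by (rule der_all_0)
    moreover have "lookup (X (int m)) {#} = 0"
    proof (cases "m = 0")
      case False then show ?thesis using lev_lookup[OF lv[of "int m"], of "{#}"] by simp
    next
      case True
      have "SS \<kappa> a * SS \<kappa>' (- a) = (if a = 0 then 1 else 0)" for a by (cases "a < 0"; cases "a = 0") auto
      then show ?thesis using True unfolding X_def by simp
    qed
    ultimately show ?case by simp
  qed
  have "X m = 0" using lev_neg[OF lv, of m] z[of "nat m"] by (cases "m < 0") auto
  then show ?thesis by (simp add: X_def)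
qed

text \<open>Normally ordered product of two vertex operators: dividing the operator product by
  \<open>(1 - w / z)\<close> to the power \<open>2 p \<kappa> \<kappa>'\<close> leaves sums that are finite on every vector.\<close>

definition nop :: "int \<Rightarrow> int \<Rightarrow> int \<Rightarrow> int \<Rightarrow> fock \<Rightarrow> nat \<Rightarrow> fock" where
  "nop \<gamma> \<gamma>' a b f i = cst ((- 1) ^ i * (- (pc * of_int \<gamma> * of_int \<gamma>' / 2) gchoose i)) * V \<gamma> (a + int i) (V \<gamma>' (b - int i) f)"

lemma fs_nop: "fs (nop \<gamma> \<gamma>' a b f)"
proof -
  obtain N where N: "\<forall>m<N. V \<gamma>' m f = 0" using V_low by blast
  have "nop \<gamma> \<gamma>' a b f i = 0" if "i > nat (b - N)" for i
    using N that by (auto simp: nop_def clin_0[OF clin_V])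
  then have "{i. nop \<gamma> \<gamma>' a b f i \<noteq> 0} \<subseteq> {..nat (b - N)}" by (auto intro: leI)
  then show ?thesis using finite_subset by blast
qed

lemma clin_nop: "clin (\<lambda>f. nop \<gamma> \<gamma>' a b f i)"
  unfolding nop_def by (intro clin_mul clin_comp[OF clin_V clin_V])

lemma nop_var: "nop \<gamma> \<gamma>' a b (var j * f) i = var j * nop \<gamma> \<gamma>' a b f i
   - (cst (pc * of_int \<gamma>) * nop \<gamma> \<gamma>' (a + int j + 1) b f i + cst (pc * of_int \<gamma>') * nop \<gamma> \<gamma>' a (b + int j + 1) f i)"
proof -
  have e: "a + int i + int j + 1 = a + int j + 1 + int i" "b - int i + int j + 1 = b + int j + 1 - int i" by auto
  show ?thesis unfolding nop_def V_var clin_diff[OF clin_V] clin_scale[OF clin_V] e by (simp add: algebra_simps)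
qed

definition NO :: "int \<Rightarrow> int \<Rightarrow> int \<Rightarrow> int \<Rightarrow> fock \<Rightarrow> fock" where
  "NO \<gamma> \<gamma>' a b f = Sum_any (nop \<gamma> \<gamma>' a b f)"

lemma clin_NO: "clin (NO \<gamma> \<gamma>' a b)"
  unfolding NO_def by (intro clin_SA clin_nop fs_nop)

lemma NO_var: "NO \<gamma> \<gamma>' a b (var j * f) = var j * NO \<gamma> \<gamma>' a b f
   - (cst (pc * of_int \<gamma>) * NO \<gamma> \<gamma>' (a + int j + 1) b f + cst (pc * of_int \<gamma>') * NO \<gamma> \<gamma>' a (b + int j + 1) f)"
proof -
  have "NO \<gamma> \<gamma>' a b (var j * f) = Sum_any (\<lambda>i. var j * nop \<gamma> \<gamma>' a b f i
   - (cst (pc * of_int \<gamma>) * nop \<gamma> \<gamma>' (a + int j + 1) b f i + cst (pc * of_int \<gamma>') * nop \<gamma> \<gamma>' a (b + int j + 1) f i))"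
    unfolding NO_def by (rule Sum_any.cong) (rule nop_var)
  then show ?thesis unfolding NO_def SA_mult[OF fs_nop]
    by (subst (asm) SA_diff, intro fs_mult fs_nop, intro fs_add fs_mult fs_nop, subst (asm) SA_add, intro fs_mult fs_nop, intro fs_mult fs_nop)
qed

text \<open>The factor produced by \<open>V_SS\<close> and the one divided out in \<open>nop\<close>
  have opposite exponents, so their expansions convolve to 1 by Vandermonde.\<close>

lemma NO_1: "NO \<gamma> \<gamma>' a b 1 = SS (of_int \<gamma> / 2) a * SS (of_int \<gamma>' / 2) b"
proof (cases "b < 0")
  case True
  then have "nop \<gamma> \<gamma>' a b 1 i = 0" for i by (simp add: nop_def V_1 clin_0[OF clin_V])
  then show ?thesis using True by (simp add: NO_def)
next
  case False
  then obtain B where B: "b = int B" using nonneg_int_cases by (metis not_less)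
  define q where "q = pc * of_int \<gamma> * (of_int \<gamma>' / 2)"
  define \<beta> where "\<beta> i = (- 1) ^ i * (q gchoose i)" for i
  define \<beta>' where "\<beta>' i = (- 1) ^ i * (- q gchoose i)" for i
  define R where "R i = SS (of_int \<gamma>' / 2) (b - int i) * SS (of_int \<gamma> / 2) (a + int i)" for i :: nat
  have nv: "nop \<gamma> \<gamma>' a b 1 i = cst (\<beta>' i) * V \<gamma> (a + int i) (SS (of_int \<gamma>' / 2) (b - int i))" for i
    unfolding nop_def \<beta>'_def q_def V_1 by simp
  have "NO \<gamma> \<gamma>' a b 1 = (\<Sum>i\<le>B. nop \<gamma> \<gamma>' a b 1 i)"
    unfolding NO_def
  proof (rule Sum_any.expand_superset)
    have "nop \<gamma> \<gamma>' a b 1 i = 0" if "i > B" for i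
      unfolding nv using that B by (simp add: clin_0[OF clin_V])
    then show "{i. nop \<gamma> \<gamma>' a b 1 i \<noteq> 0} \<subseteq> {..B}" by (auto intro: leI)
  qed simp
  also have "\<dots> = (\<Sum>i\<le>B. \<Sum>l\<le>B - i. cst (\<beta>' i * \<beta> l) * R (i + l))"
  proof (rule sum.cong[OF refl])
    fix i assume i: "i \<in> {..B}"
    then have e: "b - int i = int (B - i)" using B by auto
    have "V \<gamma> (a + int i) (SS (of_int \<gamma>' / 2) (int (B - i)) * 1) = (\<Sum>l\<le>B - i. cst (\<beta> l) * (SS (of_int \<gamma>' / 2) (int (B - i) - int l) * V \<gamma> (a + int i + int l) 1))"
      unfolding V_SS \<beta>_def q_def ..
    then have "nop \<gamma> \<gamma>' a b 1 i = (\<Sum>l\<le>B - i. cst (\<beta>' i) * (cst (\<beta> l) * (SS (of_int \<gamma>' / 2) (int (B - i) - int l) * V \<gamma> (a + int i + int l) 1)))"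
      unfolding nv e by (simp add: sum_distrib_left)
    also have "\<dots> = (\<Sum>l\<le>B - i. cst (\<beta>' i * \<beta> l) * R (i + l))"
      unfolding R_def e[symmetric] V_1 by (intro sum.cong refl) (simp add: cst_mult algebra_simps)
    finally show "nop \<gamma> \<gamma>' a b 1 i = (\<Sum>l\<le>B - i. cst (\<beta>' i * \<beta> l) * R (i + l))" .
  qed
  also have "\<dots> = (\<Sum>n\<le>B. cst (\<Sum>i\<le>n. \<beta>' i * \<beta> (n - i)) * R n)"
  proof -
    have "(\<Sum>i\<le>B. \<Sum>l\<le>B - i. cst (\<beta>' i * \<beta> l) * R (i + l)) = (\<Sum>(i,l)\<in>Sigma {..B} (\<lambda>i. {..B - i}). cst (\<beta>' i * \<beta> l) * R (i + l))"
      by (simp add: sum.Sigma)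
    also have "\<dots> = (\<Sum>(n,i)\<in>Sigma {..B} (\<lambda>n. {..n}). cst (\<beta>' i * \<beta> (n - i)) * R n)"
      by (rule sum.reindex_bij_witness[of _ "\<lambda>(n,i). (i, n - i)" "\<lambda>(i,l). (i + l, i)"]) auto
    also have "\<dots> = (\<Sum>n\<le>B. cst (\<Sum>i\<le>n. \<beta>' i * \<beta> (n - i)) * R n)"
      by (simp add: sum.Sigma[symmetric] cst_sum sum_distrib_right)
    finally show ?thesis .
  qed
  also have "\<dots> = (\<Sum>n\<le>B. if n = 0 then R 0 else 0)"
  proof (rule sum.cong[OF refl])
    fix n
    have "(\<Sum>i\<le>n. \<beta>' i * \<beta> (n - i)) = (\<Sum>i\<le>n. (- 1) ^ n * ((- q gchoose i) * (q gchoose (n - i))))"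
      by (intro sum.cong refl) (simp add: \<beta>_def \<beta>'_def power_add[symmetric] algebra_simps flip: power_add)
    also have "\<dots> = (- 1) ^ n * (0 gchoose n)"
      using gbinomial_Vandermonde[of "- q" q n] by (simp add: sum_distrib_left[symmetric] atLeast0AtMost)
    also have "\<dots> = (if n = 0 then 1 else 0)" by (cases n) auto
    finally show "cst (\<Sum>i\<le>n. \<beta>' i * \<beta> (n - i)) * R n = (if n = 0 then R 0 else 0)" by simp
  qed
  also have "\<dots> = R 0" by simp
  finally show ?thesis by (simp add: R_def mult.commute)
qed

text \<open>Truncation in the first index is not visible in \<open>nop\<close>, where that index
  grows along the sum. It holds for the explicit value at the vacuum and is carried on by
  \<open>NO_var\<close>.\<close>

lemma NO_low: "\<exists>N. \<forall>a b. a < N \<or> b < N \<longrightarrow> NO \<gamma> \<gamma>' a b f = 0"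
proof (induction f rule: fock_induct)
  case one show ?case by (rule exI[of _ 0]) (auto simp: NO_1)
next
  case (var j f)
  then obtain N where "\<forall>a b. a < N \<or> b < N \<longrightarrow> NO \<gamma> \<gamma>' a b f = 0" by blast
  then show ?case by (intro exI[of _ "N - int j - 1"]) (auto simp: NO_var)
next
  case (add f g)
  then obtain N1 N2 where "\<forall>a b. a < N1 \<or> b < N1 \<longrightarrow> NO \<gamma> \<gamma>' a b f = 0" "\<forall>a b. a < N2 \<or> b < N2 \<longrightarrow> NO \<gamma> \<gamma>' a b g = 0" by blast
  then show ?case by (intro exI[of _ "min N1 N2"]) (auto simp: clin_add[OF clin_NO])
next
  case (scale z f) then show ?case by (auto simp: clin_scale[OF clin_NO])
qed

lemma fs_NO: "fs (\<lambda>a. NO \<gamma> \<gamma>' a (m - a) f)"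
proof -
  obtain N where "\<forall>a b. a < N \<or> b < N \<longrightarrow> NO \<gamma> \<gamma>' a b f = 0" using NO_low by blast
  then show ?thesis by (intro fs_int[where a = N and b = "m - N"]) auto
qed

text \<open>Once the singular factor is divided out, the two variables may be set equal, and a
  normally ordered product of exponentials is the exponential of the sum of the charges.\<close>

lemma V_product: "V (\<gamma> + \<gamma>') m f = Sum_any (\<lambda>a. NO \<gamma> \<gamma>' a (m - a) f)"
proof -
  have "\<forall>m. V (\<gamma> + \<gamma>') m f = Sum_any (\<lambda>a. NO \<gamma> \<gamma>' a (m - a) f)"
  proof (induction f rule: fock_induct)
    case one
    then show ?case using SS_add[of "of_int \<gamma> / 2" "of_int \<gamma>' / 2"] by (simp add: V_1 NO_1 add_divide_distrib)
  next
    case (var j f)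
    show ?case
    proof
      fix m
      let ?m = "m + int j + 1"
      have "Sum_any (\<lambda>a. NO \<gamma> \<gamma>' a (m - a) (var j * f)) = Sum_any (\<lambda>a. var j * NO \<gamma> \<gamma>' a (m - a) f
          - (cst (pc * of_int \<gamma>) * NO \<gamma> \<gamma>' (a + (int j + 1)) (?m - (a + (int j + 1))) f + cst (pc * of_int \<gamma>') * NO \<gamma> \<gamma>' a (?m - a) f))"
      proof (rule Sum_any.cong)
        fix a
        have e1: "?m - (a + int j + 1) = m - a" "a + (int j + 1) = a + int j + 1" "m - a + int j + 1 = ?m - a" by auto
        show "NO \<gamma> \<gamma>' a (m - a) (var j * f) = var j * NO \<gamma> \<gamma>' a (m - a) f
          - (cst (pc * of_int \<gamma>) * NO \<gamma> \<gamma>' (a + (int j + 1)) (?m - (a + (int j + 1))) f + cst (pc * of_int \<gamma>') * NO \<gamma> \<gamma>' a (?m - a) f)"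
          by (simp only: NO_var e1)
      qed
      also have "\<dots> = var j * Sum_any (\<lambda>a. NO \<gamma> \<gamma>' a (m - a) f)
          - (cst (pc * of_int \<gamma>) * Sum_any (\<lambda>a. NO \<gamma> \<gamma>' (a + (int j + 1)) (?m - (a + (int j + 1))) f) + cst (pc * of_int \<gamma>') * Sum_any (\<lambda>a. NO \<gamma> \<gamma>' a (?m - a) f))"
        unfolding SA_mult[OF fs_NO] SA_mult[OF fs_shift[OF fs_NO]]
        by (subst SA_diff, intro fs_mult fs_NO, intro fs_add fs_mult fs_NO fs_shift[OF fs_NO], subst SA_add, intro fs_mult fs_shift[OF fs_NO], intro fs_mult fs_NO) simp
      also have "Sum_any (\<lambda>a. NO \<gamma> \<gamma>' (a + (int j + 1)) (?m - (a + (int j + 1))) f) = Sum_any (\<lambda>a. NO \<gamma> \<gamma>' a (?m - a) f)"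
        by (rule SA_shift)
      finally show "V (\<gamma> + \<gamma>') m (var j * f) = Sum_any (\<lambda>a. NO \<gamma> \<gamma>' a (m - a) (var j * f))"
        using var unfolding V_var by (simp add: cst_add distrib_left distrib_right)
    qed
  next
    case (add f g) then show ?case by (simp add: clin_add[OF clin_V] clin_add[OF clin_NO] SA_add[OF fs_NO fs_NO])
  next
    case (scale z f) then show ?case by (simp add: clin_scale[OF clin_V] clin_scale[OF clin_NO] SA_mult[OF fs_NO])
  qed
  then show ?thesis by simp
qed

end

section \<open>Double sums and binomial convolutions\<close>

lemma SA_nat: "(\<And>i. i \<ge> N \<Longrightarrow> g i = 0) \<Longrightarrow> Sum_any g = (\<Sum>i<N. g i :: fock)" for g :: "nat \<Rightarrow> fock"
  by (rule Sum_any.expand_superset) (auto intro: leI)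
lemma fs_nat: "(\<And>i. i \<ge> N \<Longrightarrow> g i = 0) \<Longrightarrow> fs (g :: nat \<Rightarrow> fock)"
  by (rule finite_subset[of _ "{..<N}"]) (auto intro: leI)

lemma SA_mult2: "fs g \<Longrightarrow> a * (b * Sum_any g) = Sum_any (\<lambda>r. a * (b * g r))"
  using SA_mult[of g "a * b"] by (simp add: mult.assoc)

abbreviation fs2 :: "('i \<Rightarrow> 'j \<Rightarrow> fock) \<Rightarrow> bool" where "fs2 g \<equiv> finite {(a, b). g a b \<noteq> 0}"

lemma fs2_inner: "fs2 g \<Longrightarrow> fs (g a)"
  by (rule finite_subset[of _ "snd ` {(a, b). g a b \<noteq> 0}"]) force+
lemma fs2_outer: "fs2 g \<Longrightarrow> fs (\<lambda>a. Sum_any (g a))"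
  by (rule finite_subset[of _ "fst ` {(a, b). g a b \<noteq> 0}"]) (force elim: Sum_any.not_neutral_obtains_not_neutral)+
lemma fs2_flip: "fs2 g \<Longrightarrow> fs2 (\<lambda>b a. g a b)"
  by (rule finite_subset[of _ "prod.swap ` {(a, b). g a b \<noteq> 0}"]) force+
lemma SA_swap: assumes "fs2 g"
  shows "Sum_any (\<lambda>a. Sum_any (\<lambda>b. g a b)) = Sum_any (\<lambda>b. Sum_any (\<lambda>a. g a b))"
proof (rule Sum_any.swap)
  let ?S = "{(a, b). g a b \<noteq> 0}"
  show "finite (fst ` ?S \<times> snd ` ?S)" using assms by blast
  show "{a. \<exists>b. g a b \<noteq> 0} \<times> {b. \<exists>a. g a b \<noteq> 0} \<subseteq> fst ` ?S \<times> snd ` ?S" by force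
qed

lemma fs2_box: "(\<And>i q. i \<ge> N \<Longrightarrow> g i q = 0) \<Longrightarrow> (\<And>i. \<exists>M. \<forall>q\<ge>M. g i q = 0) \<Longrightarrow> fs2 (g :: nat \<Rightarrow> nat \<Rightarrow> fock)"
proof -
  assume 1: "\<And>i q. i \<ge> N \<Longrightarrow> g i q = 0" and 2: "\<And>i. \<exists>M. \<forall>q\<ge>M. g i q = 0"
  from 2 obtain M where M: "\<And>i q. q \<ge> M i \<Longrightarrow> g i q = 0" by metis
  have "{(a, b). g a b \<noteq> 0} \<subseteq> Sigma {..<N} (\<lambda>i. {..<M i})"
    using 1 M by (auto; meson not_le)
  then show ?thesis by (rule finite_subset) auto
qed

lemma fs2_tri: "(\<And>i q. i + q \<ge> N \<Longrightarrow> g i q = 0) \<Longrightarrow> fs2 (g :: nat \<Rightarrow> nat \<Rightarrow> fock)"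
  by (rule fs2_box[of N]) (auto intro!: exI[of _ N])

lemma SA_diag: fixes Z :: "nat \<Rightarrow> fock" and N :: nat assumes Z: "\<And>l. l \<ge> N \<Longrightarrow> Z l = 0"
  shows "Sum_any (\<lambda>i. Sum_any (\<lambda>q. cst (c i * b q) * Z (i + q))) = Sum_any (\<lambda>l. cst (\<Sum>i\<le>l. c i * b (l - i)) * (Z l :: fock))"
proof -
  have "Sum_any (\<lambda>i. Sum_any (\<lambda>q. cst (c i * b q) * Z (i + q))) = (\<Sum>i<N. Sum_any (\<lambda>q. cst (c i * b q) * Z (i + q)))"
    by (rule SA_nat) (simp add: Z)
  also have "\<dots> = (\<Sum>i<N. \<Sum>q<N - i. cst (c i * b q) * Z (i + q))"
    by (intro sum.cong refl SA_nat) (simp add: Z)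
  also have "\<dots> = (\<Sum>(i,q)\<in>Sigma {..<N} (\<lambda>i. {..<N - i}). cst (c i * b q) * Z (i + q))"
    by (simp add: sum.Sigma)
  also have "\<dots> = (\<Sum>(l,i)\<in>Sigma {..<N} (\<lambda>l. {..l}). cst (c i * b (l - i)) * Z l)"
    by (rule sum.reindex_bij_witness[of _ "\<lambda>(l,i). (i, l - i)" "\<lambda>(i,q). (i + q, i)"]) auto
  also have "\<dots> = (\<Sum>l<N. cst (\<Sum>i\<le>l. c i * b (l - i)) * Z l)"
    by (simp add: sum.Sigma[symmetric] cst_sum sum_distrib_right)
  also have "\<dots> = Sum_any (\<lambda>l. cst (\<Sum>i\<le>l. c i * b (l - i)) * Z l)"
    by (rule SA_nat[symmetric]) (simp add: Z)
  finally show ?thesis .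
qed

lemma gchoose_flip: "(of_nat (u + j) gchoose j) = (- 1) ^ u * ((- of_nat j - 1) gchoose u :: complex)"
proof -
  have "((- of_nat j - 1) gchoose u :: complex) = (- 1) ^ u * ((of_nat u - (- of_nat j - 1) - 1) gchoose u)"
    by (rule gbinomial_negated_upper)
  also have "of_nat u - (- of_nat j - 1) - 1 = (of_nat (u + j) :: complex)" by simp
  also have "(of_nat (u + j) gchoose u) = (of_nat ((u + j) choose u) :: complex)" by (rule binomial_gbinomial[symmetric])
  also have "(u + j) choose u = (u + j) choose j" by (metis add_diff_cancel_left' binomial_symmetric le_add1)
  also have "of_nat ((u + j) choose j) = (of_nat (u + j) gchoose j :: complex)" by (rule binomial_gbinomial)
  finally show ?thesis by (simp flip: mult.assoc power_add add: mult_2[symmetric])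
qed

lemma gchoose_neg: "((- of_nat r - 1) gchoose j :: complex) = (- 1) ^ j * (- 1) ^ r * ((- of_nat j - 1) gchoose r)"
proof -
  have "((- of_nat r - 1) gchoose j :: complex) = (- 1) ^ j * ((of_nat j - (- of_nat r - 1) - 1) gchoose j)"
    by (rule gbinomial_negated_upper)
  also have "of_nat j - (- of_nat r - 1) - 1 = (of_nat (r + j) :: complex)" by simp
  also note gchoose_flip
  finally show ?thesis by (simp add: mult.assoc)
qed

text \<open>Upper negation turns the last factor into one with lower index s - j - i, and
  Vandermonde applies. In the residues below this says that a j-th divided derivative of alpha(z)
  changes (1 - x)^n into (1 - x)^(n-j-1).\<close>

lemma binom_sum1: "(\<Sum>i\<le>s. (- 1) ^ i * (x gchoose i) * (of_nat (s - i) gchoose j)) = (if s < j then 0 else (- 1) ^ (s - j) * ((x - of_nat j - 1) gchoose (s - j)) :: complex)"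
proof (cases "s < j")
  case True
  have "(of_nat (s - i) gchoose j :: complex) = 0" for i
    using True by (simp flip: binomial_gbinomial add: binomial_eq_0)
  then show ?thesis using True by (simp del: of_nat_diff)
next
  case False
  have "(\<Sum>i\<le>s. (- 1) ^ i * (x gchoose i) * (of_nat (s - i) gchoose j)) = (\<Sum>i\<le>s - j. (- 1) ^ i * (x gchoose i) * (of_nat (s - i) gchoose j :: complex))"
  proof (rule sum.mono_neutral_right)
    show "\<forall>i\<in>{..s} - {..s - j}. (- 1) ^ i * (x gchoose i) * (of_nat (s - i) gchoose j :: complex) = 0"
      using False by (auto simp: binomial_eq_0 simp flip: binomial_gbinomial simp del: of_nat_diff)
  qed auto
  also have "\<dots> = (\<Sum>i\<le>s - j. (- 1) ^ (s - j) * ((x gchoose i) * ((- of_nat j - 1) gchoose (s - j - i))))"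
  proof (rule sum.cong[OF refl])
    fix i assume "i \<in> {..s - j}"
    then have e: "s - i = (s - j - i) + j" and e2: "(- 1 :: complex) ^ (s - j) = (- 1) ^ i * (- 1) ^ (s - j - i)"
      using False by (auto simp flip: power_add)
    show "(- 1) ^ i * (x gchoose i) * (of_nat (s - i) gchoose j) = (- 1) ^ (s - j) * ((x gchoose i) * ((- of_nat j - 1) gchoose (s - j - i)))"
      unfolding e gchoose_flip e2 by (simp add: mult_ac)
  qed
  also have "\<dots> = (- 1) ^ (s - j) * ((x + (- of_nat j - 1)) gchoose (s - j))"
    using gbinomial_Vandermonde[of x "- of_nat j - 1" "s - j"] by (simp add: sum_distrib_left[symmetric] atLeast0AtMost)
  finally show ?thesis using False by (simp add: algebra_simps)
qed

lemma binom_sum2: "(\<Sum>i\<le>s. (- 1) ^ i * (x gchoose i) * ((- of_nat (s - i) - 1) gchoose j)) = (- 1) ^ j * ((- 1) ^ s * ((x - of_nat j - 1) gchoose s) :: complex)"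
proof -
  have "(\<Sum>i\<le>s. (- 1) ^ i * (x gchoose i) * ((- of_nat (s - i) - 1) gchoose j)) = (\<Sum>i\<le>s. (- 1) ^ j * ((- 1) ^ s * ((x gchoose i) * ((- of_nat j - 1) gchoose (s - i)))))"
  proof (rule sum.cong[OF refl])
    fix i assume "i \<in> {..s}"
    then have e2: "(- 1 :: complex) ^ s = (- 1) ^ i * (- 1) ^ (s - i)" by (simp flip: power_add)
    show "(- 1) ^ i * (x gchoose i) * ((- of_nat (s - i) - 1) gchoose j) = (- 1) ^ j * ((- 1) ^ s * ((x gchoose i) * ((- of_nat j - 1) gchoose (s - i))))"
      unfolding gchoose_neg[of "s - i" j] e2 by (simp add: mult_ac del: of_nat_diff)
  qed
  also have "\<dots> = (- 1) ^ j * ((- 1) ^ s * ((x + (- of_nat j - 1)) gchoose s))"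
    using gbinomial_Vandermonde[of x "- of_nat j - 1" s] by (simp add: sum_distrib_left[symmetric] atLeast0AtMost)
  finally show ?thesis by (simp add: algebra_simps)
qed

section \<open>Fields of arbitrary states\<close>

text \<open>What is needed of a field to form normally ordered products with derivatives of
  alpha(z): linear modes, truncated from below on each vector.\<close>

definition fam :: "(int \<Rightarrow> fock \<Rightarrow> fock) \<Rightarrow> bool" where
  "fam X \<longleftrightarrow> (\<forall>m. clin (X m)) \<and> (\<forall>f. \<exists>N. \<forall>m<N. X m f = 0)"

lemma fam_clin: "fam X \<Longrightarrow> clin (X m)" by (simp add: fam_def)
lemma fam_low: "fam X \<Longrightarrow> \<exists>N. \<forall>m<N. X m f = 0" by (simp add: fam_def)

lemma fam_nat: assumes "fam X" shows "\<exists>N::nat. \<forall>q\<ge>N. X (m - int q) f = 0"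
proof -
  obtain K where K: "\<forall>m<K. X m f = 0" using fam_low[OF assms] by blast
  show ?thesis by (rule exI[of _ "nat (m - K) + 1"]) (use K in auto)
qed

context trip
begin

lemma fam_V: "fam (V \<gamma>)" by (simp add: fam_def clin_V V_low)

lemma al_nat: "\<exists>N::nat. \<forall>r\<ge>N. al \<chi> (int r) f = 0"
proof -
  obtain K where K: "\<forall>r>K. al \<chi> r f = 0" using al_high by blast
  show ?thesis by (rule exI[of _ "nat K + 1"]) (use K in auto)
qed

text \<open>\<open>CP\<close> and \<open>AP\<close> are the halves of the normally ordered product
  of the j-th divided derivative of alpha(z) with the field X, as in \<open>hm\<close>: the modes
  alpha(-q-1) stand on the left, the modes alpha(r) with r at least 0 on the right.\<close>

definition CP :: "nat \<Rightarrow> (int \<Rightarrow> fock \<Rightarrow> fock) \<Rightarrow> int \<Rightarrow> fock \<Rightarrow> nat \<Rightarrow> fock" where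
  "CP j X m f q = cst (of_nat q gchoose j) * (var q * X (m - int q + int j) f)"
definition AP :: "int \<Rightarrow> nat \<Rightarrow> (int \<Rightarrow> fock \<Rightarrow> fock) \<Rightarrow> int \<Rightarrow> fock \<Rightarrow> nat \<Rightarrow> fock" where
  "AP \<chi> j X m f r = cst ((- of_nat r - 1) gchoose j) * X (m + int r + int j + 1) (al \<chi> (int r) f)"
definition NP :: "int \<Rightarrow> nat \<Rightarrow> (int \<Rightarrow> fock \<Rightarrow> fock) \<Rightarrow> int \<Rightarrow> fock \<Rightarrow> fock" where
  "NP \<chi> j X m f = Sum_any (CP j X m f) + Sum_any (AP \<chi> j X m f)"

lemma CP_large: assumes "fam X" shows "\<exists>N. \<forall>q\<ge>N. CP j X m f q = 0"
proof -
  obtain N where "\<forall>q\<ge>N. X (m + int j - int q) f = 0" using fam_nat[OF assms] by blast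
  then show ?thesis by (intro exI[of _ N]) (auto simp: CP_def algebra_simps)
qed
lemma AP_large: assumes "fam X" shows "\<exists>N. \<forall>r\<ge>N. AP \<chi> j X m f r = 0"
proof -
  obtain N where "\<forall>r\<ge>N. al \<chi> (int r) f = 0" using al_nat by blast
  then show ?thesis by (intro exI[of _ N]) (auto simp: AP_def clin_0[OF fam_clin[OF assms]])
qed
lemma fs_CP: "fam X \<Longrightarrow> fs (CP j X m f)" using CP_large fs_nat by blast
lemma fs_AP: "fam X \<Longrightarrow> fs (AP \<chi> j X m f)" using AP_large fs_nat by blast
lemma clin_CP: "fam X \<Longrightarrow> clin (\<lambda>f. CP j X m f q)" unfolding CP_def by (intro clin_mul fam_clin)
lemma clin_AP: "fam X \<Longrightarrow> clin (\<lambda>f. AP \<chi> j X m f r)" unfolding AP_def by (intro clin_mul clin_comp[OF fam_clin clin_al])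

lemma fam_NP: assumes X: "fam X" shows "fam (NP \<chi> j X)"
  unfolding fam_def
proof (intro conjI allI)
  fix m show "clin (NP \<chi> j X m)"
    unfolding NP_def by (intro clin_plus clin_SA clin_CP clin_AP fs_CP fs_AP X)
next
  fix f
  obtain N0 where N0: "\<forall>m<N0. X m f = 0" using fam_low[OF X] by blast
  obtain R where R: "\<forall>r\<ge>R. al \<chi> (int r) f = 0" using al_nat by blast
  have "\<forall>r. \<exists>K. \<forall>m<K. X m (al \<chi> (int r) f) = 0" using fam_low[OF X] by blast
  then obtain K where "\<forall>r. \<forall>m<K r. X m (al \<chi> (int r) f) = 0"
    using choice[of "\<lambda>r K. \<forall>m<K. X m (al \<chi> (int r) f) = 0"] by blast
  then have K: "\<And>r m. m < K r \<Longrightarrow> X m (al \<chi> (int r) f) = 0" by blast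
  define M where "M = Min (insert (N0 - int j) ((\<lambda>r. K r - int r - int j - 1) ` {..<R}))"
  have M1: "M \<le> N0 - int j" unfolding M_def by (rule Min_le) auto
  have M2: "\<And>r. r < R \<Longrightarrow> M \<le> K r - int r - int j - 1" unfolding M_def by (rule Min_le) auto
  show "\<exists>N. \<forall>m<N. NP \<chi> j X m f = 0"
  proof (intro exI[of _ M] allI impI)
    fix m assume m: "m < M"
    have "CP j X m f q = 0" for q using m M1 N0 by (simp add: CP_def)
    moreover have "AP \<chi> j X m f r = 0" for r
    proof (cases "r < R")
      case True then show ?thesis using m M2[OF True] K[of "m + int r + int j + 1" r] by (simp add: AP_def)
    next
      case False then show ?thesis using R by (simp add: AP_def clin_0[OF fam_clin[OF X]])
    qed
    ultimately show "NP \<chi> j X m f = 0" by (simp add: NP_def)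
  qed
qed

lemma fam_C: assumes X: "fam X" shows "fam (\<lambda>m f. Sum_any (CP j X m f))"
  unfolding fam_def
proof (intro conjI allI)
  fix m show "clin (\<lambda>f. Sum_any (CP j X m f))" by (intro clin_SA clin_CP fs_CP X)
next
  fix f
  obtain N0 where N0: "\<forall>m<N0. X m f = 0" using fam_low[OF X] by blast
  have "CP j X m f q = 0" if "m < N0 - int j" for m q using that N0 by (simp add: CP_def)
  then show "\<exists>N. \<forall>m<N. Sum_any (CP j X m f) = 0" by (intro exI[of _ "N0 - int j"]) simp
qed

lemma fam_A: assumes X: "fam X" shows "fam (\<lambda>m f. Sum_any (AP \<chi> j X m f))"
proof -
  have e: "Sum_any (AP \<chi> j X m f) = NP \<chi> j X m f - Sum_any (CP j X m f)" for m f by (simp add: NP_def)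
  show ?thesis unfolding fam_def e
  proof (intro conjI allI)
    fix m show "clin (\<lambda>f. NP \<chi> j X m f - Sum_any (CP j X m f))"
      by (intro clin_sub fam_clin[OF fam_NP[OF X]] fam_clin[OF fam_C[OF X]])
  next
    fix f
    obtain N1 N2 where "\<forall>m<N1. NP \<chi> j X m f = 0" "\<forall>m<N2. Sum_any (CP j X m f) = 0"
      using fam_low[OF fam_NP[OF X]] fam_low[OF fam_C[OF X]] by metis
    then show "\<exists>N. \<forall>m<N. NP \<chi> j X m f - Sum_any (CP j X m f) = 0" by (intro exI[of _ "min N1 N2"]) auto
  qed
qed

lemma NP_split_add: assumes X: "fam X" and Y: "fam Y"
  shows "NP \<chi> j (\<lambda>m f. X m f + Y m f) m f = NP \<chi> j X m f + NP \<chi> j Y m f"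
proof -
  have "CP j (\<lambda>m f. X m f + Y m f) m f = (\<lambda>q. CP j X m f q + CP j Y m f q)" by (auto simp: CP_def algebra_simps)
  moreover have "AP \<chi> j (\<lambda>m f. X m f + Y m f) m f = (\<lambda>q. AP \<chi> j X m f q + AP \<chi> j Y m f q)" by (auto simp: AP_def algebra_simps)
  ultimately show ?thesis unfolding NP_def by (simp add: SA_add[OF fs_CP[OF X] fs_CP[OF Y]] SA_add[OF fs_AP[OF X] fs_AP[OF Y]])
qed

lemma NP_scale: assumes X: "fam X"
  shows "NP \<chi> j (\<lambda>m f. cst z * X m f) m f = cst z * NP \<chi> j X m f"
proof -
  have "CP j (\<lambda>m f. cst z * X m f) m f = (\<lambda>q. cst z * CP j X m f q)" by (auto simp: CP_def algebra_simps)
  moreover have "AP \<chi> j (\<lambda>m f. cst z * X m f) m f = (\<lambda>q. cst z * AP \<chi> j X m f q)" by (auto simp: AP_def algebra_simps)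
  ultimately show ?thesis unfolding NP_def by (simp add: SA_mult[OF fs_CP[OF X], symmetric] SA_mult[OF fs_AP[OF X], symmetric] distrib_left)
qed

text \<open>Creation modes always stand on the left and the others on the right, so only modes that
  commute with each other are ever exchanged; the work lies in interchanging the sums.\<close>

lemma NP_swap: assumes X: "fam X"
  shows "NP \<chi> j (NP \<chi> k X) m f = NP \<chi> k (NP \<chi> j X) m f"
proof -
  let ?C = "\<lambda>j X m f. Sum_any (CP j X m f)" and ?A = "\<lambda>j X m f. Sum_any (AP \<chi> j X m f)"
  have split: "NP \<chi> j (NP \<chi> k X) m f = (?C j (?C k X) m f + ?A j (?C k X) m f) + (?C j (?A k X) m f + ?A j (?A k X) m f)" for j k
  proof -
    have "NP \<chi> k X = (\<lambda>m f. ?C k X m f + ?A k X m f)" by (intro ext) (simp add: NP_def)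
    then have "NP \<chi> j (NP \<chi> k X) m f = NP \<chi> j (?C k X) m f + NP \<chi> j (?A k X) m f"
      by (simp add: NP_split_add[OF fam_C[OF X] fam_A[OF X]])
    then show ?thesis by (simp add: NP_def)
  qed
  have CC: "?C j (?C k X) m f = ?C k (?C j X) m f" for j k
  proof -
    define g where "g j k q q' = cst (of_nat q gchoose j) * (var q * (cst (of_nat q' gchoose k) * (var q' * X (m - int q + int j - int q' + int k) f)))" for j k q q'
    obtain N where N: "\<forall>q\<ge>N. X (m + int j + int k - int q) f = 0" using fam_nat[OF X] by blast
    have f2: "fs2 (g j k)"
    proof (rule fs2_tri[of N])
      fix i q assume "i + q \<ge> N"
      then have z: "X (m + int j + int k - int (i + q)) f = 0" using N by blast
      have e: "m - int i + int j - int q + int k = m + int j + int k - int (i + q)" by simp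
      show "g j k i q = 0" unfolding g_def e z by simp
    qed
    have e: "CP j (?C k X) m f q = Sum_any (g j k q)" for j k q
      unfolding CP_def[of j] SA_mult2[OF fs_CP[OF X]] g_def CP_def ..
    have "g j k q q' = g k j q' q" for q q' unfolding g_def by (simp add: algebra_simps)
    then have "Sum_any (\<lambda>q. Sum_any (g j k q)) = Sum_any (\<lambda>q'. Sum_any (g k j q'))"
      by (subst SA_swap[OF f2]) simp
    moreover have "CP j (?C k X) m f = (\<lambda>q. Sum_any (g j k q))" for j k by (rule ext) (rule e)
    ultimately show ?thesis by simp
  qed
  have AA: "?A j (?A k X) m f = ?A k (?A j X) m f" for j k
  proof -
    define g where "g j k r s = cst ((- of_nat r - 1) gchoose j) * (cst ((- of_nat s - 1) gchoose k) * X (m + int r + int j + 1 + int s + int k + 1) (al \<chi> (int s) (al \<chi> (int r) f)))" for j k r s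
    obtain R where R: "\<forall>r\<ge>R. al \<chi> (int r) f = 0" using al_nat by blast
    have f2: "fs2 (g j k)"
    proof (rule fs2_box[of R])
      fix i
      obtain N where "\<forall>r\<ge>N. al \<chi> (int r) (al \<chi> (int i) f) = 0" using al_nat by blast
      then show "\<exists>M. \<forall>q\<ge>M. g j k i q = 0"
        by (intro exI[of _ N]) (auto simp: g_def clin_0[OF fam_clin[OF X]])
    qed (use R in \<open>auto simp: g_def clin_0[OF fam_clin[OF X]] clin_0[OF clin_al]\<close>)
    have e: "AP \<chi> j (?A k X) m f r = Sum_any (g j k r)" for j k r
      unfolding AP_def[of \<chi> j] SA_mult[OF fs_AP[OF X]] g_def AP_def ..
    have "al \<chi> (int s) (al \<chi> (int r) f) = al \<chi> (int r) (al \<chi> (int s) f)" for r s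
      using al_comm[of \<chi> "int s" "int r" f] by auto
    then have "g j k r s = g k j s r" for r s unfolding g_def by (simp add: algebra_simps)
    then have "Sum_any (\<lambda>q. Sum_any (g j k q)) = Sum_any (\<lambda>q'. Sum_any (g k j q'))"
      by (subst SA_swap[OF f2]) simp
    moreover have "AP \<chi> j (?A k X) m f = (\<lambda>q. Sum_any (g j k q))" for j k by (rule ext) (rule e)
    ultimately show ?thesis by simp
  qed
  have CA: "?C j (?A k X) m f = ?A k (?C j X) m f" for j k
  proof -
    define g where "g q s = cst (of_nat q gchoose j) * (var q * (cst ((- of_nat s - 1) gchoose k) * X (m - int q + int j + int s + int k + 1) (al \<chi> (int s) f)))" for q s
    obtain R where R: "\<forall>r\<ge>R. al \<chi> (int r) f = 0" using al_nat by blast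
    have f2: "fs2 g"
    proof (rule fs2_flip, rule fs2_box[of R])
      fix i
      obtain N where "\<forall>q\<ge>N. X (m + int j + int i + int k + 1 - int q) (al \<chi> (int i) f) = 0" using fam_nat[OF X] by blast
      then show "\<exists>M. \<forall>q\<ge>M. g q i = 0" by (intro exI[of _ N]) (auto simp: g_def algebra_simps)
    qed (use R in \<open>auto simp: g_def clin_0[OF fam_clin[OF X]]\<close>)
    have e1: "CP j (?A k X) m f q = Sum_any (g q)" for q
      unfolding CP_def SA_mult2[OF fs_AP[OF X]] g_def AP_def ..
    have e2: "AP \<chi> k (?C j X) m f s = Sum_any (\<lambda>q. g q s)" for s
      unfolding AP_def SA_mult[OF fs_CP[OF X]] g_def CP_def by (simp add: algebra_simps)
    have "CP j (?A k X) m f = (\<lambda>q. Sum_any (g q))" "AP \<chi> k (?C j X) m f = (\<lambda>s. Sum_any (\<lambda>q. g q s))"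
      using e1 e2 by auto
    then show ?thesis using SA_swap[OF f2] by simp
  qed
  show ?thesis unfolding split using CC[of j k] AA[of j k] CA[of j k] CA[of k j] by simp
qed

fun Yl :: "int \<Rightarrow> int \<Rightarrow> nat list \<Rightarrow> int \<Rightarrow> fock \<Rightarrow> fock" where
  "Yl \<gamma> \<chi> [] = V \<gamma>"
| "Yl \<gamma> \<chi> (j # js) = NP \<chi> j (Yl \<gamma> \<chi> js)"

lemma fam_Yl: "fam (Yl \<gamma> \<chi> js)" by (induction js) (auto simp: fam_V fam_NP)

text \<open>\<open>vmode\<close> takes the factors of a monomial in sorted order. With this lemma
  the order no longer matters, which is what \<open>Ys_var\<close> needs.\<close>

lemma Yl_insort: "Yl \<gamma> \<chi> (insort j js) = Yl \<gamma> \<chi> (j # js)"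
proof (induction js)
  case (Cons k js)
  show ?case
  proof (cases "j \<le> k")
    case False
    then have "Yl \<gamma> \<chi> (insort j (k # js)) = NP \<chi> k (NP \<chi> j (Yl \<gamma> \<chi> js))" using Cons by simp
    also have "\<dots> = NP \<chi> j (NP \<chi> k (Yl \<gamma> \<chi> js))" by (intro ext) (rule NP_swap[OF fam_Yl])
    finally show ?thesis by simp
  qed simp
qed simp

text \<open>The mode of \<open>z\<close>-degree \<open>m\<close> (relative to the shift \<open>p \<gamma> \<chi> / 2\<close>) of the field of the
  state \<open>b\<close> of half-charge \<open>\<gamma>\<close>, acting on the Fock space of half-charge \<open>\<chi>\<close>.\<close>

definition Ys :: "int \<Rightarrow> int \<Rightarrow> fock \<Rightarrow> int \<Rightarrow> fock \<Rightarrow> fock" where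
  "Ys \<gamma> \<chi> b m f = lext (\<lambda>c. Yl \<gamma> \<chi> (sorted_list_of_multiset c) m f) b"

lemma clin_Ys_state: "clin (\<lambda>b. Ys \<gamma> \<chi> b m f)" unfolding Ys_def by (rule clin_lext)
lemma Ys_mon: "Ys \<gamma> \<chi> (mon c) m f = Yl \<gamma> \<chi> (sorted_list_of_multiset c) m f" by (simp add: Ys_def)
lemma Ys_1: "Ys \<gamma> \<chi> 1 = V \<gamma>"
  using Ys_mon[of \<gamma> \<chi> "{#}"] by (intro ext) simp
lemma Ys_add: "Ys \<gamma> \<chi> (b + b') = (\<lambda>m f. Ys \<gamma> \<chi> b m f + Ys \<gamma> \<chi> b' m f)"
  by (intro ext) (rule clin_add[OF clin_Ys_state])
lemma Ys_scale: "Ys \<gamma> \<chi> (cst z * b) = (\<lambda>m f. cst z * Ys \<gamma> \<chi> b m f)"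
  by (intro ext) (rule clin_scale[OF clin_Ys_state])
lemma Ys_0: "Ys \<gamma> \<chi> 0 m f = 0" by (rule clin_0[OF clin_Ys_state])

lemma fam_add: "fam X \<Longrightarrow> fam Y \<Longrightarrow> fam (\<lambda>m f. X m f + Y m f)"
  unfolding fam_def
proof (elim conjE, intro conjI allI)
  fix f assume "\<forall>f. \<exists>N. \<forall>m<N. X m f = 0" "\<forall>f. \<exists>N. \<forall>m<N. Y m f = 0"
  then obtain N1 N2 where "\<forall>m<N1. X m f = 0" "\<forall>m<N2. Y m f = 0" by metis
  then show "\<exists>N. \<forall>m<N. X m f + Y m f = 0" by (intro exI[of _ "min N1 N2"]) auto
qed (auto intro: clin_plus)
lemma fam_scale: "fam X \<Longrightarrow> fam (\<lambda>m f. cst z * X m f)"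
  unfolding fam_def by (elim conjE, intro conjI allI) (auto intro: clin_mul, metis mult_zero_right)

lemma fam_Ys: "fam (Ys \<gamma> \<chi> b)"
proof (induction b rule: fock_induct_mon)
  case (mon c)
  have "Ys \<gamma> \<chi> (mon c) = Yl \<gamma> \<chi> (sorted_list_of_multiset c)" by (intro ext) (rule Ys_mon)
  then show ?case by (simp add: fam_Yl)
qed (auto simp: Ys_add Ys_scale fam_add fam_scale)

lemma clin_Ys: "clin (Ys \<gamma> \<chi> b m)" by (rule fam_clin[OF fam_Ys])

lemma Ys_var: "Ys \<gamma> \<chi> (var j * b) = NP \<chi> j (Ys \<gamma> \<chi> b)"
proof (induction b rule: fock_induct_mon)
  case (mon c)
  have "Ys \<gamma> \<chi> (mon c) = Yl \<gamma> \<chi> (sorted_list_of_multiset c)" for c by (intro ext) (rule Ys_mon)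
  then show ?case by (simp add: mon_add[symmetric] Yl_insort)
next
  case (add f g) then show ?case
    by (intro ext) (simp add: distrib_left Ys_add NP_split_add[OF fam_Ys fam_Ys])
next
  case (scale z f)
  have e: "var j * (cst z * f) = cst z * (var j * f)" by (simp add: mult_ac)
  show ?case unfolding e Ys_scale scale by (intro ext) (simp add: NP_scale[OF fam_Ys])
qed

section \<open>The iterate formula for the field of e^alpha\<close>

abbreviation ip :: int where "ip \<equiv> int p"

text \<open>\<open>em \<chi> k\<close> is the mode \<open>k\<close> of \<open>exp(\<alpha>)\<close> on half-charge \<open>\<chi>\<close>.\<close>

definition em :: "int \<Rightarrow> int \<Rightarrow> fock \<Rightarrow> fock" where "em \<chi> k = V 2 (- k - 1 - ip * \<chi>)"

lemma clin_em: "clin (em \<chi> k)" by (simp add: em_def clin_V)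

lemma em_nat: "\<exists>N::nat. \<forall>i\<ge>N. em \<chi> (int i) f = 0"
proof -
  have e: "- int i - 1 - ip * \<chi> = - 1 - ip * \<chi> - int i" for i by simp
  show ?thesis unfolding em_def e by (rule fam_nat[OF fam_V])
qed

lemma em_var: "em \<chi> k (var q * f) = var q * em \<chi> k f - cst (2 * pc) * em \<chi> (k - int q - 1) f"
  unfolding em_def V_var by (simp add: algebra_simps)

lemma al_em: "al (\<chi> + 2) r (em \<chi> k f) = em \<chi> k (al \<chi> r f) + cst (2 * pc) * em \<chi> (k + r) f"
  unfolding em_def al_V by (simp add: algebra_simps)

text \<open>The coefficients of (1 - x)^n for any integer n, used for both expansions of (z -
  w)^n.\<close>

definition bc :: "int \<Rightarrow> nat \<Rightarrow> complex" where "bc n i = (- 1) ^ i * (of_int n gchoose i)"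

text \<open>The two terms of the iterate formula, one for each order of the product: in
  \<open>R1\<close> the field of e^alpha acts last, in \<open>R2\<close> it acts first.\<close>

definition R1 :: "int \<Rightarrow> int \<Rightarrow> (int \<Rightarrow> fock \<Rightarrow> fock) \<Rightarrow> int \<Rightarrow> fock \<Rightarrow> fock" where
  "R1 \<chi>' n X m f = Sum_any (\<lambda>i. cst (bc n i) * em \<chi>' (n - int i) (X (m - int i) f))"
definition R2 :: "int \<Rightarrow> int \<Rightarrow> (int \<Rightarrow> fock \<Rightarrow> fock) \<Rightarrow> int \<Rightarrow> fock \<Rightarrow> fock" where
  "R2 \<chi> n X m f = Sum_any (\<lambda>i. cst (bc n i) * X (m + int i) (em \<chi> (int i) f))"

lemma fs_R1: assumes X: "fam X" shows "fs (\<lambda>i. cst (bc n i) * em \<chi>' (n - int i) (X (m - int i) f))"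
proof -
  obtain N where "\<forall>i\<ge>N. X (m - int i) f = 0" using fam_nat[OF X] by blast
  then show ?thesis by (intro fs_nat[of N]) (simp add: clin_0[OF clin_em])
qed
lemma fs_R2: assumes X: "fam X" shows "fs (\<lambda>i. cst (bc n i) * X (m + int i) (em \<chi> (int i) f))"
proof -
  obtain N where "\<forall>i\<ge>N. em \<chi> (int i) f = 0" using em_nat by blast
  then show ?thesis by (intro fs_nat[of N]) (simp add: clin_0[OF fam_clin[OF X]])
qed

text \<open>The creation modes of the normally ordered product have to be pulled out to the left of
  e^alpha; by \<open>binom_sum1\<close> the corrections add up to the same residue with n replaced
  by n - j - 1.\<close>

lemma R1_NP: assumes X: "fam X"
  shows "R1 \<chi>' n (NP \<chi> j X) (M + K) f = NP \<chi> j (\<lambda>m. R1 \<chi>' n X (m + K)) M f - cst (2 * pc) * R1 \<chi>' (n - int j - 1) X (M + K) f"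
proof -
  define b where "b q = (of_nat q gchoose j :: complex)" for q
  define d where "d r = ((- of_nat r - 1) gchoose j :: complex)" for r
  define Z where "Z s = em \<chi>' (n - int s - 1) (X (M + K - int s + int j) f)" for s
  define g where "g i q = cst (bc n i * b q) * (var q * em \<chi>' (n - int i) (X (M + K - int i - int q + int j) f))" for i q
  define g' where "g' i r = cst (bc n i * d r) * em \<chi>' (n - int i) (X (M + K - int i + int r + int j + 1) (al \<chi> (int r) f))" for i r
  obtain N where N: "\<forall>q\<ge>N. X (M + K + int j - int q) f = 0" using fam_nat[OF X] by blast
  have N': "X (M + K - int s + int j) f = 0" if "s \<ge> N" for s using N that by (simp add: algebra_simps)
  have Z0: "Z s = 0" if "s \<ge> N" for s using N'[OF that] by (simp add: Z_def clin_0[OF clin_em])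
  have fg: "fs2 g"
  proof (rule fs2_tri[of N])
    fix i q assume a: "i + q \<ge> N"
    have e: "M + K - int i - int q + int j = M + K - int (i + q) + int j" by simp
    show "g i q = 0" unfolding g_def e N'[OF a] by (simp add: clin_0[OF clin_em])
  qed
  have fz: "fs2 (\<lambda>i q. cst (bc n i * b q) * Z (i + q))" by (rule fs2_tri[of N]) (simp add: Z0)
  obtain R where R: "\<forall>r\<ge>R. al \<chi> (int r) f = 0" using al_nat by blast
  have fg': "fs2 g'"
  proof (rule fs2_flip, rule fs2_box[of R])
    fix r
    obtain N2 where "\<forall>q\<ge>N2. X (M + K + int r + int j + 1 - int q) (al \<chi> (int r) f) = 0" using fam_nat[OF X] by blast
    then show "\<exists>N. \<forall>i\<ge>N. g' i r = 0" by (intro exI[of _ N2]) (auto simp: g'_def clin_0[OF clin_em] algebra_simps)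
  qed (use R in \<open>auto simp: g'_def clin_0[OF fam_clin[OF X]] clin_0[OF clin_em]\<close>)
  have trm: "cst (bc n i) * em \<chi>' (n - int i) (NP \<chi> j X (M + K - int i) f)
      = (Sum_any (g i) - cst (2 * pc) * Sum_any (\<lambda>q. cst (bc n i * b q) * Z (i + q))) + Sum_any (g' i)" for i
  proof -
    have "cst (bc n i) * em \<chi>' (n - int i) (Sum_any (CP j X (M + K - int i) f)) = Sum_any (\<lambda>q. cst (bc n i) * em \<chi>' (n - int i) (CP j X (M + K - int i) f q))"
      unfolding SA_lin[OF clin_em fs_CP[OF X]] by (rule SA_mult[OF fs_lin[OF clin_em fs_CP[OF X]]])
    also have "\<dots> = Sum_any (\<lambda>q. g i q - cst (2 * pc) * (cst (bc n i * b q) * Z (i + q)))"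
    proof (rule Sum_any.cong)
      fix q
      have e: "M + K - int (i + q) + int j = M + K - int i - int q + int j" "n - int (i + q) - 1 = n - int i - int q - 1" by auto
      show "cst (bc n i) * em \<chi>' (n - int i) (CP j X (M + K - int i) f q) = g i q - cst (2 * pc) * (cst (bc n i * b q) * Z (i + q))"
        unfolding CP_def clin_scale[OF clin_em] em_var g_def Z_def b_def e by (simp add: cst_mult algebra_simps)
    qed
    also have "\<dots> = Sum_any (g i) - cst (2 * pc) * Sum_any (\<lambda>q. cst (bc n i * b q) * Z (i + q))"
      unfolding SA_mult[OF fs2_inner[OF fz]] by (rule SA_diff[OF fs2_inner[OF fg] fs_mult[OF fs2_inner[OF fz]]])
    finally have 1: "cst (bc n i) * em \<chi>' (n - int i) (Sum_any (CP j X (M + K - int i) f)) = Sum_any (g i) - cst (2 * pc) * Sum_any (\<lambda>q. cst (bc n i * b q) * Z (i + q))" .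
    have "cst (bc n i) * em \<chi>' (n - int i) (Sum_any (AP \<chi> j X (M + K - int i) f)) = Sum_any (\<lambda>r. cst (bc n i) * em \<chi>' (n - int i) (AP \<chi> j X (M + K - int i) f r))"
      unfolding SA_lin[OF clin_em fs_AP[OF X]] by (rule SA_mult[OF fs_lin[OF clin_em fs_AP[OF X]]])
    also have "\<dots> = Sum_any (g' i)"
      by (rule Sum_any.cong) (simp add: AP_def clin_scale[OF clin_em] g'_def d_def cst_mult mult.assoc)
    finally show ?thesis using 1 unfolding NP_def clin_add[OF clin_em] distrib_left by simp
  qed
  have "R1 \<chi>' n (NP \<chi> j X) (M + K) f = Sum_any (\<lambda>i. (Sum_any (g i) - cst (2 * pc) * Sum_any (\<lambda>q. cst (bc n i * b q) * Z (i + q))) + Sum_any (g' i))"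
    unfolding R1_def trm ..
  also have "\<dots> = Sum_any (\<lambda>i. Sum_any (g i)) - cst (2 * pc) * Sum_any (\<lambda>i. Sum_any (\<lambda>q. cst (bc n i * b q) * Z (i + q))) + Sum_any (\<lambda>i. Sum_any (g' i))"
  proof -
    have f3: "fs (\<lambda>i. Sum_any (g i) - cst (2 * pc) * Sum_any (\<lambda>q. cst (bc n i * b q) * Z (i + q)))"
      using fs_add[OF fs2_outer[OF fg] fs_mult[OF fs2_outer[OF fz], of "\<lambda>_. - cst (2 * pc)"]] by simp
    show ?thesis unfolding SA_add[OF f3 fs2_outer[OF fg']] SA_diff[OF fs2_outer[OF fg] fs_mult[OF fs2_outer[OF fz]]] SA_mult[OF fs2_outer[OF fz]] ..
  qed
  also have "Sum_any (\<lambda>i. Sum_any (g i)) = Sum_any (CP j (\<lambda>m. R1 \<chi>' n X (m + K)) M f)"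
  proof -
    have "Sum_any (\<lambda>i. g i q) = CP j (\<lambda>m. R1 \<chi>' n X (m + K)) M f q" for q
    proof -
      have e: "M + K - int i - int q + int j = M - int q + int j + K - int i" for i by simp
      show ?thesis unfolding CP_def R1_def SA_mult2[OF fs_R1[OF X]] g_def b_def e by (simp add: cst_mult mult_ac)
    qed
    then show ?thesis using SA_swap[OF fg] by simp
  qed
  also have "Sum_any (\<lambda>i. Sum_any (g' i)) = Sum_any (AP \<chi> j (\<lambda>m. R1 \<chi>' n X (m + K)) M f)"
  proof -
    have "Sum_any (\<lambda>i. g' i r) = AP \<chi> j (\<lambda>m. R1 \<chi>' n X (m + K)) M f r" for r
    proof -
      have e: "M + K - int i + int r + int j + 1 = M + int r + int j + 1 + K - int i" for i by simp
      show ?thesis unfolding AP_def R1_def SA_mult[OF fs_R1[OF X]] g'_def d_def e by (simp add: cst_mult mult_ac)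
    qed
    then show ?thesis using SA_swap[OF fg'] by simp
  qed
  also have "Sum_any (\<lambda>i. Sum_any (\<lambda>q. cst (bc n i * b q) * Z (i + q))) = Sum_any (\<lambda>l. cst (\<Sum>i\<le>l. bc n i * b (l - i)) * Z l)"
    by (rule SA_diag[OF Z0])
  also have "\<dots> = Sum_any (\<lambda>l. if l < j then 0 else cst (bc (n - int j - 1) (l - j)) * Z l)"
  proof (rule Sum_any.cong)
    fix l
    have "(\<Sum>i\<le>l. bc n i * b (l - i)) = (if l < j then 0 else bc (n - int j - 1) (l - j))"
      unfolding bc_def b_def using binom_sum1[of "of_int n" l j] by simp
    then show "cst (\<Sum>i\<le>l. bc n i * b (l - i)) * Z l = (if l < j then 0 else cst (bc (n - int j - 1) (l - j)) * Z l)" by simp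
  qed
  also have "\<dots> = R1 \<chi>' (n - int j - 1) X (M + K) f"
  proof -
    let ?h = "\<lambda>i. cst (bc (n - int j - 1) i) * em \<chi>' (n - int j - 1 - int i) (X (M + K - int i) f)"
    have h: "?h i = cst (bc (n - int j - 1) i) * Z (i + j)" for i unfolding Z_def by (simp add: algebra_simps)
    have "Sum_any (\<lambda>l. if l < j then 0 else cst (bc (n - int j - 1) (l - j)) * Z l) = (\<Sum>l<N + j. if l < j then 0 else cst (bc (n - int j - 1) (l - j)) * Z l)"
      by (rule SA_nat) (simp add: Z0)
    also have "\<dots> = (\<Sum>l\<in>{j..<N + j}. cst (bc (n - int j - 1) (l - j)) * Z l)"
      by (rule sum.mono_neutral_cong_right) auto
    also have "\<dots> = (\<Sum>i<N. cst (bc (n - int j - 1) i) * Z (i + j))"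
      by (rule sum.reindex_bij_witness[of _ "\<lambda>i. i + j" "\<lambda>l. l - j"]) auto
    also have "\<dots> = Sum_any ?h" unfolding h by (rule SA_nat[symmetric]) (simp add: Z0)
    finally show ?thesis unfolding R1_def .
  qed
  finally show ?thesis unfolding NP_def by simp
qed

text \<open>Here the modes alpha(r) with r at least 0 must pass e^alpha, and
  \<open>binom_sum2\<close> adds up the corrections.\<close>

lemma R2_NP: assumes X: "fam X"
  shows "R2 \<chi> n (NP (\<chi> + 2) j X) (M + K) f = NP \<chi> j (\<lambda>m. R2 \<chi> n X (m + K)) M f + cst (2 * pc * (- 1) ^ j) * R2 \<chi> (n - int j - 1) X (M + K + int j + 1) f"
proof -
  define b where "b q = (of_nat q gchoose j :: complex)" for q
  define d where "d r = ((- of_nat r - 1) gchoose j :: complex)" for r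
  define Z where "Z s = X (M + K + int s + int j + 1) (em \<chi> (int s) f)" for s
  define g where "g i q = cst (bc n i * b q) * (var q * X (M + K + int i - int q + int j) (em \<chi> (int i) f))" for i q
  define g' where "g' i r = cst (bc n i * d r) * X (M + K + int i + int r + int j + 1) (em \<chi> (int i) (al \<chi> (int r) f))" for i r
  obtain N where N: "\<forall>i\<ge>N. em \<chi> (int i) f = 0" using em_nat by blast
  have Z0: "Z s = 0" if "s \<ge> N" for s using N that by (simp add: Z_def clin_0[OF fam_clin[OF X]])
  have fg: "fs2 g"
  proof (rule fs2_box[of N])
    fix i
    obtain N2 where "\<forall>q\<ge>N2. X (M + K + int i + int j - int q) (em \<chi> (int i) f) = 0" using fam_nat[OF X] by blast
    then show "\<exists>M. \<forall>q\<ge>M. g i q = 0" by (intro exI[of _ N2]) (auto simp: g_def algebra_simps)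
  qed (use N in \<open>auto simp: g_def clin_0[OF fam_clin[OF X]]\<close>)
  have fz: "fs2 (\<lambda>i q. cst (bc n i * d q) * Z (i + q))" by (rule fs2_tri[of N]) (simp add: Z0)
  obtain R where R: "\<forall>r\<ge>R. al \<chi> (int r) f = 0" using al_nat by blast
  have fg': "fs2 g'"
  proof (rule fs2_flip, rule fs2_box[of R])
    fix r
    obtain N2 where "\<forall>i\<ge>N2. em \<chi> (int i) (al \<chi> (int r) f) = 0" using em_nat by blast
    then show "\<exists>N. \<forall>i\<ge>N. g' i r = 0" by (intro exI[of _ N2]) (auto simp: g'_def clin_0[OF fam_clin[OF X]])
  qed (use R in \<open>auto simp: g'_def clin_0[OF fam_clin[OF X]] clin_0[OF clin_em]\<close>)
  have trm: "cst (bc n i) * NP (\<chi> + 2) j X (M + K + int i) (em \<chi> (int i) f)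
      = Sum_any (g i) + (Sum_any (g' i) + cst (2 * pc) * Sum_any (\<lambda>q. cst (bc n i * d q) * Z (i + q)))" for i
  proof -
    have 1: "cst (bc n i) * Sum_any (CP j X (M + K + int i) (em \<chi> (int i) f)) = Sum_any (g i)"
      unfolding SA_mult[OF fs_CP[OF X]] by (rule Sum_any.cong) (simp add: CP_def g_def b_def cst_mult mult.assoc)
    have "cst (bc n i) * Sum_any (AP (\<chi> + 2) j X (M + K + int i) (em \<chi> (int i) f)) = Sum_any (\<lambda>r. g' i r + cst (2 * pc) * (cst (bc n i * d r) * Z (i + r)))"
      unfolding SA_mult[OF fs_AP[OF X]]
    proof (rule Sum_any.cong)
      fix r
      have e: "M + K + int (i + r) + int j + 1 = M + K + int i + int r + int j + 1" "int (i + r) = int i + int r" by auto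
      show "cst (bc n i) * AP (\<chi> + 2) j X (M + K + int i) (em \<chi> (int i) f) r = g' i r + cst (2 * pc) * (cst (bc n i * d r) * Z (i + r))"
        unfolding AP_def al_em clin_add[OF fam_clin[OF X]] clin_scale[OF fam_clin[OF X]] g'_def Z_def d_def e
        by (simp add: cst_mult algebra_simps)
    qed
    also have "\<dots> = Sum_any (g' i) + cst (2 * pc) * Sum_any (\<lambda>q. cst (bc n i * d q) * Z (i + q))"
      unfolding SA_mult[OF fs2_inner[OF fz]] by (rule SA_add[OF fs2_inner[OF fg'] fs_mult[OF fs2_inner[OF fz]]])
    finally show ?thesis using 1 unfolding NP_def distrib_left by simp
  qed
  have "R2 \<chi> n (NP (\<chi> + 2) j X) (M + K) f = Sum_any (\<lambda>i. Sum_any (g i) + (Sum_any (g' i) + cst (2 * pc) * Sum_any (\<lambda>q. cst (bc n i * d q) * Z (i + q))))"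
    unfolding R2_def trm ..
  also have "\<dots> = Sum_any (\<lambda>i. Sum_any (g i)) + (Sum_any (\<lambda>i. Sum_any (g' i)) + cst (2 * pc) * Sum_any (\<lambda>i. Sum_any (\<lambda>q. cst (bc n i * d q) * Z (i + q))))"
    unfolding SA_add[OF fs2_outer[OF fg] fs_add[OF fs2_outer[OF fg'] fs_mult[OF fs2_outer[OF fz]]]] SA_add[OF fs2_outer[OF fg'] fs_mult[OF fs2_outer[OF fz]]] SA_mult[OF fs2_outer[OF fz]] ..
  also have "Sum_any (\<lambda>i. Sum_any (g i)) = Sum_any (CP j (\<lambda>m. R2 \<chi> n X (m + K)) M f)"
  proof -
    have "Sum_any (\<lambda>i. g i q) = CP j (\<lambda>m. R2 \<chi> n X (m + K)) M f q" for q
    proof -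
      have e: "M + K + int i - int q + int j = M - int q + int j + K + int i" for i by simp
      show ?thesis unfolding CP_def R2_def SA_mult2[OF fs_R2[OF X]] g_def b_def e by (simp add: cst_mult mult_ac)
    qed
    then show ?thesis using SA_swap[OF fg] by simp
  qed
  also have "Sum_any (\<lambda>i. Sum_any (g' i)) = Sum_any (AP \<chi> j (\<lambda>m. R2 \<chi> n X (m + K)) M f)"
  proof -
    have "Sum_any (\<lambda>i. g' i r) = AP \<chi> j (\<lambda>m. R2 \<chi> n X (m + K)) M f r" for r
    proof -
      have e: "M + K + int i + int r + int j + 1 = M + int r + int j + 1 + K + int i" for i by simp
      show ?thesis unfolding AP_def R2_def SA_mult[OF fs_R2[OF X]] g'_def d_def e by (simp add: cst_mult mult_ac)
    qed
    then show ?thesis using SA_swap[OF fg'] by simp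
  qed
  also have "Sum_any (\<lambda>i. Sum_any (\<lambda>q. cst (bc n i * d q) * Z (i + q))) = Sum_any (\<lambda>l. cst (\<Sum>i\<le>l. bc n i * d (l - i)) * Z l)"
    by (rule SA_diag[OF Z0])
  also have "\<dots> = Sum_any (\<lambda>l. cst ((- 1) ^ j) * (cst (bc (n - int j - 1) l) * Z l))"
  proof (rule Sum_any.cong)
    fix l
    have "(\<Sum>i\<le>l. bc n i * d (l - i)) = (- 1) ^ j * bc (n - int j - 1) l"
      unfolding bc_def d_def using binom_sum2[of "of_int n" l j] by simp
    then show "cst (\<Sum>i\<le>l. bc n i * d (l - i)) * Z l = cst ((- 1) ^ j) * (cst (bc (n - int j - 1) l) * Z l)" by (simp add: cst_mult mult.assoc)
  qed
  also have "\<dots> = cst ((- 1) ^ j) * R2 \<chi> (n - int j - 1) X (M + K + int j + 1) f"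
  proof -
    have e: "M + K + int i + int j + 1 = M + K + int j + 1 + int i" for i by simp
    show ?thesis unfolding R2_def SA_mult[OF fs_R2[OF X]] Z_def e ..
  qed
  finally show ?thesis unfolding NP_def by (simp add: cst_mult mult.assoc add.assoc)
qed

end

lemma bconv: "(\<Sum>i\<le>n. ((- 1) ^ i * (x gchoose i)) * ((- 1) ^ (n - i) * (y gchoose (n - i)))) = (- 1) ^ n * ((x + y) gchoose n :: complex)"
proof -
  have "(\<Sum>i\<le>n. ((- 1) ^ i * (x gchoose i)) * ((- 1) ^ (n - i) * (y gchoose (n - i)))) = (\<Sum>i\<le>n. (- 1) ^ n * ((x gchoose i) * (y gchoose (n - i))))"
  proof (rule sum.cong[OF refl])
    fix i assume "i \<in> {..n}"
    then have e2: "(- 1 :: complex) ^ n = (- 1) ^ i * (- 1) ^ (n - i)" by (simp flip: power_add)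
    show "((- 1) ^ i * (x gchoose i)) * ((- 1) ^ (n - i) * (y gchoose (n - i))) = (- 1) ^ n * ((x gchoose i) * (y gchoose (n - i)))"
      unfolding e2 by (simp add: mult_ac)
  qed
  also have "\<dots> = (- 1) ^ n * ((x + y) gchoose n)"
    using gbinomial_Vandermonde[of x y n] by (simp add: sum_distrib_left[symmetric] atLeast0AtMost)
  finally show ?thesis .
qed

lemma SA_int_nat: assumes "fs H" shows "Sum_any H = Sum_any (\<lambda>k. H (int k)) + Sum_any (\<lambda>k. H (- 1 - int k))"
proof -
  obtain N where N: "\<forall>r\<in>{r. H r \<noteq> 0}. \<bar>r\<bar> < int N"
  proof -
    have "finite ((\<lambda>r. nat \<bar>r\<bar>) ` {r. H r \<noteq> 0})" using assms by blast
    then obtain N where "\<forall>x\<in>(\<lambda>r. nat \<bar>r\<bar>) ` {r. H r \<noteq> 0}. x < N" using finite_nat_set_iff_bounded by blast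
    then show ?thesis by (intro that[of N]) auto
  qed
  then have z: "H r = 0" if "\<bar>r\<bar> \<ge> int N" for r using that by force
  have sub: "{r. H r \<noteq> 0} \<subseteq> {- int N..<int N}" using N by force
  have "Sum_any H = (\<Sum>r\<in>{- int N..<int N}. H r)" by (rule Sum_any.expand_superset) (use sub in auto)
  also have "\<dots> = (\<Sum>r\<in>{0..<int N}. H r) + (\<Sum>r\<in>{- int N..<0}. H r)"
    by (subst sum.union_disjoint[symmetric]) (auto intro: sum.cong)
  also have "(\<Sum>r\<in>{0..<int N}. H r) = (\<Sum>k<N. H (int k))"
    by (rule sum.reindex_bij_witness[of _ int nat]) auto
  also have "(\<Sum>r\<in>{- int N..<0}. H r) = (\<Sum>k<N. H (- 1 - int k))"
    by (rule sum.reindex_bij_witness[of _ "\<lambda>k. - 1 - int k" "\<lambda>r. nat (- 1 - r)"]) auto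
  also have "(\<Sum>k<N. H (int k)) = Sum_any (\<lambda>k. H (int k))" by (rule SA_nat[symmetric]) (simp add: z)
  also have "(\<Sum>k<N. H (- 1 - int k)) = Sum_any (\<lambda>k. H (- 1 - int k))" by (rule SA_nat[symmetric]) (simp add: z)
  finally show ?thesis .
qed

lemma SA_drop: fixes g :: "nat \<Rightarrow> fock" assumes "fs g" "\<And>k. k < j \<Longrightarrow> g k = 0" shows "Sum_any g = Sum_any (\<lambda>k. g (k + j))"
proof -
  obtain N where N: "\<forall>x\<in>{r. g r \<noteq> 0}. x < N" using assms(1) finite_nat_set_iff_bounded by blast
  have z: "g i = 0" if "i \<ge> N" for i using N that by force
  have "Sum_any g = (\<Sum>l<N + j. g l)" by (rule SA_nat) (simp add: z)
  also have "\<dots> = (\<Sum>l\<in>{j..<N + j}. g l)" by (rule sum.mono_neutral_right) (auto simp: assms(2))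
  also have "\<dots> = (\<Sum>k<N. g (k + j))" by (rule sum.reindex_bij_witness[of _ "\<lambda>i. i + j" "\<lambda>l. l - j"]) auto
  also have "\<dots> = Sum_any (\<lambda>k. g (k + j))" by (rule SA_nat[symmetric]) (simp add: z)
  finally show ?thesis .
qed

lemma fs_diff: "fs g \<Longrightarrow> fs h \<Longrightarrow> fs (\<lambda>r. g r - h r)"
  by (rule finite_subset[of _ "{r. g r \<noteq> 0} \<union> {r. h r \<noteq> 0}"]) auto

definition par :: "int \<Rightarrow> complex" where "par k = (if even k then 1 else - 1)"

context trip
begin

text \<open>Locality: both orders of a product of vertex operators are expansions of one and the
  same normally ordered product.\<close>

lemma NO_sym: "NO \<gamma> \<gamma>' a b f = NO \<gamma>' \<gamma> b a f"
proof -
  have "\<forall>a b. NO \<gamma> \<gamma>' a b f = NO \<gamma>' \<gamma> b a f"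
  proof (induction f rule: fock_induct)
    case one show ?case by (simp add: NO_1 mult.commute)
  next
    case (var j f) show ?case
    proof (intro allI)
      fix a b
      have h: "NO \<gamma> \<gamma>' a b f = NO \<gamma>' \<gamma> b a f" for a b using var by blast
      show "NO \<gamma> \<gamma>' a b (var j * f) = NO \<gamma>' \<gamma> b a (var j * f)"
        unfolding NO_var h by (simp add: add.commute)
    qed
  qed (auto simp: clin_add[OF clin_NO] clin_scale[OF clin_NO])
  then show ?thesis by blast
qed

text \<open>The factor divided out in \<open>nop\<close> is multiplied back.\<close>

lemma V_V: "V \<gamma> a (V \<gamma>' b f) = Sum_any (\<lambda>i. cst ((- 1) ^ i * (pc * of_int \<gamma> * of_int \<gamma>' / 2 gchoose i)) * NO \<gamma> \<gamma>' (a + int i) (b - int i) f)"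
proof -
  define q where "q = pc * of_int \<gamma> * of_int \<gamma>' / 2"
  define Z where "Z s = V \<gamma> (a + int s) (V \<gamma>' (b - int s) f)" for s
  define \<beta> where "\<beta> i = (- 1) ^ i * (q gchoose i)" for i
  define \<beta>' where "\<beta>' i = (- 1) ^ i * (- q gchoose i)" for i
  obtain N where N: "\<forall>s\<ge>N. V \<gamma>' (b - int s) f = 0" using fam_nat[OF fam_V] by blast
  have Z0: "Z s = 0" if "s \<ge> N" for s using N that by (simp add: Z_def clin_0[OF clin_V])
  have "Sum_any (\<lambda>i. cst (\<beta> i) * NO \<gamma> \<gamma>' (a + int i) (b - int i) f) = Sum_any (\<lambda>i. Sum_any (\<lambda>l. cst (\<beta> i * \<beta>' l) * Z (i + l)))"
  proof (rule Sum_any.cong)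
    fix i
    have "nop \<gamma> \<gamma>' (a + int i) (b - int i) f l = cst (\<beta>' l) * Z (i + l)" for l
      unfolding nop_def \<beta>'_def Z_def q_def by (simp add: algebra_simps)
    then show "cst (\<beta> i) * NO \<gamma> \<gamma>' (a + int i) (b - int i) f = Sum_any (\<lambda>l. cst (\<beta> i * \<beta>' l) * Z (i + l))"
      unfolding NO_def SA_mult[OF fs_nop] by (simp add: cst_mult mult.assoc)
  qed
  also have "\<dots> = Sum_any (\<lambda>l. cst (\<Sum>i\<le>l. \<beta> i * \<beta>' (l - i)) * Z l)" by (rule SA_diag[OF Z0])
  also have "\<dots> = Sum_any (\<lambda>l::nat. if l = 0 then Z 0 else 0)"
  proof (rule Sum_any.cong)
    fix l show "cst (\<Sum>i\<le>l. \<beta> i * \<beta>' (l - i)) * Z l = (if l = 0 then Z 0 else 0)"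
      unfolding \<beta>_def \<beta>'_def bconv by (cases l) auto
  qed
  finally show ?thesis by (simp add: Z_def \<beta>_def q_def)
qed

lemma NO_nat1: "\<exists>N::nat. \<forall>k\<ge>N. NO \<gamma> \<gamma>' (a + int k) (b - int k) f = 0"
proof -
  obtain N where N: "\<forall>a b. a < N \<or> b < N \<longrightarrow> NO \<gamma> \<gamma>' a b f = 0" using NO_low by blast
  show ?thesis by (rule exI[of _ "nat (b - N) + 1"]) (use N in auto)
qed
lemma NO_nat2: "\<exists>N::nat. \<forall>k\<ge>N. NO \<gamma> \<gamma>' (a - int k) (b + int k) f = 0"
proof -
  obtain N where N: "\<forall>a b. a < N \<or> b < N \<longrightarrow> NO \<gamma> \<gamma>' a b f = 0" using NO_low by blast
  show ?thesis by (rule exI[of _ "nat (a - N) + 1"]) (use N in auto)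
qed

text \<open>The weight (z - w)^n of the residue and the factor (z - w)^(p gamma) of the operator
  product merge into the exponent n + p gamma on one normally ordered product; \<open>R2_V\<close>
  is the opposite expansion.\<close>

lemma R1_V: "R1 (\<chi> + \<gamma>) n (V \<gamma>) m f = Sum_any (\<lambda>k. cst (bc (n + ip * \<gamma>) k) * NO 2 \<gamma> (- n - 1 - ip * (\<chi> + \<gamma>) + int k) (m - int k) f)"
proof -
  define Z where "Z k = NO 2 \<gamma> (- n - 1 - ip * (\<chi> + \<gamma>) + int k) (m - int k) f" for k
  obtain N where N: "\<forall>k\<ge>N. Z k = 0" unfolding Z_def using NO_nat1 by blast
  have "R1 (\<chi> + \<gamma>) n (V \<gamma>) m f = Sum_any (\<lambda>i. Sum_any (\<lambda>l. cst (bc n i * bc (ip * \<gamma>) l) * Z (i + l)))"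
    unfolding R1_def
  proof (rule Sum_any.cong)
    fix i
    have q: "pc * of_int 2 * of_int \<gamma> / 2 = of_int (ip * \<gamma>)" by simp
    have e1: "- (n - int i) - 1 - ip * (\<chi> + \<gamma>) + int l = - n - 1 - ip * (\<chi> + \<gamma>) + int (i + l)" "m - int i - int l = m - int (i + l)" for l by auto
    obtain N' where N': "\<forall>k\<ge>N'. NO 2 \<gamma> (- (n - int i) - 1 - ip * (\<chi> + \<gamma>) + int k) (m - int i - int k) f = 0" using NO_nat1 by blast
    have f1: "fs (\<lambda>l. cst (bc (ip * \<gamma>) l) * NO 2 \<gamma> (- (n - int i) - 1 - ip * (\<chi> + \<gamma>) + int l) (m - int i - int l) f)"
      by (rule fs_nat[of N']) (use N' in auto)
    have "cst (bc n i) * em (\<chi> + \<gamma>) (n - int i) (V \<gamma> (m - int i) f) = cst (bc n i) * Sum_any (\<lambda>l. cst (bc (ip * \<gamma>) l) * NO 2 \<gamma> (- (n - int i) - 1 - ip * (\<chi> + \<gamma>) + int l) (m - int i - int l) f)"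
      unfolding em_def V_V q bc_def ..
    also have "\<dots> = Sum_any (\<lambda>l. cst (bc n i * bc (ip * \<gamma>) l) * Z (i + l))"
      unfolding SA_mult[OF f1] unfolding Z_def e1 cst_mult mult.assoc ..
    finally show "cst (bc n i) * em (\<chi> + \<gamma>) (n - int i) (V \<gamma> (m - int i) f) = Sum_any (\<lambda>l. cst (bc n i * bc (ip * \<gamma>) l) * Z (i + l))" .
  qed
  also have "\<dots> = Sum_any (\<lambda>l. cst (\<Sum>i\<le>l. bc n i * bc (ip * \<gamma>) (l - i)) * Z l)" by (rule SA_diag[of N]) (use N in blast)
  also have "\<dots> = Sum_any (\<lambda>l. cst (bc (n + ip * \<gamma>) l) * Z l)" unfolding bc_def bconv by simp
  finally show ?thesis by (simp add: Z_def)
qed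

lemma R2_V: "R2 \<chi> n (V \<gamma>) m f = Sum_any (\<lambda>k. cst (bc (n + ip * \<gamma>) k) * NO 2 \<gamma> (- 1 - ip * \<chi> - int k) (m + int k) f)"
proof -
  define Z where "Z k = NO 2 \<gamma> (- 1 - ip * \<chi> - int k) (m + int k) f" for k
  obtain N where N: "\<forall>k\<ge>N. Z k = 0" unfolding Z_def using NO_nat2 by blast
  have "R2 \<chi> n (V \<gamma>) m f = Sum_any (\<lambda>i. Sum_any (\<lambda>l. cst (bc n i * bc (ip * \<gamma>) l) * Z (i + l)))"
    unfolding R2_def
  proof (rule Sum_any.cong)
    fix i
    have q: "pc * of_int \<gamma> * of_int 2 / 2 = of_int (ip * \<gamma>)" by simp
    have e1: "- int i - 1 - ip * \<chi> - int l = - 1 - ip * \<chi> - int (i + l)" "m + int i + int l = m + int (i + l)" for l by auto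
    obtain N' where N': "\<forall>k\<ge>N'. NO 2 \<gamma> (- int i - 1 - ip * \<chi> - int k) (m + int i + int k) f = 0" using NO_nat2 by blast
    have f1: "fs (\<lambda>l. cst (bc (ip * \<gamma>) l) * NO 2 \<gamma> (- int i - 1 - ip * \<chi> - int l) (m + int i + int l) f)"
      by (rule fs_nat[of N']) (use N' in auto)
    have "cst (bc n i) * V \<gamma> (m + int i) (em \<chi> (int i) f) = cst (bc n i) * Sum_any (\<lambda>l. cst (bc (ip * \<gamma>) l) * NO 2 \<gamma> (- int i - 1 - ip * \<chi> - int l) (m + int i + int l) f)"
      unfolding em_def V_V q bc_def NO_sym[of \<gamma> 2] ..
    also have "\<dots> = Sum_any (\<lambda>l. cst (bc n i * bc (ip * \<gamma>) l) * Z (i + l))"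
      unfolding SA_mult[OF f1] unfolding Z_def e1 cst_mult mult.assoc ..
    finally show "cst (bc n i) * V \<gamma> (m + int i) (em \<chi> (int i) f) = Sum_any (\<lambda>l. cst (bc n i * bc (ip * \<gamma>) l) * Z (i + l))" .
  qed
  also have "\<dots> = Sum_any (\<lambda>l. cst (\<Sum>i\<le>l. bc n i * bc (ip * \<gamma>) (l - i)) * Z l)" by (rule SA_diag[of N]) (use N in blast)
  also have "\<dots> = Sum_any (\<lambda>l. cst (bc (n + ip * \<gamma>) l) * Z l)" unfolding bc_def bconv by simp
  finally show ?thesis by (simp add: Z_def)
qed

text \<open>The divided derivative of order rho in the first variable of the normally ordered
  product, restricted to the diagonal; a + p chi is the true exponent of that variable.\<close>

definition Dd :: "int \<Rightarrow> int \<Rightarrow> nat \<Rightarrow> int \<Rightarrow> fock \<Rightarrow> fock" where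
  "Dd \<gamma> \<chi> \<rho> M f = Sum_any (\<lambda>a. cst (of_int (a + ip * \<chi>) gchoose \<rho>) * NO 2 \<gamma> a (M + int \<rho> - a) f)"

text \<open>The two expansions of (z - w)^(-rho-1) differ by a divided derivative of the delta
  function, which evaluates the normally ordered product on the diagonal.\<close>

lemma residue_nonneg: assumes "- n - 1 - ip * \<gamma> = int \<rho>"
  shows "R1 (\<chi> + \<gamma>) n (V \<gamma>) (M + ip * \<chi>) f - cst (par (n + ip * \<gamma>)) * R2 \<chi> n (V \<gamma>) (M + ip * \<chi> - ip * \<gamma> - n) f = Dd \<gamma> \<chi> \<rho> M f"
proof -
  have n: "n + ip * \<gamma> = - int \<rho> - 1" using assms by simp
  define H where "H x = cst (of_int x gchoose \<rho>) * NO 2 \<gamma> (x - ip * \<chi>) (M + int \<rho> - (x - ip * \<chi>)) f" for x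
  have fH: "fs H" unfolding H_def
    by (rule fs_mult) (rule fs_shift[of "\<lambda>a. NO 2 \<gamma> a (M + int \<rho> - a) f" "- (ip * \<chi>)", OF fs_NO, simplified])
  have "Dd \<gamma> \<chi> \<rho> M f = Sum_any (\<lambda>a. H (a + ip * \<chi>))" unfolding Dd_def H_def by simp
  also have "\<dots> = Sum_any H" by (rule SA_shift)
  also have "\<dots> = Sum_any (\<lambda>k. H (int k)) + Sum_any (\<lambda>k. H (- 1 - int k))" by (rule SA_int_nat[OF fH])
  also have "Sum_any (\<lambda>k. H (int k)) = Sum_any (\<lambda>k. H (int (k + \<rho>)))"
  proof (rule SA_drop)
    show "fs (\<lambda>k. H (int k))" by (rule finite_subset[of _ "nat ` {r. H r \<noteq> 0}"]) (use fH in \<open>auto intro: rev_image_eqI\<close>)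
    fix k assume "k < \<rho>" then have "(of_int (int k) gchoose \<rho> :: complex) = 0" by (simp add: binomial_gbinomial[symmetric] binomial_eq_0)
    then show "H (int k) = 0" unfolding H_def by simp
  qed
  also have "\<dots> = R1 (\<chi> + \<gamma>) n (V \<gamma>) (M + ip * \<chi>) f"
    unfolding R1_V
  proof (rule Sum_any.cong)
    fix k
    have c: "bc (n + ip * \<gamma>) k = (of_int (int (k + \<rho>)) gchoose \<rho>)"
      unfolding n bc_def using gchoose_flip[of k \<rho>] by simp
    have e: "int (k + \<rho>) - ip * \<chi> = - n - 1 - ip * (\<chi> + \<gamma>) + int k" "M + int \<rho> - (- n - 1 - ip * (\<chi> + \<gamma>) + int k) = M + ip * \<chi> - int k"
      using assms by (auto simp: algebra_simps)
    show "H (int (k + \<rho>)) = cst (bc (n + ip * \<gamma>) k) * NO 2 \<gamma> (- n - 1 - ip * (\<chi> + \<gamma>) + int k) (M + ip * \<chi> - int k) f"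
      unfolding H_def c e ..
  qed
  also have "Sum_any (\<lambda>k. H (- 1 - int k)) = - (cst (par (n + ip * \<gamma>)) * R2 \<chi> n (V \<gamma>) (M + ip * \<chi> - ip * \<gamma> - n) f)"
  proof -
    obtain N where N: "\<forall>k\<ge>N. NO 2 \<gamma> (- 1 - ip * \<chi> - int k) (M + ip * \<chi> - ip * \<gamma> - n + int k) f = 0" using NO_nat2 by blast
    have f1: "fs (\<lambda>k. cst (bc (n + ip * \<gamma>) k) * NO 2 \<gamma> (- 1 - ip * \<chi> - int k) (M + ip * \<chi> - ip * \<gamma> - n + int k) f)"
      by (rule fs_nat[of N]) (use N in auto)
    have "H (- 1 - int k) = (- cst (par (n + ip * \<gamma>))) * (cst (bc (n + ip * \<gamma>) k) * NO 2 \<gamma> (- 1 - ip * \<chi> - int k) (M + ip * \<chi> - ip * \<gamma> - n + int k) f)" for k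
    proof -
      have pr: "- par (n + ip * \<gamma>) = (- 1) ^ \<rho>" unfolding n par_def by (cases "even \<rho>") auto
      have c: "(of_int (- 1 - int k) gchoose \<rho>) = - par (n + ip * \<gamma>) * bc (n + ip * \<gamma>) k"
      proof -
        have e: "(of_int (- 1 - int k) :: complex) = - of_nat k - 1" by simp
        show ?thesis unfolding e pr gchoose_neg[of k \<rho>] unfolding n bc_def by simp
      qed
      have e: "- 1 - int k - ip * \<chi> = - 1 - ip * \<chi> - int k" "M + int \<rho> - (- 1 - ip * \<chi> - int k) = M + ip * \<chi> - ip * \<gamma> - n + int k"
        using assms by (auto simp: algebra_simps)
      show ?thesis unfolding H_def c e cst_mult cst_minus by (simp add: mult.assoc)
    qed
    then show ?thesis unfolding R2_V using SA_mult[OF f1, of "- cst (par (n + ip * \<gamma>))"] by simp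
  qed
  finally show ?thesis by simp
qed

text \<open>A nonnegative power of z - w is a polynomial, so its two expansions agree; reversing the
  finite sum matches them up to the sign \<open>par\<close>.\<close>

lemma residue_neg: assumes "- n - 1 - ip * \<gamma> < 0"
  shows "R1 (\<chi> + \<gamma>) n (V \<gamma>) (M + ip * \<chi>) f - cst (par (n + ip * \<gamma>)) * R2 \<chi> n (V \<gamma>) (M + ip * \<chi> - ip * \<gamma> - n) f = 0"
proof -
  define K where "K = nat (n + ip * \<gamma>)"
  have K: "n + ip * \<gamma> = int K" using assms by (simp add: K_def)
  have bz: "bc (int K) k = 0" if "k > K" for k using that by (simp add: bc_def binomial_gbinomial[symmetric] binomial_eq_0)
  define G where "G k = NO 2 \<gamma> (- 1 - ip * \<chi> - int k) (M + ip * \<chi> - ip * \<gamma> - n + int k) f" for k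
  have "R1 (\<chi> + \<gamma>) n (V \<gamma>) (M + ip * \<chi>) f = (\<Sum>k<K + 1. cst (bc (int K) k) * NO 2 \<gamma> (- n - 1 - ip * (\<chi> + \<gamma>) + int k) (M + ip * \<chi> - int k) f)"
    unfolding R1_V K by (rule SA_nat) (simp add: bz)
  also have "\<dots> = (\<Sum>k<K + 1. cst (bc (int K) (K - k)) * G k)"
  proof (rule sum.reindex_bij_witness[of _ "\<lambda>k. K - k" "\<lambda>k. K - k"])
    fix k assume "k \<in> {..<K + 1}"
    then have k: "int (K - k) = int K - int k" by auto
    have e: "- 1 - ip * \<chi> - (int K - int k) = - n - 1 - ip * (\<chi> + \<gamma>) + int k" "M + ip * \<chi> - ip * \<gamma> - n + (int K - int k) = M + ip * \<chi> - int k"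
      using K by (auto simp: algebra_simps)
    show "cst (bc (int K) (K - (K - k))) * G (K - k) = cst (bc (int K) k) * NO 2 \<gamma> (- n - 1 - ip * (\<chi> + \<gamma>) + int k) (M + ip * \<chi> - int k) f"
      unfolding G_def k e using \<open>k \<in> {..<K + 1}\<close> by simp
  qed auto
  also have "\<dots> = cst (par (int K)) * (\<Sum>k<K + 1. cst (bc (int K) k) * G k)"
    unfolding sum_distrib_left
  proof (rule sum.cong[OF refl])
    fix k assume "k \<in> {..<K + 1}"
    then have k: "k \<le> K" by simp
    have "bc (int K) (K - k) = par (int K) * bc (int K) k"
      using k by (simp add: bc_def binomial_gbinomial[symmetric] binomial_symmetric[OF k, symmetric] par_def minus_one_power_iff)
    then show "cst (bc (int K) (K - k)) * G k = cst (par (int K)) * (cst (bc (int K) k) * G k)" by (simp add: cst_mult mult.assoc)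
  qed
  also have "(\<Sum>k<K + 1. cst (bc (int K) k) * G k) = R2 \<chi> n (V \<gamma>) (M + ip * \<chi> - ip * \<gamma> - n) f"
    unfolding R2_V K G_def by (rule SA_nat[symmetric]) (simp add: bz)
  finally show ?thesis by (simp add: K)
qed

text \<open>The Euler derivative in the first variable. The vacuum case is \<open>SS_rec\<close>,
  and both sides obey the same rule when a creation operator is added.\<close>

lemma NO_deriv: "cst (of_int (a + ip * \<chi>)) * NO 2 \<gamma> a b f = Sum_any (\<lambda>q. var q * NO 2 \<gamma> (a - int q - 1) b f) + Sum_any (\<lambda>r. NO 2 \<gamma> (a + int r) b (al \<chi> (int r) f))"
proof -
  have fq: "fs (\<lambda>q. var q * NO 2 \<gamma> (a - int q - 1) b f)" for a b f
  proof -
    obtain N where N: "\<forall>a b. a < N \<or> b < N \<longrightarrow> NO 2 \<gamma> a b f = 0" using NO_low by blast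
    show ?thesis by (rule fs_nat[of "nat (a - N)"]) (use N in auto)
  qed
  have fr: "fs (\<lambda>r. NO 2 \<gamma> (a + int r) b (al \<chi> (int r) f))" for a b f
  proof -
    obtain N where N: "\<forall>r\<ge>N. al \<chi> (int r) f = 0" using al_nat by blast
    show ?thesis by (rule fs_nat[of N]) (use N in \<open>auto simp: clin_0[OF clin_NO]\<close>)
  qed
  define T where "T a b f = Sum_any (\<lambda>q. var q * NO 2 \<gamma> (a - int q - 1) b f) + Sum_any (\<lambda>r. NO 2 \<gamma> (a + int r) b (al \<chi> (int r) f))" for a b f
  have lin: "clin (T a b)" for a b
    unfolding T_def by (intro clin_plus clin_SA fq fr clin_mul clin_NO clin_comp[OF clin_NO clin_al])
  have "\<forall>a b. cst (of_int (a + ip * \<chi>)) * NO 2 \<gamma> a b f = T a b f"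
  proof (induction f rule: fock_induct)
    case one
    show ?case
    proof (intro allI)
      fix a b
      have 1: "Sum_any (\<lambda>q. var q * NO 2 \<gamma> (a - int q - 1) b 1) = (\<Sum>q<nat a. var q * SS 1 (a - int q - 1)) * SS (of_int \<gamma> / 2) b"
        unfolding NO_1 sum_distrib_right by (subst SA_nat[of "nat a"]) (auto simp: mult.assoc)
      have 2: "NO 2 \<gamma> (a + int r) b (al \<chi> (int r) 1) = (if r = 0 then cst (of_int (ip * \<chi>)) * NO 2 \<gamma> a b 1 else 0)" for r
        by (cases "r = 0") (auto simp: al_0 al_1 clin_cst[OF clin_NO] clin_0[OF clin_NO])
      have "T a b 1 = (cst 1 * (\<Sum>q<nat a. var q * SS 1 (a - int q - 1))) * SS (of_int \<gamma> / 2) b + cst (of_int (ip * \<chi>)) * NO 2 \<gamma> a b 1"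
        unfolding T_def 1 2 by simp
      also have "cst 1 * (\<Sum>q<nat a. var q * SS 1 (a - int q - 1)) = cst (of_int a) * SS 1 a"
        by (rule SS_rec[symmetric]) simp
      finally show "cst (of_int (a + ip * \<chi>)) * NO 2 \<gamma> a b 1 = T a b 1"
        unfolding NO_1 of_int_add cst_add by (simp add: algebra_simps)
    qed
  next
    case (var j f)
    show ?case
    proof (intro allI)
      fix a b
      have h: "T a b f = cst (of_int (a + ip * \<chi>)) * NO 2 \<gamma> a b f" for a b using var by simp
      let ?k2 = "cst (pc * of_int 2)" and ?kg = "cst (pc * of_int \<gamma>)"
      have 1: "Sum_any (\<lambda>q. var q * NO 2 \<gamma> (a - int q - 1) b (var j * f)) = var j * Sum_any (\<lambda>q. var q * NO 2 \<gamma> (a - int q - 1) b f)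
         - (?k2 * Sum_any (\<lambda>q. var q * NO 2 \<gamma> (a + int j + 1 - int q - 1) b f) + ?kg * Sum_any (\<lambda>q. var q * NO 2 \<gamma> (a - int q - 1) (b + int j + 1) f))"
      proof -
        have "var q * NO 2 \<gamma> (a - int q - 1) b (var j * f) = var j * (var q * NO 2 \<gamma> (a - int q - 1) b f)
          - (?k2 * (var q * NO 2 \<gamma> (a + int j + 1 - int q - 1) b f) + ?kg * (var q * NO 2 \<gamma> (a - int q - 1) (b + int j + 1) f))" for q
        proof -
          have e: "a - int q - 1 + int j + 1 = a + int j + 1 - int q - 1" by simp
          show ?thesis unfolding NO_var e by (simp add: algebra_simps)
        qed
        then show ?thesis unfolding SA_mult[OF fq]
          by (simp only:) (subst SA_diff, intro fs_mult fq, intro fs_add fs_mult fq, subst SA_add, intro fs_mult fq, intro fs_mult fq, rule refl)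
      qed
      have 2: "Sum_any (\<lambda>r. NO 2 \<gamma> (a + int r) b (al \<chi> (int r) (var j * f))) = var j * Sum_any (\<lambda>r. NO 2 \<gamma> (a + int r) b (al \<chi> (int r) f))
         - (?k2 * Sum_any (\<lambda>r. NO 2 \<gamma> (a + int j + 1 + int r) b (al \<chi> (int r) f)) + ?kg * Sum_any (\<lambda>r. NO 2 \<gamma> (a + int r) (b + int j + 1) (al \<chi> (int r) f)))
         + cst (2 * pc * of_nat (j + 1)) * NO 2 \<gamma> (a + int j + 1) b f"
      proof -
        have "NO 2 \<gamma> (a + int r) b (al \<chi> (int r) (var j * f)) = (var j * NO 2 \<gamma> (a + int r) b (al \<chi> (int r) f)
          - (?k2 * NO 2 \<gamma> (a + int j + 1 + int r) b (al \<chi> (int r) f) + ?kg * NO 2 \<gamma> (a + int r) (b + int j + 1) (al \<chi> (int r) f)))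
          + (if r = j + 1 then cst (2 * pc * of_nat (j + 1)) * NO 2 \<gamma> (a + int j + 1) b f else 0)" for r
        proof -
          have e: "a + int r + int j + 1 = a + int j + 1 + int r" by simp
          have c: "al \<chi> (int r) (var j * f) = var j * al \<chi> (int r) f + (if r = j + 1 then cst (2 * pc * of_nat (j + 1)) * f else 0)"
            using al_comm[of \<chi> "int r" "- int j - 1" f] unfolding al_neg by auto
          show ?thesis unfolding c clin_add[OF clin_NO] NO_var e if_distrib[of "NO 2 \<gamma> (a + int r) b"] clin_scale[OF clin_NO] clin_0[OF clin_NO]
            by (auto simp: algebra_simps)
        qed
        then show ?thesis unfolding SA_mult[OF fr]
          by (simp only:) (subst SA_add, intro fs_diff fs_add fs_mult fr, rule fs_delta,
              subst SA_diff, intro fs_mult fr, intro fs_add fs_mult fr, subst SA_add, intro fs_mult fr, intro fs_mult fr, simp)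
      qed
      have "T a b (var j * f) = var j * T a b f - (?k2 * T (a + int j + 1) b f + ?kg * T a (b + int j + 1) f) + cst (2 * pc * of_nat (j + 1)) * NO 2 \<gamma> (a + int j + 1) b f"
        unfolding T_def 1 2 by (simp add: algebra_simps)
      then show "cst (of_int (a + ip * \<chi>)) * NO 2 \<gamma> a b (var j * f) = T a b (var j * f)"
        unfolding h NO_var by (simp add: cst_add cst_mult algebra_simps)
    qed
  next
    case (add f g) then show ?case by (auto simp: clin_add[OF clin_NO] clin_add[OF lin] distrib_left)
  next
    case (scale z f)
    show ?case
    proof (intro allI)
      fix a b
      have "T a b (cst z * f) = cst z * (cst (of_int (a + ip * \<chi>)) * NO 2 \<gamma> a b f)" using scale clin_scale[OF lin] by simp
      then show "cst (of_int (a + ip * \<chi>)) * NO 2 \<gamma> a b (cst z * f) = T a b (cst z * f)"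
        unfolding clin_scale[OF clin_NO] by (simp only: mult.left_commute)
    qed
  qed
  then show ?thesis by (simp add: T_def)
qed

lemma fs2_NO_shift: "fs2 (\<lambda>q a. cst (w q a) * (var q * NO 2 \<gamma> (a - int q - 1) (M - a) f))"
proof -
  obtain N where N: "\<forall>a b. a < N \<or> b < N \<longrightarrow> NO 2 \<gamma> a b f = 0" using NO_low by blast
  have "{(q, a). cst (w q a) * (var q * NO 2 \<gamma> (a - int q - 1) (M - a) f) \<noteq> 0} \<subseteq> {..nat (M - 2 * N)} \<times> {N..M - N}"
  proof (rule subsetI)
    fix x assume x: "x \<in> {(q, a). cst (w q a) * (var q * NO 2 \<gamma> (a - int q - 1) (M - a) f) \<noteq> 0}"
    obtain q a where e: "x = (q, a)" by (cases x)
    have "\<not> (a - int q - 1 < N \<or> M - a < N)" using N x unfolding e by auto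
    then show "x \<in> {..nat (M - 2 * N)} \<times> {N..M - N}" unfolding e by auto
  qed
  then show ?thesis by (rule finite_subset) auto
qed

lemma fs2_NO_al: "fs2 (\<lambda>r a. cst (w r a) * NO 2 \<gamma> (a + int r) (M - a) (al \<chi> (int r) f))"
proof -
  obtain R where R: "\<forall>r\<ge>R. al \<chi> (int r) f = 0" using al_nat by blast
  have "\<forall>r. \<exists>N. \<forall>a b. a < N \<or> b < N \<longrightarrow> NO 2 \<gamma> a b (al \<chi> (int r) f) = 0" using NO_low by blast
  then obtain N where N: "\<forall>r a b. a < N r \<or> b < N r \<longrightarrow> NO 2 \<gamma> a b (al \<chi> (int r) f) = 0"
    using choice[of "\<lambda>r N. \<forall>a b. a < N \<or> b < N \<longrightarrow> NO 2 \<gamma> a b (al \<chi> (int r) f) = 0"] by blast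
  have "{(r, a). cst (w r a) * NO 2 \<gamma> (a + int r) (M - a) (al \<chi> (int r) f) \<noteq> 0} \<subseteq> Sigma {..<R} (\<lambda>r. {N r - int r..M - N r})"
  proof (rule subsetI)
    fix x assume x: "x \<in> {(r, a). cst (w r a) * NO 2 \<gamma> (a + int r) (M - a) (al \<chi> (int r) f) \<noteq> 0}"
    obtain r a where e: "x = (r, a)" by (cases x)
    have "\<not> (a + int r < N r \<or> M - a < N r)" using N x unfolding e by auto
    moreover have "\<not> R \<le> r" using x R unfolding e by (auto simp: clin_0[OF clin_NO])
    ultimately show "x \<in> Sigma {..<R} (\<lambda>r. {N r - int r..M - N r})" unfolding e by auto
  qed
  then show ?thesis by (rule finite_subset) auto
qed

lemma vandermonde_upto: "0 < \<rho> \<Longrightarrow> (\<Sum>k<\<rho>. (x gchoose k) * (y gchoose (\<rho> - k - 1))) = ((x + y) gchoose (\<rho> - 1) :: complex)"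
proof -
  assume "0 < \<rho>"
  then obtain r where r: "\<rho> = Suc r" using gr0_implies_Suc by blast
  show ?thesis unfolding r lessThan_Suc_atMost using gbinomial_Vandermonde[of x y r] by (simp add: atLeast0AtMost)
qed

text \<open>A recursion for divided derivatives on the diagonal that mirrors \<open>SS_rec\<close>.
  As \<open>em gamma n 1\<close> is some \<open>SS 1 rho\<close> or zero, it determines the fields
  of these states in \<open>Ys_SS\<close>.\<close>

lemma Dd_rec: assumes rho: "0 < \<rho>" and fD: "\<And>k. k < \<rho> \<Longrightarrow> fam (Dd \<gamma> \<chi> k)"
  shows "(\<Sum>k<\<rho>. NP \<chi> k (Dd \<gamma> \<chi> (\<rho> - k - 1)) M f) = cst (of_nat \<rho>) * Dd \<gamma> \<chi> \<rho> M f"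
proof -
  define w where "w a = (of_int (a + ip * \<chi>) - 1 gchoose (\<rho> - 1) :: complex)" for a
  define gC where "gC q a = cst (w a) * (var q * NO 2 \<gamma> (a - int q - 1) (M + int \<rho> - a) f)" for q :: nat and a
  define gA where "gA r a = cst (w a) * NO 2 \<gamma> (a + int r) (M + int \<rho> - a) (al \<chi> (int r) f)" for r :: nat and a
  have f2C: "fs2 gC" unfolding gC_def by (rule fs2_NO_shift)
  have f2A: "fs2 gA" unfolding gA_def by (rule fs2_NO_al)
  have fam': "fam (Dd \<gamma> \<chi> (\<rho> - k - 1))" if "k < \<rho>" for k using that by (intro fD) simp
  have fNO: "fs (\<lambda>a. cst (z a) * NO 2 \<gamma> a (m - a) g)" for z m g by (rule fs_mult[OF fs_NO])
  have 1: "(\<Sum>k<\<rho>. CP k (Dd \<gamma> \<chi> (\<rho> - k - 1)) M f q) = Sum_any (gC q)" for q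
  proof -
    let ?G = "\<lambda>a. NO 2 \<gamma> a (M - int q + int \<rho> - 1 - a) f"
    have fG: "fs ?G" by (rule fs_NO)
    have "(\<Sum>k<\<rho>. CP k (Dd \<gamma> \<chi> (\<rho> - k - 1)) M f q) = (\<Sum>k<\<rho>. Sum_any (\<lambda>a. cst ((of_nat q gchoose k) * (of_int (a + ip * \<chi>) gchoose (\<rho> - k - 1))) * (var q * ?G a)))"
    proof (rule sum.cong[OF refl])
      fix k assume "k \<in> {..<\<rho>}"
      then have e: "M - int q + int k + int (\<rho> - k - 1) - a = M - int q + int \<rho> - 1 - a" for a by auto
      show "CP k (Dd \<gamma> \<chi> (\<rho> - k - 1)) M f q = Sum_any (\<lambda>a. cst ((of_nat q gchoose k) * (of_int (a + ip * \<chi>) gchoose (\<rho> - k - 1))) * (var q * ?G a))"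
        unfolding CP_def Dd_def e SA_mult2[OF fNO] by (simp add: cst_mult mult_ac)
    qed
    also have "\<dots> = Sum_any (\<lambda>a. \<Sum>k<\<rho>. cst ((of_nat q gchoose k) * (of_int (a + ip * \<chi>) gchoose (\<rho> - k - 1))) * (var q * ?G a))"
      (is "?l = Sum_any (\<lambda>a. \<Sum>k<\<rho>. ?t k a)")
    proof -
      have "(\<Sum>k\<in>A. Sum_any (?t k)) = Sum_any (\<lambda>a. \<Sum>k\<in>A. ?t k a)" if "finite A" for A
        using that
      proof (induction A)
        case (insert x A)
        have "fs (\<lambda>a. \<Sum>k\<in>A. ?t k a)" by (rule fs_sub[OF fG]) simp
        moreover have "fs (?t x)" by (rule fs_sub[OF fG]) simp
        ultimately show ?case using insert by (simp add: SA_add)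
      qed simp
      then show ?thesis by blast
    qed
    also have "\<dots> = Sum_any (\<lambda>a. cst ((of_nat q + of_int (a + ip * \<chi>)) gchoose (\<rho> - 1)) * (var q * ?G a))"
      unfolding sum_distrib_right[symmetric] cst_sum[symmetric] vandermonde_upto[OF rho] ..
    also have "\<dots> = Sum_any (\<lambda>a. gC q (a + (int q + 1)))"
    proof (rule Sum_any.cong)
      fix a
      have e: "of_nat q + of_int (a + ip * \<chi>) = of_int (a + (int q + 1) + ip * \<chi>) - (1::complex)" by simp
      have e2: "a + (int q + 1) - int q - 1 = a" "M + int \<rho> - (a + (int q + 1)) = M - int q + int \<rho> - 1 - a" by auto
      show "cst ((of_nat q + of_int (a + ip * \<chi>)) gchoose (\<rho> - 1)) * (var q * ?G a) = gC q (a + (int q + 1))"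
        unfolding gC_def w_def e e2 ..
    qed
    also have "\<dots> = Sum_any (gC q)" by (rule SA_shift)
    finally show ?thesis .
  qed
  have 2: "(\<Sum>k<\<rho>. AP \<chi> k (Dd \<gamma> \<chi> (\<rho> - k - 1)) M f r) = Sum_any (gA r)" for r
  proof -
    let ?G = "\<lambda>a. NO 2 \<gamma> a (M + int r + int \<rho> - a) (al \<chi> (int r) f)"
    have fG: "fs ?G" by (rule fs_NO)
    have "(\<Sum>k<\<rho>. AP \<chi> k (Dd \<gamma> \<chi> (\<rho> - k - 1)) M f r) = (\<Sum>k<\<rho>. Sum_any (\<lambda>a. cst (((- of_nat r - 1) gchoose k) * (of_int (a + ip * \<chi>) gchoose (\<rho> - k - 1))) * ?G a))"
    proof (rule sum.cong[OF refl])
      fix k assume "k \<in> {..<\<rho>}"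
      then have e: "M + int r + int k + 1 + int (\<rho> - k - 1) - a = M + int r + int \<rho> - a" for a by auto
      show "AP \<chi> k (Dd \<gamma> \<chi> (\<rho> - k - 1)) M f r = Sum_any (\<lambda>a. cst (((- of_nat r - 1) gchoose k) * (of_int (a + ip * \<chi>) gchoose (\<rho> - k - 1))) * ?G a)"
        unfolding AP_def Dd_def e SA_mult[OF fNO] by (simp add: cst_mult mult_ac)
    qed
    also have "\<dots> = Sum_any (\<lambda>a. \<Sum>k<\<rho>. cst (((- of_nat r - 1) gchoose k) * (of_int (a + ip * \<chi>) gchoose (\<rho> - k - 1))) * ?G a)"
      (is "?l = Sum_any (\<lambda>a. \<Sum>k<\<rho>. ?t k a)")
    proof -
      have "(\<Sum>k\<in>A. Sum_any (?t k)) = Sum_any (\<lambda>a. \<Sum>k\<in>A. ?t k a)" if "finite A" for A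
        using that
      proof (induction A)
        case (insert x A)
        have "fs (\<lambda>a. \<Sum>k\<in>A. ?t k a)" by (rule fs_sub[OF fG]) simp
        moreover have "fs (?t x)" by (rule fs_sub[OF fG]) simp
        ultimately show ?case using insert by (simp add: SA_add)
      qed simp
      then show ?thesis by blast
    qed
    also have "\<dots> = Sum_any (\<lambda>a. cst ((- of_nat r - 1 + of_int (a + ip * \<chi>)) gchoose (\<rho> - 1)) * ?G a)"
      unfolding sum_distrib_right[symmetric] cst_sum[symmetric] vandermonde_upto[OF rho] ..
    also have "\<dots> = Sum_any (\<lambda>a. gA r (a + - int r))"
    proof (rule Sum_any.cong)
      fix a
      have e: "- of_nat r - 1 + of_int (a + ip * \<chi>) = of_int (a + - int r + ip * \<chi>) - (1::complex)" by simp
      have e2: "a + - int r + int r = a" "M + int \<rho> - (a + - int r) = M + int r + int \<rho> - a" by auto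
      show "cst ((- of_nat r - 1 + of_int (a + ip * \<chi>)) gchoose (\<rho> - 1)) * ?G a = gA r (a + - int r)"
        unfolding gA_def w_def e e2 ..
    qed
    also have "\<dots> = Sum_any (gA r)" by (rule SA_shift)
    finally show ?thesis .
  qed
  have sumC: "(\<Sum>k\<in>A. Sum_any (CP k (Dd \<gamma> \<chi> (\<rho> - k - 1)) M f)) = Sum_any (\<lambda>q. \<Sum>k\<in>A. CP k (Dd \<gamma> \<chi> (\<rho> - k - 1)) M f q) \<and> fs (\<lambda>q. \<Sum>k\<in>A. CP k (Dd \<gamma> \<chi> (\<rho> - k - 1)) M f q)"
    if "finite A" "A \<subseteq> {..<\<rho>}" for A using that
  proof (induction A)
    case (insert x A)
    then have "fs (CP x (Dd \<gamma> \<chi> (\<rho> - x - 1)) M f)" by (intro fs_CP fam') auto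
    then show ?case using insert by (auto simp: SA_add fs_add)
  qed simp
  have sumA: "(\<Sum>k\<in>A. Sum_any (AP \<chi> k (Dd \<gamma> \<chi> (\<rho> - k - 1)) M f)) = Sum_any (\<lambda>q. \<Sum>k\<in>A. AP \<chi> k (Dd \<gamma> \<chi> (\<rho> - k - 1)) M f q) \<and> fs (\<lambda>q. \<Sum>k\<in>A. AP \<chi> k (Dd \<gamma> \<chi> (\<rho> - k - 1)) M f q)"
    if "finite A" "A \<subseteq> {..<\<rho>}" for A using that
  proof (induction A)
    case (insert x A)
    then have "fs (AP \<chi> x (Dd \<gamma> \<chi> (\<rho> - x - 1)) M f)" by (intro fs_AP fam') auto
    then show ?case using insert by (auto simp: SA_add fs_add)
  qed simp
  have "(\<Sum>k<\<rho>. NP \<chi> k (Dd \<gamma> \<chi> (\<rho> - k - 1)) M f) = Sum_any (\<lambda>q. Sum_any (gC q)) + Sum_any (\<lambda>r. Sum_any (gA r))"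
    unfolding NP_def sum.distrib conjunct1[OF sumC[OF finite_lessThan order_refl]] conjunct1[OF sumA[OF finite_lessThan order_refl]] 1 2 ..
  also have "\<dots> = Sum_any (\<lambda>a. Sum_any (\<lambda>q. gC q a)) + Sum_any (\<lambda>a. Sum_any (\<lambda>r. gA r a))"
    unfolding SA_swap[OF f2C] SA_swap[OF f2A] ..
  also have "\<dots> = Sum_any (\<lambda>a. Sum_any (\<lambda>q. gC q a) + Sum_any (\<lambda>r. gA r a))"
    by (rule SA_add[symmetric]) (rule fs2_outer[OF fs2_flip[OF f2C]], rule fs2_outer[OF fs2_flip[OF f2A]])
  also have "\<dots> = Sum_any (\<lambda>a. cst (of_nat \<rho>) * (cst (of_int (a + ip * \<chi>) gchoose \<rho>) * NO 2 \<gamma> a (M + int \<rho> - a) f))"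
  proof (rule Sum_any.cong)
    fix a
    have fq: "fs (\<lambda>q. var q * NO 2 \<gamma> (a - int q - 1) (M + int \<rho> - a) f)"
      using fs2_inner[OF fs2_flip[OF fs2_NO_shift[of "\<lambda>_ _. 1" \<gamma> "M + int \<rho>" f]], of a] by simp
    have fr: "fs (\<lambda>r. NO 2 \<gamma> (a + int r) (M + int \<rho> - a) (al \<chi> (int r) f))"
      using fs2_inner[OF fs2_flip[OF fs2_NO_al[of "\<lambda>_ _. 1" \<gamma> "M + int \<rho>" \<chi> f]], of a] by simp
    have "Sum_any (\<lambda>q. gC q a) + Sum_any (\<lambda>r. gA r a) = cst (w a) * (cst (of_int (a + ip * \<chi>)) * NO 2 \<gamma> a (M + int \<rho> - a) f)"
      unfolding gC_def gA_def NO_deriv distrib_left SA_mult[OF fq] SA_mult[OF fr] ..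
    also have "\<dots> = cst (of_int (a + ip * \<chi>) * w a) * NO 2 \<gamma> a (M + int \<rho> - a) f" by (simp only: cst_mult mult_ac)
    also have "of_int (a + ip * \<chi>) * w a = of_nat \<rho> * (of_int (a + ip * \<chi>) gchoose \<rho>)"
    proof -
      obtain r where r: "\<rho> = Suc r" using rho gr0_implies_Suc by blast
      show ?thesis unfolding w_def r using gbinomial_absorption[of r "of_int (a + ip * \<chi>) :: complex"] by simp
    qed
    finally show "Sum_any (\<lambda>q. gC q a) + Sum_any (\<lambda>r. gA r a) = cst (of_nat \<rho>) * (cst (of_int (a + ip * \<chi>) gchoose \<rho>) * NO 2 \<gamma> a (M + int \<rho> - a) f)"
      by (simp only: cst_mult mult.assoc)
  qed
  also have "\<dots> = cst (of_nat \<rho>) * Dd \<gamma> \<chi> \<rho> M f" unfolding Dd_def by (rule SA_mult[OF fNO, symmetric])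
  finally show ?thesis .
qed

lemma Ys_SS: "Ys (\<gamma> + 2) \<chi> (SS 1 (int \<rho>)) = Dd \<gamma> \<chi> \<rho>"
proof (induction \<rho> rule: less_induct)
  case (less \<rho>)
  show ?case
  proof (cases "\<rho> = 0")
    case True
    then show ?thesis by (intro ext) (simp add: Ys_1 Dd_def V_product[of 2 \<gamma>, symmetric] add.commute)
  next
    case False
    show ?thesis
    proof (intro ext)
      fix M f
      have ih: "Ys (\<gamma> + 2) \<chi> (SS 1 (int \<rho> - int k - 1)) = Dd \<gamma> \<chi> (\<rho> - k - 1)" if "k < \<rho>" for k
      proof -
        have e: "int \<rho> - int k - 1 = int (\<rho> - k - 1)" using that by simp
        show ?thesis unfolding e by (rule less) (use that in auto)
      qed
      have fD: "fam (Dd \<gamma> \<chi> k)" if "k < \<rho>" for k using less[OF that] fam_Ys[of "\<gamma> + 2" \<chi> "SS 1 (int k)"] by simp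
      have "cst (of_nat \<rho>) * Ys (\<gamma> + 2) \<chi> (SS 1 (int \<rho>)) M f = Ys (\<gamma> + 2) \<chi> (cst (of_int (int \<rho>)) * SS 1 (int \<rho>)) M f"
        by (simp add: Ys_scale)
      also have "cst (of_int (int \<rho>)) * SS 1 (int \<rho>) = (\<Sum>k<\<rho>. var k * SS 1 (int \<rho> - int k - 1))"
        using SS_rec[of "int \<rho>" \<rho> 1] by simp
      also have "Ys (\<gamma> + 2) \<chi> (\<Sum>k<\<rho>. var k * SS 1 (int \<rho> - int k - 1)) M f = (\<Sum>k<\<rho>. NP \<chi> k (Dd \<gamma> \<chi> (\<rho> - k - 1)) M f)"
        unfolding clin_sum[OF clin_Ys_state] by (intro sum.cong refl) (simp add: Ys_var ih)
      also have "\<dots> = cst (of_nat \<rho>) * Dd \<gamma> \<chi> \<rho> M f" using False by (intro Dd_rec fD) auto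
      finally have "cst (of_nat \<rho>) * (Ys (\<gamma> + 2) \<chi> (SS 1 (int \<rho>)) M f - Dd \<gamma> \<chi> \<rho> M f) = 0" by (simp add: right_diff_distrib)
      then show "Ys (\<gamma> + 2) \<chi> (SS 1 (int \<rho>)) M f = Dd \<gamma> \<chi> \<rho> M f" using False by simp
    qed
  qed
qed

text \<open>Borcherds' iterate formula for the \<open>n\<close>-th product of \<open>exp(\<alpha>)\<close> with an arbitrary state;
  the sign \<open>par (n + p \<gamma>)\<close> accounts for states of half-integral charge.\<close>

theorem iterate_formula: "Ys (\<gamma> + 2) \<chi> (em \<gamma> n b) M f
   = R1 (\<chi> + \<gamma>) n (Ys \<gamma> \<chi> b) (M + ip * \<chi>) f - cst (par (n + ip * \<gamma>)) * R2 \<chi> n (Ys \<gamma> (\<chi> + 2) b) (M + ip * \<chi> - ip * \<gamma> - n) f"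
proof -
  let ?R = "\<lambda>n b M f. R1 (\<chi> + \<gamma>) n (Ys \<gamma> \<chi> b) (M + ip * \<chi>) f - cst (par (n + ip * \<gamma>)) * R2 \<chi> n (Ys \<gamma> (\<chi> + 2) b) (M + ip * \<chi> - ip * \<gamma> - n) f"
  have "\<forall>n M f. Ys (\<gamma> + 2) \<chi> (em \<gamma> n b) M f = ?R n b M f"
  proof (induction b rule: fock_induct)
    case one
    show ?case
    proof (intro allI)
      fix n M f
      show "Ys (\<gamma> + 2) \<chi> (em \<gamma> n 1) M f = ?R n 1 M f"
      proof (cases "- n - 1 - ip * \<gamma> < 0")
        case True
        then show ?thesis unfolding Ys_1 residue_neg[OF True] em_def V_1 by (simp add: Ys_0)
      next
        case False
        then obtain \<rho> where r: "- n - 1 - ip * \<gamma> = int \<rho>" by (metis not_less nonneg_int_cases)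
        show ?thesis unfolding Ys_1 residue_nonneg[OF r] em_def V_1 r using Ys_SS by simp
      qed
    qed
  next
    case (var j b)
    show ?case
    proof (intro allI)
      fix n M f
      let ?n = "n - int j - 1"
      have ih: "Ys (\<gamma> + 2) \<chi> (em \<gamma> n b) = ?R n b" for n using var by (intro ext) blast
      have fX: "fam (\<lambda>m. R1 (\<chi> + \<gamma>) n (Ys \<gamma> \<chi> b) (m + ip * \<chi>))"
        unfolding fam_def
      proof (intro conjI allI)
        fix m show "clin (R1 (\<chi> + \<gamma>) n (Ys \<gamma> \<chi> b) (m + ip * \<chi>))"
          unfolding R1_def by (intro clin_SA clin_mul clin_comp[OF clin_em clin_Ys] fs_R1 fam_Ys)
      next
        fix f obtain N where "\<forall>m<N. Ys \<gamma> \<chi> b m f = 0" using fam_low[OF fam_Ys] by blast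
        then show "\<exists>N. \<forall>m<N. R1 (\<chi> + \<gamma>) n (Ys \<gamma> \<chi> b) (m + ip * \<chi>) f = 0"
          by (intro exI[of _ "N - ip * \<chi>"]) (auto simp: R1_def clin_0[OF clin_em])
      qed
      \<comment> \<open>The truncation of the second residue comes from the induction hypothesis,
        which makes it a difference of two truncated families.\<close>
      have fY: "fam (\<lambda>m f. cst (- par (n + ip * \<gamma>)) * R2 \<chi> n (Ys \<gamma> (\<chi> + 2) b) (m + (ip * \<chi> - ip * \<gamma> - n)) f)"
      proof -
        have "(\<lambda>m f. cst (- par (n + ip * \<gamma>)) * R2 \<chi> n (Ys \<gamma> (\<chi> + 2) b) (m + (ip * \<chi> - ip * \<gamma> - n)) f) = (\<lambda>m f. Ys (\<gamma> + 2) \<chi> (em \<gamma> n b) m f + cst (- 1) * R1 (\<chi> + \<gamma>) n (Ys \<gamma> \<chi> b) (m + ip * \<chi>) f)"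
          unfolding ih by (intro ext) (simp add: cst_minus algebra_simps)
        then show ?thesis using fam_add[OF fam_Ys fam_scale[OF fX]] by simp
      qed
      have fY': "fam (\<lambda>m f. R2 \<chi> n (Ys \<gamma> (\<chi> + 2) b) (m + (ip * \<chi> - ip * \<gamma> - n)) f)"
      proof -
        have pp: "- par (n + ip * \<gamma>) * - par (n + ip * \<gamma>) = 1" by (simp add: par_def)
        have "(\<lambda>m f. cst (- par (n + ip * \<gamma>)) * (cst (- par (n + ip * \<gamma>)) * R2 \<chi> n (Ys \<gamma> (\<chi> + 2) b) (m + (ip * \<chi> - ip * \<gamma> - n)) f)) = (\<lambda>m f. R2 \<chi> n (Ys \<gamma> (\<chi> + 2) b) (m + (ip * \<chi> - ip * \<gamma> - n)) f)"
          unfolding mult.assoc[symmetric] cst_mult[symmetric] pp by simp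
        then show ?thesis using fam_scale[OF fY, of "- par (n + ip * \<gamma>)"] by simp
      qed
      have "Ys (\<gamma> + 2) \<chi> (em \<gamma> n (var j * b)) M f = NP \<chi> j (Ys (\<gamma> + 2) \<chi> (em \<gamma> n b)) M f - cst (2 * pc) * Ys (\<gamma> + 2) \<chi> (em \<gamma> ?n b) M f"
        unfolding em_var clin_diff[OF clin_Ys_state] clin_scale[OF clin_Ys_state] Ys_var ..
      also have "NP \<chi> j (Ys (\<gamma> + 2) \<chi> (em \<gamma> n b)) M f = NP \<chi> j (\<lambda>m f. R1 (\<chi> + \<gamma>) n (Ys \<gamma> \<chi> b) (m + ip * \<chi>) f + cst (- par (n + ip * \<gamma>)) * R2 \<chi> n (Ys \<gamma> (\<chi> + 2) b) (m + (ip * \<chi> - ip * \<gamma> - n)) f) M f"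
        unfolding ih by (simp add: cst_minus algebra_simps)
      also have "\<dots> = NP \<chi> j (\<lambda>m f. R1 (\<chi> + \<gamma>) n (Ys \<gamma> \<chi> b) (m + ip * \<chi>) f) M f + cst (- par (n + ip * \<gamma>)) * NP \<chi> j (\<lambda>m f. R2 \<chi> n (Ys \<gamma> (\<chi> + 2) b) (m + (ip * \<chi> - ip * \<gamma> - n)) f) M f"
        unfolding NP_split_add[OF fX fY] NP_scale[OF fY'] ..
      also have "NP \<chi> j (\<lambda>m f. R1 (\<chi> + \<gamma>) n (Ys \<gamma> \<chi> b) (m + ip * \<chi>) f) M f = R1 (\<chi> + \<gamma>) n (Ys \<gamma> \<chi> (var j * b)) (M + ip * \<chi>) f + cst (2 * pc) * R1 (\<chi> + \<gamma>) ?n (Ys \<gamma> \<chi> b) (M + ip * \<chi>) f"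
        unfolding Ys_var R1_NP[OF fam_Ys] by simp
      also have "NP \<chi> j (\<lambda>m f. R2 \<chi> n (Ys \<gamma> (\<chi> + 2) b) (m + (ip * \<chi> - ip * \<gamma> - n)) f) M f
         = R2 \<chi> n (Ys \<gamma> (\<chi> + 2) (var j * b)) (M + (ip * \<chi> - ip * \<gamma> - n)) f - cst (2 * pc * (- 1) ^ j) * R2 \<chi> ?n (Ys \<gamma> (\<chi> + 2) b) (M + (ip * \<chi> - ip * \<gamma> - n) + int j + 1) f"
        unfolding Ys_var R2_NP[OF fam_Ys] by simp
      also have "Ys (\<gamma> + 2) \<chi> (em \<gamma> ?n b) M f = ?R ?n b M f" using var by blast
      finally have E: "Ys (\<gamma> + 2) \<chi> (em \<gamma> n (var j * b)) M f =
         R1 (\<chi> + \<gamma>) n (Ys \<gamma> \<chi> (var j * b)) (M + ip * \<chi>) f + cst (2 * pc) * R1 (\<chi> + \<gamma>) ?n (Ys \<gamma> \<chi> b) (M + ip * \<chi>) f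
         + cst (- par (n + ip * \<gamma>)) * (R2 \<chi> n (Ys \<gamma> (\<chi> + 2) (var j * b)) (M + (ip * \<chi> - ip * \<gamma> - n)) f - cst (2 * pc * (- 1) ^ j) * R2 \<chi> ?n (Ys \<gamma> (\<chi> + 2) b) (M + (ip * \<chi> - ip * \<gamma> - n) + int j + 1) f)
         - cst (2 * pc) * (R1 (\<chi> + \<gamma>) ?n (Ys \<gamma> \<chi> b) (M + ip * \<chi>) f - cst (par (?n + ip * \<gamma>)) * R2 \<chi> ?n (Ys \<gamma> (\<chi> + 2) b) (M + ip * \<chi> - ip * \<gamma> - ?n) f)" .
      have p1: "par (?n + ip * \<gamma>) = - par (n + ip * \<gamma>) * (- 1) ^ j"
      proof -
        have "par (x - int j - 1) = - par x * (- 1) ^ j" for x by (cases "even x"; cases "even j") (auto simp: par_def)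
        from this[of "n + ip * \<gamma>"] show ?thesis by (simp add: algebra_simps)
      qed
      have p2: "M + ip * \<chi> - ip * \<gamma> - ?n = M + (ip * \<chi> - ip * \<gamma> - n) + int j + 1" "M + ip * \<chi> - ip * \<gamma> - n = M + (ip * \<chi> - ip * \<gamma> - n)" by auto
      show "Ys (\<gamma> + 2) \<chi> (em \<gamma> n (var j * b)) M f = ?R n (var j * b) M f"
        unfolding E p1 p2 by (simp add: cst_mult cst_minus algebra_simps)
    qed
  next
    case (add b b')
    have a1: "R1 (\<chi> + \<gamma>) n (\<lambda>m f. Ys \<gamma> \<chi> b m f + Ys \<gamma> \<chi> b' m f) M f = R1 (\<chi> + \<gamma>) n (Ys \<gamma> \<chi> b) M f + R1 (\<chi> + \<gamma>) n (Ys \<gamma> \<chi> b') M f" for n M f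
      unfolding R1_def by (simp only: clin_add[OF clin_em] distrib_left) (rule SA_add[OF fs_R1[OF fam_Ys] fs_R1[OF fam_Ys]])
    have a2: "R2 \<chi> n (\<lambda>m f. Ys \<gamma> (\<chi> + 2) b m f + Ys \<gamma> (\<chi> + 2) b' m f) M f = R2 \<chi> n (Ys \<gamma> (\<chi> + 2) b) M f + R2 \<chi> n (Ys \<gamma> (\<chi> + 2) b') M f" for n M f
      unfolding R2_def by (simp only: distrib_left) (rule SA_add[OF fs_R2[OF fam_Ys] fs_R2[OF fam_Ys]])
    show ?case unfolding clin_add[OF clin_em] Ys_add a1 a2 add(1)[rule_format] add(2)[rule_format] by (simp add: distrib_left)
  next
    case (scale z b)
    have a1: "R1 (\<chi> + \<gamma>) n (\<lambda>m f. cst z * Ys \<gamma> \<chi> b m f) M f = cst z * R1 (\<chi> + \<gamma>) n (Ys \<gamma> \<chi> b) M f" for n M f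
      unfolding R1_def SA_mult[OF fs_R1[OF fam_Ys]] by (simp only: clin_scale[OF clin_em] mult.left_commute)
    have a2: "R2 \<chi> n (\<lambda>m f. cst z * Ys \<gamma> (\<chi> + 2) b m f) M f = cst z * R2 \<chi> n (Ys \<gamma> (\<chi> + 2) b) M f" for n M f
      unfolding R2_def SA_mult[OF fs_R2[OF fam_Ys]] by (simp only: mult.left_commute)
    show ?case unfolding clin_scale[OF clin_em] Ys_scale a1 a2 using scale by (simp add: right_diff_distrib mult.left_commute)
  qed
  then show ?thesis by blast
qed

definition Qo :: "int \<Rightarrow> fock \<Rightarrow> fock" where "Qo \<chi> = V 2 (- 1 - ip * \<chi>)"

lemma clin_Q: "clin (Qo \<chi>)" by (simp add: Qo_def clin_V)
lemma em_0: "em \<chi> 0 = Qo \<chi>" by (simp add: em_def Qo_def)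

text \<open>The case n = 0: since (1 - x)^0 = 1, only the term i = 0 of each residue
  remains.\<close>

corollary Q_derivation: "Ys (\<gamma> + 2) \<chi> (Qo \<gamma> b) M f
   = Qo (\<chi> + \<gamma>) (Ys \<gamma> \<chi> b (M + ip * \<chi>) f) - cst (par (ip * \<gamma>)) * Ys \<gamma> (\<chi> + 2) b (M + ip * \<chi> - ip * \<gamma>) (Qo \<chi> f)"
proof -
  have b: "bc 0 i = (if i = 0 then 1 else 0)" for i by (cases i) (auto simp: bc_def)
  have "R1 (\<chi> + \<gamma>) 0 (Ys \<gamma> \<chi> b) m f = Sum_any (\<lambda>i::nat. if i = 0 then Qo (\<chi> + \<gamma>) (Ys \<gamma> \<chi> b m f) else 0)" for m
    unfolding R1_def by (rule Sum_any.cong) (auto simp: b em_0)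
  moreover have "R2 \<chi> 0 (Ys \<gamma> (\<chi> + 2) b) m f = Sum_any (\<lambda>i::nat. if i = 0 then Ys \<gamma> (\<chi> + 2) b m (Qo \<chi> f) else 0)" for m
    unfolding R2_def by (rule Sum_any.cong) (auto simp: b em_0)
  ultimately show ?thesis using iterate_formula[of \<gamma> \<chi> 0 b M f] by (simp add: em_0)
qed

end

section \<open>Laurent polynomials with integer coefficients\<close>

type_synonym expo = "nat \<Rightarrow>\<^sub>0 int"
type_synonym lau = "expo \<Rightarrow>\<^sub>0 int"

abbreviation ex :: "expo \<Rightarrow> nat \<Rightarrow> int" where "ex \<equiv> Poly_Mapping.lookup"
abbreviation cf :: "lau \<Rightarrow> expo \<Rightarrow> int" where "cf \<equiv> Poly_Mapping.lookup"
abbreviation kys :: "lau \<Rightarrow> expo set" where "kys \<equiv> Poly_Mapping.keys"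

lemma lau_expand: "R = (\<Sum>e\<in>kys R. Poly_Mapping.single e (cf R e))" for R :: lau
proof (rule poly_mapping_eqI)
  fix d
  have "cf (\<Sum>e\<in>kys R. Poly_Mapping.single e (cf R e)) d = (\<Sum>e\<in>kys R. if e = d then cf R e else 0)"
    by (simp add: lookup_sum lookup_single when_def)
  also have "\<dots> = cf R d" by (simp add: sum.delta in_keys_iff)
  finally show "cf R d = cf (\<Sum>e\<in>kys R. Poly_Mapping.single e (cf R e)) d" by simp
qed

lemma lau_induct [case_names single add]:
  assumes "\<And>e c. P (Poly_Mapping.single e c)" "\<And>R S. P R \<Longrightarrow> P S \<Longrightarrow> P (R + S)" shows "P (R :: lau)"
proof -
  have P0: "P 0" using assms(1)[of 0 0] by simp
  have "P (\<Sum>e\<in>A. Poly_Mapping.single e (cf R e))" if "finite A" for A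
    using that by (induction A) (auto simp: P0 assms)
  then show ?thesis by (subst lau_expand) simp
qed

lemma cf_mult: "cf (R * S) d = (\<Sum>e\<in>kys R. cf R e * cf S (d - e))"
proof (induction R rule: lau_induct)
  case (single e c)
  have "cf (Poly_Mapping.single e c * S) d = c * cf S (d - e)"
  proof (induction S rule: lau_induct)
    case (single e' c') then show ?case by (auto simp: mult_single lookup_single when_def algebra_simps)
  next
    case (add R S) then show ?case by (simp add: distrib_left lookup_add)
  qed
  then show ?case by simp
next
  case (add R R')
  let ?A = "kys R \<union> kys R'"
  have s: "kys (R + R') \<subseteq> ?A" by (rule keys_add)
  have e: "(\<Sum>e\<in>kys T. cf T e * cf S (d - e)) = (\<Sum>e\<in>?A. cf T e * cf S (d - e))" if "kys T \<subseteq> ?A" for T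
    by (rule sum.mono_neutral_left) (use that in \<open>auto simp: in_keys_iff\<close>)
  show ?case using add e[of R] e[of R'] e[OF s]
    by (simp add: distrib_right lookup_add sum.distrib)
qed

section \<open>Powers of the screening operator do not vanish\<close>

text \<open>A power of \<open>Q\<close> applied to a highest weight vector is a coefficient extraction from the Laurent polynomial
  \<open>\<Prod>\<^sub>i\<^sub>>\<^sub>j (1 - x\<^sub>i / x\<^sub>j)\<^sup>2\<^sup>p\<close>.\<close>

definition lsum :: "(expo \<Rightarrow> fock) \<Rightarrow> lau \<Rightarrow> fock" where
  "lsum \<phi> R = (\<Sum>e\<in>kys R. cst (of_int (cf R e)) * \<phi> e)"

lemma lsum_superset: "finite A \<Longrightarrow> kys R \<subseteq> A \<Longrightarrow> lsum \<phi> R = (\<Sum>e\<in>A. cst (of_int (cf R e)) * \<phi> e)"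
  unfolding lsum_def by (rule sum.mono_neutral_left) (auto simp: in_keys_iff)
lemma lsum_add: "lsum \<phi> (R + S) = lsum \<phi> R + lsum \<phi> S"
proof -
  let ?A = "kys R \<union> kys S"
  have "kys (R + S) \<subseteq> ?A" by (rule keys_add)
  then show ?thesis by (simp add: lsum_superset[of ?A] lookup_add cst_add distrib_right sum.distrib)
qed
lemma lsum_single: "lsum \<phi> (Poly_Mapping.single e c) = cst (of_int c) * \<phi> e"
  by (simp add: lsum_def)
lemma lsum_0 [simp]: "lsum \<phi> 0 = 0" by (simp add: lsum_def)
lemma lsum_sum: "lsum \<phi> (sum R A) = (\<Sum>x\<in>A. lsum \<phi> (R x))"
  by (induction A rule: infinite_finite_induct) (auto simp: lsum_add)
lemma lsum_cong: "(\<And>e. e \<in> kys R \<Longrightarrow> \<phi> e = \<psi> e) \<Longrightarrow> lsum \<phi> R = lsum \<psi> R" by (simp add: lsum_def)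
lemma lsum_scale: "lsum (\<lambda>e. g * \<phi> e) R = g * lsum \<phi> R"
  by (simp add: lsum_def sum_distrib_left mult.left_commute)
lemma lsum_plus: "lsum (\<lambda>e. \<psi> e + \<phi> e) R = lsum \<psi> R + lsum \<phi> R"
  by (simp add: lsum_def distrib_left sum.distrib)
lemma lsum_mult: "lsum \<phi> (R * S) = lsum (\<lambda>e. lsum (\<lambda>e'. \<phi> (e + e')) S) R"
proof (induction R rule: lau_induct)
  case (single e c)
  show ?case
  proof (induction S rule: lau_induct)
    case (single e' c') show ?case by (simp add: mult_single lsum_single cst_mult mult.assoc)
  next
    case (add R S) then show ?case by (simp add: distrib_left lsum_add lsum_plus)
  qed
next
  case (add R S) then show ?case by (simp add: distrib_right lsum_add)
qed
lemma clin_lsum: "clin T \<Longrightarrow> T (lsum \<phi> R) = lsum (\<lambda>e. T (\<phi> e)) R"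
  by (simp add: lsum_def clin_sum clin_scale)

definition XX :: "nat \<Rightarrow> int \<Rightarrow> lau" where "XX i a = Poly_Mapping.single (Poly_Mapping.single i a) 1"
lemma XX_mult: "XX i a * XX i b = XX i (a + b)" by (simp add: XX_def mult_single single_add)
lemma XX_0 [simp]: "XX i 0 = 1" by (simp add: XX_def)
lemma XX_power: "XX i a ^ n = XX i (int n * a)" by (induction n) (auto simp: XX_mult algebra_simps)

context trip
begin

definition fac :: "nat \<Rightarrow> nat \<Rightarrow> nat \<Rightarrow> lau" where "fac q i j = (1 - XX i 1 * XX j (- 1)) ^ q"

lemma fac_expand: "fac q i j = (\<Sum>l\<le>q. Poly_Mapping.single (Poly_Mapping.single i (int l) + Poly_Mapping.single j (- int l)) ((- 1) ^ l * int (q choose l)))"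
proof -
  have "fac q i j = (\<Sum>l\<le>q. of_nat (q choose l) * (- (XX i 1 * XX j (- 1))) ^ l)"
    unfolding fac_def using binomial_ring[of "- (XX i 1 * XX j (- 1))" 1 q] by (simp add: algebra_simps)
  also have "\<dots> = (\<Sum>l\<le>q. Poly_Mapping.single (Poly_Mapping.single i (int l) + Poly_Mapping.single j (- int l)) ((- 1) ^ l * int (q choose l)))"
  proof (rule sum.cong[OF refl])
    fix l
    have s: "(- (XX i 1 * XX j (- 1))) ^ l = (- 1) ^ l * Poly_Mapping.single (Poly_Mapping.single i (int l) + Poly_Mapping.single j (- int l)) 1"
      unfolding power_minus[of "XX i 1 * XX j (- 1)"] power_mult_distrib XX_power by (simp add: XX_def mult_single)
    have c: "Poly_Mapping.single e (z :: int) = of_int z * Poly_Mapping.single e 1" for e :: expo and z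
    proof -
      have "of_int z * Poly_Mapping.single e (1::int) = Poly_Mapping.single 0 z * Poly_Mapping.single e 1"
        using single_of_int[where 'a = expo and 'b = int, of z] by simp
      then show ?thesis by (simp add: mult_single)
    qed
    show "of_nat (q choose l) * (- (XX i 1 * XX j (- 1))) ^ l = Poly_Mapping.single (Poly_Mapping.single i (int l) + Poly_Mapping.single j (- int l)) ((- 1) ^ l * int (q choose l))"
      unfolding s c[of _ "(- 1) ^ l * int (q choose l)"] by (simp add: mult_ac)
  qed
  finally show ?thesis .
qed

text \<open>The factor collected by the n-th vertex operator of e^alpha on its way past the creation
  exponentials of k earlier ones.\<close>

definition PP :: "nat \<Rightarrow> nat \<Rightarrow> lau" where "PP n k = (\<Prod>j<k. fac (2 * p) n j)"

definition supp :: "nat set \<Rightarrow> lau \<Rightarrow> bool" where "supp I R \<longleftrightarrow> (\<forall>e\<in>kys R. \<forall>i. i \<notin> I \<longrightarrow> ex e i = 0)"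

lemma supp_mult: "supp I R \<Longrightarrow> supp I S \<Longrightarrow> supp I (R * S)"
  unfolding supp_def using keys_mult[of R S] by (fastforce simp: lookup_add)
lemma supp_diff: "supp I R \<Longrightarrow> supp I S \<Longrightarrow> supp I (R - S)"
  unfolding supp_def using keys_diff[of R S] by fastforce
lemma supp_1: "supp I 1" by (auto simp: supp_def)
lemma supp_XX: "i \<in> I \<Longrightarrow> supp I (XX i a)" by (auto simp: supp_def XX_def lookup_single when_def)
lemma supp_mono: "supp I R \<Longrightarrow> I \<subseteq> J \<Longrightarrow> supp J R" by (auto simp: supp_def)
lemma supp_prod: "(\<And>x. x \<in> A \<Longrightarrow> supp I (R x)) \<Longrightarrow> supp I (prod R A)"
  by (induction A rule: infinite_finite_induct) (auto simp: supp_1 supp_mult)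
lemma supp_power: "supp I R \<Longrightarrow> supp I (R ^ n)" by (induction n) (auto simp: supp_1 supp_mult)
lemma supp_fac: "i \<in> I \<Longrightarrow> j \<in> I \<Longrightarrow> supp I (fac q i j)"
  unfolding fac_def by (intro supp_power supp_diff supp_1 supp_mult supp_XX)
lemma supp_PP: "supp (insert n {..<k}) (PP n k)"
  unfolding PP_def by (intro supp_prod supp_fac) auto

text \<open>For gamma = 2 and kappa = 1 the exponent is the natural number 2 p, so the expansion is
  a polynomial whose length does not depend on b.\<close>

lemma V_SS_all: "V 2 a (SS 1 b * f) = (\<Sum>l\<le>2 * p. cst (of_int ((- 1) ^ l * int ((2 * p) choose l))) * (SS 1 (b - int l) * V 2 (a + int l) f))"
proof (cases "b < 0")
  case True then show ?thesis by (simp add: clin_0[OF clin_V])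
next
  case False
  then obtain B where B: "b = int B" by (metis not_less nonneg_int_cases)
  let ?t = "\<lambda>l. cst (of_int ((- 1) ^ l * int ((2 * p) choose l))) * (SS 1 (b - int l) * V 2 (a + int l) f)"
  have q: "pc * of_int 2 * 1 = of_nat (2 * p)" by simp
  have "V 2 a (SS 1 b * f) = (\<Sum>l\<le>B. ?t l)"
    unfolding B V_SS q binomial_gbinomial[symmetric] by simp
  also have "\<dots> = (\<Sum>l\<le>B + 2 * p. ?t l)" by (rule sum.mono_neutral_left) (auto simp: B)
  also have "\<dots> = (\<Sum>l\<le>2 * p. ?t l)" by (rule sum.mono_neutral_right) (auto simp: binomial_eq_0)
  finally show ?thesis .
qed

lemma V_prod_SS: "k \<le> n \<Longrightarrow> V 2 a ((\<Prod>i<k. SS 1 (c i)) * f) = lsum (\<lambda>e. (\<Prod>i<k. SS 1 (c i + ex e i)) * V 2 (a + ex e n) f) (PP n k)"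
proof (induction k arbitrary: a)
  case 0 then show ?case by (simp add: PP_def lsum_single[of _ 0 1, simplified])
next
  case (Suc k)
  define \<phi> where "\<phi> e = (\<Prod>i<Suc k. SS 1 (c i + ex e i)) * V 2 (a + ex e n) f" for e
  let ?d = "\<lambda>l. Poly_Mapping.single n (int l) + Poly_Mapping.single k (- int l) :: expo"
  have kn: "k \<noteq> n" "k < n" using Suc.prems by auto
  have "V 2 a ((\<Prod>i<Suc k. SS 1 (c i)) * f) = V 2 a (SS 1 (c k) * ((\<Prod>i<k. SS 1 (c i)) * f))" by (simp add: mult_ac)
  also have "\<dots> = (\<Sum>l\<le>2 * p. cst (of_int ((- 1) ^ l * int ((2 * p) choose l))) * (SS 1 (c k - int l) * lsum (\<lambda>e. (\<Prod>i<k. SS 1 (c i + ex e i)) * V 2 (a + int l + ex e n) f) (PP n k)))"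
    unfolding V_SS_all using Suc.IH[of "a + int _"] Suc.prems by simp
  also have "\<dots> = (\<Sum>l\<le>2 * p. lsum (\<lambda>e'. lsum (\<lambda>e. \<phi> (e + e')) (PP n k)) (Poly_Mapping.single (?d l) ((- 1) ^ l * int ((2 * p) choose l))))"
  proof (rule sum.cong[OF refl])
    fix l
    have "SS 1 (c k - int l) * lsum (\<lambda>e. (\<Prod>i<k. SS 1 (c i + ex e i)) * V 2 (a + int l + ex e n) f) (PP n k) = lsum (\<lambda>e. \<phi> (e + ?d l)) (PP n k)"
      unfolding lsum_scale[symmetric]
    proof (rule lsum_cong)
      fix e assume "e \<in> kys (PP n k)"
      then have z: "ex e k = 0" using supp_PP[of n k] kn unfolding supp_def by auto
      have i: "(\<Prod>i<k. SS 1 (c i + ex (e + ?d l) i)) = (\<Prod>i<k. SS 1 (c i + ex e i))"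
        by (rule prod.cong) (use kn in \<open>auto simp: lookup_add lookup_single when_def\<close>)
      have k: "c k + ex (e + ?d l) k = c k - int l" "a + ex (e + ?d l) n = a + int l + ex e n"
        using kn z by (auto simp: lookup_add lookup_single when_def)
      show "SS 1 (c k - int l) * ((\<Prod>i<k. SS 1 (c i + ex e i)) * V 2 (a + int l + ex e n) f) = \<phi> (e + ?d l)"
        unfolding \<phi>_def lessThan_Suc by (simp add: i k mult_ac)
    qed
    then show "cst (of_int ((- 1) ^ l * int ((2 * p) choose l))) * (SS 1 (c k - int l) * lsum (\<lambda>e. (\<Prod>i<k. SS 1 (c i + ex e i)) * V 2 (a + int l + ex e n) f) (PP n k))
       = lsum (\<lambda>e'. lsum (\<lambda>e. \<phi> (e + e')) (PP n k)) (Poly_Mapping.single (?d l) ((- 1) ^ l * int ((2 * p) choose l)))"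
      unfolding lsum_single by simp
  qed
  also have "\<dots> = lsum (\<lambda>e'. lsum (\<lambda>e. \<phi> (e' + e)) (PP n k)) (fac (2 * p) n k)"
    unfolding fac_expand lsum_sum by (simp add: add.commute)
  also have "\<dots> = lsum \<phi> (PP n (Suc k))" unfolding lsum_mult[symmetric] PP_def by (simp add: mult.commute)
  finally show ?case unfolding \<phi>_def .
qed

primrec Vc :: "(nat \<Rightarrow> int) \<Rightarrow> nat \<Rightarrow> fock" where
  "Vc a 0 = 1" | "Vc a (Suc n) = V 2 (a n) (Vc a n)"

text \<open>The coefficient of \<open>RR a n\<close> at an exponent vector e is the multiplicity
  with which the product of all \<open>SS 1 (ex e i)\<close> enters \<open>Vc a n\<close>.\<close>

primrec RR :: "(nat \<Rightarrow> int) \<Rightarrow> nat \<Rightarrow> lau" where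
  "RR a 0 = 1" | "RR a (Suc n) = RR a n * (PP n n * XX n (a n))"

lemma supp_RR: "supp {..<n} (RR a n)"
  by (induction n) (auto intro!: supp_1 supp_mult supp_XX intro: supp_mono[of "{..<_}"] supp_mono[OF supp_PP])

lemma Vc_RR: "Vc a n = lsum (\<lambda>e. \<Prod>i<n. SS 1 (ex e i)) (RR a n)"
proof (induction n)
  case 0 then show ?case by (simp add: lsum_single[of _ 0 1, simplified])
next
  case (Suc n)
  have "Vc a (Suc n) = lsum (\<lambda>e. V 2 (a n) ((\<Prod>i<n. SS 1 (ex e i)) * 1)) (RR a n)" by (simp add: Suc clin_lsum[OF clin_V])
  also have "\<dots> = lsum (\<lambda>e. lsum (\<lambda>e'. (\<Prod>i<n. SS 1 (ex e i + ex e' i)) * V 2 (a n + ex e' n) 1) (PP n n)) (RR a n)"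
    unfolding V_prod_SS[OF order_refl] ..
  also have "\<dots> = lsum (\<lambda>e. lsum (\<lambda>e'. \<Prod>i<Suc n. SS 1 (ex (e + e') i)) (PP n n * XX n (a n))) (RR a n)"
  proof (rule lsum_cong)
    fix e assume "e \<in> kys (RR a n)"
    then have z: "ex e n = 0" using supp_RR[of n a] unfolding supp_def by auto
    show "lsum (\<lambda>e'. (\<Prod>i<n. SS 1 (ex e i + ex e' i)) * V 2 (a n + ex e' n) 1) (PP n n) = lsum (\<lambda>e'. \<Prod>i<Suc n. SS 1 (ex (e + e') i)) (PP n n * XX n (a n))"
      unfolding lsum_mult
    proof (rule lsum_cong)
      fix e'
      have i: "(\<Prod>i<n. SS 1 (ex (e + (e' + Poly_Mapping.single n (a n))) i)) = (\<Prod>i<n. SS 1 (ex e i + ex e' i))"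
        by (rule prod.cong) (auto simp: lookup_add lookup_single when_def)
      have "ex (e + (e' + Poly_Mapping.single n (a n))) n = a n + ex e' n" using z by (simp add: lookup_add)
      then show "(\<Prod>i<n. SS 1 (ex e i + ex e' i)) * V 2 (a n + ex e' n) 1 = lsum (\<lambda>e''. \<Prod>i<Suc n. SS 1 (ex (e + (e' + e'')) i)) (XX n (a n))"
        unfolding XX_def lsum_single lessThan_Suc by (simp add: i V_1 mult.commute)
    qed
  qed
  finally show ?case by (simp add: lsum_mult)
qed

section \<open>Inversion of the variables, and constant terms\<close>

definition revp :: "lau \<Rightarrow> lau \<Rightarrow> bool" where "revp G H \<longleftrightarrow> (\<forall>e. cf H e = cf G (- e))"

lemma revp_mult: assumes "revp G H" "revp G' H'" shows "revp (G * G') (H * H')"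
  unfolding revp_def
proof
  fix d
  have "cf (H * H') d = (\<Sum>e\<in>kys H. cf H e * cf H' (d - e))" by (rule cf_mult)
  also have "\<dots> = (\<Sum>e\<in>kys G. cf G e * cf G' (- d - e))"
    by (rule sum.reindex_bij_witness[of _ uminus uminus]) (use assms in \<open>auto simp: revp_def in_keys_iff\<close>)
  also have "\<dots> = cf (G * G') (- d)" by (rule cf_mult[symmetric])
  finally show "cf (H * H') d = cf (G * G') (- d)" .
qed
lemma revp_1: "revp 1 1" by (auto simp: revp_def lookup_one when_def)
lemma revp_diff: "revp G H \<Longrightarrow> revp G' H' \<Longrightarrow> revp (G - G') (H - H')" by (auto simp: revp_def lookup_minus)
lemma revp_XX: "revp (XX i a) (XX i (- a))"
proof -
  have u: "Poly_Mapping.single i (- a) = - Poly_Mapping.single i a" by (simp add: single_uminus)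
  have "Poly_Mapping.single i (- a) = e \<longleftrightarrow> Poly_Mapping.single i a = - e" for e :: expo
    unfolding u by auto
  then show ?thesis unfolding revp_def XX_def lookup_single when_def by simp
qed
lemma revp_power: "revp G H \<Longrightarrow> revp (G ^ n) (H ^ n)" by (induction n) (auto simp: revp_1 revp_mult)
lemma revp_prod: "(\<And>x. x \<in> A \<Longrightarrow> revp (G x) (H x)) \<Longrightarrow> revp (prod G A) (prod H A)"
  by (induction A rule: infinite_finite_induct) (auto simp: revp_1 revp_mult)
lemma revp_fac: "revp (fac q i j) (fac q j i)"
  unfolding fac_def
  using revp_power[OF revp_diff[OF revp_1 revp_mult[OF revp_XX[of i 1] revp_XX[of j "- 1"]]]] by (simp add: mult.commute)

text \<open>The constant term of a product pairs opposite exponents, and inverting the variables in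
  one factor makes these carry equal coefficients.\<close>

lemma revp_ct: assumes "revp G H" "G \<noteq> 0" shows "cf (G * H) 0 > 0"
proof -
  have "cf (G * H) 0 = (\<Sum>e\<in>kys G. (cf G e)\<^sup>2)"
    using assms(1) by (simp add: cf_mult revp_def power2_eq_square)
  moreover have "(\<Sum>e\<in>kys G. (cf G e)\<^sup>2) > 0"
    by (rule sum_pos) (use assms(2) in \<open>auto simp: in_keys_iff\<close>)
  ultimately show ?thesis by simp
qed

lemma fac_nz: "i \<noteq> j \<Longrightarrow> fac q i j \<noteq> 0"
proof -
  assume ij: "i \<noteq> j"
  have "1 - XX i 1 * XX j (- 1) \<noteq> 0"
  proof
    assume "1 - XX i 1 * XX j (- 1) = 0"
    then have "cf 1 0 = cf (XX i 1 * XX j (- 1)) 0" by simp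
    then have "Poly_Mapping.single i 1 + Poly_Mapping.single j (- 1) = (0 :: expo)"
      by (simp add: XX_def mult_single lookup_single when_def split: if_splits)
    then have "ex (Poly_Mapping.single i 1 + Poly_Mapping.single j (- 1)) i = 0" by simp
    then show False using ij by (simp add: lookup_add lookup_single when_def)
  qed
  then show ?thesis unfolding fac_def by simp
qed

text \<open>With u = x_i / x_j one has 1 - u = -u (1 - 1/u). Rewriting half of the 2 p factors in
  this way leaves a product that is symmetric under inversion, up to a monomial and a sign.\<close>

lemma fac_double: "fac (2 * p) i j = (- 1) ^ p * (XX i ip * XX j (- ip)) * (fac p i j * fac p j i)"
proof -
  let ?u = "XX i 1 * XX j (- 1)" and ?v = "XX j 1 * XX i (- 1)"
  have uv: "?u * ?v = 1"
  proof -
    have "?u * ?v = (XX i 1 * XX i (- 1)) * (XX j (- 1) * XX j 1)" by (simp add: mult_ac)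
    then show ?thesis by (simp add: XX_mult)
  qed
  have a: "1 - ?u = (- ?u) * (1 - ?v)" using uv by (simp add: right_diff_distrib)
  have "fac (2 * p) i j = (1 - ?u) ^ p * (1 - ?u) ^ p" by (simp add: fac_def mult_2 power_add)
  also have "(1 - ?u) ^ p * (1 - ?u) ^ p = (1 - ?u) ^ p * ((- ?u) * (1 - ?v)) ^ p" by (subst (2) a) (rule refl)
  also have "\<dots> = (- 1) ^ p * ?u ^ p * ((1 - ?u) ^ p * (1 - ?v) ^ p)"
    unfolding power_mult_distrib[of "- ?u"] power_minus[of ?u] by (simp only: mult_ac)
  also have "?u ^ p = XX i ip * XX j (- ip)" by (simp add: power_mult_distrib XX_power)
  finally show ?thesis by (simp add: fac_def)
qed

lemma RR_prod: "RR a N = (\<Prod>n<N. PP n n * XX n (a n))" by (induction N) auto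

text \<open>The monomials split off by \<open>fac_double\<close>, collected by variable. They are
  cancelled by mode indices with spacing 2 p around a common centre, and such are the mode indices
  of the powers of Q.\<close>

lemma XX_triangle: "(\<Prod>n<N. \<Prod>j<n. XX n ip * XX j (- ip)) = (\<Prod>n<N. XX n (ip * (2 * int n - int N + 1)))"
proof (induction N)
  case (Suc N)
  have "(\<Prod>j<N. XX N ip * XX j (- ip)) = XX N (ip * int N) * (\<Prod>j<N. XX j (- ip))"
    by (simp add: prod.distrib XX_power mult.commute)
  then have "(\<Prod>n<Suc N. \<Prod>j<n. XX n ip * XX j (- ip)) = (\<Prod>n<N. XX n (ip * (2 * int n - int N + 1))) * (XX N (ip * int N) * (\<Prod>j<N. XX j (- ip)))"
    by (simp only: prod.lessThan_Suc Suc)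
  also have "\<dots> = (\<Prod>n<N. XX n (ip * (2 * int n - int N + 1)) * XX n (- ip)) * XX N (ip * int N)"
    unfolding prod.distrib by (simp only: mult_ac)
  also have "(\<Prod>n<N. XX n (ip * (2 * int n - int N + 1)) * XX n (- ip)) = (\<Prod>n<N. XX n (ip * (2 * int n - int (Suc N) + 1)))"
    by (intro prod.cong refl) (simp add: XX_mult algebra_simps)
  finally show ?case by (simp add: algebra_simps)
qed simp

definition cent :: "nat \<Rightarrow> int \<Rightarrow> expo" where "cent N b = (\<Sum>i<N. Poly_Mapping.single i b)"

lemma ex_cent: "ex (cent N b) i = (if i < N then b else 0)"
  by (simp add: cent_def lookup_sum lookup_single when_def)
lemma XX_cent: "(\<Prod>n<N. XX n b) = Poly_Mapping.single (cent N b) 1"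
  by (induction N) (auto simp: cent_def XX_def mult_single add.commute)

text \<open>Dyson's constant term, in the weak form that it does not vanish: it is a sum of squares.\<close>

lemma constant_term_nonzero: "cf (RR (\<lambda>i. b + ip * (int N - 1 - 2 * int i)) N) (cent N b) \<noteq> 0"
proof -
  define G where "G = (\<Prod>n<N. \<Prod>j<n. fac p n j)"
  define H where "H = (\<Prod>n<N. \<Prod>j<n. fac p j n)"
  define s where "s = (\<Prod>n<N. \<Prod>j<n. (- 1) ^ p :: lau)"
  have "RR (\<lambda>i. b + ip * (int N - 1 - 2 * int i)) N = s * (\<Prod>n<N. \<Prod>j<n. XX n ip * XX j (- ip)) * (\<Prod>n<N. XX n (b + ip * (int N - 1 - 2 * int n))) * (G * H)"
    unfolding RR_prod PP_def fac_double prod.distrib s_def G_def H_def by (simp only: mult_ac)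
  also have "s * (\<Prod>n<N. \<Prod>j<n. XX n ip * XX j (- ip)) * (\<Prod>n<N. XX n (b + ip * (int N - 1 - 2 * int n))) = s * (\<Prod>n<N. XX n b)"
    unfolding XX_triangle mult.assoc prod.distrib[symmetric] XX_mult by (simp add: algebra_simps)
  finally have R: "RR (\<lambda>i. b + ip * (int N - 1 - 2 * int i)) N = s * (Poly_Mapping.single (cent N b) 1 * (G * H))"
    by (simp add: XX_cent mult.assoc)
  have s1: "s = 1 \<or> s = - 1" unfolding s_def
  proof -
    have p1: "x = 1 \<or> x = - 1 \<Longrightarrow> y = 1 \<or> y = - 1 \<Longrightarrow> x * y = 1 \<or> x * y = - 1" for x y :: lau by auto
    have "(\<Prod>j\<in>A. (- 1) ^ p :: lau) = 1 \<or> (\<Prod>j\<in>A. (- 1) ^ p :: lau) = - 1" for A :: "nat set"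
      by (auto simp: minus_one_power_iff)
    then show "(\<Prod>n<N. \<Prod>j<n. (- 1) ^ p :: lau) = 1 \<or> (\<Prod>n<N. \<Prod>j<n. (- 1) ^ p :: lau) = - 1"
      by (induction N) (use p1 in \<open>auto simp del: prod_constant\<close>)
  qed
  have c: "cf (Poly_Mapping.single (cent N b) 1 * (G * H)) (cent N b) = cf (G * H) 0"
    by (subst cf_mult) simp
  have "revp G H" unfolding G_def H_def by (intro revp_prod revp_fac)
  moreover have "G \<noteq> 0" unfolding G_def by (auto simp: fac_nz)
  ultimately have "cf (G * H) 0 > 0" by (rule revp_ct)
  then show ?thesis unfolding R using s1 c by auto
qed

definition homd :: "nat \<Rightarrow> int \<Rightarrow> lau \<Rightarrow> bool" where "homd N d R \<longleftrightarrow> (\<forall>e\<in>kys R. (\<Sum>i<N. ex e i) = d)"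

lemma homd_mult: "homd N d R \<Longrightarrow> homd N d' S \<Longrightarrow> homd N (d + d') (R * S)"
  unfolding homd_def using keys_mult[of R S] by (fastforce simp: lookup_add sum.distrib)
lemma homd_1: "homd N 0 1" by (simp add: homd_def)
lemma homd_XX: "i < N \<Longrightarrow> homd N a (XX i a)" by (simp add: homd_def XX_def lookup_single when_def)
lemma homd_diff: "homd N d R \<Longrightarrow> homd N d S \<Longrightarrow> homd N d (R - S)"
  unfolding homd_def using keys_diff[of R S] by fastforce
lemma homd_fac: "i < N \<Longrightarrow> j < N \<Longrightarrow> homd N 0 (fac q i j)"
proof -
  assume ij: "i < N" "j < N"
  have b: "homd N 0 (1 - XX i 1 * XX j (- 1))"
    using homd_mult[OF homd_XX[OF ij(1), of 1] homd_XX[OF ij(2), of "- 1"]] by (intro homd_diff homd_1) simp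
  show ?thesis unfolding fac_def by (induction q) (use homd_1 homd_mult[OF b, of 0] in auto)
qed
lemma homd_prod: "finite A \<Longrightarrow> (\<And>x. x \<in> A \<Longrightarrow> homd N (d x) (R x)) \<Longrightarrow> homd N (sum d A) (prod R A)"
  by (induction A rule: finite_induct) (auto simp: homd_1 homd_mult)
lemma homd_RR: "homd N (\<Sum>i<N. a i) (RR a N)"
  unfolding RR_prod
proof (rule homd_prod)
  fix n assume "n \<in> {..<N}"
  then have "homd N (\<Sum>j<n. 0) (PP n n)" unfolding PP_def by (intro homd_prod homd_fac) auto
  then show "homd N (a n) (PP n n * XX n (a n))" using homd_mult[OF _ homd_XX, of N 0 "PP n n" n "a n"] \<open>n \<in> {..<N}\<close> by simp
qed simp

lemma sum_center: "(\<Sum>i<N. b + ip * (int N - 1 - 2 * int i)) = int N * b"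
proof -
  have "(\<Sum>i<N. int N - 1 - 2 * int i) = 0"
  proof (induction N)
    case (Suc N)
    have "(\<Sum>i<Suc N. int (Suc N) - 1 - 2 * int i) = (\<Sum>i<N. (int N - 1 - 2 * int i) + 1) - int N" by simp
    also have "\<dots> = 0" unfolding sum.distrib Suc by simp
    finally show ?case .
  qed simp
  then show ?thesis by (simp add: sum.distrib sum_distrib_left[symmetric])
qed

end

text \<open>Newton's recursion solved for the values of the variables: under
  \<open>evf (tev s)\<close> the vectors \<open>SS 1 e\<close> take the prescribed values
  \<open>s e\<close>, provided that \<open>s 0\<close> is 1.\<close>

fun tev :: "(nat \<Rightarrow> complex) \<Rightarrow> nat \<Rightarrow> complex" where
  "tev s n = of_nat (n + 1) * s (n + 1) - (\<Sum>k<n. tev s k * s (n - k))"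

declare tev.simps [simp del]

definition evf :: "(nat \<Rightarrow> complex) \<Rightarrow> fock \<Rightarrow> fock" where
  "evf t = lext (\<lambda>c. cst (prod_mset (image_mset t c)))"

lemma clin_evf: "clin (evf t)" unfolding evf_def by (rule clin_lext)
lemma evf_var: "evf t (var j * f) = cst (t j) * evf t f"
  by (rule clin_eq_mon[OF clin_comp[OF clin_evf clin_mult] clin_mul[OF clin_evf]])
     (simp add: evf_def cst_mult flip: mon_add)
lemma evf_1: "evf t 1 = 1" unfolding evf_def mon_empty[symmetric] lext_mon by simp
lemma evf_mult: "evf t (f * g) = evf t f * evf t g"
  by (induction f rule: fock_induct)
     (simp_all add: evf_1 evf_var mult.assoc distrib_right clin_add[OF clin_evf] clin_scale[OF clin_evf])
lemma evf_prod: "evf t (prod g A) = (\<Prod>x\<in>A. evf t (g x))"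
  by (induction A rule: infinite_finite_induct) (auto simp: evf_1 evf_mult)

context trip
begin

lemma evf_SS: assumes "s 0 = 1" shows "evf (tev s) (SS 1 (int e)) = cst (s e)"
proof (induction e rule: less_induct)
  case (less e)
  show ?case
  proof (cases e)
    case 0 then show ?thesis by (simp add: evf_1 assms)
  next
    case (Suc n)
    have "cst (of_nat e) * evf (tev s) (SS 1 (int e)) = evf (tev s) (cst (of_int (int e)) * SS 1 (int e))"
      by (simp add: clin_scale[OF clin_evf])
    also have "\<dots> = (\<Sum>k<e. cst (tev s k) * evf (tev s) (SS 1 (int e - int k - 1)))"
      using SS_rec[of "int e" e 1] by (simp add: clin_sum[OF clin_evf] evf_var)
    also have "\<dots> = (\<Sum>k<e. cst (tev s k * s (n - k)))"
    proof (rule sum.cong[OF refl])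
      fix k assume "k \<in> {..<e}"
      then have "int e - int k - 1 = int (n - k)" "n - k < e" using Suc by auto
      then show "cst (tev s k) * evf (tev s) (SS 1 (int e - int k - 1)) = cst (tev s k * s (n - k))"
        using less[of "n - k"] by (simp add: cst_mult)
    qed
    also have "\<dots> = cst (of_nat e * s e)"
      unfolding cst_sum[symmetric] Suc lessThan_Suc using tev.simps[of s n] assms by simp
    finally have "cst (of_nat e) * (evf (tev s) (SS 1 (int e)) - cst (s e)) = 0" by (simp add: right_diff_distrib cst_mult)
    then show ?thesis using Suc by (simp del: of_nat_Suc)
  qed
qed

lemma Vc_center: "\<exists>t. \<exists>z. z \<noteq> 0 \<and> evf t (Vc (\<lambda>i. int b + ip * (int N - 1 - 2 * int i)) N) = cst z"
proof -
  \<comment> \<open>Only the exponents 0 and b survive this evaluation, and as the exponents add up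
    to N b, all of them must be b. A single coefficient is thereby extracted.\<close>
  define s where "s e = (if e = 0 \<or> e = b then 1 else 0 :: complex)" for e :: nat
  define a where "a = (\<lambda>i::nat. int b + ip * (int N - 1 - 2 * int i))"
  have sv: "evf (tev s) (SS 1 m) = (if m = 0 \<or> m = int b then 1 else 0)" for m
  proof (cases "m < 0")
    case True then show ?thesis by (simp add: clin_0[OF clin_evf])
  next
    case False
    then obtain e where e: "m = int e" by (metis not_less nonneg_int_cases)
    show ?thesis unfolding e using evf_SS[of s e] by (simp add: s_def)
  qed
  have "evf (tev s) (Vc a N) = lsum (\<lambda>e. \<Prod>i<N. evf (tev s) (SS 1 (ex e i))) (RR a N)"
    unfolding Vc_RR clin_lsum[OF clin_evf] evf_prod ..
  also have "\<dots> = lsum (\<lambda>e. if e = cent N (int b) then 1 else 0) (RR a N)"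
  proof (rule lsum_cong)
    fix e assume e: "e \<in> kys (RR a N)"
    have sm: "(\<Sum>i<N. ex e i) = int N * int b" using homd_RR[of N a] e unfolding homd_def a_def sum_center by blast
    show "(\<Prod>i<N. evf (tev s) (SS 1 (ex e i))) = (if e = cent N (int b) then 1 else 0)"
    proof (cases "\<forall>i<N. ex e i = 0 \<or> ex e i = int b")
      case True
      have "ex e i = int b" if "i < N" for i
      proof (rule ccontr)
        assume "ex e i \<noteq> int b"
        then have "ex e i < int b" using True that by auto
        then have "(\<Sum>i<N. ex e i) < (\<Sum>i<N. int b)"
          by (intro sum_strict_mono_ex1) (use True that in auto)
        then show False using sm by simp
      qed
      moreover have "ex e i = 0" if "\<not> i < N" for i using supp_RR[of N a] e that unfolding supp_def by auto
      ultimately have "e = cent N (int b)" by (intro poly_mapping_eqI) (simp add: ex_cent)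
      moreover have "(\<Prod>i<N. evf (tev s) (SS 1 (ex e i))) = 1" using True by (intro prod.neutral) (auto simp: sv)
      ultimately show ?thesis by simp
    next
      case False
      then obtain i where i: "i < N" "ex e i \<noteq> 0" "ex e i \<noteq> int b" by auto
      then have "e \<noteq> cent N (int b)" by (auto simp: ex_cent)
      moreover have "(\<Prod>i<N. evf (tev s) (SS 1 (ex e i))) = 0" using i by (intro prod_zero) (auto simp: sv intro!: bexI[of _ i])
      ultimately show ?thesis by simp
    qed
  qed
  also have "\<dots> = cst (of_int (cf (RR a N) (cent N (int b))))"
    unfolding lsum_def by (simp add: if_distrib in_keys_iff cong: if_cong)
  finally show ?thesis using constant_term_nonzero[of "int b" N] unfolding a_def by (metis of_int_eq_0_iff)
qed

primrec Qit :: "int \<Rightarrow> nat \<Rightarrow> fock \<Rightarrow> fock" where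
  "Qit \<chi> 0 f = f" | "Qit \<chi> (Suc i) f = Qo (\<chi> + 2 * int i) (Qit \<chi> i f)"

lemma clin_Qit: "clin (Qit \<chi> i)"
  by (induction i) (auto simp: clin_id intro: clin_comp[OF clin_Q])

lemma Qit_add: "Qit \<chi> (i + j) f = Qit (\<chi> + 2 * int i) j (Qit \<chi> i f)"
  by (induction j) (auto simp: algebra_simps)

text \<open>The singular vector Q^i e^{-n alpha / 2}, stripped of its doubled charge -n + 2 i, which
  the context supplies.\<close>

definition Qp :: "nat \<Rightarrow> nat \<Rightarrow> fock" where "Qp n i = Qit (- int n) i 1"

lemma Qp_Vc: "Qp n i = Vc (\<lambda>i. - 1 - ip * (- int n + 2 * int i)) i"
  unfolding Qp_def by (induction i) (auto simp: Qo_def)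

lemma Qp_top_nz: "Qp n n \<noteq> 0"
proof -
  \<comment> \<open>The mode indices of Q^n on charge -n are centred at p - 1, a natural number, so
    that \<open>Vc_center\<close> applies.\<close>
  have e: "(\<lambda>i. - 1 - ip * (- int n + 2 * int i)) = (\<lambda>i. int (p - 1) + ip * (int n - 1 - 2 * int i))"
    using p2 by (auto simp: of_nat_diff algebra_simps)
  obtain t z where "z \<noteq> 0" "evf t (Qp n n) = cst z" unfolding Qp_Vc e using Vc_center by blast
  then show ?thesis using clin_0[OF clin_evf, of t] by auto
qed

lemma Qp_nz: "i \<le> n \<Longrightarrow> Qp n i \<noteq> 0"
proof
  assume i: "i \<le> n" and z: "Qp n i = 0"
  have "Qp n n = Qit (- int n + 2 * int i) (n - i) (Qp n i)" unfolding Qp_def using Qit_add[of "- int n" i "n - i" 1] i by simp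
  then show False using Qp_top_nz z clin_0[OF clin_Qit] by simp
qed

lemma lookup_var_0: "lookup (var j * g) {#} = 0"
proof (rule ccontr)
  assume "\<not> ?thesis"
  then have "{#} \<in> keys (var j * g)" by (simp add: in_keys_iff)
  then have "{#} \<in> {a + b |a b. a \<in> keys (var j) \<and> b \<in> keys g}" using keys_mult by blast
  then show False by (auto simp: var_def)
qed

lemma lookup_mult_empty: "lookup (f * g) {#} = lookup f {#} * lookup g {#}"
proof (induction f rule: fock_induct)
  case (scale z f) then show ?case by (simp add: mult.assoc)
qed (simp_all add: lookup_1 lookup_var_0 mult.assoc distrib_right lookup_add)

lemma lev_Vc: "lev (\<Sum>i<n. a i) (Vc a n)"
proof (induction n)
  case (Suc n) then show ?case using lev_V[OF Suc, of "a n" 2] by (simp add: add.commute)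
qed (simp add: lev_1)

lemma lev_Q: "lev n f \<Longrightarrow> lev (n - 1 - ip * \<chi>) (Qo \<chi> f)"
  unfolding Qo_def using lev_V[of n f "- 1 - ip * \<chi>" 2] by (simp add: algebra_simps)

text \<open>A preimage of the vacuum of charge n + 1 under Q^n, from which the surjectivity of Q^n
  is built up.\<close>

lemma subsingular_vector: "\<exists>f z. lev (int n) f \<and> z \<noteq> 0 \<and> Qit (1 - int n) n f = cst z"
proof -
  \<comment> \<open>With this value 2 p kappa = 1, so the expansion in \<open>V_SS\<close> stops
    after two terms.\<close>
  define \<kappa> where "\<kappa> = 1 / (2 * pc)"
  define a where "a = (\<lambda>i::nat. - 1 - ip * (1 - int n + 2 * int i))"
  have step: "V 2 m (SS \<kappa> (int b) * g) = SS \<kappa> (int b) * V 2 m g - SS \<kappa> (int b - 1) * V 2 (m + 1) g" for m b g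
  proof (cases b)
    case 0 then show ?thesis by simp
  next
    case (Suc b')
    have q: "pc * of_int 2 * \<kappa> = 1" by (simp add: \<kappa>_def)
    let ?t = "\<lambda>i. cst ((- 1) ^ i * (1 gchoose i)) * (SS \<kappa> (int b - int i) * V 2 (m + int i) g)"
    have "V 2 m (SS \<kappa> (int b) * g) = (\<Sum>i\<le>b. ?t i)" unfolding V_SS q ..
    also have "\<dots> = (\<Sum>i\<le>1. ?t i)"
    proof (rule sum.mono_neutral_right)
      have "(1 gchoose i :: complex) = 0" if "i > 1" for i
        using binomial_gbinomial[of 1 i, where 'a = complex] that by (simp add: binomial_eq_0)
      then show "\<forall>i\<in>{..b} - {..1}. ?t i = 0" by auto
    qed (use Suc in auto)
    also have "\<dots> = ?t 0 + ?t 1" by (simp add: atMost_Suc_eq_insert_0 numeral_eq_Suc)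
    finally show ?thesis by (simp add: cst_minus)
  qed
  have step': "V 2 m (SS \<kappa> b * g) = SS \<kappa> b * V 2 m g - SS \<kappa> (b - 1) * V 2 (m + 1) g" for m b g
  proof (cases "b < 0")
    case True then show ?thesis by (simp add: clin_0[OF clin_V])
  next
    case False then show ?thesis using step[of m "nat b" g] by simp
  qed
  \<comment> \<open>Only the summand with \<open>SS kappa 0\<close> has a constant term, and after n
    steps it is the last one. Its factor has the mode indices a_i + 1, which are centred at 0, so
    \<open>Vc_center\<close> shows that it does not vanish.\<close>
  have ind: "\<exists>g. Qit (1 - int n) k (SS \<kappa> (int n)) = (\<Sum>j\<le>k. SS \<kappa> (int n - int j) * g j) \<and> g k = cst ((- 1) ^ k) * Vc (\<lambda>i. a i + 1) k" for k
  proof (induction k)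
    case 0 show ?case by (intro exI[of _ "\<lambda>_. 1"]) simp
  next
    case (Suc k)
    then obtain g where g: "Qit (1 - int n) k (SS \<kappa> (int n)) = (\<Sum>j\<le>k. SS \<kappa> (int n - int j) * g j)" "g k = cst ((- 1) ^ k) * Vc (\<lambda>i. a i + 1) k" by blast
    define g' where "g' j = (if j \<le> k then V 2 (a k) (g j) else 0) - (if j = 0 then 0 else V 2 (a k + 1) (g (j - 1)))" for j
    have "Qit (1 - int n) (Suc k) (SS \<kappa> (int n)) = (\<Sum>j\<le>k. SS \<kappa> (int n - int j) * V 2 (a k) (g j)) - (\<Sum>j\<le>k. SS \<kappa> (int n - int j - 1) * V 2 (a k + 1) (g j))"
      by (simp add: g Qo_def a_def[symmetric] clin_sum[OF clin_V] step' sum_subtractf) (simp add: a_def)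
    also have "(\<Sum>j\<le>k. SS \<kappa> (int n - int j) * V 2 (a k) (g j)) = (\<Sum>j\<le>Suc k. SS \<kappa> (int n - int j) * (if j \<le> k then V 2 (a k) (g j) else 0))"
      by (rule sum.mono_neutral_cong_left) auto
    also have "(\<Sum>j\<le>k. SS \<kappa> (int n - int j - 1) * V 2 (a k + 1) (g j)) = (\<Sum>j\<le>Suc k. SS \<kappa> (int n - int j) * (if j = 0 then 0 else V 2 (a k + 1) (g (j - 1))))"
      unfolding sum.atMost_Suc_shift by (simp add: algebra_simps)
    finally have "Qit (1 - int n) (Suc k) (SS \<kappa> (int n)) = (\<Sum>j\<le>Suc k. SS \<kappa> (int n - int j) * g' j)"
      unfolding g'_def right_diff_distrib sum_subtractf .
    moreover have "g' (Suc k) = cst ((- 1) ^ Suc k) * Vc (\<lambda>i. a i + 1) (Suc k)"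
      by (simp add: g'_def g(2) clin_scale[OF clin_V] cst_minus)
    ultimately show ?case by blast
  qed
  obtain g where g: "Qit (1 - int n) n (SS \<kappa> (int n)) = (\<Sum>j\<le>n. SS \<kappa> (int n - int j) * g j)" "g n = cst ((- 1) ^ n) * Vc (\<lambda>i. a i + 1) n"
    using ind[of n] by blast
  have ae: "(\<lambda>i. a i + 1) = (\<lambda>i. int 0 + ip * (int n - 1 - 2 * int i))" unfolding a_def by (auto simp: algebra_simps)
  obtain t z where z: "z \<noteq> 0" "evf t (Vc (\<lambda>i. a i + 1) n) = cst z" unfolding ae using Vc_center by blast
  have "lev 0 (Vc (\<lambda>i. a i + 1) n)" using lev_Vc[of "\<lambda>i. a i + 1" n] sum_center[of "int 0" n] unfolding ae by simp
  then have v: "Vc (\<lambda>i. a i + 1) n = cst z"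
    using lev_zero_cst z(2) by (metis clin_cst[OF clin_evf] evf_1 mult_1_right)
  have "lookup (Qit (1 - int n) n (SS \<kappa> (int n))) {#} = (\<Sum>j\<le>n. lookup (SS \<kappa> (int n - int j)) {#} * lookup (g j) {#})"
    unfolding g(1) lookup_sum lookup_mult_empty ..
  also have "\<dots> = (\<Sum>j\<le>n. if j = n then lookup (g n) {#} else 0)"
    by (intro sum.cong refl) (auto simp: lookup_SS)
  also have "\<dots> = (- 1) ^ n * z" by (simp add: g(2) v lookup_cst)
  finally have c: "lookup (Qit (1 - int n) n (SS \<kappa> (int n))) {#} = (- 1) ^ n * z" .
  have lq: "lev (int n - (\<Sum>i<k. 1 + ip * (1 - int n + 2 * int i))) (Qit (1 - int n) k (SS \<kappa> (int n)))" for k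
  proof (induction k)
    case 0 then show ?case by (simp add: lev_SS)
  next
    case (Suc k) show ?case using lev_Q[OF Suc, of "1 - int n + 2 * int k"] by (simp add: algebra_simps)
  qed
  have "(\<Sum>i<n. 1 + ip * (1 - int n + 2 * int i)) = int n"
  proof -
    have "(\<Sum>i<n. 1 + ip * (1 - int n + 2 * int i)) = (\<Sum>i<n. 1 - (0 + ip * (int n - 1 - 2 * int i)))" by (simp add: algebra_simps)
    also have "\<dots> = int n - (\<Sum>i<n. 0 + ip * (int n - 1 - 2 * int i))" by (simp add: sum_subtractf)
    finally show ?thesis unfolding sum_center by simp
  qed
  then have "lev 0 (Qit (1 - int n) n (SS \<kappa> (int n)))" using lq[of n] by simp
  then have "Qit (1 - int n) n (SS \<kappa> (int n)) = cst ((- 1) ^ n * z)" using lev_zero_cst c by metis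
  then show ?thesis using lev_SS z(1) by (intro exI[of _ "SS \<kappa> (int n)"] exI[of _ "(- 1) ^ n * z"]) auto
qed

end

section \<open>The image and the kernel of a power of the screening operator\<close>

interpretation fv: vector_space "\<lambda>z f. cst z * (f :: fock)"
  by unfold_locales (simp_all add: distrib_left distrib_right cst_add cst_mult mult.assoc)

text \<open>The only dimension argument of the proof: as many independent vectors as there are
  coordinates form a basis.\<close>

lemma square_family_spans:
  assumes A: "finite A" and k: "\<And>c. c \<in> A \<Longrightarrow> keys (g c) \<subseteq> A"
    and ind: "\<And>u. (\<Sum>c\<in>A. cst (u c) * g c) = 0 \<Longrightarrow> \<forall>c\<in>A. u c = 0" and f: "keys f \<subseteq> A"
  shows "\<exists>u. f = (\<Sum>c\<in>A. cst (u c) * g c)"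
proof -
  have sp: "h \<in> fv.span (mon ` A)" if "keys h \<subseteq> A" for h
    by (subst fock_expand[OF A that], rule fv.span_sum, rule fv.span_scale, rule fv.span_base) simp
  have inj: "inj_on g A"
  proof (rule inj_onI)
    fix c d assume cd: "c \<in> A" "d \<in> A" "g c = g d"
    show "c = d"
    proof (rule ccontr)
      assume ne: "c \<noteq> d"
      define u where "u x = (if x = c then 1 else 0) - (if x = d then 1 else 0 :: complex)" for x
      have "(\<Sum>x\<in>A. cst (u x) * g x) = (\<Sum>x\<in>A. if x = c then g x else 0) - (\<Sum>x\<in>A. if x = d then g x else 0)"
        unfolding sum_subtractf[symmetric] by (intro sum.cong) (auto simp: u_def cst_minus)
      also have "\<dots> = 0" using cd A by simp
      finally show False using ind[of u] cd ne by (auto simp: u_def)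
    qed
  qed
  have indep: "\<not> fv.dependent (g ` A)"
  proof
    assume "fv.dependent (g ` A)"
    then obtain u where u: "\<exists>v\<in>g ` A. u v \<noteq> 0" "(\<Sum>v\<in>g ` A. cst (u v) * v) = 0"
      using fv.dependent_finite[of "g ` A"] A by auto
    have "(\<Sum>c\<in>A. cst (u (g c)) * g c) = 0" using u(2) by (simp add: sum.reindex[OF inj])
    then show False using ind[of "\<lambda>c. u (g c)"] u(1) by auto
  qed
  have "f \<in> fv.span (g ` A)"
  proof (rule ccontr)
    assume nf: "f \<notin> fv.span (g ` A)"
    then have "\<not> fv.dependent (insert f (g ` A))" using fv.independent_insert indep by auto
    moreover have "insert f (g ` A) \<subseteq> fv.span (mon ` A)" using sp k f by auto
    ultimately have "card (insert f (g ` A)) \<le> card (mon ` A)" using fv.independent_span_bound[of "mon ` A"] A by auto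
    moreover have "card (insert f (g ` A)) = Suc (card A)" using nf A fv.span_base by (subst card_insert_disjoint) (auto simp: card_image[OF inj])
    moreover have "card (mon ` A) \<le> card A" by (rule card_image_le[OF A])
    ultimately show False by simp
  qed
  then obtain u where "f = (\<Sum>v\<in>g ` A. cst (u v) * v)" unfolding fv.span_finite[OF finite_imageI[OF A]] by auto
  then show ?thesis by (intro exI[of _ "\<lambda>c. u (g c)"]) (simp add: sum.reindex[OF inj])
qed

definition wnorm :: "nat multiset set \<Rightarrow> (nat multiset \<Rightarrow> real) \<Rightarrow> fock \<Rightarrow> real" where
  "wnorm A w f = (\<Sum>c\<in>A. w c * cmod (lookup f c))"

lemma wnorm_add: "(\<And>c. w c \<ge> 0) \<Longrightarrow> wnorm A w (f + g) \<le> wnorm A w f + wnorm A w g"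
  unfolding wnorm_def sum.distrib[symmetric]
  by (intro sum_mono) (simp add: lookup_add norm_triangle_ineq mult_left_mono flip: distrib_left)
lemma wnorm_scale: "wnorm A w (cst z * f) = cmod z * wnorm A w f"
  unfolding wnorm_def lookup_cst_mult norm_mult sum_distrib_left by (simp add: mult_ac)
lemma wnorm_0 [simp]: "wnorm A w 0 = 0" by (simp add: wnorm_def)
lemma wnorm_mon: "finite A \<Longrightarrow> (\<And>c. w c \<ge> 0) \<Longrightarrow> wnorm A w (mon c) \<le> w c"
  by (simp add: wnorm_def lookup_mon if_distrib cong: if_cong)
lemma wnorm_sum: "(\<And>c. w c \<ge> 0) \<Longrightarrow> wnorm A w (sum g B) \<le> (\<Sum>b\<in>B. wnorm A w (g b))"
  by (induction B rule: infinite_finite_induct) (auto intro: order_trans[OF wnorm_add])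
lemma wnorm_sum_mset: "(\<And>c. w c \<ge> 0) \<Longrightarrow> wnorm A w (\<Sum>b\<in>#M. g b) \<le> (\<Sum>b\<in>#M. wnorm A w (g b))"
  by (induction M) (auto intro: order_trans[OF wnorm_add])

text \<open>In a vanishing combination the diagonal and the off-diagonal part have equal weighted
  norms, whereas dominance makes the off-diagonal one strictly smaller unless all coefficients are
  0.\<close>

lemma diagonally_dominant_independent:
  assumes A: "finite A" and w: "\<And>c. w c \<ge> 0"
    and dom: "\<And>c. c \<in> A \<Longrightarrow> wnorm A w (g c - cst (d c) * mon c) < cmod (d c) * w c"
    and z: "(\<Sum>c\<in>A. cst (u c) * g c) = 0" and c: "c \<in> A"
  shows "u c = 0"
proof (rule ccontr)
  assume "u c \<noteq> 0"
  define o' where "o' = (\<Sum>c\<in>A. cst (u c) * (g c - cst (d c) * mon c))"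
  have "o' = - (\<Sum>c\<in>A. cst (u c * d c) * mon c)"
    using z unfolding o'_def right_diff_distrib sum_subtractf cst_mult mult.assoc by simp
  note oe = this
  have "lookup o' b = - (u b * d b)" if "b \<in> A" for b
    using that A unfolding oe lookup_uminus lookup_sum lookup_cst_mult lookup_mon by (simp add: if_distrib[of "times _"] cong: if_cong)
  then have "wnorm A w o' = (\<Sum>b\<in>A. cmod (u b) * (cmod (d b) * w b))"
    by (simp add: wnorm_def norm_mult mult_ac)
  moreover have "wnorm A w o' \<le> (\<Sum>b\<in>A. cmod (u b) * wnorm A w (g b - cst (d b) * mon b))"
    unfolding o'_def wnorm_scale[symmetric] by (rule wnorm_sum[OF w])
  moreover have "(\<Sum>b\<in>A. cmod (u b) * wnorm A w (g b - cst (d b) * mon b)) < (\<Sum>b\<in>A. cmod (u b) * (cmod (d b) * w b))"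
  proof (rule sum_strict_mono_ex1[OF A])
    show "\<forall>b\<in>A. cmod (u b) * wnorm A w (g b - cst (d b) * mon b) \<le> cmod (u b) * (cmod (d b) * w b)"
      using dom by (auto intro!: mult_left_mono simp: less_imp_le)
    show "\<exists>b\<in>A. cmod (u b) * wnorm A w (g b - cst (d b) * mon b) < cmod (u b) * (cmod (d b) * w b)"
      using dom[OF c] c \<open>u c \<noteq> 0\<close> by (intro bexI[of _ c] mult_strict_left_mono) auto
  qed
  ultimately show False by simp
qed

context trip
begin

lemma lev_L': "lev k f \<Longrightarrow> k' = k - n \<Longrightarrow> lev k' (L \<chi> n f)" using lev_L by simp

text \<open>As \<open>hw 2\<close> is 1, the commutator of L_k with the field of e^alpha is a total
  derivative, and its residue vanishes.\<close>

lemma Q_L: "Qo \<chi> (L \<chi> k f) = L (\<chi> + 2) k (Qo \<chi> f)"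
proof -
  have "(of_int (- 1 - ip * \<chi> - k) + pc * of_int 2 * of_int \<chi> / 2 + (of_int k + 1) * hw 2 :: complex) = 0"
    by (simp add: hw_def field_simps)
  then show ?thesis unfolding Qo_def using L_V[of \<chi> 2 k "- 1 - ip * \<chi>" f] by simp
qed

lemma Qit_L: "Qit \<chi> i (L \<chi> k f) = L (\<chi> + 2 * int i) k (Qit \<chi> i f)"
  by (induction i) (auto simp: Q_L algebra_simps)

lemma L_neg_var: "L \<chi> (- int k - 1) (var b * f) = var b * L \<chi> (- int k - 1) f + cst (of_nat (b + 1)) * (var (b + k + 1) * f)"
proof -
  have "- int k - 1 + (- int b - 1) = - int (b + k + 1) - 1" by simp
  moreover have "of_int (- int b - 1) = - (of_nat (b + 1) :: complex)" by simp
  ultimately have "L \<chi> (- int k - 1) (al \<chi> (- int b - 1) f) = al \<chi> (- int b - 1) (L \<chi> (- int k - 1) f) + cst (of_nat (b + 1)) * al \<chi> (- int (b + k + 1) - 1) f"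
    using L_al[of \<chi> "- int k - 1" "- int b - 1" f] by (simp only: cst_minus) simp
  then show ?thesis unfolding al_neg .
qed

lemma L_neg_1: "L \<chi> (- int k - 1) 1 = cst (of_int \<chi> / 2 + (pc - 1) * of_nat k / (2 * pc)) * var k
   + cst (1 / (4 * pc)) * (\<Sum>i<k. var i * var (k - 1 - i))"
proof -
  let ?n = "- int k - 1"
  let ?T = "\<lambda>r. if r = ?n then cst (pc * of_int \<chi>) * var k else if r = 0 then cst (pc * of_int \<chi>) * var k else if ?n < r \<and> r < 0 then var (nat (- r - 1)) * var (nat (r - ?n - 1)) else 0"
  have T: "Lt \<chi> ?n 1 r = ?T r" for r
  proof -
    consider "r < ?n" | "r = ?n" | "?n < r" "r < 0" | "r = 0" | "r > 0" by linarith
    then show ?thesis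
    proof cases
      case 1 then show ?thesis by (simp add: Lt_def al_1 clin_0[OF clin_al])
    next
      case 2 then show ?thesis by (simp add: Lt_def al_0 al_neg clin_scale[OF clin_al, of \<chi> _ _ 1, simplified] clin_cst[OF clin_al])
    next
      case 3 then show ?thesis by (auto simp: Lt_def al_def algebra_simps)
    next
      case 4 then show ?thesis by (simp add: Lt_def al_0 al_neg clin_cst[OF clin_al])
    next
      case 5 then show ?thesis by (simp add: Lt_def al_1 clin_0[OF clin_al])
    qed
  qed
  have "Sum_any (Lt \<chi> ?n 1) = (\<Sum>r\<in>{?n..0}. ?T r)"
    unfolding T by (rule Sum_any.expand_superset) auto
  also have "{?n..0} = insert ?n (insert 0 {?n<..<0})" by auto
  also have "(\<Sum>r\<in>insert ?n (insert 0 {?n<..<0}). ?T r) = cst (pc * of_int \<chi>) * var k + (cst (pc * of_int \<chi>) * var k + (\<Sum>r\<in>{?n<..<0}. var (nat (- r - 1)) * var (nat (r - ?n - 1))))"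
    by (subst sum.insert; simp)+
  also have "(\<Sum>r\<in>{?n<..<0}. var (nat (- r - 1)) * var (nat (r - ?n - 1))) = (\<Sum>i<k. var i * var (k - 1 - i))"
    by (rule sum.reindex_bij_witness[of _ "\<lambda>i. - int i - 1" "\<lambda>r. nat (- r - 1)"]) (auto simp: nat_diff_distrib' intro!: arg_cong[of _ _ var])
  finally have S: "Sum_any (Lt \<chi> ?n 1) = cst (pc * of_int \<chi>) * var k + (cst (pc * of_int \<chi>) * var k + (\<Sum>i<k. var i * var (k - 1 - i)))" .
  have S: "Sum_any (Lt \<chi> ?n 1) = cst (2 * pc * of_int \<chi>) * var k + (\<Sum>i<k. var i * var (k - 1 - i))"
  proof -
    have "cst (2 * pc * of_int \<chi>) = cst (pc * of_int \<chi>) + cst (pc * of_int \<chi>)" unfolding cst_add[symmetric] by (rule arg_cong[of _ _ cst]) simp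
    then show ?thesis using S by (simp only: distrib_right add.assoc)
  qed
  have c: "1 / (4 * pc) * (2 * pc * of_int \<chi>) - (pc - 1) / (2 * pc) * (of_int ?n + 1) = of_int \<chi> / 2 + (pc - 1) * of_nat k / (2 * pc)"
    by (simp add: field_simps)
  have "L \<chi> ?n 1 = cst (1 / (4 * pc) * (2 * pc * of_int \<chi>) - (pc - 1) / (2 * pc) * (of_int ?n + 1)) * var k + cst (1 / (4 * pc)) * (\<Sum>i<k. var i * var (k - 1 - i))"
    unfolding L_def S al_neg cst_diff cst_mult by (simp add: algebra_simps)
  then show ?thesis unfolding c .
qed

text \<open>On the variables L_{-k-1} acts as a derivation that sends \<open>var b\<close> to a
  multiple of \<open>var (b + k + 1)\<close>; its value at the vacuum is added as a multiplication
  operator.\<close>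

lemma L_neg_mon: "L \<chi> (- int k - 1) (mon c) = mon c * L \<chi> (- int k - 1) 1 + (\<Sum>b\<in>#c. cst (of_nat (b + 1)) * mon (add_mset (b + k + 1) (c - {#b#})))"
proof (induction c)
  case (add x c)
  have e: "(\<Sum>b\<in>#c. cst (of_nat (b + 1)) * mon (add_mset (b + k + 1) (add_mset x c - {#b#}))) = var x * (\<Sum>b\<in>#c. cst (of_nat (b + 1)) * mon (add_mset (b + k + 1) (c - {#b#})))"
    unfolding sum_mset_distrib_left
  proof (rule arg_cong[of _ _ sum_mset], rule image_mset_cong)
    fix b assume b: "b \<in># c"
    then have "add_mset x c - {#b#} = add_mset x (c - {#b#})" by simp
    then show "cst (of_nat (b + 1)) * mon (add_mset (b + k + 1) (add_mset x c - {#b#})) = var x * (cst (of_nat (b + 1)) * mon (add_mset (b + k + 1) (c - {#b#})))"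
      by (simp add: mon_add mult_ac)
  qed
  show ?case unfolding mon_add[of x c] L_neg_var add e image_mset_add_mset sum_mset.add_mset
    by (simp add: mon_add algebra_simps)
qed simp

text \<open>\<open>hL \<chi> c\<close> is the value at \<open>mon c\<close> of \<open>\<Sum>\<^sub>j L\<^sub>-\<^sub>j \<alpha>(j)\<close>. On level \<open>r \<le> p \<chi>\<close> its matrix is strictly diagonally
  dominant for the weights \<open>(2 p)\<close> to the number of parts, hence invertible.\<close>

definition hL :: "int \<Rightarrow> nat multiset \<Rightarrow> fock" where
  "hL \<chi> c = (\<Sum>a\<in>#c. cst (2 * pc * of_nat (a + 1)) * L \<chi> (- int a - 1) (mon (c - {#a#})))"

lemma lev_sum_mset: "(\<And>x. x \<in># M \<Longrightarrow> lev n (g x)) \<Longrightarrow> lev n (\<Sum>x\<in>#M. g x)"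
  by (induction M) (auto intro: lev_add)

lemma lev_hL: "lev (int (pwt c)) (hL \<chi> c)"
  unfolding hL_def
proof (rule lev_sum_mset, rule lev_scale)
  fix a assume "a \<in># c"
  then obtain d where "c = add_mset a d" by (metis insert_DiffM)
  then show "lev (int (pwt c)) (L \<chi> (- int a - 1) (mon (c - {#a#})))"
    by (intro lev_L'[OF lev_mon[of "c - {#a#}"]]) simp
qed

lemma pwt_real: "(\<Sum>a\<in>#c. real a + 1) = real (pwt c)" by (induction c) auto

lemma hL_dominant:
  assumes r: "0 < pwt c" and chi: "int (pwt c) \<le> ip * \<chi>" and A: "finite A"
  defines "w \<equiv> \<lambda>c. (2 * real p) ^ size c"
  shows "wnorm A w (hL \<chi> c - cst (of_real (\<Sum>a\<in>#c. (real a + 1) * (real p * \<chi> + (real p - 1) * a))) * mon c)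
     < cmod (of_real (\<Sum>a\<in>#c. (real a + 1) * (real p * \<chi> + (real p - 1) * a))) * w c"
proof -
  define dd where "dd a = (real a + 1) * (real p * \<chi> + (real p - 1) * a)" for a :: nat
  define off where "off a = cst (2 * pc * of_nat (a + 1)) * (cst (1 / (4 * pc)) * (\<Sum>i<a. mon (add_mset i (add_mset (a - 1 - i) (c - {#a#}))))
      + (\<Sum>b\<in>#c - {#a#}. cst (of_nat (b + 1)) * mon (add_mset (b + a + 1) (c - {#a#} - {#b#}))))" for a
  have w0: "w c \<ge> 0" for c by (simp add: w_def)
  have t: "cst (2 * pc * of_nat (a + 1)) * L \<chi> (- int a - 1) (mon (c - {#a#})) = cst (of_real (dd a)) * mon c + off a" if "a \<in># c" for a
  proof -
    have m: "mon (c - {#a#}) * var a = mon c" using that by (metis insert_DiffM mon_add mult.commute)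
    have "2 * pc * of_nat (a + 1) * (of_int \<chi> / 2 + (pc - 1) * of_nat a / (2 * pc)) = of_real (dd a)"
      by (simp add: dd_def field_simps)
    then have d: "cst (of_real (dd a)) = cst (2 * pc * of_nat (a + 1)) * cst (of_int \<chi> / 2 + (pc - 1) * of_nat a / (2 * pc))"
      by (simp only: cst_mult[symmetric])
    have mm: "mon (c - {#a#}) * (\<Sum>i<a. var i * var (a - 1 - i)) = (\<Sum>i<a. mon (add_mset i (add_mset (a - 1 - i) (c - {#a#}))))"
      by (simp add: sum_distrib_left mon_add mult_ac)
    show ?thesis unfolding L_neg_mon L_neg_1 off_def d mm[symmetric] m[symmetric] by (simp only: distrib_left mult_ac add_ac)
  qed
  have "hL \<chi> c = (\<Sum>a\<in>#c. cst (of_real (dd a)) * mon c + off a)"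
    unfolding hL_def by (rule arg_cong[of _ _ sum_mset], rule image_mset_cong) (rule t)
  also have "\<dots> = cst (of_real (\<Sum>a\<in>#c. dd a)) * mon c + (\<Sum>a\<in>#c. off a)"
  proof -
    have "(\<Sum>a\<in>#M. cst (of_real (dd a)) * mon c) = cst (of_real (\<Sum>a\<in>#M. dd a)) * mon c" for M
      by (induction M) (auto simp: cst_add distrib_right)
    then show ?thesis by (simp add: sum_mset.distrib)
  qed
  finally have e: "hL \<chi> c - cst (of_real (\<Sum>a\<in>#c. dd a)) * mon c = (\<Sum>a\<in>#c. off a)" by simp
  \<comment> \<open>Splitting the part a adds a part, merging it with another one removes a part.
    With the weight 2 p per part, splitting contributes (a + 1) a p and merging (a + 1)
    (\<open>pwt c\<close> - a - 1), both relative to \<open>w c\<close>.\<close>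
  have wo: "wnorm A w (off a) \<le> (real a + 1) * (real a * p + real (pwt c) - a - 1) * w c" if a: "a \<in># c" for a
  proof -
    define d where "d = c - {#a#}"
    have c: "c = add_mset a d" using a by (simp add: d_def)
    have sz: "size (d - {#b#}) + 1 = size d" if "b \<in># d" for b using that by (metis Suc_eq_plus1 insert_DiffM size_add_mset)
    have "wnorm A w (\<Sum>i<a. mon (add_mset i (add_mset (a - 1 - i) d))) \<le> (\<Sum>i<a. (2 * real p) ^ (size d + 2))"
      by (rule order_trans[OF wnorm_sum[OF w0]], rule sum_mono, rule order_trans[OF wnorm_mon[OF A w0]]) (simp add: w_def)
    then have "wnorm A w (\<Sum>i<a. mon (add_mset i (add_mset (a - 1 - i) d))) \<le> a * (2 * real p) ^ (size d + 2)"
      by (simp only: sum_constant card_lessThan)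
    from mult_left_mono[OF this, of "1 / (4 * real p)"] have 1: "wnorm A w (cst (1 / (4 * pc)) * (\<Sum>i<a. mon (add_mset i (add_mset (a - 1 - i) d)))) \<le> 1 / (4 * real p) * (a * (2 * real p) ^ (size d + 2))"
      unfolding wnorm_scale norm_divide norm_mult norm_of_nat by simp
    have "wnorm A w (\<Sum>b\<in>#d. cst (of_nat (b + 1)) * mon (add_mset (b + a + 1) (d - {#b#}))) \<le> (\<Sum>b\<in>#d. wnorm A w (cst (of_nat (b + 1)) * mon (add_mset (b + a + 1) (d - {#b#}))))"
      by (rule wnorm_sum_mset[OF w0])
    also have "\<dots> \<le> (\<Sum>b\<in>#d. (real b + 1) * (2 * real p) ^ size d)"
    proof (rule sum_mset_mono)
      fix b assume b: "b \<in># d"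
      have "wnorm A w (mon (add_mset (b + a + 1) (d - {#b#}))) \<le> (2 * real p) ^ size d"
        by (rule order_trans[OF wnorm_mon[OF A w0]]) (use sz[OF b] in \<open>simp add: w_def flip: power_Suc\<close>)
      moreover have "cmod (of_nat (b + 1)) = real b + 1" unfolding norm_of_nat by simp
      ultimately show "wnorm A w (cst (of_nat (b + 1)) * mon (add_mset (b + a + 1) (d - {#b#}))) \<le> (real b + 1) * (2 * real p) ^ size d"
        unfolding wnorm_scale by (metis mult_left_mono norm_ge_zero)
    qed
    also have "\<dots> = real (pwt d) * (2 * real p) ^ size d" unfolding pwt_real[symmetric] sum_mset_distrib_right ..
    finally have 2: "wnorm A w (\<Sum>b\<in>#d. cst (of_nat (b + 1)) * mon (add_mset (b + a + 1) (d - {#b#}))) \<le> real (pwt d) * (2 * real p) ^ size d" .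
    have n: "cmod (2 * pc * of_nat (a + 1)) = 2 * real p * (real a + 1)" unfolding norm_mult norm_of_nat by simp
    have "wnorm A w (off a) \<le> 2 * real p * (real a + 1) * (1 / (4 * real p) * (a * (2 * real p) ^ (size d + 2)) + real (pwt d) * (2 * real p) ^ size d)"
      unfolding off_def wnorm_scale[of A w "2 * pc * of_nat (a + 1)"] n d_def[symmetric]
      by (intro mult_left_mono order_trans[OF wnorm_add[OF w0]] add_mono 1 2) auto
    also have "\<dots> = (real a + 1) * (real a * p + real (pwt c) - a - 1) * w c"
      using p2 by (simp add: w_def c field_simps power2_eq_square)
    finally show ?thesis .
  qed
  have "wnorm A w (\<Sum>a\<in>#c. off a) \<le> (\<Sum>a\<in>#c. (real a + 1) * (real a * p + real (pwt c) - a - 1) * w c)"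
    by (rule order_trans[OF wnorm_sum_mset[OF w0] sum_mset_mono]) (rule wo)
  also have "\<dots> = (\<Sum>a\<in>#c. (real a + 1) * (real a * p + real (pwt c) - a - 1)) * w c" by (rule sum_mset_distrib_right[symmetric])
  also have "\<dots> < (\<Sum>a\<in>#c. dd a) * w c"
  proof (rule mult_strict_right_mono)
    \<comment> \<open>The margin left by the part a is (a + 1) (p chi - \<open>pwt c\<close> + 1),
      which the bound on the level makes positive.\<close>
    have "(\<Sum>a\<in>#c. dd a) = (\<Sum>a\<in>#c. (real a + 1) * (real a * p + real (pwt c) - a - 1) + (real a + 1) * (real p * \<chi> - pwt c + 1))"
      by (rule arg_cong[of _ _ sum_mset], rule image_mset_cong) (simp add: dd_def algebra_simps)
    also have "\<dots> = (\<Sum>a\<in>#c. (real a + 1) * (real a * p + real (pwt c) - a - 1)) + real (pwt c) * (real p * \<chi> - pwt c + 1)"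
      by (subst sum_mset.distrib) (simp only: sum_mset_distrib_right[symmetric] pwt_real)
    finally have "(\<Sum>a\<in>#c. dd a) = (\<Sum>a\<in>#c. (real a + 1) * (real a * p + real (pwt c) - a - 1)) + real (pwt c) * (real p * \<chi> - pwt c + 1)" .
    moreover have "real (pwt c) * (real p * \<chi> - pwt c + 1) > 0"
    proof -
      have "real_of_int (int (pwt c)) \<le> real_of_int (ip * \<chi>)" using chi by (simp only: of_int_le_iff)
      then show ?thesis using r by simp
    qed
    ultimately show "(\<Sum>a\<in>#c. (real a + 1) * (real a * p + real (pwt c) - a - 1)) < (\<Sum>a\<in>#c. dd a)" by linarith
    show "0 < w c" using p2 by (simp add: w_def)
  qed
  also have "\<dots> \<le> cmod (of_real (\<Sum>a\<in>#c. dd a)) * w c" unfolding norm_of_real by (intro mult_right_mono w0) simp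
  finally show ?thesis unfolding e[symmetric] dd_def .
qed

lemma hL_spans:
  assumes r: "0 < r" "int r \<le> ip * \<chi>" and f: "lev (int r) f"
  shows "\<exists>u. f = (\<Sum>c\<in>{c. pwt c = r}. cst (u c) * hL \<chi> c)"
proof (rule square_family_spans)
  show A: "finite {c. pwt c = r}" by (rule finite_pwt_eq)
  show "keys f \<subseteq> {c. pwt c = r}" using f by (auto simp: lev_def)
  show "keys (hL \<chi> c) \<subseteq> {c. pwt c = r}" if "c \<in> {c. pwt c = r}" for c using lev_hL[of c \<chi>] that by (auto simp: lev_def)
  fix u assume z: "(\<Sum>c\<in>{c. pwt c = r}. cst (u c) * hL \<chi> c) = 0"
  show "\<forall>c\<in>{c. pwt c = r}. u c = 0"
  proof
    fix c assume c: "c \<in> {c. pwt c = r}"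
    show "u c = 0"
      by (rule diagonally_dominant_independent[OF A _ hL_dominant[OF _ _ A] z c]) (use r in auto)
  qed
qed

text \<open>The image is stable under Virasoro modes, and \<open>hL_spans\<close> writes a vector of
  positive level as a sum of negative Virasoro modes applied to lower levels. The induction starts
  with \<open>subsingular_vector\<close>.\<close>

lemma Q_power_surjective:
  assumes "int r \<le> ip * (int n + 1)" "lev (int r) f"
  shows "\<exists>y. lev (int r + int n) y \<and> Qit (1 - int n) n y = f"
  using assms
proof (induction r arbitrary: f rule: less_induct)
  case (less r)
  let ?P = "\<lambda>f. \<exists>y. lev (int r + int n) y \<and> Qit (1 - int n) n y = f"
  have P0: "?P 0" using clin_0[OF clin_Qit] lev_0 by blast
  have Padd: "?P (f + g)" if "?P f" "?P g" for f g
    using that clin_add[OF clin_Qit] lev_add by metis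
  have Psc: "?P (cst z * f)" if "?P f" for z f
    using that clin_scale[OF clin_Qit] lev_scale by metis
  show ?case
  proof (cases "r = 0")
    case True
    obtain x z where x: "lev (int n) x" "z \<noteq> 0" "Qit (1 - int n) n x = cst z" using subsingular_vector by blast
    have "f = cst (lookup f {#})" using less.prems(2) True lev_zero_cst by simp
    also have "\<dots> = Qit (1 - int n) n (cst (lookup f {#} / z) * x)"
      using x(2) unfolding clin_scale[OF clin_Qit] x(3) by (simp flip: cst_mult)
    finally show ?thesis using lev_scale[OF x(1)] True by (metis add_0 of_nat_0)
  next
    case False
    obtain u where u: "f = (\<Sum>c\<in>{c. pwt c = r}. cst (u c) * hL (int n + 1) c)"
      using hL_spans[of r "int n + 1" f] False less.prems by auto
    have hP: "?P (hL (int n + 1) c)" if c: "pwt c = r" for c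
    proof -
      have "?P (cst (2 * pc * of_nat (a + 1)) * L (int n + 1) (- int a - 1) (mon (c - {#a#})))" if a: "a \<in># c" for a
      proof (rule Psc)
        obtain d where d: "c = add_mset a d" using a by (metis insert_DiffM)
        have "pwt d < r" using c d by simp
        moreover have "int (pwt d) \<le> ip * (int n + 1)" using less.prems(1) c d by simp
        ultimately obtain y where y: "lev (int (pwt d) + int n) y" "Qit (1 - int n) n y = mon d" using less.IH[of "pwt d" "mon d"] lev_mon by blast
        have "lev (int r + int n) (L (1 - int n) (- int a - 1) y)" by (rule lev_L'[OF y(1)]) (use c d in simp)
        then show "?P (L (int n + 1) (- int a - 1) (mon (c - {#a#})))"
          using Qit_L[of "1 - int n" n "- int a - 1" y] y(2) d
          by (intro exI[of _ "L (1 - int n) (- int a - 1) y"]) (simp add: add.commute)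
      qed
      then have "set_mset M \<subseteq> set_mset c \<Longrightarrow> ?P (\<Sum>a\<in>#M. cst (2 * pc * of_nat (a + 1)) * L (int n + 1) (- int a - 1) (mon (c - {#a#})))" for M
      proof (induction M)
        case empty show ?case using P0 by simp
      next
        case (add x M)
        then show ?case unfolding image_mset_add_mset sum_mset.add_mset by (intro Padd) auto
      qed
      then show ?thesis unfolding hL_def by blast
    qed
    have "?P (\<Sum>c\<in>B. cst (u c) * hL (int n + 1) c)" if "finite B" "B \<subseteq> {c. pwt c = r}" for B
      using that
    proof (induction B rule: finite_induct)
      case empty show ?case using P0 by simp
    next
      case (insert x B) then show ?case unfolding sum.insert[OF insert.hyps] by (intro Padd Psc hP) auto
    qed
    then show ?thesis using u finite_pwt_eq by blast
  qed
qed

end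

section \<open>Degree in alpha(-1) and leading symbols\<close>

definition Dle :: "int \<Rightarrow> fock \<Rightarrow> bool" where "Dle d f \<longleftrightarrow> (\<forall>c\<in>keys f. int (count c 0) \<le> d)"
definition Dh :: "int \<Rightarrow> fock \<Rightarrow> bool" where "Dh d f \<longleftrightarrow> (\<forall>c\<in>keys f. int (count c 0) = d)"

lemma Dle_0 [simp]: "Dle d 0" by (simp add: Dle_def)
lemma Dle_add: "Dle d f \<Longrightarrow> Dle d g \<Longrightarrow> Dle d (f + g)" unfolding Dle_def using keys_add[of f g] by blast
lemma Dle_diff: "Dle d f \<Longrightarrow> Dle d g \<Longrightarrow> Dle d (f - g)" unfolding Dle_def using keys_diff[of f g] by blast
lemma Dle_scale: "Dle d f \<Longrightarrow> Dle d (cst z * f)" by (auto simp: Dle_def in_keys_iff)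
lemma Dle_sum: "(\<And>x. x \<in> A \<Longrightarrow> Dle d (g x)) \<Longrightarrow> Dle d (sum g A)"
  by (induction A rule: infinite_finite_induct) (auto intro: Dle_add)
lemma Dle_sum_mset: "(\<And>x. x \<in># M \<Longrightarrow> Dle d (g x)) \<Longrightarrow> Dle d (\<Sum>x\<in>#M. g x)"
  by (induction M) (auto intro: Dle_add)
lemma Dle_mono: "Dle d f \<Longrightarrow> d \<le> e \<Longrightarrow> Dle e f" by (force simp: Dle_def)
lemma Dle_mult: "Dle d f \<Longrightarrow> Dle e g \<Longrightarrow> Dle (d + e) (f * g)"
  unfolding Dle_def using keys_mult[of f g] by fastforce
lemma Dle_mon: "int (count c 0) \<le> d \<Longrightarrow> Dle d (mon c)" by (simp add: Dle_def)
lemma Dh_Dle: "Dh d f \<Longrightarrow> Dle d f" by (simp add: Dh_def Dle_def)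
lemma Dh_mult: "Dh d f \<Longrightarrow> Dh e g \<Longrightarrow> Dh (d + e) (f * g)"
  unfolding Dh_def using keys_mult[of f g] by fastforce
lemma Dh_mon: "int (count c 0) = d \<Longrightarrow> Dh d (mon c)" by (simp add: Dh_def)
lemma Dh_scale: "Dh d f \<Longrightarrow> Dh d (cst z * f)" by (auto simp: Dh_def in_keys_iff)
lemma Dh_sum: "(\<And>x. x \<in> A \<Longrightarrow> Dh d (g x)) \<Longrightarrow> Dh d (sum g A)"
proof (induction A rule: infinite_finite_induct)
  case (insert x A)
  then show ?case unfolding sum.insert[OF insert.hyps] Dh_def using keys_add[of "g x" "sum g A"] by auto
qed (auto simp: Dh_def)

text \<open>Leading parts multiply without cancellation because the Fock space is a domain, and the
  homogeneous P is its own leading part.\<close>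

lemma top_degree_cancel:
  assumes P: "Dh a P" and v: "Dle d v" "\<not> Dle (d - 1) v" and pv: "Dle (a + d - 1) (P * v)"
  shows "P = 0"
proof -
  define v1 where "v1 = (\<Sum>c\<in>{c\<in>keys v. int (count c 0) = d}. cst (lookup v c) * mon c)"
  define v2 where "v2 = (\<Sum>c\<in>{c\<in>keys v. int (count c 0) \<noteq> d}. cst (lookup v c) * mon c)"
  have vv: "v = v1 + v2"
  proof -
    have "v = (\<Sum>c\<in>keys v. cst (lookup v c) * mon c)" by (rule fock_expand) auto
    also have "\<dots> = v1 + v2" unfolding v1_def v2_def by (subst sum.union_disjoint[symmetric]) (auto intro!: sum.cong)
    finally show ?thesis .
  qed
  have v1: "Dh d v1" unfolding v1_def by (intro Dh_sum Dh_scale Dh_mon) simp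
  have v2: "Dle (d - 1) v2" unfolding v2_def using v(1) by (intro Dle_sum Dle_scale Dle_mon) (force simp: Dle_def)
  have "v1 \<noteq> 0" using v(2) v2 vv by auto
  have "Dle (a + (d - 1)) (P * v2)" by (rule Dle_mult[OF Dh_Dle[OF P] v2])
  then have "Dle (a + d - 1) (P * v - P * v2)" using pv by (intro Dle_diff) (simp_all add: algebra_simps)
  then have "Dle (a + d - 1) (P * v1)" unfolding vv by (simp add: algebra_simps)
  moreover have "Dh (a + d) (P * v1)" by (rule Dh_mult[OF P v1])
  ultimately have "keys (P * v1) = {}" unfolding Dle_def Dh_def by fastforce
  then have "P * v1 = 0" by simp
  then show ?thesis using \<open>v1 \<noteq> 0\<close> by simp
qed

text \<open>The monomials of highest degree in \<open>\<alpha>(-1)\<close> that occur in Virasoro monomials. The multiplicity of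
  \<open>L\<^sub>-\<^sub>1\<close> is lost in them, but it is recovered from the dependence of the coefficients on \<open>\<chi>\<close>.\<close>

definition top_part :: "nat \<Rightarrow> nat multiset" where
  "top_part k = (if k = 0 then {#0#} else if k = 1 then {#0, 0#} else {#0, k - 1#})"
definition top_mset :: "nat multiset \<Rightarrow> nat multiset" where "top_mset \<mu> = (\<Sum>k\<in>#\<mu>. top_part k)"

lemma top_mset_add: "top_mset (add_mset k \<mu>) = top_part k + top_mset \<mu>" by (simp add: top_mset_def)
lemma count_tm: "0 < j \<Longrightarrow> count (top_mset \<mu>) j = count \<mu> (j + 1)"
  by (induction \<mu>) (auto simp: top_mset_add top_part_def, simp add: top_mset_def)
lemma count_tm_0: "count (top_mset \<mu>) 0 = count \<mu> 0 + 2 * count \<mu> 1 + size (filter_mset (\<lambda>k. 2 \<le> k) \<mu>)"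
  by (induction \<mu>) (auto simp: top_mset_add top_part_def, simp add: top_mset_def)
text \<open>The element k stands for L_{-k-1}. From k = 2 on multiplicities can be read off; 0 and 1
  both contribute powers of \<open>var 0\<close> only, so one of their multiplicities has to be
  given.\<close>

lemma top_mset_inj: assumes "top_mset \<mu> = top_mset \<nu>" "count \<mu> 0 = count \<nu> 0" shows "\<mu> = \<nu>"
proof -
  have ge2: "count \<mu> k = count \<nu> k" if "2 \<le> k" for k
    using count_tm[of "k - 1" \<mu>] count_tm[of "k - 1" \<nu>] assms(1) that by simp
  then have "filter_mset (\<lambda>k. 2 \<le> k) \<mu> = filter_mset (\<lambda>k. 2 \<le> k) \<nu>" by (intro multiset_eqI) simp
  then have "count \<mu> 1 = count \<nu> 1" using count_tm_0[of \<mu>] count_tm_0[of \<nu>] assms by simp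
  then show ?thesis using ge2 assms(2) by (intro multiset_eqI) (metis One_nat_def less_2_cases not_less)
qed

context trip
begin

definition top_sym :: "int \<Rightarrow> nat \<Rightarrow> fock" where
  "top_sym \<chi> k = cst (if k = 0 then of_int \<chi> / 2 else if k = 1 then 1 / (4 * pc) else 1 / (2 * pc)) * mon (top_part k)"
text \<open>The coefficient in \<open>top_sym\<close> without its dependence on chi.\<close>

definition kap :: "nat \<Rightarrow> complex" where
  "kap k = (if k = 0 then 1 else if k = 1 then 1 / (4 * pc) else 1 / (2 * pc))"

lemma L_1_top: "Dle 0 (L \<chi> (- int k - 1) 1 - top_sym \<chi> k)"
proof -
  have v: "Dle 0 (var j)" if "0 < j" for j using that unfolding var_def by (intro Dle_mon) simp
  consider "k = 0" | "k = 1" | j where "k = Suc (Suc j)" by (metis One_nat_def nat.exhaust)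
  then show ?thesis
  proof cases
    case 1 then show ?thesis by (simp add: L_m1_1 top_sym_def top_part_def var_def)
  next
    case 2 then show ?thesis unfolding L_neg_1 top_sym_def top_part_def using v[of 1] by (simp add: mon_add Dle_scale)
  next
    case 3
    have s: "(\<Sum>i<k. var i * var (k - 1 - i)) = (\<Sum>i<j. var (Suc i) * var (j - i)) + cst 2 * (var 0 * var (Suc j))"
    proof -
      have "(\<Sum>i<k. var i * var (k - 1 - i)) = var 0 * var (Suc j) + (\<Sum>i<Suc j. var (Suc i) * var (j - i))"
        unfolding 3 sum.lessThan_Suc_shift[of _ "Suc j"] by simp
      also have "\<dots> = var 0 * var (Suc j) + ((\<Sum>i<j. var (Suc i) * var (j - i)) + var (Suc j) * var 0)" by simp
      also have "cst 2 = 1 + 1" using cst_add[of 1 1] by simp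
      ultimately show ?thesis by (simp add: algebra_simps)
    qed
    have t: "top_sym \<chi> k = cst (1 / (4 * pc)) * (cst 2 * (var 0 * var (Suc j)))"
      unfolding top_sym_def top_part_def 3 by (simp add: mon_add flip: cst_mult mult.assoc)
    have "L \<chi> (- int k - 1) 1 - top_sym \<chi> k = cst (of_int \<chi> / 2 + (pc - 1) * of_nat k / (2 * pc)) * var k + cst (1 / (4 * pc)) * (\<Sum>i<j. var (Suc i) * var (j - i))"
      unfolding L_neg_1 s t by (simp add: algebra_simps)
    moreover have "Dle 0 (var (Suc i) * var (j - i))" if "i < j" for i using Dle_mult[OF v v, of "Suc i" "j - i"] that by simp
    ultimately show ?thesis using v[of k] 3 by (simp del: cst_add) (intro Dle_add Dle_scale Dle_sum; simp)
  qed
qed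

text \<open>The derivation part of L_{-k-1} replaces a factor by one of larger index and never
  creates \<open>var 0\<close>; all growth of the degree comes from the value at the vacuum.\<close>

lemma L_top: assumes "Dle d f" shows "Dle d (L \<chi> (- int k - 1) f - top_sym \<chi> k * f)"
proof -
  let ?T = "\<lambda>f. L \<chi> (- int k - 1) f - top_sym \<chi> k * f"
  have T: "clin ?T" by (intro clin_sub clin_L clin_mult)
  have m: "Dle (int (count c 0)) (?T (mon c))" for c
  proof -
    have "?T (mon c) = mon c * (L \<chi> (- int k - 1) 1 - top_sym \<chi> k) + (\<Sum>b\<in>#c. cst (of_nat (b + 1)) * mon (add_mset (b + k + 1) (c - {#b#})))"
      unfolding L_neg_mon by (simp add: algebra_simps)
    moreover have "Dle (int (count c 0) + 0) (mon c * (L \<chi> (- int k - 1) 1 - top_sym \<chi> k))" by (intro Dle_mult L_1_top Dle_mon) simp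
    moreover have "Dle (int (count c 0)) (\<Sum>b\<in>#c. cst (of_nat (b + 1)) * mon (add_mset (b + k + 1) (c - {#b#})))"
      by (intro Dle_sum_mset Dle_scale Dle_mon) simp
    ultimately show ?thesis by (simp add: Dle_add)
  qed
  have "?T f = (\<Sum>c\<in>keys f. cst (lookup f c) * ?T (mon c))"
    using arg_cong[of _ _ ?T, OF fock_expand[OF finite_keys order_refl, of f]] unfolding clin_sum[OF T] clin_scale[OF T] .
  moreover have "Dle d (\<Sum>c\<in>keys f. cst (lookup f c) * ?T (mon c))"
    using assms by (intro Dle_sum Dle_scale Dle_mono[OF m]) (auto simp: Dle_def)
  ultimately show ?thesis by simp
qed

section \<open>Virasoro monomials and their independence\<close>

definition LLl :: "int \<Rightarrow> nat list \<Rightarrow> fock \<Rightarrow> fock" where "LLl \<chi> ks = foldr (\<lambda>k. L \<chi> (- int k - 1)) ks"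
definition LL :: "int \<Rightarrow> nat multiset \<Rightarrow> fock \<Rightarrow> fock" where "LL \<chi> \<mu> = LLl \<chi> (sorted_list_of_multiset \<mu>)"

lemma LLl_simps [simp]: "LLl \<chi> [] f = f" "LLl \<chi> (k # ks) f = L \<chi> (- int k - 1) (LLl \<chi> ks f)" by (simp_all add: LLl_def)

lemma lev_LLl: "lev r f \<Longrightarrow> lev (r + int (pwt (mset ks))) (LLl \<chi> ks f)"
  by (induction ks) (auto intro!: lev_L')
lemma lev_LL: "lev r f \<Longrightarrow> lev (r + int (pwt \<mu>)) (LL \<chi> \<mu> f)" unfolding LL_def using lev_LLl[of r f "sorted_list_of_multiset \<mu>"] by simp
lemma Qit_LLl: "Qit \<chi> i (LLl \<chi> ks f) = LLl (\<chi> + 2 * int i) ks (Qit \<chi> i f)"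
  by (induction ks) (auto simp: Qit_L)
lemma Qit_LL: "Qit \<chi> i (LL \<chi> \<mu> f) = LL (\<chi> + 2 * int i) \<mu> (Qit \<chi> i f)" by (simp add: LL_def Qit_LLl)
lemma clin_LLl: "clin (LLl \<chi> ks)"
proof (induction ks)
  case Nil then show ?case by (simp add: LLl_def clin_id)
next
  case (Cons k ks) then show ?case using clin_comp[OF clin_L Cons] by simp
qed
lemma clin_LL: "clin (LL \<chi> \<mu>)" by (simp add: LL_def clin_LLl)

definition Tm :: "int \<Rightarrow> nat multiset \<Rightarrow> fock" where "Tm \<chi> \<mu> = prod_mset (image_mset (top_sym \<chi>) \<mu>)"

lemma Tm_eq: "Tm \<chi> \<mu> = cst ((of_int \<chi> / 2) ^ count \<mu> 0 * prod_mset (image_mset kap \<mu>)) * mon (top_mset \<mu>)"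
proof (induction \<mu>)
  case empty show ?case by (simp add: Tm_def top_mset_def)
next
  case (add k \<mu>)
  have t: "top_sym \<chi> k = cst ((if k = 0 then of_int \<chi> / 2 else 1) * kap k) * mon (top_part k)" by (auto simp: top_sym_def kap_def)
  have "Tm \<chi> (add_mset k \<mu>) = top_sym \<chi> k * Tm \<chi> \<mu>" by (simp add: Tm_def)
  also have "\<dots> = cst ((if k = 0 then of_int \<chi> / 2 else 1) * kap k * ((of_int \<chi> / 2) ^ count \<mu> 0 * prod_mset (image_mset kap \<mu>))) * mon (top_mset (add_mset k \<mu>))"
    unfolding t add top_mset_add mon_plus cst_mult by (simp only: mult_ac)
  also have "(if k = 0 then of_int \<chi> / 2 else 1) * kap k * ((of_int \<chi> / 2) ^ count \<mu> 0 * prod_mset (image_mset kap \<mu>)) = (of_int \<chi> / 2) ^ count (add_mset k \<mu>) 0 * prod_mset (image_mset kap (add_mset k \<mu>))"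
    by auto
  finally show ?case .
qed

lemma Tm_Dh: "Dh (int (count (top_mset \<mu>) 0)) (Tm \<chi> \<mu>)" unfolding Tm_eq by (intro Dh_scale Dh_mon) simp

lemma kap_nz: "prod_mset (image_mset kap \<mu>) \<noteq> 0" by (induction \<mu>) (auto simp: kap_def)

lemma LLl_top: assumes "Dle d f" shows "Dle (d + int (count (top_mset (mset ks)) 0) - 1) (LLl \<chi> ks f - Tm \<chi> (mset ks) * f)"
proof (induction ks)
  case Nil show ?case by (simp add: Tm_def)
next
  case (Cons k ks)
  let ?g = "LLl \<chi> ks f" and ?T = "Tm \<chi> (mset ks)" and ?e = "int (count (top_mset (mset ks)) 0)"
  have "Dle (?e + d) (?T * f)" by (intro Dle_mult Dh_Dle[OF Tm_Dh] assms)
  then have "Dle (d + ?e) ((?g - ?T * f) + ?T * f)" by (intro Dle_add Dle_mono[OF Cons]) (auto simp: add.commute)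
  then have 1: "Dle (d + ?e) (L \<chi> (- int k - 1) ?g - top_sym \<chi> k * ?g)" by (intro L_top) simp
  have t: "Dle (int (count (top_part k) 0)) (top_sym \<chi> k)" unfolding top_sym_def by (intro Dle_scale Dle_mon) simp
  have "count (top_part k) 0 \<ge> 1" by (simp add: top_part_def)
  then have "Dle (int (count (top_part k) 0) + (d + ?e - 1)) ((L \<chi> (- int k - 1) ?g - top_sym \<chi> k * ?g) + top_sym \<chi> k * (?g - ?T * f))"
    by (intro Dle_add Dle_mono[OF 1] Dle_mult t Cons) simp
  moreover have "(L \<chi> (- int k - 1) ?g - top_sym \<chi> k * ?g) + top_sym \<chi> k * (?g - ?T * f) = LLl \<chi> (k # ks) f - Tm \<chi> (mset (k # ks)) * f"
    by (simp add: Tm_def algebra_simps)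
  moreover have "int (count (top_part k) 0) + (d + ?e - 1) = d + int (count (top_mset (mset (k # ks))) 0) - 1" by (simp add: top_mset_add)
  ultimately show ?case by (simp only:)
qed

lemma LL_top: "Dle d f \<Longrightarrow> Dle (d + int (count (top_mset \<mu>) 0) - 1) (LL \<chi> \<mu> f - Tm \<chi> \<mu> * f)"
  unfolding LL_def using LLl_top[of d f "sorted_list_of_multiset \<mu>" \<chi>] by simp

lemma exact_degree: assumes "v \<noteq> 0" shows "\<exists>d. Dle d v \<and> \<not> Dle (d - 1) v"
proof -
  let ?S = "(\<lambda>c. int (count c 0)) ` keys v"
  have S: "finite ?S" "?S \<noteq> {}" using assms by auto
  have "Dle (Max ?S) v" unfolding Dle_def using S by auto
  moreover have "\<not> Dle (Max ?S - 1) v" unfolding Dle_def using Max_in[OF S] by force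
  ultimately show ?thesis by blast
qed

text \<open>The powers Q^i with i at most k transport a relation to k + 1 different charges, each
  time to a nonzero singular vector, which can be cancelled from the leading part. So a polynomial
  of degree at most k in chi / 2 has k + 1 zeros.\<close>

lemma LL_independent:
  assumes B: "B = {\<mu>. pwt \<mu> = r \<and> count \<mu> 0 \<le> k}" and z: "(\<Sum>\<mu>\<in>B. cst (w \<mu>) * LL (- int k) \<mu> 1) = 0"
  shows "\<forall>\<mu>\<in>B. w \<mu> = 0"
proof (rule ccontr)
  assume nz: "\<not> (\<forall>\<mu>\<in>B. w \<mu> = 0)"
  define S where "S = {\<mu>\<in>B. w \<mu> \<noteq> 0}"
  have fB: "finite B" unfolding B by (rule finite_subset[OF _ finite_pwt_eq[of r]]) auto
  then have S: "finite S" "S \<noteq> {}" using nz by (auto simp: S_def)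
  define E where "E \<mu> = count (top_mset \<mu>) 0" for \<mu>
  define D where "D = Max (E ` S)"
  obtain \<mu>0 where mu0: "\<mu>0 \<in> S" "E \<mu>0 = D" using Max_in[of "E ` S"] S unfolding D_def by fastforce
  have ED: "E \<mu> \<le> D" if "\<mu> \<in> S" for \<mu> using that S(1) by (auto simp: D_def)
  define C where "C = {\<mu>\<in>B. top_mset \<mu> = top_mset \<mu>0}"
  define \<kappa> where "\<kappa> \<mu> = prod_mset (image_mset kap \<mu>)" for \<mu>
  have root: "(\<Sum>\<mu>\<in>C. w \<mu> * \<kappa> \<mu> * (of_int (- int k + 2 * int i) / 2) ^ count \<mu> 0) = 0" if i: "i \<le> k" for i
  proof -
    define \<chi> where "\<chi> = - int k + 2 * int i"
    define v where "v = Qp k i"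
    define P where "P = (\<Sum>\<mu>\<in>{\<mu>\<in>B. E \<mu> = D}. cst (w \<mu>) * Tm \<chi> \<mu>)"
    have v0: "v \<noteq> 0" unfolding v_def by (rule Qp_nz[OF i])
    obtain d where d: "Dle d v" "\<not> Dle (d - 1) v" using exact_degree[OF v0] by blast
    have "Qit (- int k) i (\<Sum>\<mu>\<in>B. cst (w \<mu>) * LL (- int k) \<mu> 1) = 0" unfolding z by (rule clin_0[OF clin_Qit])
    then have zi: "(\<Sum>\<mu>\<in>B. cst (w \<mu>) * LL \<chi> \<mu> v) = 0"
      unfolding clin_sum[OF clin_Qit] clin_scale[OF clin_Qit] Qit_LL \<chi>_def v_def Qp_def .
    have "P * v = (\<Sum>\<mu>\<in>B. if E \<mu> = D then cst (w \<mu>) * (Tm \<chi> \<mu> * v) else 0)"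
      unfolding P_def sum_distrib_right by (subst sum.inter_filter[OF fB]) (simp only: mult.assoc)
    then have Pv: "P * v = (\<Sum>\<mu>\<in>B. (if E \<mu> = D then cst (w \<mu>) * (Tm \<chi> \<mu> * v) else 0) - cst (w \<mu>) * LL \<chi> \<mu> v)"
      unfolding sum_subtractf zi by simp
    have "Dle (int D + d - 1) (P * v)" unfolding Pv
    proof (rule Dle_sum)
      fix \<mu> assume mu: "\<mu> \<in> B"
      show "Dle (int D + d - 1) ((if E \<mu> = D then cst (w \<mu>) * (Tm \<chi> \<mu> * v) else 0) - cst (w \<mu>) * LL \<chi> \<mu> v)"
      proof (cases "w \<mu> = 0")
        case True then show ?thesis by simp
      next
        case False
        then have le: "E \<mu> \<le> D" using ED mu by (simp add: S_def)
        have t: "Dle (d + int (E \<mu>) - 1) (LL \<chi> \<mu> v - Tm \<chi> \<mu> * v)" unfolding E_def by (rule LL_top[OF d(1)])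
        show ?thesis
        proof (cases "E \<mu> = D")
          case True
          have "(if E \<mu> = D then cst (w \<mu>) * (Tm \<chi> \<mu> * v) else 0) - cst (w \<mu>) * LL \<chi> \<mu> v = cst (- w \<mu>) * (LL \<chi> \<mu> v - Tm \<chi> \<mu> * v)"
            using True by (simp add: cst_minus right_diff_distrib)
          moreover have "d + int (E \<mu>) - 1 = int D + d - 1" using True by simp
          ultimately show ?thesis using Dle_scale[OF t, of "- w \<mu>"] by (simp only:)
        next
          case False
          have "Dle (int (E \<mu>) + d) (Tm \<chi> \<mu> * v)" unfolding E_def by (intro Dle_mult Dh_Dle[OF Tm_Dh] d)
          then have "Dle (int D + d - 1) ((LL \<chi> \<mu> v - Tm \<chi> \<mu> * v) + Tm \<chi> \<mu> * v)"
            using le False by (intro Dle_add Dle_mono[OF t]) (auto elim: Dle_mono)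
          then have "Dle (int D + d - 1) (cst (- w \<mu>) * LL \<chi> \<mu> v)" by (intro Dle_scale) simp
          then show ?thesis using False by (simp add: cst_minus)
        qed
      qed
    qed
    moreover have "Dh (int D) P" unfolding P_def by (intro Dh_sum Dh_scale) (use Tm_Dh in \<open>auto simp: E_def\<close>)
    ultimately have P0: "P = 0" using top_degree_cancel[OF _ d] by blast
    have "0 = lookup P (top_mset \<mu>0)" by (simp add: P0)
    also have "\<dots> = (\<Sum>\<mu>\<in>{\<mu>\<in>B. E \<mu> = D}. if top_mset \<mu> = top_mset \<mu>0 then w \<mu> * \<kappa> \<mu> * (of_int \<chi> / 2) ^ count \<mu> 0 else 0)"
      unfolding P_def lookup_sum lookup_cst_mult Tm_eq lookup_mon \<kappa>_def by (intro sum.cong) (auto simp: mult_ac)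
    also have "\<dots> = (\<Sum>\<mu>\<in>{\<mu>\<in>{\<mu>\<in>B. E \<mu> = D}. top_mset \<mu> = top_mset \<mu>0}. w \<mu> * \<kappa> \<mu> * (of_int \<chi> / 2) ^ count \<mu> 0)"
      using fB by (subst sum.inter_filter) auto
    also have "{\<mu>\<in>{\<mu>\<in>B. E \<mu> = D}. top_mset \<mu> = top_mset \<mu>0} = C" using mu0 by (auto simp: C_def E_def)
    finally show ?thesis unfolding \<chi>_def by simp
  qed
  define c where "c j = (\<Sum>\<mu>\<in>{\<mu>\<in>C. count \<mu> 0 = j}. w \<mu> * \<kappa> \<mu>)" for j
  have fC: "finite C" using fB by (simp add: C_def)
  have poly: "(\<Sum>j\<le>k. c j * x ^ j) = (\<Sum>\<mu>\<in>C. w \<mu> * \<kappa> \<mu> * x ^ count \<mu> 0)" for x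
  proof -
    have "(\<Sum>\<mu>\<in>C. w \<mu> * \<kappa> \<mu> * x ^ count \<mu> 0) = (\<Sum>j\<le>k. \<Sum>\<mu>\<in>{\<mu>\<in>C. count \<mu> 0 = j}. w \<mu> * \<kappa> \<mu> * x ^ count \<mu> 0)"
      by (rule sum.group[symmetric]) (use fC in \<open>auto simp: C_def B\<close>)
    also have "\<dots> = (\<Sum>j\<le>k. c j * x ^ j)" unfolding c_def sum_distrib_right by (intro sum.cong) auto
    finally show ?thesis by simp
  qed
  have c0: "\<forall>j\<le>k. c j = 0"
  proof (rule ccontr)
    assume "\<not> ?thesis"
    then obtain j where j: "c j \<noteq> 0" "j \<le> k" by auto
    let ?Z = "{x. (\<Sum>j\<le>k. c j * x ^ j) = 0}"
    have "finite ?Z \<and> card ?Z \<le> k" using polyfun_rootbound[of c j k] j by auto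
    moreover have "(\<lambda>i. of_int (- int k + 2 * int i) / 2) ` {..k} \<subseteq> ?Z" using root by (auto simp: poly)
    moreover have "card ((\<lambda>i. of_int (- int k + 2 * int i) / 2 :: complex) ` {..k}) = k + 1"
      by (subst card_image) (auto simp: inj_on_def)
    ultimately show False using card_mono[of ?Z "(\<lambda>i. of_int (- int k + 2 * int i) / 2) ` {..k}"] by linarith
  qed
  have "{\<mu>\<in>C. count \<mu> 0 = count \<mu>0 0} = {\<mu>0}" using mu0(1) top_mset_inj by (auto simp: C_def S_def)
  then have "w \<mu>0 * \<kappa> \<mu>0 = c (count \<mu>0 0)" by (simp add: c_def)
  also have "\<dots> = 0" using c0 mu0(1) by (simp add: S_def B)
  finally show False using mu0(1) kap_nz by (simp add: S_def \<kappa>_def)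
qed

lemma lev_Qp: "lev (int i * (ip * (int n + 1 - int i) - 1)) (Qp n i)"
proof (induction i)
  case 0 show ?case by (simp add: Qp_def)
next
  case (Suc i)
  have "int i * (ip * (int n + 1 - int i) - 1) - 1 - ip * (- int n + 2 * int i) = int (Suc i) * (ip * (int n + 1 - int (Suc i)) - 1)"
    by (simp add: algebra_simps)
  then show ?case using lev_Q[OF Suc, of "- int n + 2 * int i"] by (simp add: Qp_def)
qed

text \<open>By \<open>lev_Qp\<close> its level would be -(n + 1).\<close>

lemma Qp_Suc_0: "Qp n (Suc n) = 0"
  using lev_neg[OF lev_Qp[of "Suc n" n]] by simp

lemma Q_kernel:
  assumes x: "lev (int r) x" "int r \<le> ip * (int k + 2) + int k + 1" and q: "Qit (- int k) (Suc k) x = 0"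
  shows "\<exists>u. x = (\<Sum>\<mu>\<in>{\<mu>. pwt \<mu> = r}. cst (u \<mu>) * LL (- int k) \<mu> 1)"
proof -
  define A where "A = {\<mu>. pwt \<mu> = r}"
  define A1 where "A1 = {\<mu>. pwt \<mu> = r \<and> count \<mu> 0 \<le> k}"
  define A2 where "A2 = {\<mu>. pwt \<mu> = r \<and> Suc k \<le> count \<mu> 0}"
  define rd where "rd \<mu> = \<mu> - replicate_mset (Suc k) 0" for \<mu> :: "nat multiset"
  have fA: "finite A" "finite A1" "finite A2" unfolding A_def A1_def A2_def by (rule finite_subset[OF _ finite_pwt_eq[of r]], auto)+
  have AA: "A = A1 \<union> A2" "A1 \<inter> A2 = {}" by (auto simp: A_def A1_def A2_def)
  have rd: "\<mu> = rd \<mu> + replicate_mset (Suc k) 0" if "\<mu> \<in> A2" for \<mu>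
    using that unfolding rd_def A2_def by (metis (mono_tags, lifting) count_le_replicate_mset_subset_eq mem_Collect_eq subset_mset.diff_add)
  have pr: "pwt (replicate_mset m 0) = m" for m by (induction m) auto
  have pw: "int (pwt (rd \<mu>)) + int (Suc k) = int r" if "\<mu> \<in> A2" for \<mu>
  proof -
    have "pwt \<mu> = pwt (rd \<mu>) + Suc k" by (subst rd[OF that]) (simp only: pwt_plus pr)
    then show ?thesis using that by (simp add: A2_def)
  qed
  \<comment> \<open>The bound on r is that of \<open>Q_power_surjective\<close> for Q^(k+1), since
    removing k + 1 parts 1 lowers the level by k + 1.\<close>
  have "\<exists>y. lev (int r) y \<and> Qit (- int k) (Suc k) y = mon (rd \<mu>)" if mu: "\<mu> \<in> A2" for \<mu>
    using Q_power_surjective[of "pwt (rd \<mu>)" "Suc k" "mon (rd \<mu>)"] pw[OF mu] x(2) lev_mon by (simp add: algebra_simps)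
  then obtain y where y: "\<And>\<mu>. \<mu> \<in> A2 \<Longrightarrow> lev (int r) (y \<mu>) \<and> Qit (- int k) (Suc k) (y \<mu>) = mon (rd \<mu>)" by metis
  define g where "g \<mu> = (if count \<mu> 0 \<le> k then LL (- int k) \<mu> 1 else y \<mu>)" for \<mu>
  have g1: "g \<mu> = LL (- int k) \<mu> 1" if "\<mu> \<in> A1" for \<mu> using that by (simp add: g_def A1_def)
  have g2: "g \<mu> = y \<mu>" if "\<mu> \<in> A2" for \<mu> using that by (simp add: g_def A2_def)
  have kill: "Qit (- int k) (Suc k) (LL (- int k) \<mu> 1) = 0" for \<mu>
    unfolding Qit_LL Qp_def[symmetric] Qp_Suc_0 by (rule clin_0[OF clin_LL])
  have Qg: "Qit (- int k) (Suc k) (\<Sum>\<mu>\<in>A. cst (u \<mu>) * g \<mu>) = (\<Sum>\<mu>\<in>A2. cst (u \<mu>) * mon (rd \<mu>))" for u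
  proof -
    have "Qit (- int k) (Suc k) (\<Sum>\<mu>\<in>A. cst (u \<mu>) * g \<mu>) = (\<Sum>\<mu>\<in>A1 \<union> A2. cst (u \<mu>) * Qit (- int k) (Suc k) (g \<mu>))"
      unfolding clin_sum[OF clin_Qit] clin_scale[OF clin_Qit] AA(1) ..
    then show ?thesis unfolding sum.union_disjoint[OF fA(2,3) AA(2)]
      by (simp add: g1 g2 kill y del: Qit.simps)
  qed
  have inj: "inj_on rd A2" using rd by (metis inj_onI)
  \<comment> \<open>Q^(k+1) kills the Virasoro vectors and sends the remaining members of the family
    to distinct monomials.\<close>
  have u2: "u \<mu> = 0" if "Qit (- int k) (Suc k) (\<Sum>\<mu>\<in>A. cst (u \<mu>) * g \<mu>) = 0" "\<mu> \<in> A2" for u \<mu>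
  proof -
    have "0 = lookup (\<Sum>\<nu>\<in>A2. cst (u \<nu>) * mon (rd \<nu>)) (rd \<mu>)" using that(1) unfolding Qg by simp
    also have "\<dots> = (\<Sum>\<nu>\<in>A2. if \<nu> = \<mu> then u \<nu> else 0)"
      unfolding lookup_sum lookup_cst_mult lookup_mon by (intro sum.cong) (use inj that(2) in \<open>auto simp: inj_on_def\<close>)
    also have "\<dots> = u \<mu>" using that(2) fA by simp
    finally show ?thesis by simp
  qed
  have red: "(\<Sum>\<mu>\<in>A. cst (u \<mu>) * g \<mu>) = (\<Sum>\<mu>\<in>A1. cst (u \<mu>) * LL (- int k) \<mu> 1)" if "\<And>\<mu>. \<mu> \<in> A2 \<Longrightarrow> u \<mu> = 0" for u
    unfolding AA(1) sum.union_disjoint[OF fA(2,3) AA(2)] using that by (simp add: g1)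
  have "\<exists>u. x = (\<Sum>\<mu>\<in>A. cst (u \<mu>) * g \<mu>)"
  proof (rule square_family_spans[OF fA(1)])
    show "keys x \<subseteq> A" using x(1) by (auto simp: lev_def A_def)
    fix \<mu> assume mu: "\<mu> \<in> A"
    have "lev (int r) (g \<mu>)"
    proof (cases "\<mu> \<in> A1")
      case True then show ?thesis using lev_LL[OF lev_1, of \<mu> "- int k"] by (simp add: g1 A1_def)
    next
      case False then show ?thesis using mu AA y g2 by auto
    qed
    then show "keys (g \<mu>) \<subseteq> A" by (auto simp: lev_def A_def)
  next
    fix u assume z: "(\<Sum>\<mu>\<in>A. cst (u \<mu>) * g \<mu>) = 0"
    have z2: "u \<mu> = 0" if "\<mu> \<in> A2" for \<mu> by (rule u2[OF _ that]) (simp only: z clin_0[OF clin_Qit])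
    have "\<forall>\<mu>\<in>A1. u \<mu> = 0" by (rule LL_independent[OF A1_def]) (use red[OF z2] z in simp)
    then show "\<forall>\<mu>\<in>A. u \<mu> = 0" using z2 AA by auto
  qed
  then obtain u where u: "x = (\<Sum>\<mu>\<in>A. cst (u \<mu>) * g \<mu>)" by blast
  have z2: "u \<mu> = 0" if "\<mu> \<in> A2" for \<mu> by (rule u2[OF _ that]) (use u q in simp)
  have "x = (\<Sum>\<mu>\<in>A. cst (u \<mu>) * LL (- int k) \<mu> 1)"
  proof -
    have "x = (\<Sum>\<mu>\<in>A1. cst (u \<mu>) * LL (- int k) \<mu> 1)" using red[OF z2] u by simp
    also have "\<dots> = (\<Sum>\<mu>\<in>A1 \<union> A2. cst (u \<mu>) * LL (- int k) \<mu> 1)"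
      unfolding sum.union_disjoint[OF fA(2,3) AA(2)] using z2 by simp
    finally show ?thesis unfolding AA(1) .
  qed
  then show ?thesis unfolding A_def by blast
qed

section \<open>Closure of the doublet module under vertex operators\<close>

inductive Wmod :: "int \<Rightarrow> fock \<Rightarrow> bool" where
  gen: "i \<le> n \<Longrightarrow> Wmod (- int n + 2 * int i) (Qp n i)"
| zero: "Wmod \<chi> 0"
| add: "Wmod \<chi> f \<Longrightarrow> Wmod \<chi> g \<Longrightarrow> Wmod \<chi> (f + g)"
| scale: "Wmod \<chi> f \<Longrightarrow> Wmod \<chi> (cst z * f)"
| vir: "Wmod \<chi> f \<Longrightarrow> Wmod \<chi> (L \<chi> k f)"

lemma Wmod_eq: "Wmod \<chi> f \<Longrightarrow> \<chi> = \<chi>' \<Longrightarrow> Wmod \<chi>' f" by simp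
lemma Wmod_minus: "Wmod \<chi> f \<Longrightarrow> Wmod \<chi> (- f)" using Wmod.scale[of \<chi> f "- 1"] by (simp add: cst_minus)
lemma Wmod_diff: "Wmod \<chi> f \<Longrightarrow> Wmod \<chi> g \<Longrightarrow> Wmod \<chi> (f - g)" using Wmod.add[OF _ Wmod_minus, of \<chi> f g] by simp
lemma Wmod_sum: "(\<And>x. x \<in> A \<Longrightarrow> Wmod \<chi> (g x)) \<Longrightarrow> Wmod \<chi> (sum g A)"
  by (induction A rule: infinite_finite_induct) (auto intro: Wmod.zero Wmod.add)
lemma Wmod_SA: "(\<And>r. Wmod \<chi> (g r)) \<Longrightarrow> Wmod \<chi> (Sum_any g)"
  unfolding Sum_any.expand_set by (intro Wmod_sum)
lemma Wmod_cancel: assumes "Wmod \<chi> (cst z * f)" "z \<noteq> 0" shows "Wmod \<chi> f"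
proof -
  have "cst (1 / z) * (cst z * f) = f" using cst_inverse_mult[OF assms(2), of f] by (simp only: mult.left_commute)
  then show ?thesis using Wmod.scale[OF assms(1), of "1 / z"] by (simp only:)
qed
lemma Wmod_1: "Wmod (- int n) 1" using Wmod.gen[of 0 n] by (simp add: Qp_def)
lemma Wmod_LLl: "Wmod \<chi> f \<Longrightarrow> Wmod \<chi> (LLl \<chi> ks f)" by (induction ks) (auto intro: Wmod.vir)

lemma Wmod_Q: "Wmod \<chi> f \<Longrightarrow> Wmod (\<chi> + 2) (Qo \<chi> f)"
proof (induction rule: Wmod.induct)
  case (gen i n)
  show ?case
  proof (cases "i = n")
    case True
    then have "Qo (- int n + 2 * int i) (Qp n i) = 0" using Qp_Suc_0[of n] by (simp add: Qp_def)
    then show ?thesis by (simp add: Wmod.zero)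
  next
    case False
    then show ?thesis using Wmod.gen[of "Suc i" n] gen by (simp add: Qp_def algebra_simps)
  qed
next
  case (vir \<chi> f k) then show ?case unfolding Q_L by (intro Wmod.vir)
qed (auto simp: clin_simps[OF clin_Q] intro: Wmod.intros)

section \<open>The field of e^{-alpha/2} on singular vectors\<close>

lemma L_Qp_pos: "k > 0 \<Longrightarrow> L (- int n + 2 * int i) k (Qp n i) = 0"
  unfolding Qp_def Qit_L[symmetric] by (simp add: L_pos_1 clin_0[OF clin_Qit])
lemma L_Qp_0: "L (- int n + 2 * int i) 0 (Qp n i) = cst (hw (- int n)) * Qp n i"
  unfolding Qp_def Qit_L[symmetric] by (simp add: L_0_1 clin_cst[OF clin_Qit])

lemma par_sq: "par k * par k = 1" by (simp add: par_def)
lemma par_uminus: "par (- k) = par k" by (simp add: par_def)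

text \<open>Here \<open>Q\<^sup>2\<close> annihilates \<open>exp (- \<alpha> / 2)\<close>.\<close>

lemma V_Q_Q: "V (- 1) (N + 2 * ip) (Qo (\<chi> + 2) (Qo \<chi> f)) = cst (2 * par ip) * Qo (\<chi> + 1) (V (- 1) (N + ip) (Qo \<chi> f)) - Qo (\<chi> + 1) (Qo (\<chi> - 1) (V (- 1) N f))"
proof -
  define e where "e = par ip"
  define s where "s = Qo (- 1) 1"
  have s0: "Qo 1 s = 0" using Qp_Suc_0[of 1] by (simp add: s_def Qp_def)
  have h: "Ys 1 \<chi> s M f = Qo (\<chi> - 1) (V (- 1) (M + ip * \<chi>) f) - cst e * V (- 1) (M + ip * \<chi> + ip) (Qo \<chi> f)" for \<chi> M f
    using Q_derivation[of "- 1" \<chi> 1 M f] by (simp add: s_def e_def par_uminus Ys_1)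
  have "0 = Ys (1 + 2) \<chi> (Qo 1 s) (N - 2 * ip * \<chi>) f" unfolding s0 by (simp add: Ys_0)
  also have "\<dots> = Qo (\<chi> + 1) (Ys 1 \<chi> s (N - ip * \<chi>) f) - cst e * Ys 1 (\<chi> + 2) s (N - ip * \<chi> - ip) (Qo \<chi> f)"
    unfolding Q_derivation by (simp add: e_def algebra_simps)
  also have "\<dots> = Qo (\<chi> + 1) (Qo (\<chi> - 1) (V (- 1) N f)) - cst e * Qo (\<chi> + 1) (V (- 1) (N + ip) (Qo \<chi> f))
      - cst e * (Qo (\<chi> + 1) (V (- 1) (N + ip) (Qo \<chi> f)) - cst e * V (- 1) (N + 2 * ip) (Qo (\<chi> + 2) (Qo \<chi> f)))"
    unfolding h clin_diff[OF clin_Q] clin_scale[OF clin_Q] by (simp add: algebra_simps)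
  finally have z: "0 = Qo (\<chi> + 1) (Qo (\<chi> - 1) (V (- 1) N f)) - cst e * Qo (\<chi> + 1) (V (- 1) (N + ip) (Qo \<chi> f))
      - cst e * (Qo (\<chi> + 1) (V (- 1) (N + ip) (Qo \<chi> f)) - cst e * V (- 1) (N + 2 * ip) (Qo (\<chi> + 2) (Qo \<chi> f)))" .
  have ee: "cst e * cst e = 1" using par_sq[of ip] by (simp add: e_def flip: cst_mult)
  have e2: "cst (2 * e) = cst e + cst e" unfolding cst_add[symmetric] by simp
  have "cst e * (cst e * V (- 1) (N + 2 * ip) (Qo (\<chi> + 2) (Qo \<chi> f))) = V (- 1) (N + 2 * ip) (Qo (\<chi> + 2) (Qo \<chi> f))"
    unfolding mult.assoc[symmetric] ee by simp
  then show ?thesis using z unfolding e_def[symmetric] e2 by (simp add: algebra_simps)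
qed

text \<open>\<open>V_Q_Q\<close> is a linear recursion in i with the double characteristic root
  \<open>par ip\<close>, so its solution is \<open>par ip ^ i\<close> times an affine function of i,
  fixed by i = 0 and i = 1. The remaining powers of Q bring all terms to one charge.\<close>

lemma V_Qit:
  assumes "i \<le> K"
  shows "Qit (\<chi> + 2 * int i - 1) (K - i) (V (- 1) (N + int i * ip) (Qit \<chi> i f))
    = cst (par ip ^ i * (1 - of_nat i)) * Qit (\<chi> - 1) K (V (- 1) N f)
    + cst (par ip ^ i * of_nat i * par ip) * Qit (\<chi> + 1) (K - 1) (V (- 1) (N + ip) (Qo \<chi> f))"
  using assms
proof (induction i rule: less_induct)
  case (less i)
  define e where "e = par ip"
  have ee: "e * e = 1" by (simp add: e_def par_sq)
  let ?a = "Qit (\<chi> - 1) K (V (- 1) N f)" and ?b = "Qit (\<chi> + 1) (K - 1) (V (- 1) (N + ip) (Qo \<chi> f))"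
  consider "i = 0" | "i = 1" | j where "i = Suc (Suc j)" by (metis One_nat_def nat.exhaust)
  then show ?case
  proof cases
    case 1 then show ?thesis by simp
  next
    case 2 then show ?thesis using par_sq[of ip] by (simp add: add.commute)
  next
    case 3
    define T where "T = Qit (\<chi> + 2 * int i - 1) (K - i)"
    define \<psi> where "\<psi> = \<chi> + 2 * int j"
    have es: "e * e ^ Suc j = e ^ j" using ee by (simp flip: mult.assoc)
    have ei: "e ^ i = e ^ j" using es by (simp add: 3)
    have T: "clin T" by (simp add: T_def clin_Qit)
    have x1: "T (Qo (\<psi> + 1) (V (- 1) (N + int j * ip + ip) (Qo \<psi> (Qit \<chi> j f)))) = cst (e ^ Suc j * (1 - of_nat (Suc j))) * ?a + cst (e ^ Suc j * of_nat (Suc j) * e) * ?b"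
    proof -
      have "K - Suc j = Suc (K - i)" using less.prems 3 by simp
      then have "Qit (\<chi> + 2 * int (Suc j) - 1) (K - Suc j) g = T (Qo (\<psi> + 1) g)" for g
        using Qit_add[of "\<psi> + 1" 1 "K - i" g] 3 by (simp add: T_def \<psi>_def algebra_simps del: Qit.simps(2)) simp
      then show ?thesis using less.IH[of "Suc j"] 3 less.prems by (simp add: e_def \<psi>_def algebra_simps)
    qed
    have x0: "T (Qo (\<psi> + 1) (Qo (\<psi> - 1) (V (- 1) (N + int j * ip) (Qit \<chi> j f)))) = cst (e ^ j * (1 - of_nat j)) * ?a + cst (e ^ j * of_nat j * e) * ?b"
    proof -
      have "K - j = 2 + (K - i)" using less.prems 3 by simp
      moreover have "Qit (\<psi> - 1) 2 g = Qo (\<psi> + 1) (Qo (\<psi> - 1) g)" for g by (simp add: numeral_2_eq_2 algebra_simps)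
      ultimately have "Qit (\<chi> + 2 * int j - 1) (K - j) g = T (Qo (\<psi> + 1) (Qo (\<psi> - 1) g))" for g
        using Qit_add[of "\<psi> - 1" 2 "K - i" g] 3 by (simp add: T_def \<psi>_def algebra_simps)
      then show ?thesis using less.IH[of j] 3 less.prems by (simp add: e_def)
    qed
    have "T (V (- 1) (N + int i * ip) (Qit \<chi> i f)) = cst (2 * e) * T (Qo (\<psi> + 1) (V (- 1) (N + int j * ip + ip) (Qo \<psi> (Qit \<chi> j f)))) - T (Qo (\<psi> + 1) (Qo (\<psi> - 1) (V (- 1) (N + int j * ip) (Qit \<chi> j f))))"
    proof -
      have "N + int i * ip = N + int j * ip + 2 * ip" "Qit \<chi> i f = Qo (\<psi> + 2) (Qo \<psi> (Qit \<chi> j f))" by (simp_all add: 3 \<psi>_def algebra_simps)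
      then show ?thesis using arg_cong[OF V_Q_Q[of "N + int j * ip" \<psi> "Qit \<chi> j f"], of T] by (simp only: clin_diff[OF T] clin_scale[OF T] e_def)
    qed
    also have "\<dots> = cst (2 * e * (e ^ Suc j * (1 - of_nat (Suc j))) - e ^ j * (1 - of_nat j)) * ?a + cst (2 * e * (e ^ Suc j * of_nat (Suc j) * e) - e ^ j * of_nat j * e) * ?b"
      unfolding x0 x1 cst_diff cst_mult by (simp only: algebra_simps)
    also have "2 * e * (e ^ Suc j * (1 - of_nat (Suc j))) - e ^ j * (1 - of_nat j) = e ^ i * (1 - of_nat i)"
    proof -
      have "2 * e * (e ^ Suc j * (1 - of_nat (Suc j))) = 2 * (e * e ^ Suc j) * (1 - of_nat (Suc j))" by (simp only: mult_ac)
      then show ?thesis unfolding es ei by (simp add: 3 algebra_simps)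
    qed
    also have "2 * e * (e ^ Suc j * of_nat (Suc j) * e) - e ^ j * of_nat j * e = e ^ i * of_nat i * e"
    proof -
      have "2 * e * (e ^ Suc j * of_nat (Suc j) * e) = 2 * (e * e ^ Suc j) * of_nat (Suc j) * e" by (simp only: mult_ac)
      then show ?thesis unfolding es ei by (simp add: 3 algebra_simps)
    qed
    finally show ?thesis unfolding T_def e_def .
  qed
qed

text \<open>Positive modes kill a singular vector and L_0 is a scalar on it, so \<open>bz2\<close>
  moves to the left side and the polynomial factors. At its roots the level is that of
  \<open>Qp (n + 1) i\<close> and, for i at least 1, of \<open>Qp (n - 1) (i - 1)\<close>.\<close>

lemma null_vector_equation_singular:
  defines "y \<equiv> \<lambda>n i m. V (- 1) m (Qp n i)"
  shows "cst (of_int ((m - ip * int i) * (m - ip * int i + ip * int n + ip - 1))) * y n i m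
    = cst pc * Sum_any (bz1 (- int n + 2 * int i) m (Qp n i))"
proof -
  let ?\<chi> = "- int n + 2 * int i"
  have "bz2 ?\<chi> m (Qp n i) r = (if r = 0 then cst (hw (- int n)) * y n i m else 0)" for r
  proof -
    have "V (- 1) (m + r) (L ?\<chi> r (Qp n i)) = (if r = 0 then cst (hw (- int n)) * y n i m else 0)" if "0 \<le> r"
    proof (cases "r = 0")
      case True then show ?thesis unfolding True L_Qp_0 clin_scale[OF clin_V] y_def by simp
    next
      case False
      then have "L ?\<chi> r (Qp n i) = 0" using L_Qp_pos[of r n i] that by simp
      then show ?thesis using False by (simp only: clin_0[OF clin_V] if_False)
    qed
    then show ?thesis unfolding bz2_def by auto
  qed
  then have b: "Sum_any (bz2 ?\<chi> m (Qp n i)) = cst (hw (- int n)) * y n i m" by simp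
  have c: "of_int ((m - ip * int i) * (m - ip * int i + ip * int n + ip - 1)) = (of_int m - pc * of_int ?\<chi> / 2) * (of_int m - pc * of_int ?\<chi> / 2 + pc - 1) - pc * hw (- int n)"
  proof -
    define X h where "X = of_int m - pc * of_nat i" and "h = (of_nat n / 2 :: complex)"
    have gen: "x * (x + 2 * P * h + P - 1) = (x + P * h) * (x + P * h + P - 1) - P * (P * h * h + (P - 1) * h)" for x P h :: complex by algebra
    have 1: "of_int ((m - ip * int i) * (m - ip * int i + ip * int n + ip - 1)) = X * (X + 2 * pc * h + pc - 1)" by (simp add: X_def h_def)
    have 2: "of_int m - pc * of_int ?\<chi> / 2 = X + pc * h" by (simp add: X_def h_def field_simps)
    have 3: "hw (- int n) = pc * h * h + (pc - 1) * h" by (simp add: hw_def h_def power2_eq_square field_simps)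
    show ?thesis unfolding 1 2 3 by (rule gen)
  qed
  show ?thesis unfolding c using null_vector_equation[of ?\<chi> m "Qp n i"] unfolding b
    unfolding cst_diff cst_mult left_diff_distrib distrib_left y_def by (simp only: mult.assoc diff_conv_add_uminus add_ac) (simp add: algebra_simps)
qed

lemma Wmod_bpz_step:
  assumes "(m - ip * int i) * (m - ip * int i + ip * int n + ip - 1) \<noteq> 0"
    and "\<And>m'. m' < m \<Longrightarrow> Wmod (- int n + 2 * int i - 1) (V (- 1) m' (Qp n i))"
  shows "Wmod (- int n + 2 * int i - 1) (V (- 1) m (Qp n i))"
proof (rule Wmod_cancel)
  show "Wmod (- int n + 2 * int i - 1) (cst (of_int ((m - ip * int i) * (m - ip * int i + ip * int n + ip - 1))) * V (- 1) m (Qp n i))"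
  proof -
    have "Wmod (- int n + 2 * int i - 1) (bz1 (- int n + 2 * int i) m (Qp n i) r)" for r
    proof (cases "r > 0")
      case True
      then have "bz1 (- int n + 2 * int i) m (Qp n i) r = L (- int n + 2 * int i - 1) (- r) (V (- 1) (m - r) (Qp n i))" by (simp only: bz1_def if_True)
      then show ?thesis using True by (simp only:) (intro Wmod.vir assms(2), simp)
    next
      case False then show ?thesis by (simp only: bz1_def if_False Wmod.zero)
    qed
    then show ?thesis unfolding null_vector_equation_singular by (intro Wmod.scale Wmod_SA)
  qed
  show "of_int ((m - ip * int i) * (m - ip * int i + ip * int n + ip - 1)) \<noteq> (0 :: complex)" using assms(1) of_int_eq_0_iff by blast
qed

lemma int_below_induct [case_names low step]:
  fixes P :: "int \<Rightarrow> bool"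
  assumes "\<And>m. m < a \<Longrightarrow> P m" "\<And>m. m \<ge> a \<Longrightarrow> (\<And>m'. m' < m \<Longrightarrow> P m') \<Longrightarrow> P m"
  shows "P m"
proof (induction "nat (m - a)" arbitrary: m rule: less_induct)
  case less
  show ?case
  proof (cases "m < a")
    case False
    show ?thesis
    proof (rule assms(2))
      fix m' assume "m' < m"
      then show "P m'" using less[of m'] assms(1)[of m'] False by (cases "m' < a") auto
    qed (use False in simp)
  qed (rule assms(1))
qed

text \<open>The root 1 - p (n + 1) is negative, where the mode kills the vacuum; at the other root,
  m = 0, the value is the vacuum of charge -n - 1.\<close>

lemma Wmod_V_gen0: "Wmod (- int n - 1) (V (- 1) m (Qp n 0))"
proof (induction m rule: int_below_induct[of 0])
  case (low m) then show ?case by (simp add: Qp_def V_1 Wmod.zero)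
next
  case (step m)
  show ?case
  proof (cases "m = 0")
    case True then show ?thesis using Wmod_eq[OF Wmod_1[of "Suc n"], of "- int n - 1"] by (simp add: Qp_def V_1)
  next
    case False
    have "m + ip * int n + ip - 1 > 0" using step(1) False p2 mult_nonneg_nonneg[of ip "int n"] by linarith
    then show ?thesis using Wmod_bpz_step[of m 0 n] step False by simp
  qed
qed

lemma Wmod_V_gen1: assumes "1 \<le> n" shows "Wmod (1 - int n) (V (- 1) m (Qp n 1))"
proof (induction m rule: int_below_induct[of "1 - ip * int n"])
  case (low m)
  have "lev (ip * int n - 1 + m) (V (- 1) m (Qp n 1))" using lev_V[OF lev_Qp[of 1 n]] by simp
  then have "V (- 1) m (Qp n 1) = 0" by (rule lev_neg) (use low in simp)
  then show ?case by (simp add: Wmod.zero)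
next
  case (step m)
  have lv: "lev (ip * int n - 1 + m) (V (- 1) m (Qp n 1))" using lev_V[OF lev_Qp[of 1 n]] by simp
  have W1: "Wmod (1 - int n) 1" using Wmod_1[of "n - 1"] assms by (simp add: of_nat_diff)
  \<comment> \<open>The first case is the root belonging to n - 1: the level is 0 there, so the
    value is a multiple of a vacuum. The second is the resonance, in the level of
    \<open>Qp (Suc n) 1\<close>.\<close>
  consider "m = 1 - ip * int n" | "m = ip" | "m \<noteq> ip" "m > 1 - ip * int n" using step(1) by linarith
  then show ?case
  proof cases
    case 1
    then have "V (- 1) m (Qp n 1) = cst (lookup (V (- 1) m (Qp n 1)) {#})" using lv lev_zero_cst by simp
    then show ?thesis using Wmod.scale[OF W1] by (metis mult.right_neutral)
  next
    case 3
    have "m - ip + ip * int n + ip - 1 \<noteq> 0" using 3 by simp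
    then have "(m - ip * int 1) * (m - ip * int 1 + ip * int n + ip - 1) \<noteq> 0" using 3 by simp
    then show ?thesis using Wmod_bpz_step[of m 1 n] step(2) by simp
  next
    case 2
    \<comment> \<open>Chosen so that Q^n kills x: for i = n + 1, where Q^i annihilates the highest
      weight vector, \<open>V_Qit\<close> becomes a linear relation between the images under Q^n of
      \<open>V (- 1) ip (Qp n 1)\<close> and \<open>Qp (Suc n) 1\<close>.\<close>
    define c where "c = par ip * of_nat n / of_nat (n + 1)"
    define x where "x = V (- 1) ip (Qp n 1) - cst c * Qp (Suc n) 1"
    have lx: "lev (int (p * (n + 1) - 1)) x"
    proof -
      have e: "int (p * (n + 1) - 1) = ip * (int n + 1) - 1" using p2 by (simp add: of_nat_diff algebra_simps)
      show ?thesis unfolding e x_def using lv[unfolded 2] lev_Qp[of 1 "Suc n"]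
        by (intro lev_diff lev_scale) (simp_all add: algebra_simps)
    qed
    have "Qit (1 - int n) n x = 0"
    proof -
      have "0 = V (- 1) (0 + int (n + 1) * ip) (Qit (- int n) (n + 1) 1)"
        using Qp_Suc_0[of n] by (simp add: Qp_def clin_0[OF clin_V])
      also have "\<dots> = cst (par ip ^ (n + 1) * (1 - of_nat (n + 1))) * Qit (- int n - 1) (n + 1) (V (- 1) 0 1)
         + cst (par ip ^ (n + 1) * of_nat (n + 1) * par ip) * Qit (- int n + 1) n (V (- 1) (0 + ip) (Qo (- int n) 1))"
        using V_Qit[of "n + 1" "n + 1" "- int n" 0 1] by simp
      also have "V (- 1) 0 1 = 1" by (simp add: V_1)
      also have "Qit (- int n - 1) (n + 1) 1 = Qit (1 - int n) n (Qp (Suc n) 1)"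
      proof -
        have e: "- int n - 1 = - int (Suc n)" by simp
        show ?thesis unfolding e using Qit_add[of "- int (Suc n)" 1 n 1] by (simp add: Qp_def)
      qed
      also have "Qo (- int n) 1 = Qp n 1" by (simp add: Qp_def)
      finally have z0: "0 = cst (par ip ^ (n + 1) * (1 - of_nat (n + 1))) * Qit (1 - int n) n (Qp (Suc n) 1)
         + cst (par ip ^ (n + 1) * of_nat (n + 1) * par ip) * Qit (- int n + 1) n (V (- 1) (0 + ip) (Qp n 1))" .
      have z: "0 = cst (par ip ^ (n + 1)) * (cst (of_nat (n + 1) * par ip) * Qit (1 - int n) n (V (- 1) ip (Qp n 1)) - cst (of_nat n) * Qit (1 - int n) n (Qp (Suc n) 1))"
      proof -
        have n1: "par ip ^ (n + 1) * (1 - of_nat (n + 1)) = - (par ip ^ (n + 1) * of_nat n)" by (simp add: algebra_simps)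
        have "- int n + 1 = 1 - int n" "0 + ip = ip" by simp_all
        then have "0 = cst (- (par ip ^ (n + 1) * of_nat n)) * Qit (1 - int n) n (Qp (Suc n) 1)
         + cst (par ip ^ (n + 1) * of_nat (n + 1) * par ip) * Qit (1 - int n) n (V (- 1) ip (Qp n 1))" using z0 by (simp only: n1)
        then show ?thesis unfolding cst_minus cst_mult right_diff_distrib by (simp only: mult.assoc mult_minus_left) simp
      qed
      have "cst (of_nat (n + 1) * par ip) * Qit (1 - int n) n x = cst (of_nat (n + 1) * par ip) * Qit (1 - int n) n (V (- 1) ip (Qp n 1)) - cst (of_nat (n + 1) * par ip * c) * Qit (1 - int n) n (Qp (Suc n) 1)"
        unfolding x_def clin_diff[OF clin_Qit] clin_scale[OF clin_Qit] cst_mult by (simp add: algebra_simps)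
      also have "of_nat (n + 1) * par ip * c = of_nat n"
        unfolding c_def using par_sq[of ip] by (simp add: field_simps del: of_nat_Suc of_nat_add)
      also have "cst (of_nat (n + 1) * par ip) * Qit (1 - int n) n (V (- 1) ip (Qp n 1)) - cst (of_nat n) * Qit (1 - int n) n (Qp (Suc n) 1) = 0"
        using z par_sq[of ip] by (auto simp: par_def)
      finally show ?thesis using par_sq[of ip] by (auto simp del: of_nat_Suc of_nat_add)
    qed
    then have "Qit (- int (n - 1)) (Suc (n - 1)) x = 0" using assms by (simp add: of_nat_diff)
    \<comment> \<open>For k = n - 1 the bound of \<open>Q_kernel\<close> is p (n + 1) + n.\<close>
    moreover have "int (p * (n + 1) - 1) \<le> ip * (int (n - 1) + 2) + int (n - 1) + 1"
      using assms p2 by (simp add: of_nat_diff algebra_simps)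
    ultimately obtain u where "x = (\<Sum>\<mu>\<in>{\<mu>. pwt \<mu> = p * (n + 1) - 1}. cst (u \<mu>) * LL (- int (n - 1)) \<mu> 1)"
      using Q_kernel[OF lx] by blast
    moreover have "Wmod (- int (n - 1)) (LL (- int (n - 1)) \<mu> 1)" for \<mu> unfolding LL_def by (intro Wmod_LLl Wmod_1)
    ultimately have "Wmod (- int (n - 1)) x" by (simp only:) (intro Wmod_sum Wmod.scale)
    then have "Wmod (1 - int n) x" using assms by (simp add: of_nat_diff)
    moreover have "Wmod (1 - int n) (cst c * Qp (Suc n) 1)" using Wmod.scale[OF Wmod.gen[of 1 "Suc n"]] by simp
    ultimately have "Wmod (1 - int n) (x + cst c * Qp (Suc n) 1)" by (rule Wmod.add)
    then show ?thesis unfolding 2 x_def by simp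
  qed
qed

text \<open>No further resonance has to be treated: from i = 2 on, \<open>V_Q_Q\<close> reduces to i
  - 1 and i - 2.\<close>

lemma Wmod_V_gen: "i \<le> n \<Longrightarrow> Wmod (- int n + 2 * int i - 1) (V (- 1) m (Qp n i))"
proof (induction i arbitrary: m rule: less_induct)
  case (less i)
  consider "i = 0" | "i = 1" | j where "i = Suc (Suc j)" by (metis One_nat_def nat.exhaust)
  then show ?case
  proof cases
    case 1 then show ?thesis using Wmod_V_gen0 by simp
  next
    case 2 then show ?thesis using Wmod_V_gen1[of n m] less.prems by (simp add: algebra_simps)
  next
    case 3
    define \<psi> where "\<psi> = - int n + 2 * int j"
    have e: "Qp n i = Qo (\<psi> + 2) (Qo \<psi> (Qp n j))" "Qp n (Suc j) = Qo \<psi> (Qp n j)" by (simp_all add: 3 Qp_def \<psi>_def algebra_simps)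
    have 1: "Wmod (\<psi> + 1) (V (- 1) m' (Qp n (Suc j)))" for m' using less.IH[of "Suc j" m'] 3 less.prems by (simp add: \<psi>_def algebra_simps)
    have 2: "Wmod (\<psi> - 1) (V (- 1) m' (Qp n j))" for m' using less.IH[of j m'] 3 less.prems by (simp add: \<psi>_def)
    have "V (- 1) m (Qp n i) = cst (2 * par ip) * Qo (\<psi> + 1) (V (- 1) (m - 2 * ip + ip) (Qp n (Suc j))) - Qo (\<psi> + 1) (Qo (\<psi> - 1) (V (- 1) (m - 2 * ip) (Qp n j)))"
      using V_Q_Q[of "m - 2 * ip" \<psi> "Qp n j"] unfolding e by simp
    moreover have "Wmod (\<psi> + 1 + 2) (cst (2 * par ip) * Qo (\<psi> + 1) (V (- 1) (m - 2 * ip + ip) (Qp n (Suc j))) - Qo (\<psi> + 1) (Qo (\<psi> - 1) (V (- 1) (m - 2 * ip) (Qp n j))))"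
    proof -
      have "\<psi> - 1 + 2 = \<psi> + 1" by simp
      then have "Wmod (\<psi> + 1 + 2) (Qo (\<psi> + 1) (Qo (\<psi> - 1) (V (- 1) (m - 2 * ip) (Qp n j))))"
        using Wmod_Q[OF Wmod_Q[OF 2[of "m - 2 * ip"]]] by (simp only:)
      then show ?thesis by (intro Wmod_diff Wmod.scale Wmod_Q[OF 1])
    qed
    ultimately have "Wmod (\<psi> + 1 + 2) (V (- 1) m (Qp n i))" by (simp only:)
    then show ?thesis by (rule Wmod_eq) (simp add: \<psi>_def 3)
  qed
qed

theorem Wmod_V1: "Wmod \<chi> f \<Longrightarrow> Wmod (\<chi> - 1) (V (- 1) m f)"
proof (induction arbitrary: m rule: Wmod.induct)
  case (gen i n) then show ?case by (rule Wmod_V_gen)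
next
  case (vir \<chi> f k)
  have "V (- 1) m (L \<chi> k f) = L (\<chi> - 1) k (V (- 1) m f) - cst (of_int (m - k) + pc * of_int (- 1) * of_int \<chi> / 2 + (of_int k + 1) * hw (- 1)) * V (- 1) (m - k) f"
    using L_V[of \<chi> "- 1" k m f] by simp
  then show ?case using vir by (auto intro: Wmod_diff Wmod.vir Wmod.scale)
qed (auto simp: clin_simps[OF clin_V] intro: Wmod.intros)

text \<open>\<open>V_product\<close> expresses the field of e^{-(k+2) alpha / 2} by sums, finite on
  each vector, of products of modes of e^{-alpha/2} and e^{-(k+1) alpha / 2}.\<close>

theorem Wmod_V: "Wmod \<chi> f \<Longrightarrow> Wmod (\<chi> - int (Suc k)) (V (- int (Suc k)) m f)"
proof (induction k arbitrary: m)
  case 0 then show ?case using Wmod_V1 by simp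
next
  case (Suc k)
  have e: "- int (Suc (Suc k)) = - 1 + - int (Suc k)" by simp
  have e2: "\<chi> - int (Suc (Suc k)) = \<chi> - int (Suc k) - 1" by simp
  show ?case unfolding e V_product NO_def nop_def unfolding e2
    by (intro Wmod_SA Wmod.scale Wmod_V1 Suc)
qed

end

section \<open>Vectors of the lattice vertex algebra\<close>

definition fin_vec :: "vec \<Rightarrow> bool" where "fin_vec v \<longleftrightarrow> finite {b. v b \<noteq> 0}"
definition mk :: "(int \<Rightarrow> fock) \<Rightarrow> vec" where "mk F = (\<lambda>(c, h). lookup (F h) c)"
text \<open>The component of charge h as a polynomial. The abstraction is meaningful for finite
  support only, hence the hypotheses \<open>fin_vec\<close> below.\<close>

definition pr :: "int \<Rightarrow> vec \<Rightarrow> fock" where "pr h v = Abs_poly_mapping (\<lambda>c. v (c, h))"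
definition ev :: "int \<Rightarrow> fock \<Rightarrow> vec" where "ev g f = mk (\<lambda>h. if h = g then f else 0)"

lemma lookup_pr: assumes "fin_vec v" shows "lookup (pr h v) c = v (c, h)"
proof -
  have "{c. v (c, h) \<noteq> 0} \<subseteq> fst ` {b. v b \<noteq> 0}" by (auto simp: image_iff)
  then have "finite {c. v (c, h) \<noteq> 0}" using assms unfolding fin_vec_def using finite_subset by blast
  then show ?thesis unfolding pr_def by (simp add: Abs_poly_mapping_inverse)
qed

lemma finite_pr: assumes "fin_vec v" shows "finite {h. pr h v \<noteq> 0}"
proof (rule finite_subset)
  show "{h. pr h v \<noteq> 0} \<subseteq> snd ` {b. v b \<noteq> 0}"
  proof
    fix h assume "h \<in> {h. pr h v \<noteq> 0}"
    then obtain c where "lookup (pr h v) c \<noteq> 0" by (metis (mono_tags) fock_eqI lookup_zero mem_Collect_eq)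
    then show "h \<in> snd ` {b. v b \<noteq> 0}" by (auto simp: lookup_pr[OF assms] image_iff intro!: exI[of _ "(c, h)"])
  qed
qed (use assms in \<open>simp add: fin_vec_def\<close>)
lemma fin_vec_mk: assumes "finite {h. F h \<noteq> 0}" shows "fin_vec (mk F)"
proof -
  have "{b. mk F b \<noteq> 0} \<subseteq> (\<Union>h\<in>{h. F h \<noteq> 0}. (\<lambda>c. (c, h)) ` keys (F h))"
    by (auto simp: mk_def in_keys_iff image_iff)
  then show ?thesis unfolding fin_vec_def using assms finite_subset by (metis (no_types, lifting) finite_UN_I finite_imageI finite_keys)
qed
lemma pr_mk: "finite {h. F h \<noteq> 0} \<Longrightarrow> pr h (mk F) = F h"
  by (rule fock_eqI) (subst lookup_pr[OF fin_vec_mk], assumption, simp add: mk_def)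
lemma fin_vec_ev: "fin_vec (ev g f)" unfolding ev_def by (rule fin_vec_mk) simp
lemma pr_ev: "pr h (ev g f) = (if h = g then f else 0)" unfolding ev_def by (rule pr_mk) simp
lemma ev_apply: "ev g f (c, h) = (if h = g then lookup f c else 0)" by (simp add: ev_def mk_def)

lemma lin_single: assumes v: "fin_vec v" and f: "\<And>c h. h \<noteq> h0 \<Longrightarrow> f (c, h) b' = 0"
  shows "lin f v b' = (\<Sum>c\<in>keys (pr h0 v). lookup (pr h0 v) c * f (c, h0) b')"
proof -
  have "lin f v b' = (\<Sum>b\<in>(\<lambda>c. (c, h0)) ` keys (pr h0 v). v b * f b b')"
    unfolding lin_def
  proof (rule sum.mono_neutral_right)
    show "finite {b. v b \<noteq> 0}" using v by (simp add: fin_vec_def)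
    show "(\<lambda>c. (c, h0)) ` keys (pr h0 v) \<subseteq> {b. v b \<noteq> 0}" by (auto simp: in_keys_iff lookup_pr[OF v])
    show "\<forall>b\<in>{b. v b \<noteq> 0} - (\<lambda>c. (c, h0)) ` keys (pr h0 v). v b * f b b' = 0"
    proof (clarsimp)
      fix c h assume "v (c, h) \<noteq> 0" "(c, h) \<notin> (\<lambda>c. (c, h0)) ` keys (pr h0 v)"
      then have "h \<noteq> h0" by (auto simp: in_keys_iff lookup_pr[OF v] image_iff)
      then show "f (c, h) b' = 0" by (rule f)
    qed
  qed
  also have "\<dots> = (\<Sum>c\<in>keys (pr h0 v). lookup (pr h0 v) c * f (c, h0) b')"
    by (subst sum.reindex) (auto simp: inj_on_def lookup_pr[OF v])
  finally show ?thesis .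
qed

lemma clin_lookup: assumes "clin T" shows "lookup (T f) c' = (\<Sum>c\<in>keys f. lookup f c * lookup (T (mon c)) c')"
proof -
  have "T f = (\<Sum>c\<in>keys f. cst (lookup f c) * T (mon c))"
    using arg_cong[of _ _ T, OF fock_expand[OF finite_keys order_refl, of f]] unfolding clin_sum[OF assms] clin_scale[OF assms] .
  then show ?thesis by (simp only: lookup_sum lookup_cst_mult)
qed

text \<open>The infinite sums in \<open>hm\<close> have finitely many nonzero terms at each
  coordinate, so they are finite sums.\<close>

lemma infsum_neg: assumes "\<And>q. q \<ge> N \<Longrightarrow> f (- int q - 1) = 0"
  shows "infsum f {r::int. r < 0} = (\<Sum>q<N. f (- int q - 1) :: complex)"
proof -
  have "infsum f {r::int. r < 0} = infsum f ((\<lambda>q. - int q - 1) ` {..<N})"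
  proof (rule infsum_cong_neutral)
    fix r assume r: "r \<in> {r::int. r < 0} - (\<lambda>q. - int q - 1) ` {..<N}"
    then have "r = - int (nat (- r - 1)) - 1" by auto
    moreover from this have "nat (- r - 1) \<ge> N" using r by (metis DiffD2 image_eqI lessThan_iff not_less)
    ultimately show "f r = 0" using assms by metis
  qed auto
  also have "\<dots> = (\<Sum>r\<in>(\<lambda>q. - int q - 1) ` {..<N}. f r)" by (rule infsum_finite) simp
  also have "\<dots> = (\<Sum>q<N. f (- int q - 1))" by (subst sum.reindex) (auto simp: inj_on_def)
  finally show ?thesis .
qed

lemma infsum_nonneg: assumes "\<And>q. q \<ge> N \<Longrightarrow> f (int q) = 0"
  shows "infsum f {r::int. 0 \<le> r} = (\<Sum>q<N. f (int q) :: complex)"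
proof -
  have "infsum f {r::int. 0 \<le> r} = infsum f (int ` {..<N})"
  proof (rule infsum_cong_neutral)
    fix r assume r: "r \<in> {r::int. 0 \<le> r} - int ` {..<N}"
    then have "r = int (nat r)" by auto
    moreover from this have "nat r \<ge> N" using r by (metis DiffD2 image_eqI lessThan_iff not_less)
    ultimately show "f r = 0" using assms by metis
  qed auto
  also have "\<dots> = (\<Sum>r\<in>int ` {..<N}. f r)" by (rule infsum_finite) simp
  also have "\<dots> = (\<Sum>q<N. f (int q))" by (subst sum.reindex) (auto simp: inj_on_def)
  finally show ?thesis .
qed

context trip
begin

section \<open>The concrete operators expressed by Fock space operators\<close>

lemma alpha_mk: assumes v: "fin_vec v" shows "alpha p r v = mk (\<lambda>h. al (2 * h) r (pr h v))"
proof
  fix b' :: idx obtain c' h' where b: "b' = (c', h')" by (cases b')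
  have m: "alpha_b p r (c, h') (c', h') = lookup (al (2 * h') r (mon c)) c'" for c
  proof -
    consider "r < 0" | "r = 0" | "r > 0" by linarith
    then show ?thesis
    proof cases
      case 3
      then have "nat (r - 1) = nat r - 1" by auto
      then show ?thesis using 3 by (auto simp: alpha_b_def al_def der_mon bv_def lookup_mon)
    qed (auto simp: alpha_b_def al_def bv_def lookup_mon simp flip: mon_add)
  qed
  have "alpha p r v b' = (\<Sum>c\<in>keys (pr h' v). lookup (pr h' v) c * alpha_b p r (c, h') b')"
    unfolding alpha_def by (rule lin_single[OF v]) (auto simp: alpha_b_def bv_def b)
  also have "\<dots> = lookup (al (2 * h') r (pr h' v)) c'" unfolding b m by (rule clin_lookup[OF clin_al, symmetric])
  finally show "alpha p r v b' = mk (\<lambda>h. al (2 * h) r (pr h v)) b'" by (simp add: mk_def b)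
qed

lemma finite_mk_lin: "fin_vec v \<Longrightarrow> (\<And>h. clin (T h)) \<Longrightarrow> finite {h. T h (pr (h - g) v) \<noteq> 0}"
proof (rule finite_subset)
  assume "\<And>h. clin (T h)"
  then show "{h. T h (pr (h - g) v) \<noteq> 0} \<subseteq> (\<lambda>h. h + g) ` {h. pr h v \<noteq> 0}"
    by (auto simp: image_iff clin_0) (metis clin_0 diff_add_cancel)
qed (simp add: finite_pr)

lemma fin_vec_alpha: "fin_vec v \<Longrightarrow> fin_vec (alpha p r v)"
  using finite_mk_lin[of v "\<lambda>h. al (2 * h) r" 0] by (simp add: alpha_mk fin_vec_mk clin_al)
lemma pr_alpha: "fin_vec v \<Longrightarrow> pr h (alpha p r v) = al (2 * h) r (pr h v)"
  using finite_mk_lin[of v "\<lambda>h. al (2 * h) r" 0] by (simp add: alpha_mk pr_mk clin_al)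

lemma latt_mk: assumes v: "fin_vec v" shows "lin (latt p g n) v = mk (\<lambda>h. V (2 * g) (- n - 1 - 2 * ip * g * (h - g)) (pr (h - g) v))"
proof
  fix b' :: idx obtain c' h' where b: "b' = (c', h')" by (cases b')
  define h where "h = h' - g"
  define M where "M = - n - 1 - 2 * ip * g * h"
  have m: "latt p g n (c, h) (c', h') = lookup (V (2 * g) M (mon c)) c'" for c
  proof -
    have t: "lookup (cst z * SS (of_int (2 * g) / 2) K * mon d) c' = (\<Sum>\<mu>\<in>{\<mu>. int (pwt \<mu>) = K}. if c' = d + \<mu> then of_int g ^ size \<mu> / zee \<mu> * z else 0)" for z K d
    proof -
      have "cst z * SS (of_int (2 * g) / 2) K * mon d = (\<Sum>\<mu>\<in>{\<mu>. int (pwt \<mu>) = K}. cst (of_int g ^ size \<mu> / zee \<mu> * z) * mon (d + \<mu>))"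
      proof -
        have g2: "of_int (2 * g) / 2 = (of_int g :: complex)" by simp
        show ?thesis unfolding g2 SS_def sum_distrib_left sum_distrib_right by (intro sum.cong refl) (simp only: mon_plus cst_mult mult_ac)
      qed
      then show ?thesis by (simp only: lookup_sum lookup_cst_mult lookup_mon) (auto intro!: sum.cong)
    qed
    have "lookup (V (2 * g) M (mon c)) c' = (\<Sum>\<nu>\<in>{\<nu>. \<nu> \<subseteq># c}. \<Sum>\<mu>\<in>{\<mu>. int (pwt \<mu>) = M + int (pwt \<nu>)}. if c' = c - \<nu> + \<mu> then of_int g ^ size \<mu> / zee \<mu> * ((- pc * of_int (2 * g)) ^ size \<nu> * Bin c \<nu>) else 0)"
      unfolding V_def lext_mon lookup_sum t ..
    also have "- pc * of_int (2 * g) = of_int (- 2 * int p * g)" by simp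
    finally show ?thesis by (simp add: latt_def Bin_def M_def h_def cong: if_cong)
  qed
  have "lin (latt p g n) v b' = (\<Sum>c\<in>keys (pr h v). lookup (pr h v) c * latt p g n (c, h) b')"
    by (rule lin_single[OF v]) (auto simp: latt_def b h_def)
  also have "\<dots> = lookup (V (2 * g) M (pr h v)) c'" unfolding b m by (rule clin_lookup[OF clin_V, symmetric])
  finally show "lin (latt p g n) v b' = mk (\<lambda>h. V (2 * g) (- n - 1 - 2 * ip * g * (h - g)) (pr (h - g) v)) b'" by (simp add: mk_def b M_def h_def)
qed

lemma hm_mk: "fin_vec v \<Longrightarrow> hm p js g n v = mk (\<lambda>h. Yl (2 * g) (2 * (h - g)) js (- n - 1 - 2 * ip * g * (h - g)) (pr (h - g) v))"
proof (induction js arbitrary: n v)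
  case Nil then show ?case by (simp add: latt_mk)
next
  case (Cons j js)
  note v = Cons.prems
  let ?X = "\<lambda>h. Yl (2 * g) (2 * (h - g)) js"
  have fm: "finite {h. ?X h (M h) (pr (h - g) w) \<noteq> 0}" if "fin_vec w" for w M
    by (rule finite_mk_lin[OF that]) (rule fam_clin[OF fam_Yl])
  have fh: "fin_vec (hm p js g n' v)" for n' unfolding Cons.IH[OF v] by (rule fin_vec_mk[OF fm[OF v]])
  have ph: "pr h (hm p js g n' v) = ?X h (- n' - 1 - 2 * ip * g * (h - g)) (pr (h - g) v)" for h n'
    unfolding Cons.IH[OF v] by (rule pr_mk[OF fm[OF v]])
  show ?case
  proof
    fix b' :: idx obtain c' h' where b: "b' = (c', h')" by (cases b')
    define h where "h = h' - g"
    define m where "m = - n - 1 - 2 * ip * g * h"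
    let ?f = "pr h v"
    obtain N1 where N1: "\<And>q. q \<ge> N1 \<Longrightarrow> CP j (?X h') m ?f q = 0" using CP_large[OF fam_Yl] by blast
    obtain N2 where N2: "\<And>q. q \<ge> N2 \<Longrightarrow> AP (2 * h) j (?X h') m ?f q = 0" using AP_large[OF fam_Yl] by blast
    have c: "(of_int (- (- int q - 1) - 1) gchoose j) * alpha p (- int q - 1) (hm p js g (n - (- int q - 1) - int j - 1) v) b' = lookup (CP j (?X h') m ?f q) c'" for q
    proof -
      have e: "- (n - (- int q - 1) - int j - 1) - 1 - 2 * ip * g * h = m - int q + int j" by (simp add: m_def)
      show ?thesis unfolding alpha_mk[OF fh] ph CP_def lookup_cst_mult mk_def b prod.case al_neg h_def[symmetric] e by simp
    qed
    have a: "(of_int (- int q - 1) gchoose j) * hm p js g (n - int q - int j - 1) (alpha p (int q) v) b' = lookup (AP (2 * h) j (?X h') m ?f q) c'" for q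
    proof -
      have e: "- (n - int q - int j - 1) - 1 - 2 * ip * g * h = m + int q + int j + 1" by (simp add: m_def)
      show ?thesis unfolding Cons.IH[OF fin_vec_alpha[OF v]] AP_def lookup_cst_mult pr_alpha[OF v] mk_def b prod.case h_def[symmetric] e by simp
    qed
    have "hm p (j # js) g n v b' = (\<Sum>q<N1. lookup (CP j (?X h') m ?f q) c') + (\<Sum>q<N2. lookup (AP (2 * h) j (?X h') m ?f q) c')"
      unfolding hm.simps
      by (subst infsum_neg[of N1]; (subst infsum_nonneg[of N2])?) (simp_all only: a c N1 N2 lookup_zero)
    also have "\<dots> = lookup (NP (2 * h) j (?X h') m ?f) c'"
    proof -
      have "Sum_any (CP j (?X h') m ?f) = (\<Sum>q<N1. CP j (?X h') m ?f q)" by (rule SA_nat) (rule N1)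
      moreover have "Sum_any (AP (2 * h) j (?X h') m ?f) = (\<Sum>q<N2. AP (2 * h) j (?X h') m ?f q)" by (rule SA_nat) (rule N2)
      ultimately show ?thesis by (simp only: NP_def lookup_add lookup_sum)
    qed
    finally show "hm p (j # js) g n v b' = mk (\<lambda>h. Yl (2 * g) (2 * (h - g)) (j # js) (- n - 1 - 2 * ip * g * (h - g)) (pr (h - g) v)) b'"
      by (simp add: mk_def b h_def m_def)
  qed
qed

text \<open>The mode \<open>b\<^sub>n\<close> of a state \<open>b\<close> of charge \<open>g\<close> on charge \<open>h\<close>; charges are not doubled here.\<close>

definition md :: "int \<Rightarrow> fock \<Rightarrow> int \<Rightarrow> int \<Rightarrow> fock \<Rightarrow> fock" where
  "md g b n h = Ys (2 * g) (2 * h) b (- n - 1 - 2 * ip * g * h)"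

lemma clin_md: "clin (md g b n h)" unfolding md_def by (rule clin_Ys)

lemma vmode_ev: assumes v: "fin_vec v" shows "vmode p (ev g b) n v = mk (\<lambda>h. md g b n (h - g) (pr (h - g) v))"
proof
  fix b' :: idx obtain c' h' where b': "b' = (c', h')" by (cases b')
  have s: "{x. ev g b x \<noteq> 0} = (\<lambda>c. (c, g)) ` keys b" by (auto simp: ev_apply in_keys_iff image_iff split: if_splits)
  have "vmode p (ev g b) n v b' = (\<Sum>c\<in>keys b. lookup b c * hm p (sorted_list_of_multiset c) g n v b')"
    unfolding vmode_def s by (subst sum.reindex) (auto simp: inj_on_def ev_apply)
  also have "\<dots> = lookup (md g b n (h' - g) (pr (h' - g) v)) c'"
    unfolding md_def Ys_def lext_def lookup_sum lookup_cst_mult hm_mk[OF v] by (simp add: mk_def b')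
  finally show "vmode p (ev g b) n v b' = mk (\<lambda>h. md g b n (h - g) (pr (h - g) v)) b'" by (simp add: mk_def b')
qed

lemma pr_vmode: "fin_vec v \<Longrightarrow> pr h (vmode p (ev g b) n v) = md g b n (h - g) (pr (h - g) v)"
  unfolding vmode_ev by (rule pr_mk, rule finite_mk_lin) (simp_all add: clin_md)
lemma fin_vec_vmode: "fin_vec v \<Longrightarrow> fin_vec (vmode p (ev g b) n v)"
  unfolding vmode_ev by (rule fin_vec_mk, rule finite_mk_lin) (simp_all add: clin_md)

lemma vmode_ev_ev: "vmode p (ev g b) n (ev h f) = ev (g + h) (md g b n h f)"
proof -
  have "md g b n (k - g) (if k - g = h then f else 0) = (if k = g + h then md g b n h f else 0)" for k
    by (auto simp: clin_0[OF clin_md])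
  then show ?thesis unfolding vmode_ev[OF fin_vec_ev] pr_ev by (simp add: ev_def)
qed

lemma eL_ev: "eL n = ev n 1" by (auto simp: eL_def bv_def ev_apply lookup_1)
lemma vac_ev: "vac = ev 0 1" by (auto simp: vac_def bv_def ev_apply lookup_1)

lemma Qs_ev: "Qs p (ev h f) = ev (h + 1) (Qo (2 * h) f)"
  unfolding Qs_def eL_ev vmode_ev_ev by (simp add: md_def Ys_1 Qo_def add.commute algebra_simps)

lemma Qs_power: "(Qs p ^^ i) (eL (- int n)) = ev (int i - int n) (Qp (2 * n) i)"
proof (induction i)
  case 0 show ?case by (simp add: eL_ev Qp_def)
next
  case (Suc i) then show ?case by (simp add: Qs_ev Qp_def algebra_simps)
qed

text \<open>Written with a final factor 1, the form in which \<open>Ys_var\<close> and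
  \<open>Ys_1\<close> unfold it.\<close>

definition om :: fock where "om = cst (1 / (4 * pc)) * (var 0 * (var 0 * 1)) + cst ((pc - 1) / (2 * pc)) * (var 1 * 1)"

lemma omega_ev: "omega p = ev 0 om"
proof
  fix b' :: idx obtain c' h' where b': "b' = (c', h')" by (cases b')
  have "var 0 * (var 0 * 1) = mon {#0, 0#}" "var 1 * 1 = mon {#1#}" by (simp_all add: mon_add)
  then show "omega p b' = ev 0 om b'"
    unfolding omega_def om_def b' ev_apply by (auto simp: bv_def lookup_add lookup_mon)
qed

lemma V_zero: "V 0 m f = (if m = 0 then f else 0)"
proof (rule clin_eqI[OF clin_V clin_if[OF clin_id clin_zero]])
  show "V 0 m 1 = (if m = 0 then 1 else 0)"
  proof -
    have "SS 0 m = (if m = 0 then 1 else 0)"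
      by (rule fock_eqI) (auto simp: lookup_SS lookup_1 nonempty_has_size)
    then show ?thesis by (simp add: V_1)
  qed
qed (simp add: V_var)

lemma NP_V_zero: "NP \<chi> 0 (V 0) m f = al \<chi> (- m - 1) f"
proof (cases "m \<ge> 0")
  case True
  have "CP 0 (V 0) m f q = (if q = nat m then var q * f else 0)" for q using True by (auto simp: CP_def V_zero)
  moreover have "AP \<chi> 0 (V 0) m f q = 0" for q using True by (auto simp: AP_def V_zero)
  ultimately show ?thesis using al_neg[of \<chi> "nat m" f] True by (simp add: NP_def)
next
  case False
  have "CP 0 (V 0) m f q = 0" for q using False by (auto simp: CP_def V_zero)
  moreover have "AP \<chi> 0 (V 0) m f q = (if q = nat (- m - 1) then al \<chi> (int q) f else 0)" for q using False by (auto simp: AP_def V_zero)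
  ultimately show ?thesis using False by (simp add: NP_def)
qed

lemma NP1_V_zero: "NP \<chi> 1 (V 0) m f = cst (of_int m + 1) * al \<chi> (- m - 2) f"
proof (cases "m \<ge> - 1")
  case True
  have "CP 1 (V 0) m f q = (if q = nat (m + 1) then cst (of_int m + 1) * (var q * f) else 0)" for q using True by (auto simp: CP_def V_zero)
  moreover have "AP \<chi> 1 (V 0) m f q = 0" for q using True by (auto simp: AP_def V_zero)
  moreover have "al \<chi> (- m - 2) f = var (nat (m + 1)) * f"
  proof -
    have "- int (nat (m + 1)) - 1 = - m - 2" using True by simp
    then show ?thesis using al_neg[of \<chi> "nat (m + 1)" f] by (simp only:)
  qed
  ultimately show ?thesis by (simp add: NP_def)
next
  case False
  have "CP 1 (V 0) m f q = 0" for q using False by (auto simp: CP_def V_zero)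
  moreover have "AP \<chi> 1 (V 0) m f q = (if q = nat (- m - 2) then cst (of_int m + 1) * al \<chi> (int q) f else 0)" for q using False by (auto simp: AP_def V_zero add.commute)
  ultimately show ?thesis using False by (simp add: NP_def)
qed

lemma md_om: "md 0 om n h f = L (2 * h) (n - 1) f"
proof -
  let ?\<chi> = "2 * h"
  define k where "k = n - 1"
  have "NP ?\<chi> 0 (\<lambda>m f. al ?\<chi> (- m - 1) f) (- k - 2) f = Sum_any (Lt ?\<chi> k f)"
  proof -
    have c: "CP 0 (\<lambda>m f. al ?\<chi> (- m - 1) f) (- k - 2) f q = Lt ?\<chi> k f (- 1 - int q)" for q
    proof -
      have e: "- (- k - 2 - int q + int 0) - 1 = k - (- 1 - int q)" "- 1 - int q = - int q - 1" by simp_all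
      have "Lt ?\<chi> k f (- 1 - int q) = al ?\<chi> (- 1 - int q) (al ?\<chi> (k - (- 1 - int q)) f)" unfolding Lt_def by simp
      also have "\<dots> = var q * al ?\<chi> (k - (- 1 - int q)) f" unfolding e(2) by (rule al_neg)
      finally show ?thesis unfolding CP_def e(1) by simp
    qed
    have a: "AP ?\<chi> 0 (\<lambda>m f. al ?\<chi> (- m - 1) f) (- k - 2) f r = Lt ?\<chi> k f (int r)" for r
    proof -
      have "- (- k - 2 + int r + 1) - 1 = k - int r" by simp
      then show ?thesis by (simp add: AP_def Lt_def)
    qed
    show ?thesis unfolding NP_def SA_int_nat[OF fs_Lt] a c by (simp add: add.commute)
  qed
  moreover have "NP ?\<chi> 0 (V 0) = (\<lambda>m f. al ?\<chi> (- m - 1) f)" by (intro ext) (rule NP_V_zero)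
  ultimately have 0: "NP ?\<chi> 0 (NP ?\<chi> 0 (V 0)) (- k - 2) f = Sum_any (Lt ?\<chi> k f)" by (simp only:)
  have 1: "NP ?\<chi> 1 (V 0) (- k - 2) f = - (cst (of_int k + 1) * al ?\<chi> k f)"
  proof -
    have "- (- k - 2) - 2 = k" "of_int (- k - 2) + 1 = - (of_int k + 1 :: complex)" by simp_all
    then show ?thesis unfolding NP1_V_zero by (simp only: cst_minus mult_minus_left)
  qed
  have e: "- n - 1 - 2 * ip * 0 * h = - k - 2" "2 * 0 = (0 :: int)" by (simp_all add: k_def)
  show ?thesis unfolding md_def e om_def Ys_add Ys_scale Ys_var Ys_1 0 1 L_def k_def[symmetric]
    by (simp add: cst_mult mult.assoc)
qed

lemma Vir_ev: "Vir p n (ev h f) = ev h (L (2 * h) n f)"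
  unfolding Vir_def omega_ev vmode_ev_ev md_om by simp
lemma pr_Vir: "fin_vec v \<Longrightarrow> pr h (Vir p n v) = L (2 * h) n (pr h v)"
  unfolding Vir_def omega_ev by (simp add: pr_vmode md_om)
lemma fin_vec_Vir: "fin_vec v \<Longrightarrow> fin_vec (Vir p n v)"
  unfolding Vir_def omega_ev by (rule fin_vec_vmode)

lemma ev_0: "ev h 0 = (\<lambda>_. 0)" by (auto simp: ev_apply)
lemma ev_add: "ev h (f + g) = (\<lambda>b. ev h f b + ev h g b)" by (auto simp: ev_apply lookup_add)
lemma ev_scale: "ev h (cst z * f) = (\<lambda>b. z * ev h f b)" by (auto simp: ev_apply)
lemma fin_vec_0: "fin_vec (\<lambda>_. 0)" by (simp add: fin_vec_def)
lemma fin_vec_add: "fin_vec u \<Longrightarrow> fin_vec v \<Longrightarrow> fin_vec (\<lambda>b. u b + v b)"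
  unfolding fin_vec_def by (rule finite_subset[of _ "{b. u b \<noteq> 0} \<union> {b. v b \<noteq> 0}"]) auto
lemma fin_vec_scale: "fin_vec u \<Longrightarrow> fin_vec (\<lambda>b. z * u b)"
  unfolding fin_vec_def by (rule finite_subset[of _ "{b. u b \<noteq> 0}"]) auto
lemma pr_add: "fin_vec u \<Longrightarrow> fin_vec v \<Longrightarrow> pr h (\<lambda>b. u b + v b) = pr h u + pr h v"
  by (rule fock_eqI) (simp add: lookup_pr fin_vec_add lookup_add)
lemma pr_scale: "fin_vec u \<Longrightarrow> pr h (\<lambda>b. z * u b) = cst z * pr h u"
  by (rule fock_eqI) (simp add: lookup_pr fin_vec_scale)

lemma Wtrip_Wmod: "v \<in> Wtrip p \<Longrightarrow> fin_vec v \<and> (\<forall>h. Wmod (2 * h) (pr h v))"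
proof (induction rule: Wtrip.induct)
  case (gen i n)
  have "Wmod (2 * (int i - int n)) (Qp (2 * n) i)" using Wmod.gen[of i "2 * n"] gen by (simp add: algebra_simps)
  then show ?case unfolding Qs_power by (auto simp: fin_vec_ev pr_ev Wmod.zero)
next
  case zero
  have "pr h (\<lambda>_. 0) = 0" for h by (rule fock_eqI) (simp add: lookup_pr[OF fin_vec_0])
  then show ?case by (simp add: fin_vec_0 Wmod.zero)
qed (auto simp: fin_vec_add fin_vec_scale fin_vec_Vir pr_add pr_scale pr_Vir intro: Wmod.intros)

lemma Wmod_Wtrip: "Wmod \<chi> f \<Longrightarrow> \<chi> = 2 * h \<Longrightarrow> ev h f \<in> Wtrip p"
proof (induction arbitrary: h rule: Wmod.induct)
  case (gen i n)
  \<comment> \<open>An even doubled charge forces n to be even, so the generator belongs to the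
    triplet module.\<close>
  then have "n = 2 * nat (int i - h)" and h: "h = int i - int (nat (int i - h))" by auto
  then show ?case using Wtrip.gen[of i "nat (int i - h)" p] gen.hyps unfolding Qs_power by simp
next
  case (zero \<chi>) show ?case unfolding ev_0 by (rule Wtrip.zero)
next
  case (add \<chi> f g) then show ?case unfolding ev_add by (intro Wtrip.add) auto
next
  case (scale \<chi> f z) then show ?case unfolding ev_scale by (intro Wtrip.smult) auto
next
  case (vir \<chi> f k) then show ?case using Wtrip.vir[of "ev h f" p k] unfolding Vir_ev by simp
qed

lemma ev_decomp: assumes v: "fin_vec v" shows "v = (\<lambda>b. \<Sum>h\<in>{h. pr h v \<noteq> 0}. ev h (pr h v) b)"
proof
  fix b' :: idx obtain c' h' where b': "b' = (c', h')" by (cases b')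
  have "(\<Sum>h\<in>{h. pr h v \<noteq> 0}. ev h (pr h v) b') = lookup (pr h' v) c'"
    unfolding b' ev_apply using finite_pr[OF v] by auto
  then show "v b' = (\<Sum>h\<in>{h. pr h v \<noteq> 0}. ev h (pr h v) b')" by (simp add: lookup_pr[OF v] b')
qed

lemma cspan_zero: "(\<lambda>_. 0) \<in> cspan S" unfolding cspan_def by (auto intro!: exI[of _ "{}"])
lemma cspan_base: "w \<in> S \<Longrightarrow> w \<in> cspan S"
  unfolding cspan_def by (intro CollectI exI[of _ "{w}"] exI[of _ "\<lambda>_. 1"]) auto
lemma cspan_scale: "v \<in> cspan S \<Longrightarrow> (\<lambda>b. z * v b) \<in> cspan S"
proof -
  assume "v \<in> cspan S"
  then obtain F c where F: "finite F" "F \<subseteq> S" "v = (\<lambda>b. \<Sum>w\<in>F. c w * w b)" unfolding cspan_def by auto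
  then have "(\<lambda>b. z * v b) = (\<lambda>b. \<Sum>w\<in>F. (z * c w) * w b)" by (simp add: sum_distrib_left mult.assoc)
  then show ?thesis unfolding cspan_def using F(1,2) by (intro CollectI exI[of _ F] exI[of _ "\<lambda>w. z * c w"]) simp
qed
lemma cspan_add: assumes "u \<in> cspan S" "v \<in> cspan S" shows "(\<lambda>b. u b + v b) \<in> cspan S"
proof -
  obtain F c where F: "finite F" "F \<subseteq> S" "u = (\<lambda>b. \<Sum>w\<in>F. c w * w b)" using assms(1) unfolding cspan_def by auto
  obtain G d where G: "finite G" "G \<subseteq> S" "v = (\<lambda>b. \<Sum>w\<in>G. d w * w b)" using assms(2) unfolding cspan_def by auto
  define e where "e w = (if w \<in> F then c w else 0) + (if w \<in> G then d w else 0)" for w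
  have "u b + v b = (\<Sum>w\<in>F \<union> G. e w * w b)" for b
  proof -
    have "(\<Sum>w\<in>F. c w * w b) = (\<Sum>w\<in>F \<union> G. (if w \<in> F then c w else 0) * w b)" by (rule sum.mono_neutral_cong_left) (use F G in auto)
    moreover have "(\<Sum>w\<in>G. d w * w b) = (\<Sum>w\<in>F \<union> G. (if w \<in> G then d w else 0) * w b)" by (rule sum.mono_neutral_cong_left) (use F G in auto)
    ultimately show ?thesis unfolding F G e_def distrib_right sum.distrib by simp
  qed
  then show ?thesis unfolding cspan_def using F G by (intro CollectI exI[of _ "F \<union> G"] exI[of _ e]) auto
qed
lemma cspan_sum: "(\<And>x. x \<in> A \<Longrightarrow> g x \<in> cspan S) \<Longrightarrow> (\<lambda>b. \<Sum>x\<in>A. g x b) \<in> cspan S"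
  by (induction A rule: infinite_finite_induct) (auto intro: cspan_zero cspan_add)

lemma cspan_closed_under:
  assumes T: "\<And>w. w \<in> S \<Longrightarrow> fin_vec w \<and> vmode p (ev g b) n w \<in> cspan S" and v: "v \<in> cspan S"
  shows "vmode p (ev g b) n v \<in> cspan S"
proof -
  obtain F c where F: "finite F" "F \<subseteq> S" "v = (\<lambda>b. \<Sum>w\<in>F. c w * w b)" using v unfolding cspan_def by auto
  have "F \<subseteq> S \<Longrightarrow> fin_vec (\<lambda>b. \<Sum>w\<in>F. c w * w b) \<and> vmode p (ev g b) n (\<lambda>b. \<Sum>w\<in>F. c w * w b) \<in> cspan S"
    using F(1)
  proof (induction F rule: finite_induct)
    case empty
    have "vmode p (ev g b) n (\<lambda>b. 0) = ev (g + 0) (md g b n 0 0)" using vmode_ev_ev[of g b n 0 0] by (simp add: ev_0)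
    then show ?case by (simp add: clin_0[OF clin_md] ev_0 fin_vec_0 cspan_zero)
  next
    case (insert w F)
    let ?r = "\<lambda>b. \<Sum>w\<in>F. c w * w b"
    have r: "fin_vec ?r" "vmode p (ev g b) n ?r \<in> cspan S" and w: "fin_vec w" "vmode p (ev g b) n w \<in> cspan S" using insert T by auto
    have e: "(\<lambda>b. \<Sum>w\<in>insert w F. c w * w b) = (\<lambda>b. c w * w b + ?r b)" using insert.hyps by simp
    have cw: "fin_vec (\<lambda>b. c w * w b)" by (rule fin_vec_scale[OF w(1)])
    have "vmode p (ev g b) n (\<lambda>b. c w * w b + ?r b) = (\<lambda>b'. c w * vmode p (ev g b) n w b' + vmode p (ev g b) n ?r b')"
      unfolding vmode_ev[OF fin_vec_add[OF cw r(1)]] vmode_ev[OF w(1)] vmode_ev[OF r(1)] pr_add[OF cw r(1)] pr_scale[OF w(1)] clin_add[OF clin_md] clin_scale[OF clin_md]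
      by (auto simp: mk_def lookup_add)
    then show ?case unfolding e using fin_vec_add[OF cw r(1)] cspan_add[OF cspan_scale[OF w(2)] r(2)] by simp
  qed
  then show ?thesis using F by simp
qed

section \<open>Generation by \<open>E\<close>, \<open>F\<close>, \<open>H\<close> and \<open>\<omega>\<close>\<close>

lemma md_1: "md g 1 n h = V (2 * g) (- n - 1 - 2 * ip * g * h)" by (simp add: md_def Ys_1)

text \<open>For integral charges the sign in \<open>Q_derivation\<close> is 1, and Q obeys the plain
  Leibniz rule on modes.\<close>

lemma md_Q: "md (g + 1) (Qo (2 * g) b) n h f = Qo (2 * (g + h)) (md g b n h f) - md g b n (h + 1) (Qo (2 * h) f)"
proof -
  define M where "M = - n - 1 - 2 * ip * (g + 1) * h"
  have e: "M + ip * (2 * h) = - n - 1 - 2 * ip * g * h" "- n - 1 - 2 * ip * g * h - ip * (2 * g) = - n - 1 - 2 * ip * g * (h + 1)"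
    "2 * (g + 1) = 2 * g + 2" "2 * h + 2 * g = 2 * (g + h)" "2 * (h + 1) = 2 * h + 2" "par (ip * (2 * g)) = 1"
    by (simp_all add: M_def par_def algebra_simps)
  show ?thesis unfolding md_def M_def[symmetric] e(3) Q_derivation unfolding e by simp
qed

lemma Q_md: "Qo (2 * (g + h)) (md g b n h f) = md (g + 1) (Qo (2 * g) b) n h f + md g b n (h + 1) (Qo (2 * h) f)"
  by (simp add: md_Q)

definition Wclosed :: "int \<Rightarrow> fock \<Rightarrow> bool" where
  "Wclosed g b \<longleftrightarrow> (\<forall>n h f. Wmod (2 * h) f \<longrightarrow> Wmod (2 * (g + h)) (md g b n h f))"

lemma Wclosed_Q: assumes "Wclosed g b" shows "Wclosed (g + 1) (Qo (2 * g) b)"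
  unfolding Wclosed_def
proof (intro allI impI)
  fix n h f assume f: "Wmod (2 * h) f"
  have e: "2 * (g + h) + 2 = 2 * (g + 1 + h)" "2 * h + 2 = 2 * (h + 1)" "2 * (g + (h + 1)) = 2 * (g + 1 + h)" by simp_all
  have 1: "Wmod (2 * (g + 1 + h)) (Qo (2 * (g + h)) (md g b n h f))"
    using Wmod_Q[of "2 * (g + h)" "md g b n h f"] assms f unfolding Wclosed_def e by blast
  have "Wmod (2 * (h + 1)) (Qo (2 * h) f)" using Wmod_Q[OF f] unfolding e .
  then have 2: "Wmod (2 * (g + 1 + h)) (md g b n (h + 1) (Qo (2 * h) f))" using assms unfolding Wclosed_def e(3)[symmetric] by blast
  show "Wmod (2 * (g + 1 + h)) (md (g + 1) (Qo (2 * g) b) n h f)" unfolding md_Q by (rule Wmod_diff[OF 1 2])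
qed

lemma Wclosed_F: assumes "1 \<le> m" shows "Wclosed (- int m) 1"
  unfolding Wclosed_def md_1
proof (intro allI impI)
  fix n h f assume f: "Wmod (2 * h) f"
  obtain k where k: "2 * m = Suc k" using assms by (cases "2 * m") auto
  have e: "2 * (- int m) = - int (Suc k)" "2 * (- int m + h) = 2 * h - int (Suc k)" using k by simp_all
  show "Wmod (2 * (- int m + h)) (V (2 * - int m) (- n - 1 - 2 * ip * - int m * h) f)"
    unfolding e(1) unfolding e(2) by (rule Wmod_V[OF f])
qed

lemma Wclosed_Qp: assumes "1 \<le> m" shows "Wclosed (- int m + int i) (Qp (2 * m) i)"
proof (induction i)
  case 0 show ?case using Wclosed_F[OF assms] by (simp add: Qp_def)
next
  case (Suc i)
  have "2 * (- int m + int i) = - int (2 * m) + 2 * int i" "- int m + int i + 1 = - int m + int (Suc i)" by simp_all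
  then show ?case using Wclosed_Q[OF Suc] by (simp only: Qp_def Qit.simps)
qed

lemma Em_ev: "Em p m = ev (int m) (Qp (2 * m) (2 * m))" unfolding Em_def Qs_power by simp
lemma Fm_ev: "Fm m = ev (- int m) 1" by (simp add: Fm_def eL_ev)
lemma Hv_ev: "Hv p = ev 0 (Qp 2 1)"
  using Qs_power[of 1 1] by (simp add: Hv_def)

lemma Wclosed_E: "1 \<le> m \<Longrightarrow> Wclosed (int m) (Qp (2 * m) (2 * m))" using Wclosed_Qp[of m "2 * m"] by simp
lemma Wclosed_H: "Wclosed 0 (Qp 2 1)" using Wclosed_Qp[of 1 1] by simp
lemma Wclosed_om: "Wclosed 0 om" by (simp add: Wclosed_def md_om Wmod.vir)

lemma Mon_Wmod: assumes m: "1 \<le> m" shows "w \<in> Mon p m \<Longrightarrow> \<exists>h f. w = ev h f \<and> int m dvd h \<and> Wmod (2 * h) f"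
proof (induction rule: Mon.induct)
  case vac
  show ?case using Wmod_1[of 0] by (intro exI[of _ 0] exI[of _ 1]) (simp add: vac_ev)
next
  case (step w a n)
  then obtain h f where w: "w = ev h f" "int m dvd h" "Wmod (2 * h) f" by blast
  have "\<exists>g b. a = ev g b \<and> int m dvd g \<and> Wclosed g b"
  proof -
    have "\<exists>g b. Em p m = ev g b \<and> int m dvd g \<and> Wclosed g b" using Em_ev Wclosed_E[OF m] dvd_refl by blast
    moreover have "\<exists>g b. Fm m = ev g b \<and> int m dvd g \<and> Wclosed g b"
      using Fm_ev Wclosed_F[OF m] by (intro exI[of _ "- int m"] exI[of _ 1]) simp
    moreover have "\<exists>g b. Hv p = ev g b \<and> int m dvd g \<and> Wclosed g b" using Hv_ev Wclosed_H dvd_0_right by blast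
    moreover have "\<exists>g b. omega p = ev g b \<and> int m dvd g \<and> Wclosed g b" using omega_ev Wclosed_om dvd_0_right by blast
    ultimately show ?thesis using step.hyps(2) by (elim insertE emptyE) simp_all
  qed
  then obtain g b where a: "a = ev g b" "int m dvd g" "Wclosed g b" by blast
  show ?case unfolding a(1) w(1) vmode_ev_ev using a(2,3) w(2,3) unfolding Wclosed_def
    by (intro exI[of _ "g + h"] exI[of _ "md g b (- int n - 1) h f"] conjI refl) auto
qed

lemma WA_sum: "finite F \<Longrightarrow> F \<subseteq> WA p m \<Longrightarrow> (\<lambda>b. \<Sum>w\<in>F. c w * w b) \<in> WA p m"
proof (induction F rule: finite_induct)
  case empty show ?case by (simp add: WA_def Wtrip.zero)
next
  case (insert w F)
  then have "w \<in> WA p m" and r: "(\<lambda>b. \<Sum>w\<in>F. c w * w b) \<in> WA p m" by auto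
  then have "(\<lambda>b. c w * w b + (\<Sum>w\<in>F. c w * w b)) \<in> Wtrip p"
    unfolding WA_def by (intro Wtrip.add Wtrip.smult) auto
  moreover have "int m dvd snd b" if "c w * w b + (\<Sum>w\<in>F. c w * w b) \<noteq> 0" for b
  proof (cases "w b = 0")
    case True then show ?thesis using that r unfolding WA_def by (cases b) auto
  next
    case False then show ?thesis using \<open>w \<in> WA p m\<close> unfolding WA_def by (cases b) auto
  qed
  ultimately show ?case unfolding sum.insert[OF insert.hyps] WA_def by blast
qed

lemma cspan_Mon_WA: assumes m: "1 \<le> m" shows "cspan (Mon p m) \<subseteq> WA p m"
proof -
  have "Mon p m \<subseteq> WA p m"
  proof
    fix w assume "w \<in> Mon p m"
    then obtain h f where w: "w = ev h f" "int m dvd h" "Wmod (2 * h) f" using Mon_Wmod[OF m] by blast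
    then show "w \<in> WA p m" unfolding WA_def using Wmod_Wtrip[OF w(3) refl] by (auto simp: ev_apply split: if_splits)
  qed
  then show ?thesis unfolding cspan_def using WA_sum by auto
qed

text \<open>The span of \<open>Mon\<close>, charge by charge. The mode -n - 1 of omega is L_{-n-2},
  so L_{-1} is not among the rules.\<close>

inductive gen_span :: "nat \<Rightarrow> int \<Rightarrow> fock \<Rightarrow> bool" for m where
  vac: "gen_span m 0 1"
| zero: "gen_span m h 0"
| add: "gen_span m h f \<Longrightarrow> gen_span m h g \<Longrightarrow> gen_span m h (f + g)"
| scale: "gen_span m h f \<Longrightarrow> gen_span m h (cst z * f)"
| F: "gen_span m h f \<Longrightarrow> gen_span m (- int m + h) (md (- int m) 1 (- int n - 1) h f)"
| E: "gen_span m h f \<Longrightarrow> gen_span m (int m + h) (md (int m) (Qp (2 * m) (2 * m)) (- int n - 1) h f)"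
| H: "gen_span m h f \<Longrightarrow> gen_span m h (md 0 (Qp 2 1) (- int n - 1) h f)"
| om: "gen_span m h f \<Longrightarrow> gen_span m h (L (2 * h) (- int n - 2) f)"

lemma gen_span_cspan: assumes m: "1 \<le> m" shows "gen_span m h f \<Longrightarrow> ev h f \<in> cspan (Mon p m)"
proof (induction rule: gen_span.induct)
  case vac show ?case using cspan_base[OF Mon.vac] by (simp add: vac_ev)
next
  case (zero h) show ?case unfolding ev_0 by (rule cspan_zero)
next
  case (add h f g) then show ?case unfolding ev_add by (intro cspan_add)
next
  case (scale h f z) then show ?case unfolding ev_scale by (intro cspan_scale)
next
  have cl: "vmode p a (- int n - 1) v \<in> cspan (Mon p m)" if "a \<in> {Em p m, Fm m, Hv p, omega p}" "v \<in> cspan (Mon p m)" for a n v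
  proof -
    have "\<exists>g b. a = ev g b" using that(1) Em_ev[of m] Fm_ev[of m] Hv_ev omega_ev by (elim insertE emptyE) metis+
    then obtain g b where a: "a = ev g b" by blast
    show ?thesis unfolding a
      by (rule cspan_closed_under[OF _ that(2)])
         (use Mon.step[OF _ that(1)] Mon_Wmod[OF m] fin_vec_ev cspan_base a in \<open>metis\<close>)
  qed
  {
    case (F h f n) then show ?case using cl[of "Fm m" "ev h f" n] by (simp add: Fm_ev vmode_ev_ev)
  next
    case (E h f n) then show ?case using cl[of "Em p m" "ev h f" n] by (simp add: Em_ev vmode_ev_ev)
  next
    case (H h f n) then show ?case using cl[of "Hv p" "ev h f" n] by (simp add: Hv_ev vmode_ev_ev)
  next
    case (om h f n)
    have e: "- int n - 1 - 1 = - int n - 2" "0 + h = h" by simp_all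
    show ?case using cl[of "omega p" "ev h f" n, OF _ om.IH] unfolding omega_ev vmode_ev_ev md_om e by blast
  }
qed

section \<open>Stability of the generated span under negative Virasoro modes\<close>

definition translation_covariant :: "int \<Rightarrow> fock \<Rightarrow> bool" where
  "translation_covariant g b \<longleftrightarrow> (\<forall>n h f. L (2 * (g + h)) (- 1) (md g b n h f) = md g b n h (L (2 * h) (- 1) f) - cst (of_int n) * md g b (n - 1) h f)"

lemma translation_covariant_1: "translation_covariant g 1"
  unfolding translation_covariant_def
proof (intro allI)
  fix n h f
  define M where "M = - n - 1 - 2 * ip * g * h"
  have e: "2 * (g + h) = 2 * h + 2 * g" "- (n - 1) - 1 - 2 * ip * g * h = M - - 1" by (simp_all add: M_def)
  have c: "of_int (M - - 1) + pc * of_int (2 * g) * of_int (2 * h) / 2 + (of_int (- 1) + 1) * hw (2 * g) = - of_int n"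
    by (simp add: M_def)
  show "L (2 * (g + h)) (- 1) (md g 1 n h f) = md g 1 n h (L (2 * h) (- 1) f) - cst (of_int n) * md g 1 (n - 1) h f"
    unfolding md_1 e M_def[symmetric] L_V c by (simp add: cst_minus)
qed

lemma translation_covariant_Q: assumes "translation_covariant g b" shows "translation_covariant (g + 1) (Qo (2 * g) b)"
  unfolding translation_covariant_def
proof (intro allI)
  fix n h f
  have e: "2 * (g + 1 + h) = 2 * (g + h) + 2" "2 * (g + (h + 1)) = 2 * (g + h) + 2" "2 * (h + 1) = 2 * h + 2" by simp_all
  have 1: "L (2 * (g + h) + 2) (- 1) (Qo (2 * (g + h)) (md g b n h f)) = Qo (2 * (g + h)) (md g b n h (L (2 * h) (- 1) f)) - cst (of_int n) * Qo (2 * (g + h)) (md g b (n - 1) h f)"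
    using assms unfolding translation_covariant_def Q_L[symmetric] by (simp only: clin_diff[OF clin_Q] clin_scale[OF clin_Q])
  have 2: "L (2 * (g + h) + 2) (- 1) (md g b n (h + 1) (Qo (2 * h) f)) = md g b n (h + 1) (Qo (2 * h) (L (2 * h) (- 1) f)) - cst (of_int n) * md g b (n - 1) (h + 1) (Qo (2 * h) f)"
  proof -
    have "L (2 * (g + (h + 1))) (- 1) (md g b n (h + 1) (Qo (2 * h) f)) = md g b n (h + 1) (L (2 * (h + 1)) (- 1) (Qo (2 * h) f)) - cst (of_int n) * md g b (n - 1) (h + 1) (Qo (2 * h) f)"
      using assms unfolding translation_covariant_def by blast
    then show ?thesis unfolding e(2) unfolding e(3) Q_L .
  qed
  show "L (2 * (g + 1 + h)) (- 1) (md (g + 1) (Qo (2 * g) b) n h f) = md (g + 1) (Qo (2 * g) b) n h (L (2 * h) (- 1) f) - cst (of_int n) * md (g + 1) (Qo (2 * g) b) (n - 1) h f"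
    unfolding md_Q e(1) clin_diff[OF clin_L] 1 2 right_diff_distrib by simp
qed

lemma translation_covariant_Qp: "translation_covariant (- int m + int i) (Qp (2 * m) i)"
proof (induction i)
  case 0 show ?case using translation_covariant_1 by (simp add: Qp_def)
next
  case (Suc i)
  have "2 * (- int m + int i) = - int (2 * m) + 2 * int i" "- int m + int i + 1 = - int m + int (Suc i)" by simp_all
  then show ?case using translation_covariant_Q[OF Suc] by (simp only: Qp_def Qit.simps)
qed

lemma gen_span_diff: "gen_span m h f \<Longrightarrow> gen_span m h g \<Longrightarrow> gen_span m h (f - g)"
  using gen_span.add[of m h f "cst (- 1) * g"] gen_span.scale[of m h g "- 1"] by (simp add: cst_minus)

lemma gen_span_cancel: assumes "gen_span m h (cst z * f)" "z \<noteq> 0" shows "gen_span m h f"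
proof -
  have "cst (1 / z) * (cst z * f) = f" using cst_inverse_mult[OF assms(2), of f] by (simp only: mult.left_commute)
  then show ?thesis using gen_span.scale[OF assms(1), of "1 / z"] by (simp only:)
qed

text \<open>L_{-1} kills the vacuum of charge 0, and its commutator with a generator mode of index
  -n - 1 is a multiple of the mode of index -n - 2, which is again allowed.\<close>

lemma gen_span_Lm1: "gen_span m h f \<Longrightarrow> gen_span m h (L (2 * h) (- 1) f)"
proof (induction rule: gen_span.induct)
  case vac show ?case by (simp add: L_m1_1 gen_span.zero)
next
  case (F h f n)
  have e: "- int n - 1 - 1 = - int (Suc n) - 1" by simp
  show ?case using translation_covariant_1[of "- int m"] unfolding translation_covariant_def by (simp only: e) (intro gen_span_diff gen_span.scale gen_span.F F)
next
  case (E h f n)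
  have e: "- int n - 1 - 1 = - int (Suc n) - 1" by simp
  have "translation_covariant (int m) (Qp (2 * m) (2 * m))" using translation_covariant_Qp[of m "2 * m"] by simp
  then show ?case unfolding translation_covariant_def by (simp only: e) (intro gen_span_diff gen_span.scale gen_span.E E)
next
  case (H h f n)
  have e: "- int n - 1 - 1 = - int (Suc n) - 1" by simp
  have "translation_covariant 0 (Qp 2 1)" using translation_covariant_Qp[of 1 1] by simp
  then have "L (2 * h) (- 1) (md 0 (Qp 2 1) (- int n - 1) h f) = md 0 (Qp 2 1) (- int n - 1) h (L (2 * h) (- 1) f) - cst (of_int (- int n - 1)) * md 0 (Qp 2 1) (- int (Suc n) - 1) h f"
    unfolding translation_covariant_def e[symmetric] by (metis add_0)
  then show ?case by (simp only:) (intro gen_span_diff gen_span.scale gen_span.H H)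
next
  case (om h f n)
  obtain z where "\<forall>f. L (2 * h) (- 1) (L (2 * h) (- int n - 2) f) - L (2 * h) (- int n - 2) (L (2 * h) (- 1) f) = cst (of_int (- 1 - (- int n - 2))) * L (2 * h) (- 1 + (- int n - 2)) f + (if - 1 + (- int n - 2) = 0 then cst z * f else 0)"
    using Virasoro by blast
  moreover have "- 1 + (- int n - 2) = - int (Suc n) - 2" "- 1 + (- int n - 2) \<noteq> 0" by simp_all
  ultimately have "L (2 * h) (- 1) (L (2 * h) (- int n - 2) f) = L (2 * h) (- int n - 2) (L (2 * h) (- 1) f) + cst (of_int (- 1 - (- int n - 2))) * L (2 * h) (- int (Suc n) - 2) f"
    by (simp only: if_False add_0_right) (metis add.commute diff_add_cancel)
  then show ?case by (simp only:) (intro gen_span.add gen_span.scale gen_span.om om)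
qed (auto simp: clin_simps[OF clin_L] intro: gen_span.intros)

lemma gen_span_L: "gen_span m h f \<Longrightarrow> gen_span m h (L (2 * h) (- int k - 1) f)"
proof (cases k)
  case 0 assume "gen_span m h f" then show ?thesis using gen_span_Lm1 0 by simp
next
  case (Suc n) assume f: "gen_span m h f"
  have "- int k - 1 = - int n - 2" using Suc by simp
  then show ?thesis using gen_span.om[OF f, of n] by (simp only:)
qed

text \<open>Only negative Virasoro modes, and only the singular vectors with \<open>n < K\<close>.\<close>

inductive Wbelow :: "nat \<Rightarrow> int \<Rightarrow> fock \<Rightarrow> bool" for K where
  gen: "n < K \<Longrightarrow> i \<le> n \<Longrightarrow> Wbelow K (- int n + 2 * int i) (Qp n i)"
| zero: "Wbelow K \<chi> 0"
| add: "Wbelow K \<chi> f \<Longrightarrow> Wbelow K \<chi> g \<Longrightarrow> Wbelow K \<chi> (f + g)"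
| scale: "Wbelow K \<chi> f \<Longrightarrow> Wbelow K \<chi> (cst z * f)"
| neg: "Wbelow K \<chi> f \<Longrightarrow> Wbelow K \<chi> (L \<chi> (- int k - 1) f)"

lemma Wbelow_diff: "Wbelow K \<chi> f \<Longrightarrow> Wbelow K \<chi> g \<Longrightarrow> Wbelow K \<chi> (f - g)"
  using Wbelow.add[of K \<chi> f "cst (- 1) * g"] Wbelow.scale[of K \<chi> g "- 1"] by (simp add: cst_minus)

lemma Wbelow_mono: "Wbelow K \<chi> f \<Longrightarrow> K \<le> K' \<Longrightarrow> Wbelow K' \<chi> f"
proof (induction rule: Wbelow.induct)
  case (gen n i) then show ?case by (intro Wbelow.gen) auto
qed (auto intro: Wbelow.intros)

text \<open>Nonnegative modes are moved to the right by the Virasoro relation until they reach a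
  singular vector, where they act by scalars.\<close>

lemma Wbelow_L_nat: "Wbelow K \<chi> f \<Longrightarrow> Wbelow K \<chi> (L \<chi> (int k) f)"
proof (induction arbitrary: k rule: Wbelow.induct)
  case (gen n i)
  show ?case
  proof (cases "k = 0")
    case True then show ?thesis using L_Qp_0[of n i] Wbelow.scale[OF Wbelow.gen[OF gen]] by (simp only: of_nat_0)
  next
    case False
    then have "L (- int n + 2 * int i) (int k) (Qp n i) = 0" by (intro L_Qp_pos) simp
    then show ?thesis by (simp only: Wbelow.zero)
  qed
next
  case (neg \<chi> f j)
  have neg': "Wbelow K \<chi> (L \<chi> l f)" for l
  proof (cases "l \<ge> 0")
    case True then show ?thesis using neg.IH[of "nat l"] by simp
  next
    case False
    then have "l = - int (nat (- l - 1)) - 1" by simp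
    then show ?thesis using Wbelow.neg[OF neg.hyps, of "nat (- l - 1)"] by (simp only:)
  qed
  obtain z where "\<forall>f. L \<chi> (int k) (L \<chi> (- int j - 1) f) - L \<chi> (- int j - 1) (L \<chi> (int k) f) = cst (of_int (int k - (- int j - 1))) * L \<chi> (int k + (- int j - 1)) f + (if int k + (- int j - 1) = 0 then cst z * f else 0)"
    using Virasoro by blast
  then have "L \<chi> (int k) (L \<chi> (- int j - 1) f) = L \<chi> (- int j - 1) (L \<chi> (int k) f) + (cst (of_int (int k - (- int j - 1))) * L \<chi> (int k + (- int j - 1)) f + (if int k + (- int j - 1) = 0 then cst z * f else 0))"
    by (metis add.commute diff_add_cancel)
  moreover have "Wbelow K \<chi> (if int k + (- int j - 1) = 0 then cst z * f else 0)" using neg.hyps by (simp add: Wbelow.zero Wbelow.scale)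
  ultimately show ?case by (simp only:) (intro Wbelow.add Wbelow.neg Wbelow.scale neg' neg.IH)
qed (auto simp: clin_simps[OF clin_L] intro: Wbelow.intros)

lemma Wbelow_L: assumes "Wbelow K \<chi> f" shows "Wbelow K \<chi> (L \<chi> l f)"
proof (cases "l \<ge> 0")
  case True then show ?thesis using Wbelow_L_nat[OF assms, of "nat l"] by simp
next
  case False
  then have "l = - int (nat (- l - 1)) - 1" by simp
  then show ?thesis using Wbelow.neg[OF assms, of "nat (- l - 1)"] by (simp only:)
qed

lemma Wmod_Wbelow: "Wmod \<chi> f \<Longrightarrow> \<exists>K. Wbelow K \<chi> f"
proof (induction rule: Wmod.induct)
  case (gen i n) then show ?case using Wbelow.gen[of n "Suc n" i] by blast
next
  case (add \<chi> f g)
  then obtain K K' where "Wbelow K \<chi> f" "Wbelow K' \<chi> g" by blast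
  then show ?case using Wbelow.add[OF Wbelow_mono[of K \<chi> f "max K K'"] Wbelow_mono[of K' \<chi> g "max K K'"]] by auto
qed (auto intro: Wbelow.zero Wbelow.scale Wbelow_L)

lemma Wbelow_Q: "Wbelow K \<chi> f \<Longrightarrow> Wbelow K (\<chi> + 2) (Qo \<chi> f)"
proof (induction rule: Wbelow.induct)
  case (gen n i)
  have q: "Qo (- int n + 2 * int i) (Qp n i) = Qp n (Suc i)" by (simp add: Qp_def)
  show ?case
  proof (cases "i = n")
    case True then show ?thesis unfolding q by (simp add: Qp_Suc_0 Wbelow.zero)
  next
    case False
    have "- int n + 2 * int i + 2 = - int n + 2 * int (Suc i)" by simp
    then show ?thesis unfolding q using Wbelow.gen[of n K "Suc i"] gen False by (simp only:)
  qed
next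
  case (neg \<chi> f k) then show ?case unfolding Q_L by (intro Wbelow.neg)
qed (auto simp: clin_simps[OF clin_Q] intro: Wbelow.intros)

lemma Wbelow_Qit: "Wbelow K \<chi> f \<Longrightarrow> Wbelow K (\<chi> + 2 * int i) (Qit \<chi> i f)"
proof (induction i)
  case (Suc i)
  have "\<chi> + 2 * int i + 2 = \<chi> + 2 * int (Suc i)" by simp
  then show ?case using Wbelow_Q[OF Suc.IH[OF Suc.prems]] by (simp only: Qit.simps)
qed simp

text \<open>A generator \<open>Qp n i\<close> with n < K has doubled charge at most n, hence less
  than K, and Virasoro modes keep the charge.\<close>

lemma Wbelow_top: "Wbelow K \<chi> f \<Longrightarrow> int K \<le> \<chi> \<Longrightarrow> f = 0"
  by (induction rule: Wbelow.induct) (auto simp: clin_0[OF clin_L])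

text \<open>The power Q^(K-j) leads to charge K, where \<open>Wbelow K\<close> contains only 0 but
  \<open>Qp K K\<close> is nonzero.\<close>

lemma Qp_not_Wbelow: assumes "j \<le> K" "Wbelow K (- int K + 2 * int j) (cst z * Qp K j)" shows "z = 0"
proof -
  have "Wbelow K (- int K + 2 * int j + 2 * int (K - j)) (Qit (- int K + 2 * int j) (K - j) (cst z * Qp K j))"
    by (rule Wbelow_Qit[OF assms(2)])
  moreover have "Qit (- int K + 2 * int j) (K - j) (cst z * Qp K j) = cst z * Qp K K"
    unfolding clin_scale[OF clin_Qit] using Qit_add[of "- int K" j "K - j" 1] assms(1) by (simp add: Qp_def)
  moreover have "- int K + 2 * int j + 2 * int (K - j) = int K" using assms(1) by (simp add: of_nat_diff)
  ultimately have "Wbelow K (int K) (cst z * Qp K K)" by (simp only:)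
  then have "cst z * Qp K K = 0" by (rule Wbelow_top) simp
  then show ?thesis using Qp_top_nz by simp
qed

lemma Wbelow_gen_span:
  assumes "Wbelow K \<chi> f" "\<chi> = 2 * h" "\<And>n i. n < K \<Longrightarrow> i \<le> n \<Longrightarrow> - int n + 2 * int i = 2 * h \<Longrightarrow> gen_span m h (Qp n i)"
  shows "gen_span m h f"
  using assms
proof (induction rule: Wbelow.induct)
  case (neg \<chi> f k) then show ?case using gen_span_L[of m h f k] by simp
qed (auto intro: gen_span.zero gen_span.add gen_span.scale)

section \<open>Detecting singular vectors by their level\<close>

definition cmp :: "int \<Rightarrow> fock \<Rightarrow> fock" where "cmp r = lext (\<lambda>c. if int (pwt c) = r then mon c else 0)"

lemma clin_cmp: "clin (cmp r)" by (simp add: cmp_def clin_lext)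

lemma cmp_lev: assumes "lev s f" shows "cmp r f = (if r = s then f else 0)"
proof -
  have "cmp r f = (\<Sum>c\<in>keys f. cst (lookup f c) * (if r = s then mon c else 0))"
    unfolding cmp_def lext_def by (intro sum.cong) (use assms in \<open>auto simp: lev_def\<close>)
  also have "\<dots> = (if r = s then f else 0)" using fock_expand[OF finite_keys order_refl, of f] by simp
  finally show ?thesis .
qed

lemma cmp_shift: assumes "clin T" "\<And>n f. lev n f \<Longrightarrow> lev (n + s) (T f)" shows "cmp (r + s) (T f) = T (cmp r f)"
  by (rule clin_eq_mon[OF clin_comp[OF clin_cmp assms(1)] clin_comp[OF assms(1) clin_cmp]])
     (simp add: cmp_lev[OF assms(2)[OF lev_mon]] cmp_lev[OF lev_mon] clin_0[OF assms(1)])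

lemma cmp_L: "cmp r (L \<chi> (- int k - 1) f) = L \<chi> (- int k - 1) (cmp (r - int k - 1) f)"
proof -
  have "lev (n + (int k + 1)) (L \<chi> (- int k - 1) f)" if "lev n f" for n f by (rule lev_L'[OF that]) simp
  then show ?thesis using cmp_shift[OF clin_L, of "int k + 1" \<chi> "- int k - 1" "r - int k - 1" f] by simp
qed

lemma Wbelow_cmp: "Wbelow K \<chi> f \<Longrightarrow> Wbelow K \<chi> (cmp r f)"
proof (induction arbitrary: r rule: Wbelow.induct)
  case (gen n i) show ?case unfolding cmp_lev[OF lev_Qp] using Wbelow.gen[OF gen] Wbelow.zero[of K] by (simp only: split: if_splits) simp
next
  case (neg \<chi> f k) then show ?case unfolding cmp_L by (intro Wbelow.neg)
qed (auto simp: clin_simps[OF clin_cmp] intro: Wbelow.intros)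

text \<open>Among the generators of this charge with n at least K, \<open>Qp K i\<close> has the
  lowest level. Up to that level everything else comes from \<open>Wbelow K\<close>, and strictly
  below it everything does.\<close>

lemma level_decomposition:
  assumes "Wbelow K' \<chi> f" "\<chi> = - int K + 2 * int i" "i \<le> K" and r0: "r0 = int i * (ip * (int K + 1 - int i) - 1)" and "r \<le> r0"
  shows "\<exists>z. Wbelow K \<chi> (cmp r f - cst z * Qp K i) \<and> (r < r0 \<longrightarrow> z = 0)"
  using assms(1,2,5)
proof (induction arbitrary: r rule: Wbelow.induct)
  case (gen n i')
  show ?case
  proof (cases "n < K")
    case True
    show ?thesis by (rule exI[of _ 0]) (use Wbelow_cmp[OF Wbelow.gen[OF True gen.hyps(2)], of r] in simp)
  next
    case False
    then obtain t where t: "i' = i + t" "n = K + 2 * t" using gen.prems(1) assms(3)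
      by (intro that[of "i' - i"]) auto
    \<comment> \<open>Equality of charges gives n = K + 2 t and i' = i + t; for t > 0 the level
      strictly exceeds r0.\<close>
    have e: "int i' * (ip * (int n + 1 - int i') - 1) = r0 + int t * (ip * (int K + 1 - int i) - 1) + (int i + int t) * (ip * int t)"
      unfolding r0 t by (simp add: algebra_simps)
    show ?thesis
    proof (cases "t = 0")
      case True
      then have "cmp r (Qp n i') = cst (if r = r0 then 1 else 0) * Qp K i" unfolding cmp_lev[OF lev_Qp] e using t by simp
      then show ?thesis by (intro exI[of _ "if r = r0 then 1 else 0"]) (simp add: Wbelow.zero)
    next
      case False
      have "ip * (int K + 1 - int i) \<ge> 1 * 1" using assms(3) p2 by (intro mult_mono) auto
      then have "int t * (ip * (int K + 1 - int i) - 1) \<ge> 0" by simp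
      moreover have "(int i + int t) * (ip * int t) > 0" using False p2 by simp
      ultimately have "r \<noteq> int i' * (ip * (int n + 1 - int i') - 1)" unfolding e using gen.prems(2) by linarith
      then have "cmp r (Qp n i') = 0" unfolding cmp_lev[OF lev_Qp] by (simp only: if_False)
      then show ?thesis by (intro exI[of _ 0]) (simp add: Wbelow.zero)
    qed
  qed
next
  case (zero \<chi>) show ?case by (intro exI[of _ 0]) (simp add: clin_0[OF clin_cmp] Wbelow.zero)
next
  case (add \<chi> f g)
  then obtain z w where z: "Wbelow K \<chi> (cmp r f - cst z * Qp K i)" "r < r0 \<longrightarrow> z = 0" and w: "Wbelow K \<chi> (cmp r g - cst w * Qp K i)" "r < r0 \<longrightarrow> w = 0" by metis
  have "cmp r (f + g) - cst (z + w) * Qp K i = (cmp r f - cst z * Qp K i) + (cmp r g - cst w * Qp K i)"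
    by (simp add: clin_add[OF clin_cmp] cst_add algebra_simps)
  then show ?case using Wbelow.add[OF z(1) w(1)] z(2) w(2) by (intro exI[of _ "z + w"]) auto
next
  case (scale \<chi> f y)
  then obtain z where z: "Wbelow K \<chi> (cmp r f - cst z * Qp K i)" "r < r0 \<longrightarrow> z = 0" by metis
  have "cmp r (cst y * f) - cst (y * z) * Qp K i = cst y * (cmp r f - cst z * Qp K i)"
    unfolding clin_scale[OF clin_cmp] cst_mult right_diff_distrib by (simp only: mult.assoc)
  then show ?case using Wbelow.scale[OF z(1)] z(2) by (intro exI[of _ "y * z"]) auto
next
  case (neg \<chi> f k)
  have "r - int k - 1 < r0" using neg.prems by linarith
  then have "Wbelow K \<chi> (cmp (r - int k - 1) f)" using neg.IH[of "r - int k - 1"] neg.prems(1) by force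
  then show ?case unfolding cmp_L by (intro exI[of _ 0]) (simp add: Wbelow.neg)
qed

lemma singular_component:
  assumes "Wmod (- int K + 2 * int i) f" "i \<le> K" "lev (int i * (ip * (int K + 1 - int i) - 1)) f"
  shows "\<exists>z. Wbelow K (- int K + 2 * int i) (f - cst z * Qp K i)"
proof -
  obtain K' where "Wbelow K' (- int K + 2 * int i) f" using Wmod_Wbelow[OF assms(1)] by blast
  from level_decomposition[OF this refl assms(2) refl order_refl] show ?thesis unfolding cmp_lev[OF assms(3)] by auto
qed

text \<open>As third differences vanish, the first difference is affine in i. It is 0 at M + 1, so
  it is (M + 1 - i) delta, and delta = 0 would make beta constantly 1, against
  \<open>\<beta> (M + 1) = 0\<close>.\<close>

lemma first_difference_nonzero:
  fixes \<beta> :: "nat \<Rightarrow> complex"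
  assumes b: "\<beta> 0 = 1" "\<beta> (M + 1) = 0" "\<beta> (M + 2) = 0"
    and d: "\<And>i. i < M \<Longrightarrow> ((\<beta> i - \<beta> (i + 1)) - (\<beta> (i + 1) - \<beta> (i + 2))) - ((\<beta> (i + 1) - \<beta> (i + 2)) - (\<beta> (i + 2) - \<beta> (i + 3))) = 0"
    and i: "i \<le> M"
  shows "\<beta> i - \<beta> (i + 1) \<noteq> 0"
proof -
  define \<gamma> where "\<gamma> i = \<beta> i - \<beta> (i + 1)" for i
  define \<delta> where "\<delta> = \<gamma> 0 - \<gamma> 1"
  have dl: "i \<le> M \<Longrightarrow> \<gamma> i - \<gamma> (i + 1) = \<delta>" for i
  proof (induction i)
    case (Suc i) then show ?case using d[of i] by (simp add: \<gamma>_def numeral_eq_Suc)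
  qed (simp add: \<delta>_def)
  have g: "j \<le> M + 1 \<Longrightarrow> \<gamma> (M + 1 - j) = of_nat j * \<delta>" for j
  proof (induction j)
    case 0 then show ?case using b by (simp add: \<gamma>_def)
  next
    case (Suc j)
    then have "M - j + 1 = M + 1 - j" "M + 1 - Suc j = M - j" by simp_all
    then show ?case using dl[of "M - j"] Suc by (simp add: algebra_simps)
  qed
  have "\<delta> \<noteq> 0"
  proof
    assume "\<delta> = 0"
    then have z: "\<gamma> i = 0" if "i \<le> M" for i using g[of "M + 1 - i"] that by simp
    have "i \<le> M + 1 \<Longrightarrow> \<beta> i = 1" for i
    proof (induction i)
      case (Suc i) then show ?case using z[of i] by (simp add: \<gamma>_def)
    qed (simp add: b)
    then show False using b(2) by simp
  qed
  moreover have "\<gamma> i = of_nat (M + 1 - i) * \<delta>" using g[of "M + 1 - i"] i by simp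
  moreover have "(of_nat (M + 1 - i) :: complex) \<noteq> 0" using i by (subst of_nat_eq_0_iff) simp
  ultimately show ?thesis unfolding \<gamma>_def by (metis mult_eq_0_iff)
qed

text \<open>Modulo \<open>Wbelow\<close> the mode of \<open>F = exp (- \<alpha>)\<close> maps \<open>Qp (2 N) i\<close> to a multiple \<open>\<beta> i\<close> of \<open>Qp (2 N + 2) i\<close>, and the mode
  of \<open>H\<close> has the coefficient \<open>\<beta> i - \<beta> (i + 1)\<close>. Since \<open>Q\<^sup>3 F = 0\<close>, the third differences of \<open>\<beta>\<close> vanish.\<close>

lemma H_raises:
  assumes i: "i \<le> 2 * N"
  shows "\<exists>c. c \<noteq> 0 \<and> Wbelow (2 * N + 2) (- int (2 * N + 2) + 2 * int (i + 1))
    (md 0 (Qp 2 1) (- int (2 * p * N) - 1) (int i - int N) (Qp (2 * N) i) - cst c * Qp (2 * N + 2) (i + 1))"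
proof -
  define K where "K = 2 * N + 2"
  \<comment> \<open>With this index the mode of F maps \<open>Qp (2 * N) i\<close> exactly into the
    level of \<open>Qp K i\<close>, so \<open>singular_component\<close> applies.\<close>
  define k where "k = - int (2 * p * N) - 1"
  define J where "J j f = Wbelow K (- int K + 2 * int j) f" for j f
  define h where "h i = int i - int N" for i :: nat
  define X where "X g b i = md g b k (h i) (Qp (2 * N) i)" for g b i
  define a1 where "a1 = Qo (2 * (- 1)) 1"
  define a2 where "a2 = Qo (2 * 0) a1"
  have a3: "Qo (2 * 1) a2 = 0" using Qp_Suc_0[of 2] by (simp add: Qp_def a2_def a1_def numeral_eq_Suc)
  have a1: "a1 = Qp 2 1" by (simp add: a1_def Qp_def)
  have rel: "X (g + 1) (Qo (2 * g) b) i = Qo (2 * (g + h i)) (X g b i) - X g b (Suc i)" for g b i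
  proof -
    have "Qp (2 * N) (Suc i) = Qo (2 * h i) (Qp (2 * N) i)" by (simp add: Qp_def h_def algebra_simps)
    moreover have "h (Suc i) = h i + 1" by (simp add: h_def)
    ultimately show ?thesis unfolding X_def md_Q by (simp only:)
  qed
  have step: "J (j + 1) (Qo (- int K + 2 * int j) x - y - cst (u - w) * Qp K (j + 1))"
    if "J j (x - cst u * Qp K j)" "J (j + 1) (y - cst w * Qp K (j + 1))" for j x y u w
  proof -
    have q: "Qp K (j + 1) = Qo (- int K + 2 * int j) (Qp K j)" by (simp add: Qp_def)
    have "- int K + 2 * int j + 2 = - int K + 2 * int (j + 1)" by simp
    then have "J (j + 1) (Qo (- int K + 2 * int j) (x - cst u * Qp K j))" using Wbelow_Q that(1) unfolding J_def by metis
    then have "J (j + 1) (Qo (- int K + 2 * int j) (x - cst u * Qp K j) - (y - cst w * Qp K (j + 1)))"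
      using that(2) unfolding J_def by (rule Wbelow_diff)
    moreover have "Qo (- int K + 2 * int j) (x - cst u * Qp K j) - (y - cst w * Qp K (j + 1)) = Qo (- int K + 2 * int j) x - y - cst (u - w) * Qp K (j + 1)"
      unfolding clin_diff[OF clin_Q] clin_scale[OF clin_Q] q cst_diff by (simp add: algebra_simps)
    ultimately show ?thesis by (simp only:)
  qed
  have "\<exists>z. J i (X (- 1) 1 i - cst z * Qp K i) \<and> (i = 0 \<longrightarrow> z = 1) \<and> (i > 2 * N \<longrightarrow> z = 0)" if i: "i \<le> K" for i
  proof -
    have XV: "X (- 1) 1 i = V (- 2) (2 * ip * int i) (Qp (2 * N) i)"
      unfolding X_def md_1 k_def h_def by (simp add: algebra_simps)
    \<comment> \<open>The boundary values of beta: at i = 0 the vacuum is mapped to the vacuum, and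
      beyond 2 N the vector \<open>Qp (2 * N) i\<close> is zero.\<close>
    consider "i = 0" | "i > 2 * N" | "0 < i" "i \<le> 2 * N" by linarith
    then show ?thesis
    proof cases
      case 1
      then have "X (- 1) 1 i = Qp K i" unfolding XV by (simp add: Qp_def V_1)
      then show ?thesis using 1 by (intro exI[of _ 1]) (simp add: J_def Wbelow.zero)
    next
      case 2
      have "Qp (2 * N) i = 0"
      proof -
        have "Qp (2 * N) (Suc (2 * N) + j) = 0" for j
          using Qit_add[of "- int (2 * N)" "Suc (2 * N)" j 1] Qp_Suc_0[of "2 * N"] unfolding Qp_def by (simp only: clin_0[OF clin_Qit])
        from this[of "i - Suc (2 * N)"] show ?thesis using 2 by simp
      qed
      then show ?thesis using 2 by (intro exI[of _ 0]) (simp add: X_def clin_0[OF clin_md] J_def Wbelow.zero)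
    next
      case 3
      have "Wmod (2 * h i) (Qp (2 * N) i)" using Wmod.gen[OF 3(2)] by (rule Wmod_eq) (simp add: h_def)
      then have "Wmod (2 * (- 1 + h i)) (X (- 1) 1 i)" using Wclosed_F[of 1] unfolding Wclosed_def X_def by simp
      then have "Wmod (- int K + 2 * int i) (X (- 1) 1 i)" by (rule Wmod_eq) (simp add: h_def K_def)
      moreover have "lev (int i * (ip * (int K + 1 - int i) - 1)) (X (- 1) 1 i)"
      proof -
        have "int i * (ip * (int (2 * N) + 1 - int i) - 1) + 2 * ip * int i = int i * (ip * (int K + 1 - int i) - 1)" by (simp add: K_def algebra_simps)
        then show ?thesis using lev_V[OF lev_Qp[of i "2 * N"], of "2 * ip * int i" "- 2"] unfolding XV by (simp only:)
      qed
      ultimately show ?thesis using singular_component[OF _ i] 3 unfolding J_def by auto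
    qed
  qed
  then obtain \<beta> where b: "\<And>i. i \<le> K \<Longrightarrow> J i (X (- 1) 1 i - cst (\<beta> i) * Qp K i) \<and> (i = 0 \<longrightarrow> \<beta> i = 1) \<and> (i > 2 * N \<longrightarrow> \<beta> i = 0)" by metis
  have e: "2 * (- 1 + h i) = - int K + 2 * int i" "2 * (0 + h i) = - int K + 2 * int (i + 1)" "2 * (1 + h i) = - int K + 2 * int (i + 1 + 1)" for i
    by (simp_all add: h_def K_def)
  define c where "c i = \<beta> i - \<beta> (i + 1)" for i
  have H: "J (i + 1) (X 0 a1 i - cst (c i) * Qp K (i + 1))" if "i + 1 \<le> K" for i
    using step[of i "X (- 1) 1 i" "\<beta> i" "X (- 1) 1 (i + 1)" "\<beta> (i + 1)"] b[of i] b[of "i + 1"] that rel[of "- 1" 1 i]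
    unfolding e a1_def[symmetric] c_def by simp
  have G: "J (i + 1 + 1) (X 1 a2 i - cst (c i - c (i + 1)) * Qp K (i + 1 + 1))" if "i + 2 \<le> K" for i
    using step[of "i + 1" "X 0 a1 i" "c i" "X 0 a1 (i + 1)" "c (i + 1)"] H[of i] H[of "i + 1"] that rel[of 0 a1 i]
    unfolding e a2_def[symmetric] by simp
  have Z: "(c i - c (i + 1)) - (c (i + 1) - c (i + 2)) = 0" if "i + 3 \<le> K" for i
  proof -
    have "J (i + 1 + 1 + 1) (X 2 (Qo (2 * 1) a2) i - cst ((c i - c (i + 1)) - (c (i + 1) - c (i + 2))) * Qp K (i + 1 + 1 + 1))"
      using step[of "i + 1 + 1" "X 1 a2 i" "c i - c (i + 1)" "X 1 a2 (i + 1)" "c (i + 1) - c (i + 2)"] G[of i] G[of "i + 1"] that rel[of 1 a2 i]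
      unfolding e by simp
    moreover have "X 2 (Qo (2 * 1) a2) i = 0" unfolding a3 X_def md_def by (rule Ys_0)
    ultimately have "J (i + 1 + 1 + 1) (cst (- ((c i - c (i + 1)) - (c (i + 1) - c (i + 2)))) * Qp K (i + 1 + 1 + 1))"
      by (simp only: diff_0 cst_minus mult_minus_left)
    moreover have "i + 1 + 1 + 1 = i + 3" by simp
    ultimately have "J (i + 3) (cst (- ((c i - c (i + 1)) - (c (i + 1) - c (i + 2)))) * Qp K (i + 3))" by (simp only:)
    \<comment> \<open>The third difference is the coefficient belonging to the field of Q^3
      e^{-alpha}, which is zero; a multiple of \<open>Qp K (i + 3)\<close> lies in
      \<open>Wbelow K\<close> only if it vanishes.\<close>
    then show ?thesis using Qp_not_Wbelow[of "i + 3" K] that unfolding J_def by (metis neg_equal_0_iff_equal)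
  qed
  have "c i \<noteq> 0" unfolding c_def
  proof (rule first_difference_nonzero[of \<beta> "2 * N"])
    show "\<beta> 0 = 1" "\<beta> (2 * N + 1) = 0" "\<beta> (2 * N + 2) = 0" using b[of 0] b[of "2 * N + 1"] b[of "2 * N + 2"] by (simp_all add: K_def)
    fix j assume "j < 2 * N"
    then show "\<beta> j - \<beta> (j + 1) - (\<beta> (j + 1) - \<beta> (j + 2)) - (\<beta> (j + 1) - \<beta> (j + 2) - (\<beta> (j + 2) - \<beta> (j + 3))) = 0"
      using Z[of j] by (simp add: c_def K_def numeral_eq_Suc)
  qed (rule i)
  moreover have "J (i + 1) (X 0 (Qp 2 1) i - cst (c i) * Qp K (i + 1))" using H[of i] i unfolding a1 by (simp add: K_def)
  ultimately show ?thesis unfolding J_def X_def h_def K_def k_def by blast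
qed

text \<open>Expanding Q^(A+B) by the Leibniz rule, every term has more than A factors on b or more
  than B factors on f, except those with exactly A and B.\<close>

lemma top_Leibniz:
  assumes "Qit (2 * g) (Suc A) b = 0" "Qit (2 * h) (Suc B) f = 0"
  shows "\<exists>c. Qit (2 * (g + h)) (A + B) (md g b n h f) = cst c * md (g + int A) (Qit (2 * g) A b) n (h + int B) (Qit (2 * h) B f)"
  using assms
proof (induction "A + B" arbitrary: A B g b h f)
  case 0 then show ?case by (intro exI[of _ 1]) simp
next
  case (Suc d)
  have sh: "Qit \<chi> (Suc i) f = Qit (\<chi> + 2) i (Qo \<chi> f)" for \<chi> i f using Qit_add[of \<chi> 1 i f] by simp
  have e: "2 * (g + h) + 2 = 2 * (g + 1 + h)" "2 * (g + h) + 2 = 2 * (g + (h + 1))" "2 * g + 2 = 2 * (g + 1)" "2 * h + 2 = 2 * (h + 1)" by simp_all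
  let ?R = "md (g + int A) (Qit (2 * g) A b) n (h + int B) (Qit (2 * h) B f)"
  have 1: "\<exists>c. Qit (2 * (g + h) + 2) d (md (g + 1) (Qo (2 * g) b) n h f) = cst c * ?R"
  proof (cases A)
    case 0
    then have "Qo (2 * g) b = 0" using Suc.prems(1) by simp
    then have "md (g + 1) (Qo (2 * g) b) n h f = 0" unfolding md_def by (simp only: Ys_0)
    then show ?thesis by (intro exI[of _ 0]) (simp add: clin_0[OF clin_Qit])
  next
    case A: (Suc A')
    have "\<exists>c. Qit (2 * (g + 1 + h)) (A' + B) (md (g + 1) (Qo (2 * g) b) n h f) = cst c * md (g + 1 + int A') (Qit (2 * (g + 1)) A' (Qo (2 * g) b)) n (h + int B) (Qit (2 * h) B f)"
    proof (rule Suc.hyps(1))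
      show "d = A' + B" using A Suc.hyps(2) by simp
      show "Qit (2 * (g + 1)) (Suc A') (Qo (2 * g) b) = 0" using Suc.prems(1) unfolding A sh[of "2 * g" "Suc A'" b] e(3) .
    qed (rule Suc.prems(2))
    moreover have "A' + B = d" "g + 1 + int A' = g + int A" using A Suc.hyps(2) by simp_all
    moreover have "Qit (2 * (g + 1)) A' (Qo (2 * g) b) = Qit (2 * g) A b" unfolding A sh e(3) ..
    ultimately show ?thesis unfolding e(1) by (simp only:)
  qed
  have 2: "\<exists>c. Qit (2 * (g + h) + 2) d (md g b n (h + 1) (Qo (2 * h) f)) = cst c * ?R"
  proof (cases B)
    case 0
    then have "Qo (2 * h) f = 0" using Suc.prems(2) by simp
    then show ?thesis by (intro exI[of _ 0]) (simp add: clin_0[OF clin_Qit] clin_0[OF clin_md])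
  next
    case B: (Suc B')
    have "\<exists>c. Qit (2 * (g + (h + 1))) (A + B') (md g b n (h + 1) (Qo (2 * h) f)) = cst c * md (g + int A) (Qit (2 * g) A b) n (h + 1 + int B') (Qit (2 * (h + 1)) B' (Qo (2 * h) f))"
    proof (rule Suc.hyps(1))
      show "d = A + B'" using B Suc.hyps(2) by simp
      show "Qit (2 * (h + 1)) (Suc B') (Qo (2 * h) f) = 0" using Suc.prems(2) unfolding B sh[of "2 * h" "Suc B'" f] e(4) .
    qed (rule Suc.prems(1))
    moreover have "A + B' = d" "h + 1 + int B' = h + int B" using B Suc.hyps(2) by simp_all
    moreover have "Qit (2 * (h + 1)) B' (Qo (2 * h) f) = Qit (2 * h) B f" unfolding B sh e(4) ..
    ultimately show ?thesis unfolding e(2) by (simp only:)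
  qed
  obtain c1 c2 where c: "Qit (2 * (g + h) + 2) d (md (g + 1) (Qo (2 * g) b) n h f) = cst c1 * ?R"
    "Qit (2 * (g + h) + 2) d (md g b n (h + 1) (Qo (2 * h) f)) = cst c2 * ?R" using 1 2 by blast
  have "Qit (2 * (g + h)) (A + B) (md g b n h f) = cst (c1 + c2) * ?R"
    unfolding Suc.hyps(2)[symmetric] sh Q_md clin_add[OF clin_Qit] c cst_add by (simp only: distrib_right)
  then show ?case by blast
qed

text \<open>The exponent 2 p m (N - m) is the pairing of m alpha and (N - m) alpha, so this mode
  extracts the leading coefficient, e^{-N alpha}.\<close>

lemma F_on_top: "m \<le> N \<Longrightarrow> md (- int m) 1 (- int (2 * p * m * (N - m)) - 1) (- int (N - m)) 1 = 1"
  unfolding md_1 V_1 by (simp add: algebra_simps)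

text \<open>Induction on N. \<open>E\<close> and \<open>F\<close> reach the extremal vectors from N
  - m. \<open>H\<close> has charge 0, so the others come from N - 1 at the same charge, and
  divisibility by m is kept.\<close>

lemma singular_gen_span:
  assumes m: "1 \<le> m" and "i \<le> 2 * N" "int m dvd (int i - int N)"
  shows "gen_span m (int i - int N) (Qp (2 * N) i)"
  using assms(2,3)
proof (induction N arbitrary: i rule: less_induct)
  case (less N)
  show ?case
  proof (cases "N = 0")
    case True then show ?thesis using gen_span.vac less.prems by (simp add: Qp_def)
  next
    case False
    consider "i = 0" | "i = 2 * N" | "0 < i" "i < 2 * N" using less.prems(1) by linarith
    then show ?thesis
    proof cases
      case 1
      then have "m dvd N" using less.prems(2) by simp
      then have mN: "m \<le> N" using False dvd_imp_le by simp
      have "gen_span m (- int (N - m)) 1" using less.IH[of "N - m" 0] m mN \<open>m dvd N\<close> False by (simp add: Qp_def)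
      from gen_span.F[OF this, of "2 * p * m * (N - m)"] show ?thesis unfolding F_on_top[OF mN] using mN 1 by (simp add: Qp_def of_nat_diff)
    next
      case 2
      then have "m dvd N" using less.prems(2) by simp
      then have mN: "m \<le> N" using False dvd_imp_le by simp
      define n where "n = 2 * p * m * (N - m)"
      have e: "2 * - int m = - int (2 * m)" "2 * - int (N - m) = - int (2 * (N - m))" "2 * (- int m + - int (N - m)) = - int (2 * N)" "2 * m + 2 * (N - m) = 2 * N"
        "- int m + int (2 * m) = int m" "- int (N - m) + int (2 * (N - m)) = int (N - m)"
        using mN by (simp_all add: of_nat_diff)
      obtain c where "Qit (2 * (- int m + - int (N - m))) (2 * m + 2 * (N - m)) (md (- int m) 1 (- int n - 1) (- int (N - m)) 1)
          = cst c * md (- int m + int (2 * m)) (Qit (2 * - int m) (2 * m) 1) (- int n - 1) (- int (N - m) + int (2 * (N - m))) (Qit (2 * - int (N - m)) (2 * (N - m)) 1)"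
        using top_Leibniz[of "- int m" "2 * m" 1 "- int (N - m)" "2 * (N - m)" 1 "- int n - 1"] Qp_Suc_0[of "2 * m"] Qp_Suc_0[of "2 * (N - m)"]
        unfolding e(1,2) Qp_def by blast
      then have q: "Qp (2 * N) (2 * N) = cst c * md (int m) (Qp (2 * m) (2 * m)) (- int n - 1) (int (N - m)) (Qp (2 * (N - m)) (2 * (N - m)))"
        unfolding n_def F_on_top[OF mN] unfolding e Qp_def .
      have "int (2 * (N - m)) - int (N - m) = int (N - m)" by simp
      then have "gen_span m (int (N - m)) (Qp (2 * (N - m)) (2 * (N - m)))" using less.IH[of "N - m" "2 * (N - m)"] m mN \<open>m dvd N\<close> False by simp
      from gen_span.scale[OF gen_span.E[OF this, of n], of c] show ?thesis unfolding 2 q using mN by (simp add: of_nat_diff)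
    next
      case 3
      obtain N' where N': "N = Suc N'" using False by (cases N) auto
      obtain j where j: "i = Suc j" using 3 by (cases i) auto
      have h: "int j - int N' = int i - int N" by (simp add: N' j)
      have jN: "j \<le> 2 * N'" using 3 N' j by simp
      have K: "2 * N' + 2 = 2 * N" "j + 1 = i" by (simp_all add: N' j)
      obtain c where c: "c \<noteq> 0" "Wbelow (2 * N) (- int (2 * N) + 2 * int i) (md 0 (Qp 2 1) (- int (2 * p * N') - 1) (int j - int N') (Qp (2 * N') j) - cst c * Qp (2 * N) i)"
        using H_raises[OF jN] unfolding K by blast
      have "gen_span m (int j - int N') (Qp (2 * N') j)"
      proof (rule less.IH)
        show "int m dvd int j - int N'" unfolding h by (rule less.prems(2))
      qed (use jN N' in auto)
      from gen_span.H[OF this, of "2 * p * N'"] have 1: "gen_span m (int i - int N) (md 0 (Qp 2 1) (- int (2 * p * N') - 1) (int j - int N') (Qp (2 * N') j))" unfolding h .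
      have 2: "gen_span m (int i - int N) (md 0 (Qp 2 1) (- int (2 * p * N') - 1) (int j - int N') (Qp (2 * N') j) - cst c * Qp (2 * N) i)"
      proof (rule Wbelow_gen_span[OF c(2)])
        show "- int (2 * N) + 2 * int i = 2 * (int i - int N)" by simp
        fix n i' assume n: "n < 2 * N" "i' \<le> n" "- int n + 2 * int i' = 2 * (int i - int N)"
        \<comment> \<open>The error terms have the same charge, hence even n, and n < 2 N puts them
          under the induction hypothesis.\<close>
        then have "even n" by presburger
        then obtain l where l: "n = 2 * l" by (elim evenE)
        have e: "int i' - int l = int i - int N" using n(3) l by simp
        have "gen_span m (int i' - int l) (Qp (2 * l) i')"
        proof (rule less.IH)
          show "l < N" "i' \<le> 2 * l" using n(1,2) l by simp_all
          show "int m dvd int i' - int l" unfolding e by (rule less.prems(2))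
        qed
        then show "gen_span m (int i - int N) (Qp n i')" unfolding e l .
      qed
      have "gen_span m (int i - int N) (cst c * Qp (2 * N) i)" using gen_span_diff[OF 1 2] by simp
      then show ?thesis using c(1) by (rule gen_span_cancel)
    qed
  qed
qed

lemma Wmod_gen_span: assumes m: "1 \<le> m" and "int m dvd h" "Wmod (2 * h) f" shows "gen_span m h f"
proof -
  obtain K where "Wbelow K (2 * h) f" using Wmod_Wbelow[OF assms(3)] by blast
  then show ?thesis
  proof (rule Wbelow_gen_span[OF _ refl])
    fix n i assume n: "n < K" "i \<le> n" "- int n + 2 * int i = 2 * h"
    then have "even n" by presburger
    then obtain l where l: "n = 2 * l" by (elim evenE)
    have e: "int i - int l = h" using n(3) l by simp
    have "gen_span m (int i - int l) (Qp (2 * l) i)" by (rule singular_gen_span[OF m]) (use n(2) l e assms(2) in simp_all)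
    then show "gen_span m h (Qp n i)" unfolding e l .
  qed
qed

theorem WA_eq_cspan_Mon: assumes m: "1 \<le> m" shows "WA p m = cspan (Mon p m)"
proof
  show "cspan (Mon p m) \<subseteq> WA p m" by (rule cspan_Mon_WA[OF m])
  show "WA p m \<subseteq> cspan (Mon p m)"
  proof
    fix v assume v: "v \<in> WA p m"
    then have f: "fin_vec v" and W: "\<And>h. Wmod (2 * h) (pr h v)" using Wtrip_Wmod[of v] by (auto simp: WA_def)
    have "ev h (pr h v) \<in> cspan (Mon p m)" if "pr h v \<noteq> 0" for h
    proof (rule gen_span_cspan[OF m Wmod_gen_span[OF m _ W]])
      have "\<exists>c. lookup (pr h v) c \<noteq> 0"
      proof (rule ccontr)
        assume "\<not> ?thesis"
        then have "pr h v = 0" by (intro fock_eqI) simp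
        then show False using that by simp
      qed
      then obtain c where "lookup (pr h v) c \<noteq> 0" by blast
      then have "v (c, h) \<noteq> 0" by (simp add: lookup_pr[OF f])
      then show "int m dvd h" using v unfolding WA_def by force
    qed
    then have "(\<lambda>b. \<Sum>h\<in>{h. pr h v \<noteq> 0}. ev h (pr h v) b) \<in> cspan (Mon p m)" by (intro cspan_sum) simp
    then show "v \<in> cspan (Mon p m)" using ev_decomp[OF f] by simp
  qed
qed

end

theorem mainTheorem5:
  fixes p m :: nat
  assumes "p \<ge> 2" and "m \<ge> 1"
  shows "WA p m = cspan (Mon p m)"
proof -
  interpret trip p by unfold_locales (rule assms(1))
  show ?thesis by (rule WA_eq_cspan_Mon[OF assms(2)])
qed

end
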